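(* Let $\mathfrak g$ be a Kac--Moody Lie algebra without Serre's relations, $M=M(\Lambda_1)\otimes\cdots\otimes M(\Lambda_n)$ a tensor product of Verma modules with highest weights $\Lambda_1,\dots,\Lambda_n\in\mathfrak h^*$, $\lambda=(m_1,\dots,m_r)\in\mathbb N^r$, $m=\sum_im_i$. Let $u(\mu,z)=\sum_{I\in P(\lambda,n)}u_I\,f_Iv$ be a hypergeometric integral with values in the weight space $M_\lambda$, i.e. $$u_I=\int_{\gamma(z)}\Phi_\mu^{1/\kappa}\Big(\sum_{\sigma\in\Sigma(I)}(-1)^{|\sigma|}\omega_{I,\sigma}\Big),$$ where $\gamma(z)$ is a horizontal family of twisted cycles in $\{z\}\times\mathbb C^m$. Then $u(\mu,z)$ solves the KZ equations in $M_\lambda$: $$\kappa\frac{\partial u}{\partial z_i}=\mu^{(i)}u+\sum_{j:\,j\neq i}\frac{\Omega_{+,ij}}{z_i-z_j}u,\qquad i=1,\dots,n.$$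
   Context: Lie algebra. Let $\mathfrak h$ be a finite dimensional complex vector space with a non-degenerate symmetric bilinear form $(\,,)$, and $\alpha_1,\dots,\alpha_r\in\mathfrak h^*$ linearly independent. $b:\mathfrak h\to\mathfrak h^*$ is the induced isomorphism, the form is transported to $\mathfrak h^*$, $h_i=b^{-1}(\alpha_i)$. The Kac--Moody Lie algebra without Serre's relations $\mathfrak g$ is generated by $\mathfrak h$, $e_i,f_i$ ($1\le i\le r$) with relations $[h,e_i]=\langle\alpha_i,h\rangle e_i$, $[h,f_i]=-\langle\alpha_i,h\rangle f_i$, $[e_i,f_j]=\delta_{ij}h_i$, $[h,h']=0$. $\mathfrak n_-$ is the subalgebra generated by the $f_i$. For $\beta=\sum k_i\alpha_i$, $k_i\in\mathbb N$, $(\mathfrak n_-)_\beta=\{x\in\mathfrak n_-:[h,x]=-\langle\beta,h\rangle x\ \forall h\in\mathfrak h\}$; $\beta$ is a positive root if $\beta\neq0$ and $(\mathfrak n_-)_\beta\ne0$. $M(\Lambda)$ is the Verma module with highest weight $\Lambda$ and generating vector $v$; $M_\lambda$ is the subspace of $M$ of weight $\sum_j\Lambda_j-\sum_im_i\alpha_i$. $x^{(i)}$ means $x$ acting on the $i$th factor. $\kappa\in\mathbb C\setminus\{0\}$, $\mu\in\mathfrak h$. Operators. $\nu_-:M(\Lambda)\to\mathfrak n_-\otimes M(\Lambda)$ is the linear map with $\nu_-(v)=0$, $\nu_-(f_ix)=f_i\otimes h_ix+f_i\cdot\nu_-(x)$, where $a\cdot(d\otimes y)=[a,d]\otimes y+d\otimes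 ay$. For $\xi$ in the graded dual $\mathfrak n_-^*$ put $\xi\lrcorner x=(\xi\otimes\mathrm{id})\nu_-(x)$. For weight vectors $p\in M(\Lambda')$, $q\in M(\Lambda'')$ of weights $\mathrm{wt}\,p,\mathrm{wt}\,q$, $$\Omega_+(p\otimes q)=(\mathrm{wt}\,p,\mathrm{wt}\,q)\,p\otimes q+\sum_{\beta>0}\sum_k\big(x_k^{\beta}p\otimes (x_k^{\beta})^*\lrcorner q+(x_k^{\beta})^*\lrcorner p\otimes x_k^\beta q\big),$$ where $\beta$ runs over positive roots, $(x_k^\beta)_k$ is a basis of $(\mathfrak n_-)_\beta$ and $((x_k^\beta)^* )_k$ the dual basis of $(\mathfrak n_-)_\beta^*$. (This is the action of the canonical element of the double of $\mathfrak b_+$.) $\Omega_{+,ij}$ acts as $\Omega_+$ on factors $i,j$ and as the identity on the others. Integrand. $c:\{1,\dots,m\}\to\{1,\dots,r\}$ is the unique non-decreasing function with $\#c^{-1}(i)=m_i$; $$\Phi_\mu=\exp\Big(-\sum_{i=1}^m\langle\alpha_{c(i)},\mu\rangle t_i+\sum_{j=1}^n\langle\Lambda_j,\mu\rangle z_j\Big)\prod_{i<j}(z_i-z_j)^{(\Lambda_i,\Lambda_j)}\prod_{k,j}(t_k-z_j)^{-(\alpha_{c(k)},\Lambda_j)}\prod_{k<l}(t_k-t_l)^{(\alpha_{c(k)},\alpha_{c(l)})}.$$ $P(\lambda,n)$ is the set of sequences $I=(i^1_1,\dots,i^1_{s_1};\dots;i^n_1,\dots,i^n_{s_n})$, $s_j\ge0$,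 in $\{1,\dots,r\}$ in which each $i$ appears exactly $m_i$ times. For a permutation $\sigma$ of $\{1,\dots,m\}$, $\sigma_j(l)=\sigma(s_1+\cdots+s_{j-1}+l)$, $1\le l\le s_j$; $\Sigma(I)$ is the set of $\sigma$ with $c(\sigma_j(l))=i^j_l$ for all $j,l$; $(-1)^{|\sigma|}$ is the sign. $f_Iv=f_{i^1_1}\cdots f_{i^1_{s_1}}v_1\otimes\cdots\otimes f_{i^n_1}\cdots f_{i^n_{s_n}}v_n$ with $v_j$ the generating vector of $M(\Lambda_j)$. $\omega_{i_1,\dots,i_s}(x)=d\log(t_{i_1}-t_{i_2})\wedge\cdots\wedge d\log(t_{i_{s-1}}-t_{i_s})\wedge d\log(t_{i_s}-x)$ (equal to $1$ if $s=0$), $\omega_{I,\sigma}=\omega_{\sigma_1(1),\dots,\sigma_1(s_1)}(z_1)\wedge\cdots\wedge\omega_{\sigma_n(1),\dots,\sigma_n(s_n)}(z_n)$. Twisted cycles. For fixed $z$ with distinct coordinates, a twisted cycle is an $m$-cycle in the complement in $\mathbb C^m$ of the hyperplanes $t_k=z_j$, $t_k=t_l$, with coefficients in the local system of branches of $\Phi_\mu^{1/\kappa}$ (compact, or non-compact such that the integrals converge and $\int_\gamma d_t(\Phi_\mu^{1/\kappa}\eta)=0$ for forms $\eta$ that are products of $d\log$'s of the functions defining the hyperplanes). A horizontal family is one locally constant in the parameters, so that one may differentiate under the integral sign. *)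

theory Defs
  imports
    "HOL-Analysis.Analysis"
    "HOL-Combinatorics.Permutations"
    "HOL-Library.Poly_Mapping"
    "HOL-Library.Groups_Big_Fun"
    "HOL-Homology.Simplices"
begin

text \<open>Indices are 0-based throughout: simple roots are indexed by \<open>i < r\<close>, tensor factors and the
  points \<open>z\<^sub>j\<close> by \<open>j < n\<close>, integration variables \<open>t\<^sub>k\<close> by \<open>k < m\<close>.\<close>

section \<open>Complex vector spaces and presentations\<close>

class complex_vector = ab_group_add +
  fixes scaleC :: "complex \<Rightarrow> 'a \<Rightarrow> 'a" (infixr "*\<^sub>C" 75)
  assumes scaleC_add_right: "a *\<^sub>C (x + y) = a *\<^sub>C x + a *\<^sub>C y"
    and scaleC_add_left: "(a + b) *\<^sub>C x = a *\<^sub>C x + b *\<^sub>C x"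
    and scaleC_scaleC: "a *\<^sub>C (b *\<^sub>C x) = (a * b) *\<^sub>C x"
    and scaleC_one: "1 *\<^sub>C x = x"

global_interpretation cvec: vector_space "scaleC :: complex \<Rightarrow> 'a \<Rightarrow> 'a::complex_vector"
  by unfold_locales (simp_all add: scaleC_add_right scaleC_add_left scaleC_scaleC scaleC_one)

abbreviation clinear :: "('a::complex_vector \<Rightarrow> 'b::complex_vector) \<Rightarrow> bool" where
  "clinear \<equiv> Vector_Spaces.linear scaleC scaleC"

instantiation complex :: complex_vector
begin
definition scaleC_complex :: "complex \<Rightarrow> complex \<Rightarrow> complex" where
  "scaleC_complex = (*)"
instance
  by standard (simp_all add: scaleC_complex_def algebra_simps)
end

instantiation poly_mapping :: (type, complex_vector) complex_vector
begin
definition scaleC_poly_mapping ::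
    "complex \<Rightarrow> ('a \<Rightarrow>\<^sub>0 'b) \<Rightarrow> ('a \<Rightarrow>\<^sub>0 'b)" where
  "scaleC_poly_mapping c p = Poly_Mapping.map (\<lambda>x. c *\<^sub>C x) p"
lemma lookup_scaleC:
  "Poly_Mapping.lookup (c *\<^sub>C p) k = c *\<^sub>C Poly_Mapping.lookup (p :: 'a \<Rightarrow>\<^sub>0 'b) k"
  by (simp add: scaleC_poly_mapping_def Poly_Mapping.map.rep_eq when_def)
instance
  by standard
    (rule poly_mapping_eqI,
      simp add: lookup_scaleC lookup_add scaleC_add_right scaleC_add_left scaleC_scaleC scaleC_one)+
end

definition lin_ext :: "('x \<Rightarrow> 'v::complex_vector) \<Rightarrow> ('x \<Rightarrow>\<^sub>0 complex) \<Rightarrow> 'v" where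
  "lin_ext g p = (\<Sum>x\<in>Poly_Mapping.keys p. Poly_Mapping.lookup p x *\<^sub>C g x)"

text \<open>\<open>g\<close> identifies the vector space \<open>'v\<close> with the quotient of the free vector space
  on \<open>X\<close> by its subspace \<open>R\<close>.\<close>

definition presented_by ::
    "'x set \<Rightarrow> ('x \<Rightarrow> 'v::complex_vector) \<Rightarrow> ('x \<Rightarrow>\<^sub>0 complex) set \<Rightarrow> bool" where
  "presented_by X g R \<longleftrightarrow>
     lin_ext g ` {p. Poly_Mapping.keys p \<subseteq> X} = UNIV \<and>
     {p. Poly_Mapping.keys p \<subseteq> X \<and> lin_ext g p = 0} = R"

abbreviation fgen :: "'x \<Rightarrow> ('x \<Rightarrow>\<^sub>0 complex)" where
  "fgen x \<equiv> Poly_Mapping.single x 1"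


section \<open>The Kac--Moody Lie algebra without Serre's relations\<close>

record 'h cartan =
  bil :: "'h \<Rightarrow> 'h \<Rightarrow> complex"
  rk :: nat
  sroot :: "nat \<Rightarrow> 'h \<Rightarrow> complex"

definition cartan_datum :: "'h::complex_vector cartan \<Rightarrow> bool" where
  "cartan_datum D \<longleftrightarrow>
     (\<exists>B :: 'h set. finite B \<and> cvec.span B = UNIV) \<and>
     (\<forall>x. clinear (bil D x)) \<and> (\<forall>x y. bil D x y = bil D y x) \<and>
     (\<forall>x. (\<forall>y. bil D x y = 0) \<longrightarrow> x = 0) \<and>
     (\<forall>i<rk D. clinear (sroot D i)) \<and>
     (\<forall>a. (\<forall>h. (\<Sum>i<rk D. a i * sroot D i h) = 0) \<longrightarrow> (\<forall>i<rk D. a i = 0))"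

definition binv :: "'h cartan \<Rightarrow> ('h \<Rightarrow> complex) \<Rightarrow> 'h" where
  "binv D \<xi> = (THE x. bil D x = \<xi>)"

definition dform :: "'h cartan \<Rightarrow> ('h \<Rightarrow> complex) \<Rightarrow> ('h \<Rightarrow> complex) \<Rightarrow> complex" where
  "dform D \<xi> \<eta> = bil D (binv D \<xi>) (binv D \<eta>)"

definition hcor :: "'h cartan \<Rightarrow> nat \<Rightarrow> 'h" where
  "hcor D i = binv D (sroot D i)"

definition root_fun :: "'h cartan \<Rightarrow> (nat \<Rightarrow> nat) \<Rightarrow> 'h \<Rightarrow> complex" where
  "root_fun D k h = (\<Sum>i<rk D. of_nat (k i) * sroot D i h)"

datatype 'h km_gen = GenH 'h | GenE nat | GenF nat

datatype 'x magma = Leaf 'x | Br "'x magma" "'x magma"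

definition km_words :: "'h cartan \<Rightarrow> 'h km_gen magma set" where
  "km_words D = {w. \<forall>i. GenE i \<in> set_magma w \<or> GenF i \<in> set_magma w \<longrightarrow> i < rk D}"

definition fprod ::
    "('x magma \<Rightarrow>\<^sub>0 complex) \<Rightarrow> ('x magma \<Rightarrow>\<^sub>0 complex) \<Rightarrow> ('x magma \<Rightarrow>\<^sub>0 complex)" where
  "fprod p q = (\<Sum>a\<in>Poly_Mapping.keys p. \<Sum>b\<in>Poly_Mapping.keys q.
      Poly_Mapping.single (Br a b) (Poly_Mapping.lookup p a * Poly_Mapping.lookup q b))"

abbreviation gH :: "'h \<Rightarrow> ('h km_gen magma \<Rightarrow>\<^sub>0 complex)" where "gH h \<equiv> fgen (Leaf (GenH h))"
abbreviation gE :: "nat \<Rightarrow> ('h km_gen magma \<Rightarrow>\<^sub>0 complex)" where "gE i \<equiv> fgen (Leaf (GenE i))"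
abbreviation gF :: "nat \<Rightarrow> ('h km_gen magma \<Rightarrow>\<^sub>0 complex)" where "gF i \<equiv> fgen (Leaf (GenF i))"

text \<open>The ideal of the free non-associative algebra on the generators \<open>h \<in> \<hh>\<close>, \<open>e\<^sub>i\<close>, \<open>f\<^sub>i\<close>
  generated by the Lie algebra axioms, the linear relations of \<open>\<hh>\<close> and the defining relations.\<close>

inductive_set km_ideal :: "'h::complex_vector cartan \<Rightarrow> ('h km_gen magma \<Rightarrow>\<^sub>0 complex) set"
  for D :: "'h cartan" where
  zero: "0 \<in> km_ideal D"
| add: "p \<in> km_ideal D \<Longrightarrow> q \<in> km_ideal D \<Longrightarrow> p + q \<in> km_ideal D"
| scale: "p \<in> km_ideal D \<Longrightarrow> c *\<^sub>C p \<in> km_ideal D"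
| left: "p \<in> km_ideal D \<Longrightarrow> Poly_Mapping.keys a \<subseteq> km_words D \<Longrightarrow> fprod a p \<in> km_ideal D"
| right: "p \<in> km_ideal D \<Longrightarrow> Poly_Mapping.keys a \<subseteq> km_words D \<Longrightarrow> fprod p a \<in> km_ideal D"
| alternating: "Poly_Mapping.keys a \<subseteq> km_words D \<Longrightarrow> fprod a a \<in> km_ideal D"
| jacobi: "Poly_Mapping.keys a \<subseteq> km_words D \<Longrightarrow> Poly_Mapping.keys b \<subseteq> km_words D \<Longrightarrow>
    Poly_Mapping.keys c \<subseteq> km_words D \<Longrightarrow>
    fprod a (fprod b c) + fprod b (fprod c a) + fprod c (fprod a b) \<in> km_ideal D"
| H_add: "gH (h + h') - gH h - gH h' \<in> km_ideal D"
| H_scale: "gH (c *\<^sub>C h) - c *\<^sub>C gH h \<in> km_ideal D"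
| H_E: "i < rk D \<Longrightarrow> fprod (gH h) (gE i) - sroot D i h *\<^sub>C gE i \<in> km_ideal D"
| H_F: "i < rk D \<Longrightarrow> fprod (gH h) (gF i) + sroot D i h *\<^sub>C gF i \<in> km_ideal D"
| E_F: "i < rk D \<Longrightarrow> j < rk D \<Longrightarrow>
    fprod (gE i) (gF j) - (if i = j then gH (hcor D i) else 0) \<in> km_ideal D"
| H_H: "fprod (gH h) (gH h') \<in> km_ideal D"

record ('h, 'g) km_lie =
  brk :: "'g \<Rightarrow> 'g \<Rightarrow> 'g"
  inH :: "'h \<Rightarrow> 'g"
  geE :: "nat \<Rightarrow> 'g"
  geF :: "nat \<Rightarrow> 'g"

definition lie_bracket :: "('g::complex_vector \<Rightarrow> 'g \<Rightarrow> 'g) \<Rightarrow> bool" where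
  "lie_bracket b \<longleftrightarrow>
     (\<forall>x. clinear (b x)) \<and> (\<forall>y. clinear (\<lambda>x. b x y)) \<and> (\<forall>x. b x x = 0) \<and>
     (\<forall>x y z. b x (b y z) + b y (b z x) + b z (b x y) = 0)"

fun gen_val :: "('h, 'g) km_lie \<Rightarrow> 'h km_gen \<Rightarrow> 'g" where
  "gen_val G (GenH h) = inH G h"
| "gen_val G (GenE i) = geE G i"
| "gen_val G (GenF i) = geF G i"

primrec magma_val :: "('h, 'g) km_lie \<Rightarrow> 'h km_gen magma \<Rightarrow> 'g" where
  "magma_val G (Leaf x) = gen_val G x"
| "magma_val G (Br a b) = brk G (magma_val G a) (magma_val G b)"

definition km_lie_algebra ::
    "'h::complex_vector cartan \<Rightarrow> ('h, 'g::complex_vector) km_lie \<Rightarrow> bool" where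
  "km_lie_algebra D G \<longleftrightarrow>
     lie_bracket (brk G) \<and> presented_by (km_words D) (magma_val G) (km_ideal D)"

inductive_set n_minus :: "'h cartan \<Rightarrow> ('h, 'g::complex_vector) km_lie \<Rightarrow> 'g set"
  for D :: "'h cartan" and G :: "('h, 'g) km_lie" where
  "0 \<in> n_minus D G"
| "i < rk D \<Longrightarrow> geF G i \<in> n_minus D G"
| "x \<in> n_minus D G \<Longrightarrow> y \<in> n_minus D G \<Longrightarrow> x + y \<in> n_minus D G"
| "x \<in> n_minus D G \<Longrightarrow> c *\<^sub>C x \<in> n_minus D G"
| "x \<in> n_minus D G \<Longrightarrow> y \<in> n_minus D G \<Longrightarrow> brk G x y \<in> n_minus D G"

definition n_minus_wt ::
    "'h cartan \<Rightarrow> ('h, 'g::complex_vector) km_lie \<Rightarrow> (nat \<Rightarrow> nat) \<Rightarrow> 'g set" where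
  "n_minus_wt D G \<beta> =
     {x \<in> n_minus D G. \<forall>h. brk G (inH G h) x = - (root_fun D \<beta> h *\<^sub>C x)}"

text \<open>A positive root \<open>\<Sum>\<^sub>i k\<^sub>i \<alpha>\<^sub>i\<close> is encoded by its coefficients \<open>k\<close> (zero beyond the rank).\<close>

definition pos_roots :: "'h cartan \<Rightarrow> ('h, 'g::complex_vector) km_lie \<Rightarrow> (nat \<Rightarrow> nat) set" where
  "pos_roots D G =
     {\<beta>. (\<forall>i\<ge>rk D. \<beta> i = 0) \<and> (\<exists>i. \<beta> i \<noteq> 0) \<and> n_minus_wt D G \<beta> \<noteq> {0}}"

definition root_bases ::
    "'h cartan \<Rightarrow> ('h, 'g::complex_vector) km_lie \<Rightarrow> ((nat \<Rightarrow> nat) \<Rightarrow> 'g set) \<Rightarrow> bool" where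
  "root_bases D G B \<longleftrightarrow>
     (\<forall>\<beta>\<in>pos_roots D G. cvec.independent (B \<beta>) \<and> cvec.span (B \<beta>) = n_minus_wt D G \<beta>)"

text \<open>The graded dual element \<open>(x\<^sub>k\<^sup>\<beta>)\<^sup>*\<close>: the coordinate of \<open>x \<in> B \<beta>\<close> with respect to the homogeneous
  basis \<open>\<Union>\<^sub>\<gamma> B \<gamma>\<close> of \<open>\<nn>\<^sub>-\<close>. So it is dual to \<open>B \<beta>\<close> in degree \<open>\<beta>\<close> and zero in the other degrees.\<close>

definition dual_vec ::
    "'h cartan \<Rightarrow> ('h, 'g::complex_vector) km_lie \<Rightarrow> ((nat \<Rightarrow> nat) \<Rightarrow> 'g set) \<Rightarrow>
     'g \<Rightarrow> 'g \<Rightarrow> complex" where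
  "dual_vec D G B x = (\<lambda>d. cvec.representation (\<Union>\<gamma>\<in>pos_roots D G. B \<gamma>) d x)"


section \<open>Verma modules and tensor products\<close>

definition lie_module ::
    "('g \<Rightarrow> 'g \<Rightarrow> 'g::complex_vector) \<Rightarrow> ('g \<Rightarrow> 'm \<Rightarrow> 'm::complex_vector) \<Rightarrow> bool" where
  "lie_module b act \<longleftrightarrow>
     (\<forall>x. clinear (act x)) \<and> (\<forall>w. clinear (\<lambda>x. act x w)) \<and>
     (\<forall>x y w. act (b x y) w = act x (act y w) - act y (act x w))"

definition prep :: "'g \<Rightarrow> ('g list \<Rightarrow>\<^sub>0 complex) \<Rightarrow> ('g list \<Rightarrow>\<^sub>0 complex)" where
  "prep x p = lin_ext (\<lambda>w. fgen (x # w)) p"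

text \<open>A word \<open>x\<^sub>1\<dots>x\<^sub>k\<close> of elements of the Lie algebra stands for \<open>x\<^sub>1\<cdots>x\<^sub>k v\<close>. The subspace below
  consists of the relations of the universal enveloping algebra together with the left ideal
  generated by \<open>e\<^sub>i\<close> and \<open>h - \<langle>\<Lambda>,h\<rangle>\<close>.\<close>

inductive_set verma_rel ::
    "'h cartan \<Rightarrow> ('h, 'g::complex_vector) km_lie \<Rightarrow> ('h \<Rightarrow> complex) \<Rightarrow>
     ('g list \<Rightarrow>\<^sub>0 complex) set"
  for D :: "'h cartan" and G :: "('h, 'g) km_lie" and \<Lambda> :: "'h \<Rightarrow> complex" where
  zero: "0 \<in> verma_rel D G \<Lambda>"
| add: "p \<in> verma_rel D G \<Lambda> \<Longrightarrow> q \<in> verma_rel D G \<Lambda> \<Longrightarrow> p + q \<in> verma_rel D G \<Lambda>"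
| scale: "p \<in> verma_rel D G \<Lambda> \<Longrightarrow> c *\<^sub>C p \<in> verma_rel D G \<Lambda>"
| left: "p \<in> verma_rel D G \<Lambda> \<Longrightarrow> prep x p \<in> verma_rel D G \<Lambda>"
| lin_add: "fgen ((x + y) # w) - fgen (x # w) - fgen (y # w) \<in> verma_rel D G \<Lambda>"
| lin_scale: "fgen ((c *\<^sub>C x) # w) - c *\<^sub>C fgen (x # w) \<in> verma_rel D G \<Lambda>"
| comm: "fgen (brk G x y # w) - fgen (x # y # w) + fgen (y # x # w) \<in> verma_rel D G \<Lambda>"
| highest: "i < rk D \<Longrightarrow> fgen [geE G i] \<in> verma_rel D G \<Lambda>"
| weight: "fgen [inH G h] - \<Lambda> h *\<^sub>C fgen [] \<in> verma_rel D G \<Lambda>"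

definition verma_module ::
    "'h cartan \<Rightarrow> ('h, 'g::complex_vector) km_lie \<Rightarrow> ('h \<Rightarrow> complex) \<Rightarrow>
     ('g \<Rightarrow> 'm \<Rightarrow> 'm::complex_vector) \<Rightarrow> 'm \<Rightarrow> bool" where
  "verma_module D G \<Lambda> act v \<longleftrightarrow>
     lie_module (brk G) act \<and>
     presented_by UNIV (\<lambda>w. foldr act w v) (verma_rel D G \<Lambda>)"

definition weight_vec ::
    "('h, 'g) km_lie \<Rightarrow> ('g \<Rightarrow> 'm \<Rightarrow> 'm::complex_vector) \<Rightarrow> ('h \<Rightarrow> complex) \<Rightarrow> 'm \<Rightarrow> bool" where
  "weight_vec G act wt x \<longleftrightarrow> (\<forall>h. act (inH G h) x = wt h *\<^sub>C x)"

definition tuples :: "nat \<Rightarrow> (nat \<Rightarrow> 'm) set" where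
  "tuples n = (\<Pi>\<^sub>E j\<in>{..<n}. UNIV)"

text \<open>\<open>'t\<close> is the \<open>n\<close>-th tensor power of the vector space \<open>'m\<close> and
  \<open>tens p = p\<^sub>0 \<otimes> \<dots> \<otimes> p\<^bsub>n-1\<^esub>\<close>. All Verma modules have isomorphic underlying vector spaces, so
  the factors \<open>M(\<Lambda>\<^sub>j)\<close> are different module structures on the same space \<open>'m\<close>.\<close>

definition tensor_power ::
    "nat \<Rightarrow> ((nat \<Rightarrow> 'm::complex_vector) \<Rightarrow> 't::complex_vector) \<Rightarrow> bool" where
  "tensor_power n tens \<longleftrightarrow> presented_by (tuples n) tens
     (cvec.span
       ({fgen (p(i := x + y)) - fgen (p(i := x)) - fgen (p(i := y)) | p i x y.
           p \<in> tuples n \<and> i < n} \<union>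
        {fgen (p(i := c *\<^sub>C x)) - c *\<^sub>C fgen (p(i := x)) | p i c x.
           p \<in> tuples n \<and> i < n}))"

text \<open>\<open>'s\<close> is the tensor product of the subspace \<open>V\<close> of \<open>'g\<close> with \<open>'m\<close>.\<close>

definition tensor_product ::
    "'g::complex_vector set \<Rightarrow> ('g \<Rightarrow> 'm::complex_vector \<Rightarrow> 's::complex_vector) \<Rightarrow> bool" where
  "tensor_product V tn \<longleftrightarrow> presented_by (V \<times> UNIV) (\<lambda>(d, y). tn d y)
     (cvec.span
       ({fgen (d + d', y) - fgen (d, y) - fgen (d', y) | d d' y. d \<in> V \<and> d' \<in> V} \<union>
        {fgen (d, y + y') - fgen (d, y) - fgen (d, y') | d y y'. d \<in> V} \<union>
        {fgen (c *\<^sub>C d, y) - c *\<^sub>C fgen (d, y) | c d y. d \<in> V} \<union>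
        {fgen (d, c *\<^sub>C y) - c *\<^sub>C fgen (d, y) | c d y. d \<in> V}))"

definition factor_op ::
    "nat \<Rightarrow> ((nat \<Rightarrow> 'm) \<Rightarrow> 't::complex_vector) \<Rightarrow> nat \<Rightarrow> ('m \<Rightarrow> 'm) \<Rightarrow> 't \<Rightarrow> 't" where
  "factor_op n tens i A =
     (THE L. clinear L \<and> (\<forall>p\<in>tuples n. L (tens p) = tens (p(i := A (p i)))))"


section \<open>The operators \<open>\<nu>\<^sub>-\<close> and \<open>\<Omega>\<^sub>+\<close>\<close>

definition nm_act ::
    "'h cartan \<Rightarrow> ('h, 'g::complex_vector) km_lie \<Rightarrow> ('g \<Rightarrow> 'm \<Rightarrow> 's::complex_vector) \<Rightarrow>
     ('g \<Rightarrow> 'm \<Rightarrow> 'm) \<Rightarrow> 'g \<Rightarrow> 's \<Rightarrow> 's" where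
  "nm_act D G tn act a =
     (THE L. clinear L \<and>
        (\<forall>d\<in>n_minus D G. \<forall>y. L (tn d y) = tn (brk G a d) y + tn d (act a y)))"

definition nu_minus ::
    "'h cartan \<Rightarrow> ('h, 'g::complex_vector) km_lie \<Rightarrow> ('g \<Rightarrow> 'm \<Rightarrow> 's::complex_vector) \<Rightarrow>
     ('g \<Rightarrow> 'm \<Rightarrow> 'm::complex_vector) \<Rightarrow> 'm \<Rightarrow> 'm \<Rightarrow> 's" where
  "nu_minus D G tn act v =
     (THE \<nu>. clinear \<nu> \<and> \<nu> v = 0 \<and>
        (\<forall>i<rk D. \<forall>x. \<nu> (act (geF G i) x) =
           tn (geF G i) (act (inH G (hcor D i)) x) + nm_act D G tn act (geF G i) (\<nu> x)))"

definition contract ::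
    "'h cartan \<Rightarrow> ('h, 'g::complex_vector) km_lie \<Rightarrow> ('g \<Rightarrow> 'm \<Rightarrow> 's::complex_vector) \<Rightarrow>
     ('g \<Rightarrow> complex) \<Rightarrow> 's \<Rightarrow> 'm::complex_vector" where
  "contract D G tn \<xi> =
     (THE L. clinear L \<and> (\<forall>d\<in>n_minus D G. \<forall>y. L (tn d y) = \<xi> d *\<^sub>C y))"

definition lowering ::
    "'h cartan \<Rightarrow> ('h, 'g::complex_vector) km_lie \<Rightarrow> ('g \<Rightarrow> 'm \<Rightarrow> 's::complex_vector) \<Rightarrow>
     ('g \<Rightarrow> 'm \<Rightarrow> 'm::complex_vector) \<Rightarrow> 'm \<Rightarrow> ('g \<Rightarrow> complex) \<Rightarrow> 'm \<Rightarrow> 'm" where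
  "lowering D G tn act v \<xi> x = contract D G tn \<xi> (nu_minus D G tn act v x)"

text \<open>\<open>act j\<close> and \<open>v j\<close> are the action and the generating vector of the \<open>j\<close>-th factor.
  For fixed weight vectors only finitely many positive roots contribute to the sum, which is why it
  can be written with \<^const>\<open>Sum_any\<close>.\<close>

definition Omega_plus ::
    "'h cartan \<Rightarrow> ('h, 'g::complex_vector) km_lie \<Rightarrow> ((nat \<Rightarrow> nat) \<Rightarrow> 'g set) \<Rightarrow>
     ('g \<Rightarrow> 'm \<Rightarrow> 's::complex_vector) \<Rightarrow> (nat \<Rightarrow> 'g \<Rightarrow> 'm \<Rightarrow> 'm::complex_vector) \<Rightarrow>
     (nat \<Rightarrow> 'm) \<Rightarrow> nat \<Rightarrow> ((nat \<Rightarrow> 'm) \<Rightarrow> 't::complex_vector) \<Rightarrow> nat \<Rightarrow> nat \<Rightarrow> 't \<Rightarrow> 't" where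
  "Omega_plus D G B tn act v n tens i j =
     (THE L. clinear L \<and>
        (\<forall>p\<in>tuples n. \<forall>wt1 wt2.
           weight_vec G (act i) wt1 (p i) \<longrightarrow> weight_vec G (act j) wt2 (p j) \<longrightarrow>
           L (tens p) = dform D wt1 wt2 *\<^sub>C tens p +
             Sum_any (\<lambda>\<beta>. if \<beta> \<in> pos_roots D G then
               (\<Sum>x\<in>B \<beta>.
                  tens (p(i := act i x (p i),
                          j := lowering D G tn (act j) (v j) (dual_vec D G B x) (p j))) +
                  tens (p(i := lowering D G tn (act i) (v i) (dual_vec D G B x) (p i),
                          j := act j x (p j))))
               else 0)))"


section \<open>Master functions, their branches and differential forms\<close>

text \<open>Data of the multivalued function \<open>\<Phi>\<^bsup>1/\<kappa>\<^esup>\<close>, where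
  \<open>\<Phi> = exp (\<Sum>\<^sub>k coef_t k \<cdot> t\<^sub>k + \<Sum>\<^sub>j coef_z j \<cdot> z\<^sub>j) \<cdot> \<Prod>\<^bsub>i<j\<^esub> (z\<^sub>i - z\<^sub>j)^(exp_zz i j) \<cdot>
  \<Prod>\<^bsub>k,j\<^esub> (t\<^sub>k - z\<^sub>j)^(exp_tz k j) \<cdot> \<Prod>\<^bsub>k<l\<^esub> (t\<^sub>k - t\<^sub>l)^(exp_tt k l)\<close>.\<close>

record master =
  npts :: nat
  nvars :: nat
  coef_t :: "nat \<Rightarrow> complex"
  coef_z :: "nat \<Rightarrow> complex"
  exp_zz :: "nat \<Rightarrow> nat \<Rightarrow> complex"
  exp_tz :: "nat \<Rightarrow> nat \<Rightarrow> complex"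
  exp_tt :: "nat \<Rightarrow> nat \<Rightarrow> complex"
  kap :: complex

text \<open>A point, or a tangent vector, \<open>(t, z)\<close> of the total space. Coordinates of index at least \<open>m\<close>,
  respectively \<open>n\<close>, are kept equal to zero.\<close>

type_synonym point = "(nat \<Rightarrow> complex) \<times> (nat \<Rightarrow> complex)"

type_synonym one_form = "point \<Rightarrow> point \<Rightarrow> complex"

definition base :: "master \<Rightarrow> (nat \<Rightarrow> complex) set" where
  "base A = {z. inj_on z {..<npts A} \<and> (\<forall>j\<ge>npts A. z j = 0)}"

definition fibre :: "master \<Rightarrow> (nat \<Rightarrow> complex) \<Rightarrow> (nat \<Rightarrow> complex) set" where
  "fibre A z = {t. (\<forall>k<nvars A. \<forall>j<npts A. t k \<noteq> z j) \<and>
                   (\<forall>k<nvars A. \<forall>l<nvars A. k \<noteq> l \<longrightarrow> t k \<noteq> t l) \<and>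
                   (\<forall>k\<ge>nvars A. t k = 0)}"

definition zz :: "nat \<Rightarrow> nat \<Rightarrow> point \<Rightarrow> complex" where "zz i j = (\<lambda>(t, z). z i - z j)"
definition tz :: "nat \<Rightarrow> nat \<Rightarrow> point \<Rightarrow> complex" where "tz k j = (\<lambda>(t, z). t k - z j)"
definition tt :: "nat \<Rightarrow> nat \<Rightarrow> point \<Rightarrow> complex" where "tt k l = (\<lambda>(t, z). t k - t l)"

text \<open>\<open>\<phi>\<close> is a horizontal section of the pull-back along \<open>P\<close> of the local system of branches of
  \<open>\<Phi>\<^bsup>1/\<kappa>\<^esup>\<close>, that is, a constant multiple of a branch. A branch is given by continuous
  logarithms along \<open>P\<close> of the linear functions occurring in \<open>\<Phi>\<close>.\<close>

definition flat_section ::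
    "master \<Rightarrow> 's::topological_space set \<Rightarrow> ('s \<Rightarrow> point) \<Rightarrow> ('s \<Rightarrow> complex) \<Rightarrow> bool" where
  "flat_section A S P \<phi> \<longleftrightarrow>
     (\<exists>C Lzz Ltz Ltt.
        (\<forall>j<npts A. \<forall>i<j. continuous_on S (Lzz i j) \<and>
            (\<forall>s\<in>S. exp (Lzz i j s) = zz i j (P s))) \<and>
        (\<forall>k<nvars A. \<forall>j<npts A. continuous_on S (Ltz k j) \<and>
            (\<forall>s\<in>S. exp (Ltz k j s) = tz k j (P s))) \<and>
        (\<forall>l<nvars A. \<forall>k<l. continuous_on S (Ltt k l) \<and>
            (\<forall>s\<in>S. exp (Ltt k l s) = tt k l (P s))) \<and>
        (\<forall>s\<in>S. \<phi> s = C * exp ((1 / kap A) *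
            ((\<Sum>k<nvars A. coef_t A k * fst (P s) k) + (\<Sum>j<npts A. coef_z A j * snd (P s) j) +
             (\<Sum>j<npts A. \<Sum>i<j. exp_zz A i j * Lzz i j s) +
             (\<Sum>k<nvars A. \<Sum>j<npts A. exp_tz A k j * Ltz k j s) +
             (\<Sum>l<nvars A. \<Sum>k<l. exp_tt A k l * Ltt k l s)))))"

text \<open>\<open>d log\<close> of a function that is linear in \<open>(t, z)\<close>.\<close>

definition dlog :: "(point \<Rightarrow> complex) \<Rightarrow> one_form" where
  "dlog f = (\<lambda>p v. f v / f p)"

definition dlog_Phi :: "master \<Rightarrow> one_form" where
  "dlog_Phi A = (\<lambda>p v.
     (\<Sum>k<nvars A. coef_t A k * fst v k) + (\<Sum>j<npts A. coef_z A j * snd v j) +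
     (\<Sum>j<npts A. \<Sum>i<j. exp_zz A i j * dlog (zz i j) p v) +
     (\<Sum>k<nvars A. \<Sum>j<npts A. exp_tz A k j * dlog (tz k j) p v) +
     (\<Sum>l<nvars A. \<Sum>k<l. exp_tt A k l * dlog (tt k l) p v))"

text \<open>\<open>wedge [\<theta>\<^sub>1, \<dots>, \<theta>\<^sub>p]\<close> is \<open>\<theta>\<^sub>1 \<and> \<dots> \<and> \<theta>\<^sub>p\<close>, as an alternating form on \<open>p\<close> tangent vectors.\<close>

definition wedge :: "one_form list \<Rightarrow> point \<Rightarrow> (nat \<Rightarrow> point) \<Rightarrow> complex" where
  "wedge \<theta>s p v = (\<Sum>\<pi> | \<pi> permutes {..<length \<theta>s}.
     of_int (sign \<pi>) * (\<Prod>a<length \<theta>s. (\<theta>s ! a) p (v (\<pi> a))))"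

text \<open>Products of \<open>d log\<close>'s of the functions defining the hyperplanes \<open>t\<^sub>k = z\<^sub>j\<close>, \<open>t\<^sub>k = t\<^sub>l\<close>.\<close>

definition dlog_lists :: "master \<Rightarrow> one_form list set" where
  "dlog_lists A = lists
     ({dlog (tz k j) | k j. k < nvars A \<and> j < npts A} \<union>
      {dlog (tt k l) | k l. k < nvars A \<and> l < nvars A \<and> k \<noteq> l})"

text \<open>Since products of \<open>d log\<close>'s are closed, \<open>d(\<Phi>\<^bsup>1/\<kappa>\<^esup> \<eta>) = \<Phi>\<^bsup>1/\<kappa>\<^esup> \<cdot> twisted_d A \<eta>\<close> for such \<open>\<eta>\<close>, where
  \<open>d\<close> is the differential of the total space. On vectors tangent to the fibres this is \<open>d\<^sub>t\<close>.\<close>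

definition twisted_d :: "master \<Rightarrow> one_form list \<Rightarrow> point \<Rightarrow> (nat \<Rightarrow> point) \<Rightarrow> complex" where
  "twisted_d A \<eta> p v = (1 / kap A) * wedge (dlog_Phi A # \<eta>) p v"

definition insert_dz ::
    "nat \<Rightarrow> (point \<Rightarrow> (nat \<Rightarrow> point) \<Rightarrow> complex) \<Rightarrow> point \<Rightarrow> (nat \<Rightarrow> point) \<Rightarrow> complex" where
  "insert_dz i \<omega> p v =
     \<omega> p (\<lambda>b. case b of 0 \<Rightarrow> ((\<lambda>_. 0), (\<lambda>j. if j = i then 1 else 0)) | Suc b' \<Rightarrow> v b')"


section \<open>Twisted chains, cycles and integrals\<close>

type_synonym tsimplex = "(nat \<Rightarrow> real) \<Rightarrow> nat \<Rightarrow> complex"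

text \<open>A chain with coefficients in the local system of branches assigns to every singular simplex
  a horizontal section over it; sections are extended by zero to points outside the standard
  simplex.\<close>

type_synonym tchain = "tsimplex \<Rightarrow> (nat \<Rightarrow> real) \<Rightarrow> complex"

definition supp :: "tchain \<Rightarrow> tsimplex set" where
  "supp c = {\<sigma>. c \<sigma> \<noteq> (\<lambda>_. 0)}"

primrec Ck_on :: "nat \<Rightarrow> nat \<Rightarrow> (nat \<Rightarrow> real) set \<Rightarrow> ((nat \<Rightarrow> real) \<Rightarrow> complex) \<Rightarrow> bool" where
  "Ck_on 0 p W g \<longleftrightarrow> continuous_on W g"
| "Ck_on (Suc q) p W g \<longleftrightarrow> continuous_on W g \<and>
     (\<forall>i\<le>p. \<exists>g'. (\<forall>x\<in>W. ((\<lambda>s. g (x(i := s))) has_vector_derivative g' x) (at (x i))) \<and>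
                Ck_on q p W g')"

definition smooth_simplex :: "nat \<Rightarrow> tsimplex \<Rightarrow> bool" where
  "smooth_simplex p \<sigma> \<longleftrightarrow>
     (\<forall>k. \<exists>W g. open W \<and> standard_simplex p \<subseteq> W \<and> (\<forall>q. Ck_on q p W g) \<and>
            (\<forall>x\<in>standard_simplex p. \<sigma> x k = g x))"

text \<open>Locally finite (possibly infinite) smooth singular chains in the fibre over \<open>z\<close>.\<close>

definition twisted_chain :: "master \<Rightarrow> nat \<Rightarrow> (nat \<Rightarrow> complex) \<Rightarrow> tchain \<Rightarrow> bool" where
  "twisted_chain A p z c \<longleftrightarrow>
     (\<forall>\<sigma>\<in>supp c. singular_simplex p (top_of_set (fibre A z)) \<sigma> \<and> smooth_simplex p \<sigma> \<and>
        flat_section A (standard_simplex p) (\<lambda>x. (\<sigma> x, z)) (c \<sigma>) \<and>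
        (\<forall>x. x \<notin> standard_simplex p \<longrightarrow> c \<sigma> x = 0)) \<and>
     (\<forall>K. compact K \<longrightarrow> K \<subseteq> fibre A z \<longrightarrow>
        finite {\<sigma>\<in>supp c. \<sigma> ` standard_simplex p \<inter> K \<noteq> {}})"

definition tboundary :: "nat \<Rightarrow> tchain \<Rightarrow> tchain" where
  "tboundary p c = (\<lambda>\<tau> x.
     if p \<noteq> 0 \<and> x \<in> standard_simplex (p - 1) then
       (\<Sum>(\<sigma>, k) \<in> {(\<sigma>, k). \<sigma> \<in> supp c \<and> k \<le> p \<and> singular_face p k \<sigma> = \<tau>}.
          (-1) ^ k * c \<sigma> (simplical_face k x))
     else 0)"

definition twisted_homologous ::
    "master \<Rightarrow> (nat \<Rightarrow> complex) \<Rightarrow> tchain \<Rightarrow> tchain \<Rightarrow> bool" where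
  "twisted_homologous A z c c' \<longleftrightarrow>
     (\<exists>d. twisted_chain A (Suc (nvars A)) z d \<and> finite (supp d) \<and>
          tboundary (Suc (nvars A)) d = (\<lambda>\<tau> x. c \<tau> x - c' \<tau> x))"

text \<open>Affine parametrisation of the standard \<open>m\<close>-simplex compatible with its orientation. Integration is
  over the interior, where two-sided partial derivatives of the simplex exist; the boundary is null.\<close>

definition bary :: "nat \<Rightarrow> (nat \<Rightarrow> real) \<Rightarrow> nat \<Rightarrow> real" where
  "bary m y = (\<lambda>i. if i = 0 then 1 - (\<Sum>b<m. y b) else if i \<le> m then y (i - 1) else 0)"

definition bary_dom :: "nat \<Rightarrow> (nat \<Rightarrow> real) set" where
  "bary_dom m = {y. (\<forall>b<m. 0 < y b) \<and> (\<Sum>b<m. y b) < 1}"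

definition simplex_integral ::
    "nat \<Rightarrow> (nat \<Rightarrow> complex) \<Rightarrow> tsimplex \<Rightarrow> ((nat \<Rightarrow> real) \<Rightarrow> complex) \<Rightarrow>
     (point \<Rightarrow> (nat \<Rightarrow> point) \<Rightarrow> complex) \<Rightarrow> complex" where
  "simplex_integral m z \<sigma> \<phi> \<omega> =
     (LINT y : bary_dom m | (\<Pi>\<^sub>M b\<in>{..<m}. lborel).
        \<phi> (bary m y) * \<omega> (\<sigma> (bary m y), z)
          (\<lambda>b. ((\<lambda>k. vector_derivative (\<lambda>s. \<sigma> (bary m (y(b := s))) k) (at (y b))), (\<lambda>_. 0))))"

text \<open>\<open>\<integral>\<^sub>\<gamma> \<Phi>\<^bsup>1/\<kappa>\<^esup> \<omega>\<close>; the branches of \<open>\<Phi>\<^bsup>1/\<kappa>\<^esup>\<close> are the coefficients of \<open>\<gamma>\<close>.\<close>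

definition twisted_integral ::
    "master \<Rightarrow> (nat \<Rightarrow> complex) \<Rightarrow> tchain \<Rightarrow> (point \<Rightarrow> (nat \<Rightarrow> point) \<Rightarrow> complex) \<Rightarrow>
     complex" where
  "twisted_integral A z \<gamma> \<omega> =
     (\<Sum>\<^sub>\<infinity>\<sigma>\<in>supp \<gamma>. simplex_integral (nvars A) z \<sigma> (\<gamma> \<sigma>) \<omega>)"

definition integral_converges ::
    "master \<Rightarrow> (nat \<Rightarrow> complex) \<Rightarrow> tchain \<Rightarrow> (point \<Rightarrow> (nat \<Rightarrow> point) \<Rightarrow> complex) \<Rightarrow> bool" where
  "integral_converges A z \<gamma> \<omega> \<longleftrightarrow>
     (\<lambda>\<sigma>. simplex_integral (nvars A) z \<sigma> (\<gamma> \<sigma>) \<omega>) summable_on supp \<gamma>"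

definition compact_twisted_cycle :: "master \<Rightarrow> (nat \<Rightarrow> complex) \<Rightarrow> tchain \<Rightarrow> bool" where
  "compact_twisted_cycle A z \<gamma> \<longleftrightarrow>
     twisted_chain A (nvars A) z \<gamma> \<and> finite (supp \<gamma>) \<and> tboundary (nvars A) \<gamma> = (\<lambda>_ _. 0)"

definition noncompact_twisted_cycle :: "master \<Rightarrow> (nat \<Rightarrow> complex) \<Rightarrow> tchain \<Rightarrow> bool" where
  "noncompact_twisted_cycle A z \<gamma> \<longleftrightarrow>
     twisted_chain A (nvars A) z \<gamma> \<and> tboundary (nvars A) \<gamma> = (\<lambda>_ _. 0) \<and>
     (\<forall>\<eta>\<in>dlog_lists A. length \<eta> = nvars A \<longrightarrow>
        integral_converges A z \<gamma> (wedge \<eta>)) \<and>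
     (\<forall>\<eta>\<in>dlog_lists A. Suc (length \<eta>) = nvars A \<longrightarrow>
        integral_converges A z \<gamma> (twisted_d A \<eta>) \<and>
        twisted_integral A z \<gamma> (twisted_d A \<eta>) = 0)"

text \<open>A family of compact cycles over \<open>U\<close> is horizontal if locally it is represented, up to
  homology, by fixed simplices with branches that vary continuously with \<open>z\<close>.\<close>

definition horizontal_compact ::
    "master \<Rightarrow> (nat \<Rightarrow> complex) set \<Rightarrow> ((nat \<Rightarrow> complex) \<Rightarrow> tchain) \<Rightarrow> bool" where
  "horizontal_compact A U \<gamma> \<longleftrightarrow>
     (\<forall>z\<in>U. compact_twisted_cycle A z (\<gamma> z)) \<and>
     (\<forall>z0\<in>U. \<exists>N K b. openin (top_of_set U) N \<and> z0 \<in> N \<and> finite K \<and>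
        (\<forall>z\<in>N. compact_twisted_cycle A z (b z) \<and> supp (b z) \<subseteq> K \<and>
           twisted_homologous A z (\<gamma> z) (b z)) \<and>
        (\<forall>\<sigma>\<in>K. flat_section A (standard_simplex (nvars A) \<times> N)
           (\<lambda>(x, z). (\<sigma> x, z)) (\<lambda>(x, z). b z \<sigma> x)))"

text \<open>A family of non-compact cycles is horizontal if locally its simplices and branches are
  transported continuously and, so that one may differentiate under the integral sign, integration
  over the family commutes with the differential of the total space:
  \<open>\<partial>/\<partial>z\<^sub>i \<integral>\<^sub>\<gamma> \<Psi> = \<integral>\<^sub>\<gamma> \<iota>(\<partial>/\<partial>z\<^sub>i) d\<Psi>\<close> for \<open>\<Psi> = \<Phi>\<^bsup>1/\<kappa>\<^esup> \<eta>\<close>. Here the \<open>d log\<close>'s include their \<open>dz\<close> parts, so no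
  boundary term from the moving ends and no higher order pole appears.\<close>

definition horizontal_noncompact ::
    "master \<Rightarrow> (nat \<Rightarrow> complex) set \<Rightarrow> ((nat \<Rightarrow> complex) \<Rightarrow> tchain) \<Rightarrow> bool" where
  "horizontal_noncompact A U \<gamma> \<longleftrightarrow>
     (\<forall>z\<in>U. noncompact_twisted_cycle A z (\<gamma> z)) \<and>
     (\<forall>z0\<in>U. \<exists>N T. openin (top_of_set U) N \<and> z0 \<in> N \<and>
        (\<forall>\<sigma>\<in>supp (\<gamma> z0). T z0 \<sigma> = \<sigma>) \<and>
        (\<forall>z\<in>N. bij_betw (T z) (supp (\<gamma> z0)) (supp (\<gamma> z))) \<and>
        (\<forall>\<sigma>\<in>supp (\<gamma> z0).
           continuous_on (standard_simplex (nvars A) \<times> N) (\<lambda>(x, z). T z \<sigma> x) \<and>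
           flat_section A (standard_simplex (nvars A) \<times> N)
             (\<lambda>(x, z). (T z \<sigma> x, z)) (\<lambda>(x, z). \<gamma> z (T z \<sigma>) x)) \<and>
        (\<forall>Q. compact Q \<longrightarrow> Q \<subseteq> {(t, z). z \<in> N \<and> t \<in> fibre A z} \<longrightarrow>
           finite {\<sigma>\<in>supp (\<gamma> z0). \<exists>x\<in>standard_simplex (nvars A). \<exists>z\<in>N. (T z \<sigma> x, z) \<in> Q})) \<and>
     (\<forall>z\<in>U. \<forall>i<npts A. \<forall>\<eta>\<in>dlog_lists A. length \<eta> = nvars A \<longrightarrow>
        integral_converges A z (\<gamma> z) (insert_dz i (twisted_d A \<eta>)) \<and>
        ((\<lambda>w. twisted_integral A (z(i := w)) (\<gamma> (z(i := w))) (wedge \<eta>))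
           has_field_derivative
           twisted_integral A z (\<gamma> z) (insert_dz i (twisted_d A \<eta>))) (at (z i)))"

definition horizontal_family ::
    "master \<Rightarrow> (nat \<Rightarrow> complex) set \<Rightarrow> ((nat \<Rightarrow> complex) \<Rightarrow> tchain) \<Rightarrow> bool" where
  "horizontal_family A U \<gamma> \<longleftrightarrow> horizontal_compact A U \<gamma> \<or> horizontal_noncompact A U \<gamma>"


section \<open>Hypergeometric integrals\<close>

definition colouring :: "nat \<Rightarrow> (nat \<Rightarrow> nat) \<Rightarrow> nat \<Rightarrow> (nat \<Rightarrow> nat) \<Rightarrow> bool" where
  "colouring r lam m c \<longleftrightarrow>
     (\<forall>k<m. c k < r) \<and> (\<forall>k l. k \<le> l \<and> l < m \<longrightarrow> c k \<le> c l) \<and>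
     (\<forall>i<r. card {k. k < m \<and> c k = i} = lam i)"

definition kz_master ::
    "'h cartan \<Rightarrow> nat \<Rightarrow> (nat \<Rightarrow> 'h \<Rightarrow> complex) \<Rightarrow> nat \<Rightarrow> (nat \<Rightarrow> nat) \<Rightarrow> 'h \<Rightarrow> complex \<Rightarrow>
     master" where
  "kz_master D n \<Lambda> m c \<mu> \<kappa> =
     \<lparr> npts = n, nvars = m,
       coef_t = (\<lambda>k. - sroot D (c k) \<mu>),
       coef_z = (\<lambda>j. \<Lambda> j \<mu>),
       exp_zz = (\<lambda>i j. dform D (\<Lambda> i) (\<Lambda> j)),
       exp_tz = (\<lambda>k j. - dform D (sroot D (c k)) (\<Lambda> j)),
       exp_tt = (\<lambda>k l. dform D (sroot D (c k)) (sroot D (c l))),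
       kap = \<kappa> \<rparr>"

definition Pseq :: "nat \<Rightarrow> (nat \<Rightarrow> nat) \<Rightarrow> nat \<Rightarrow> nat list list set" where
  "Pseq r lam n = {I. length I = n \<and> set (concat I) \<subseteq> {..<r} \<and>
                      (\<forall>i<r. count_list (concat I) i = lam i)}"

definition block :: "nat list list \<Rightarrow> (nat \<Rightarrow> nat) \<Rightarrow> nat \<Rightarrow> nat list" where
  "block I \<sigma> j =
     map (\<lambda>l. \<sigma> (sum_list (map length (take j I)) + l)) [0..<length (I ! j)]"

definition Sig :: "nat \<Rightarrow> (nat \<Rightarrow> nat) \<Rightarrow> nat list list \<Rightarrow> (nat \<Rightarrow> nat) set" where
  "Sig m c I = {\<sigma>. \<sigma> permutes {..<m} \<and> (\<forall>j<length I. map c (block I \<sigma> j) = I ! j)}"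

fun omega_block :: "nat list \<Rightarrow> nat \<Rightarrow> one_form list" where
  "omega_block [] j = []"
| "omega_block [k] j = [dlog (tz k j)]"
| "omega_block (k # l # ks) j = dlog (tt k l) # omega_block (l # ks) j"

definition omega :: "nat list list \<Rightarrow> (nat \<Rightarrow> nat) \<Rightarrow> one_form list" where
  "omega I \<sigma> = concat (map (\<lambda>j. omega_block (block I \<sigma> j) j) [0..<length I])"

definition f_vec ::
    "('h, 'g) km_lie \<Rightarrow> nat \<Rightarrow> (nat \<Rightarrow> 'g \<Rightarrow> 'm \<Rightarrow> 'm) \<Rightarrow> (nat \<Rightarrow> 'm) \<Rightarrow>
     ((nat \<Rightarrow> 'm) \<Rightarrow> 't) \<Rightarrow> nat list list \<Rightarrow> 't" where
  "f_vec G n act v tens I =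
     tens (\<lambda>j\<in>{..<n}. foldr (\<lambda>i. act j (geF G i)) (I ! j) (v j))"

definition u_coef ::
    "master \<Rightarrow> (nat \<Rightarrow> nat) \<Rightarrow> ((nat \<Rightarrow> complex) \<Rightarrow> tchain) \<Rightarrow> (nat \<Rightarrow> complex) \<Rightarrow>
     nat list list \<Rightarrow> complex" where
  "u_coef A c \<gamma> z I =
     twisted_integral A z (\<gamma> z)
       (\<lambda>p w. \<Sum>\<sigma>\<in>Sig (nvars A) c I. of_int (sign \<sigma>) * wedge (omega I \<sigma>) p w)"

definition hypergeometric_integral ::
    "'h cartan \<Rightarrow> ('h, 'g) km_lie \<Rightarrow> nat \<Rightarrow> (nat \<Rightarrow> 'h \<Rightarrow> complex) \<Rightarrow>
     (nat \<Rightarrow> 'g \<Rightarrow> 'm \<Rightarrow> 'm) \<Rightarrow> (nat \<Rightarrow> 'm) \<Rightarrow> ((nat \<Rightarrow> 'm) \<Rightarrow> 't::complex_vector) \<Rightarrow>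
     (nat \<Rightarrow> nat) \<Rightarrow> nat \<Rightarrow> (nat \<Rightarrow> nat) \<Rightarrow> 'h \<Rightarrow> complex \<Rightarrow> ((nat \<Rightarrow> complex) \<Rightarrow> tchain) \<Rightarrow>
     (nat \<Rightarrow> complex) \<Rightarrow> 't" where
  "hypergeometric_integral D G n \<Lambda> act v tens lam m c \<mu> \<kappa> \<gamma> z =
     (\<Sum>I\<in>Pseq (rk D) lam n.
        u_coef (kz_master D n \<Lambda> m c \<mu> \<kappa>) c \<gamma> z I *\<^sub>C f_vec G n act v tens I)"

definition weight_space ::
    "'h cartan \<Rightarrow> ('h, 'g) km_lie \<Rightarrow> nat \<Rightarrow> (nat \<Rightarrow> 'h \<Rightarrow> complex) \<Rightarrow>
     (nat \<Rightarrow> 'g \<Rightarrow> 'm \<Rightarrow> 'm) \<Rightarrow> ((nat \<Rightarrow> 'm) \<Rightarrow> 't::complex_vector) \<Rightarrow>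
     (nat \<Rightarrow> nat) \<Rightarrow> 't set" where
  "weight_space D G n \<Lambda> act tens lam =
     {x. \<forall>h. (\<Sum>j<n. factor_op n tens j (act j (inH G h)) x) =
              ((\<Sum>j<n. \<Lambda> j h) - root_fun D lam h) *\<^sub>C x}"

text \<open>Derivative of a function with values in a finite dimensional subspace (here a weight space):
  every linear functional is differentiated.\<close>

definition has_vec_derivative_at ::
    "(complex \<Rightarrow> 't::complex_vector) \<Rightarrow> 't \<Rightarrow> complex \<Rightarrow> bool" where
  "has_vec_derivative_at u d w0 \<longleftrightarrow>
     (\<forall>\<phi> :: 't \<Rightarrow> complex. clinear \<phi> \<longrightarrow> ((\<lambda>w. \<phi> (u w)) has_field_derivative \<phi> d) (at w0))"

end

theory Submission
 imports Defs "HOL-Combinatorics.Multiset_Permutations" "Jordan_Normal_Form.Determinant"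
begin

text \<open>On a fibre, the integral \<open>u\<close> is a sum over the ways \<open>W\<close> of arranging the integration variables in \<open>n\<close>
 words, the \<open>i\<close>-th of which is attached to \<open>z\<^sub>i\<close>; the integrand is \<open>\<Phi>\<^bsup>1/\<kappa>\<^esup>\<close> times a product of inverse differences along
 the words. This product is invariant when \<open>z\<^sub>i\<close> is translated together with the variables of the \<open>i\<close>-th word.
 Since the integral of a derivative in a variable \<open>t\<^sub>k\<close> vanishes, \<open>\<kappa> \<partial>u/\<partial>z\<^sub>i\<close> is obtained by inserting the logarithmic
 derivative of \<open>\<Phi>\<close> along this translation. It consists of the eigenvalue of \<open>\<mu>\<^bsup>(i)\<^esup>\<close> and, for each \<open>j \<noteq> i\<close>,
 of the interaction of the points of the words \<open>i\<close> and \<open>j\<close>. For fixed \<open>t\<close>, the latter sums up to the action of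
 \<open>\<Omega>\<^sub>+\<^sub>,\<^sub>i\<^sub>j/(z\<^sub>i - z\<^sub>j)\<close>: in the tensor product of the \<open>i\<close>-th and \<open>j\<close>-th factors, \<open>\<nu>\<^sub>-\<close> of a word is a sum over its letters,
 sums over words are group-like with respect to shuffles, and the operators \<open>f\<^sub>k\<close> are derivations.\<close>

text \<open>The derivative of \<open>u\<close> arises differently for the two kinds of cycles. For
  compact cycles, invariance under homology and the vanishing of integrals of derivatives have to be
  derived: coefficients are sections over single simplices and smoothness is coordinatewise, so
  Stokes' theorem is proved for determinants of directional derivatives and summed over faces. For
  non-compact cycles the derivative is a contraction with d/dz_i, which agrees pointwise with the
  translation formula, because the translation differs from d/dz_i by vertical vectors only. On the
  algebraic side everything is given by presentations and definite descriptions, so every operator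
  needs existence as well as uniqueness. For \<nu>_- existence is freeness of the Verma modules over
  the words in the f_i; in the absence of Serre relations it is read off from an explicit action on
  formal combinations of words. The sum over roots in \<Omega>_+ collapses to a basis-free insertion
  map. The pole 1/(z_i - z_j) comes from passing a letter b from one word to the other, which costs
  a factor t_b - z; writing z - z' through t_b turns such factors into differences of logarithmic
  derivatives.\<close>

abbreviation "perms == permutations_of_set"
abbreviation "std == standard_simplex"
abbreviation "sface == simplical_face"
abbreviation "sint == simplex_integral"
abbreviation "tint == twisted_integral"

section \<open>Sums over words with distinct letters\<close>

text \<open>Words are read from the root outwards: \<open>chain t [k\<^sub>1,\<dots>,k\<^sub>s] x\<close> is the coefficient of
  \<open>\<omega>\<^bsub>k\<^sub>s,\<dots>,k\<^sub>1\<^esub>(x)\<close>.\<close>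

fun chain :: "(nat => complex) => nat list => complex => complex" where
 "chain t [] x = 1"
| "chain t (k # w) x = chain t w (t k) / (t k - x)"

lemma chain_append: "chain t (q @ b # a) x = chain t (q @ [b]) x * chain t a (t b)"
 by (induction q arbitrary: x) auto

text \<open>This is 1/((l-k)(k-x)) + 1/((k-l)(l-x)) = 1/((k-x)(l-x)), the shuffle identity for two
  single letters. The numerators \<open>p\<close> and \<open>q\<close> stand for the parts of two
  words that follow these letters.\<close>

lemma partial_fractions:
 fixes k l x p q :: complex
 assumes "k ~= l" "k ~= x" "l ~= x"
 shows "p * (q / (l - k)) / (k - x) + p / (k - l) * q / (l - x) = p / (k - x) * (q / (l - x))"
proof -
 have "1 / ((l - k) * (k - x)) + 1 / ((k - l) * (l - x)) = 1 / ((k - x) * (l - x))"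
 proof -
  have "1 / ((l - k) * (k - x)) = (l - x) / ((l - k) * ((k - x) * (l - x)))"
   using assms by simp
  moreover have "1 / ((k - l) * (l - x)) = - (k - x) / ((l - k) * ((k - x) * (l - x)))"
   using assms by (simp add: divide_simps) (simp add: algebra_simps)
  ultimately have "1 / ((l - k) * (k - x)) + 1 / ((k - l) * (l - x))
    = ((l - x) - (k - x)) / ((l - k) * ((k - x) * (l - x)))"
   by (simp only: add_divide_distrib diff_conv_add_uminus)
  thus ?thesis using assms by simp
 qed
 hence "p * q * (1 / ((l - k) * (k - x)) + 1 / ((k - l) * (l - x))) = p * q * (1 / ((k - x) * (l - x)))"
  by simp
 thus ?thesis by (simp add: ring_distribs)
qed

text \<open>A shuffle starts with the first letter of \<open>u\<close> or with that of
  \<open>v\<close>. Beyond this letter the induction hypothesis applies with the letter's position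
  as the new root, and partial fractions add the two contributions.\<close>

lemma sum_chain_shuffles:
 assumes "inj_on t (set u \<union> set v)" "set u \<inter> set v = {}" "distinct u" "distinct v"
  "x \<notin> t ` (set u \<union> set v)"
 shows "(\<Sum>w\<in>shuffles u v. chain t w x) = chain t u x * chain t v x"
 using assms
proof (induction u v arbitrary: x rule: shuffles.induct)
 case (3 k u l v)
 have kl: "t k ~= t l" using 3(3,4) by (auto simp: inj_on_def)
 have xk: "t k ~= x" "t l ~= x" using 3(7) by auto
 have k: "t k \<notin> t ` (set u \<union> set (l # v))" "t l \<notin> t ` (set (k # u) \<union> set v)"
  using 3(3-6) by (auto simp: inj_on_def)
 have 1: "(\<Sum>w\<in>shuffles u (l # v). chain t w (t k)) = chain t u (t k) * chain t (l # v) (t k)"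
  using 3(3-6) k by (intro 3(1)) (auto simp: inj_on_def)
 have 2: "(\<Sum>w\<in>shuffles (k # u) v. chain t w (t l)) = chain t (k # u) (t l) * chain t v (t l)"
  using 3(3-6) k by (intro 3(2)) (auto simp: inj_on_def)
 have "(\<Sum>w\<in>shuffles (k # u) (l # v). chain t w x)
   = (\<Sum>w\<in>(#) k ` shuffles u (l # v). chain t w x) + (\<Sum>w\<in>(#) l ` shuffles (k # u) v. chain t w x)"
  using kl by (simp, subst sum.union_disjoint) auto
 also have "... = (\<Sum>w\<in>shuffles u (l # v). chain t w (t k)) / (t k - x)
    + (\<Sum>w\<in>shuffles (k # u) v. chain t w (t l)) / (t l - x)"
  by (simp add: sum.reindex sum_divide_distrib)
 also have "... = chain t (k # u) x * chain t (l # v) x"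
  unfolding 1 2 using partial_fractions[OF kl xk] by simp
 finally show ?case .
qed auto

text \<open>These are the shuffles with the one-letter word \<open>[b]\<close>, whose chain is
  \<open>1 / (t b - x)\<close>. They are indexed by the position of \<open>b\<close>, since words
  are cut at this position later.\<close>

lemma sum_chain_insert:
 assumes "distinct (b # p)" "inj_on t (insert b (set p))" "x \<notin> t ` insert b (set p)"
 shows "(\<Sum>j\<le>length p. chain t (take j p @ b # drop j p) x) = chain t p x / (t b - x)"
 using assms
proof (induction p arbitrary: x)
 case (Cons k p)
 have ne: "t k ~= t b" "t k ~= x" "t b ~= x" using Cons(2-4) by (auto simp: inj_on_def)
 have IH: "(\<Sum>j\<le>length p. chain t (take j p @ b # drop j p) (t k)) = chain t p (t k) / (t b - t k)"
  using Cons(2-4) by (intro Cons(1)) (auto simp: inj_on_def)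
 have "(\<Sum>j\<le>length (k # p). chain t (take j (k # p) @ b # drop j (k # p)) x)
   = chain t (k # p) (t b) / (t b - x) + (\<Sum>j\<le>length p. chain t (take j p @ b # drop j p) (t k)) / (t k - x)"
  by (simp add: sum.atMost_Suc_shift del: sum.atMost_Suc) (simp add: sum_divide_distrib)
 also have "... = chain t (k # p) x / (t b - x)"
  unfolding IH using partial_fractions[of "t k" "t b" x "chain t p (t k)" 1] ne by (simp add: divide_simps) (simp add: algebra_simps)
 finally show ?case .
qed auto

text \<open>A letter \<open>c\<close> is counted when \<open>b\<close> stands after it. Peeling off
  the first letter \<open>k\<close>, its weight multiplies an unweighted insertion with root
  \<open>t k\<close>, which produces \<open>1 / (t b - t k)\<close>. The weights model the
  eigenvalue of the coroot of \<open>b\<close> on the letters applied before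
  \<open>b\<close>.\<close>

lemma sum_chain_insert_weighted:
 assumes "distinct (b # p)" "inj_on t (insert b (set p))" "x \<notin> t ` insert b (set p)"
 shows "(\<Sum>j\<le>length p. (\<Sum>c\<leftarrow>take j p. g c) * chain t (take j p @ b # drop j p) x)
   = chain t p x * (\<Sum>c\<leftarrow>p. g c / (t b - t c))"
 using assms
proof (induction p arbitrary: x)
 case (Cons k p)
 have IH: "(\<Sum>j\<le>length p. (\<Sum>c\<leftarrow>take j p. g c) * chain t (take j p @ b # drop j p) (t k))
   = chain t p (t k) * (\<Sum>c\<leftarrow>p. g c / (t b - t c))"
  using Cons(2-4) by (intro Cons(1)) (auto simp: inj_on_def)
 have I: "(\<Sum>j\<le>length p. chain t (take j p @ b # drop j p) (t k)) = chain t p (t k) / (t b - t k)"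
  using Cons(2-4) by (intro sum_chain_insert) (auto simp: inj_on_def)
 have "(\<Sum>j\<le>length (k # p). (\<Sum>c\<leftarrow>take j (k # p). g c) * chain t (take j (k # p) @ b # drop j (k # p)) x)
   = (g k * (\<Sum>j\<le>length p. chain t (take j p @ b # drop j p) (t k))
   + (\<Sum>j\<le>length p. (\<Sum>c\<leftarrow>take j p. g c) * chain t (take j p @ b # drop j p) (t k))) / (t k - x)"
  by (simp add: sum.atMost_Suc_shift del: sum.atMost_Suc) (simp add: sum_divide_distrib sum_distrib_left ring_distribs sum.distrib add_divide_distrib)
 also have "... = chain t (k # p) x * (\<Sum>c\<leftarrow>k # p. g c / (t b - t c))"
  unfolding IH I by (simp add: ring_distribs add_divide_distrib mult_ac)
 finally show ?case .
qed auto

section \<open>Sums over the arrangements and the subsets of a finite set\<close>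

lemma append_parts:
 assumes "distinct (q @ a)" "set (q @ a) = S"
 shows "distinct q" "distinct a" "set a = S - set q" "set q \<subseteq> S"
 using assms by auto

lemma append_Cons_parts:
 assumes "distinct (q @ b # a)" "set (q @ b # a) = S"
 shows "distinct q" "distinct a" "b \<in> S" "set q \<subseteq> S - {b}" "set a = S - {b} - set q"
 using assms by auto

text \<open>Cutting an arrangement is reversible: the position \<open>j\<close> is the length of the
  first piece and the subset \<open>Q\<close> is its set of letters.\<close>

lemma sum_permutations_split:
 assumes "finite S"
 shows "(\<Sum>p\<in>perms S. \<Sum>j\<le>length p. F (take j p) (drop j p))
   = (\<Sum>Q\<in>Pow S. \<Sum>q\<in>perms Q. \<Sum>a\<in>perms (S - Q). F q a)"
proof -
 have "(\<Sum>p\<in>perms S. \<Sum>j\<le>length p. F (take j p) (drop j p))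
   = (\<Sum>(p, j)\<in>(SIGMA p:perms S. {..length p}). F (take j p) (drop j p))"
  by (simp add: sum.Sigma)
 also have "... = (\<Sum>(Q, q, a)\<in>(SIGMA Q:Pow S. perms Q \<times> perms (S - Q)). F q a)"
 proof (rule sum.reindex_bij_witness[where j = "%(p, j). (set (take j p), take j p, drop j p)"
     and i = "%(Q, q, a). (q @ a, length q)"], goal_cases)
  case (2 x)
  obtain p j where x: "x = (p, j)" "distinct p" "set p = S" "j \<le> length p"
   using 2 by (auto simp: permutations_of_set_def)
  have d: "distinct (take j p @ drop j p)" "set (take j p @ drop j p) = S"
   using x by simp_all
  show ?case unfolding x(1) prod.case
   by (intro SigmaI PowI permutations_of_setI refl append_parts[OF d])
 next
  case (4 x)
  obtain Q q a where x: "x = (Q, q, a)" by (cases x)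
  have "set q = Q" "distinct q" "set a = S - Q" "distinct a" "Q \<subseteq> S"
   using 4 unfolding x by (auto dest: permutations_of_setD)
  thus ?case unfolding x by (auto intro!: permutations_of_setI)
 qed (auto dest!: permutations_of_setD(1))
 also have "... = (\<Sum>Q\<in>Pow S. \<Sum>q\<in>perms Q. \<Sum>a\<in>perms (S - Q). F q a)"
  unfolding sum.cartesian_product using assms by (subst sum.Sigma) auto
 finally show ?thesis .
qed

lemma sum_permutations_split_at:
 assumes "finite S"
 shows "(\<Sum>p\<in>perms S. \<Sum>j<length p. F (take j p) (p ! j) (drop (Suc j) p))
   = (\<Sum>b\<in>S. \<Sum>Q\<in>Pow (S - {b}). \<Sum>q\<in>perms Q. \<Sum>a\<in>perms (S - {b} - Q). F q b a)"
proof -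
 have "(\<Sum>p\<in>perms S. \<Sum>j<length p. F (take j p) (p ! j) (drop (Suc j) p))
   = (\<Sum>(p, j)\<in>(SIGMA p:perms S. {..<length p}). F (take j p) (p ! j) (drop (Suc j) p))"
  by (simp add: sum.Sigma)
 also have "... = (\<Sum>(b, Q, q, a)\<in>(SIGMA b:S. SIGMA Q:Pow (S - {b}). perms Q \<times> perms (S - {b} - Q)). F q b a)"
 proof (rule sum.reindex_bij_witness[where j = "%(p, j). (p ! j, set (take j p), take j p, drop (Suc j) p)"
     and i = "%(b, Q, q, a). (q @ b # a, length q)"], goal_cases)
  case (1 x)
  thus ?case using id_take_nth_drop[of "snd x" "fst x", symmetric]
   by (cases x) (simp only: prod.case mem_Sigma_iff lessThan_iff fst_conv snd_conv, simp)
 next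
  case (2 x)
  obtain p j where x: "x = (p, j)" "distinct p" "set p = S" "j < length p"
   using 2 by (auto simp: permutations_of_set_def)
  have d: "distinct (take j p @ p ! j # drop (Suc j) p)" "set (take j p @ p ! j # drop (Suc j) p) = S"
   using x(2-3) unfolding id_take_nth_drop[OF x(4), symmetric] by simp_all
  show ?case unfolding x(1) prod.case
   by (intro SigmaI PowI permutations_of_setI refl append_Cons_parts[OF d])
 next
  case (4 x)
  obtain b Q q a where x: "x = (b, Q, q, a)" by (cases x)
  have "set q = Q" "distinct q" "set a = S - {b} - Q" "distinct a" "Q \<subseteq> S - {b}" "b \<in> S"
   using 4 unfolding x by (auto dest: permutations_of_setD)
  thus ?case unfolding x by (auto intro!: permutations_of_setI)
 next
  case (3 x)
  obtain b Q q a where x: "x = (b, Q, q, a)" by (cases x)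
  have "set q = Q" using 3 unfolding x by (simp add: permutations_of_set_def)
  thus ?case unfolding x by simp
 next
  case (5 x)
  show ?case by (cases x) simp
 qed
 also have "... = (\<Sum>b\<in>S. \<Sum>Q\<in>Pow (S - {b}). \<Sum>q\<in>perms Q. \<Sum>a\<in>perms (S - {b} - Q). F q b a)"
 proof -
  have fin: "finite (SIGMA Q:Pow (S - {b}). perms Q \<times> perms (S - {b} - Q))" for b
   using assms by (intro finite_SigmaI finite_cartesian_product) auto
  have "(\<Sum>Q\<in>Pow (S - {b}). \<Sum>q\<in>perms Q. \<Sum>a\<in>perms (S - {b} - Q). F q b a)
   = (\<Sum>(Q, q, a)\<in>(SIGMA Q:Pow (S - {b}). perms Q \<times> perms (S - {b} - Q)). F q b a)" for b
   unfolding sum.cartesian_product using assms by (subst sum.Sigma) auto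
  thus ?thesis using assms fin by (simp only:) (subst sum.Sigma, auto)
 qed
 finally show ?thesis .
qed

lemma sum_Pow_swap:
 assumes "finite X"
 shows "(\<Sum>A\<in>Pow X. \<Sum>B\<in>Pow (X - A). h A B) = (\<Sum>B\<in>Pow X. \<Sum>A\<in>Pow (X - B). h A B)"
proof -
 have "(\<Sum>A\<in>Pow X. \<Sum>B\<in>Pow (X - A). h A B) = (\<Sum>(A, B)\<in>(SIGMA A:Pow X. Pow (X - A)). h A B)"
  using assms by (subst sum.Sigma) auto
 also have "... = (\<Sum>(B, A)\<in>(SIGMA B:Pow X. Pow (X - B)). h A B)"
  by (rule sum.reindex_bij_witness[where i = prod.swap and j = prod.swap]) auto
 finally show ?thesis using assms by (subst sum.Sigma) auto
qed

lemma sum_Pow_Un: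
 assumes "finite X"
 shows "(\<Sum>P\<in>Pow X. \<Sum>Q\<in>Pow P. h P Q) = (\<Sum>Q\<in>Pow X. \<Sum>Y\<in>Pow (X - Q). h (Q \<union> Y) Q)"
proof -
 have "(\<Sum>P\<in>Pow X. \<Sum>Q\<in>Pow P. h P Q) = (\<Sum>(P, Q)\<in>(SIGMA P:Pow X. Pow P). h P Q)"
  using assms by (subst sum.Sigma) (auto intro: finite_subset)
 also have "... = (\<Sum>(Q, Y)\<in>(SIGMA Q:Pow X. Pow (X - Q)). h (Q \<union> Y) Q)"
  by (rule sum.reindex_bij_witness[where j = "%(P, Q). (Q, P - Q)" and i = "%(Q, Y). (Q \<union> Y, Q)"])
    (auto simp: Un_absorb1)
 finally show ?thesis using assms by (subst sum.Sigma) auto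
qed

lemma sum_Pow_insert_swap:
 assumes "finite S"
 shows "(\<Sum>P\<in>Pow S. \<Sum>b\<in>P. h P b) = (\<Sum>b\<in>S. \<Sum>P\<in>Pow (S - {b}). h (insert b P) b)"
proof -
 have "(\<Sum>P\<in>Pow S. \<Sum>b\<in>P. h P b) = (\<Sum>(P, b)\<in>(SIGMA P:Pow S. P). h P b)"
  using assms by (subst sum.Sigma) (auto intro: finite_subset)
 also have "... = (\<Sum>(b, P)\<in>(SIGMA b:S. Pow (S - {b})). h (insert b P) b)"
  by (rule sum.reindex_bij_witness[where j = "%(P, b). (b, P - {b})" and i = "%(b, P). (insert b P, b)"])
    (auto simp: insert_absorb)
 finally show ?thesis using assms by (subst sum.Sigma) auto
qed

lemma sum_Pow_Diff_swap:
 assumes "finite S"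
 shows "(\<Sum>P\<in>Pow S. \<Sum>b\<in>S - P. h P b) = (\<Sum>b\<in>S. \<Sum>P\<in>Pow (S - {b}). h P b)"
proof -
 have "(\<Sum>P\<in>Pow S. \<Sum>b\<in>S - P. h P b) = (\<Sum>(P, b)\<in>(SIGMA P:Pow S. S - P). h P b)"
  using assms by (subst sum.Sigma) auto
 also have "... = (\<Sum>(b, P)\<in>(SIGMA b:S. Pow (S - {b})). h P b)"
  by (rule sum.reindex_bij_witness[where j = prod.swap and i = prod.swap]) auto
 finally show ?thesis using assms by (subst sum.Sigma) auto
qed

text \<open>A word with distinct letters is recovered from its subwords inside and outside
  \<open>A\<close> and from the way these are shuffled. This brings the Leibniz rule into the form
  to which the shuffle identity applies.\<close>

lemma sum_permutations_partition:
 assumes "finite X" "A \<subseteq> X"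
 shows "(\<Sum>w\<in>perms X. F w (filter (%k. k \<in> A) w) (filter (%k. k \<notin> A) w))
  = (\<Sum>u\<in>perms A. \<Sum>v\<in>perms (X - A). \<Sum>w\<in>shuffles u v. F w u v)"
proof -
 have "(\<Sum>w\<in>perms X. F w (filter (%k. k \<in> A) w) (filter (%k. k \<notin> A) w))
  = (\<Sum>(u, v, w)\<in>(SIGMA u:perms A. SIGMA v:perms (X - A). shuffles u v). F w u v)"
 proof (rule sum.reindex_bij_witness[where j = "%w. (filter (%k. k \<in> A) w, filter (%k. k \<notin> A) w, w)"
    and i = "%(u, v, w). w"], goal_cases)
  case (2 w) thus ?case using assms partition_in_shuffles[of w "%k. k \<in> A"]
   by (auto simp: permutations_of_set_def)
 next
  case (3 x)
  obtain u v w where x: "x = (u, v, w)" by (cases x)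
  have "set u = A" "set v = X - A" "w \<in> shuffles u v" using 3 x by (auto simp: permutations_of_set_def)
  moreover from this have "set u \<inter> set v = {}" by auto
  ultimately show ?case using x filter_shuffles_disjoint1[of u v w] by auto
 next
  case (4 x)
  obtain u v w where x: "x = (u, v, w)" by (cases x)
  have "set u = A" "set v = X - A" "w \<in> shuffles u v" "distinct u" "distinct v"
   using 4 x by (auto simp: permutations_of_set_def)
  moreover from this have "set u \<inter> set v = {}" by auto
  ultimately show ?case using x assms set_shuffles[of w u v] distinct_disjoint_shuffles[of u v w]
   by (auto simp: permutations_of_set_def)
 qed auto
 also have "... = (\<Sum>u\<in>perms A. \<Sum>v\<in>perms (X - A). \<Sum>w\<in>shuffles u v. F w u v)"
  using assms by (subst sum.Sigma, simp, blast intro: finite_SigmaI finite_permutations_of_set)+ auto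
 finally show ?thesis .
qed

section \<open>Group-like sums of words of operators\<close>

lemma clinear_add: "clinear f ==> f (x + y) = f x + f y"
 and clinear_scale: "clinear f ==> f (a *\<^sub>C x) = a *\<^sub>C f x"
 by (simp_all add: Vector_Spaces.linear_iff)

lemma clinearI:
 "(!!x y. f (x + y) = f x + f y) ==> (!!a x. f (a *\<^sub>C x) = a *\<^sub>C f x) ==> clinear f"
 by (simp add: Vector_Spaces.linear_iff cvec.vector_space_axioms)

lemma clinear_zero: "clinear f ==> f 0 = 0"
 using clinear_scale[of f 0 0] by simp

lemma clinear_neg: "clinear f ==> f (- x) = - f x"
 using clinear_scale[of f "-1" x] by (simp add: cvec.scale_minus_left)

lemma clinear_diff: "clinear f ==> f (x - y) = f x - f y"
 using clinear_add[of f x "- y"] clinear_neg[of f y] by simp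

lemma clinear_sum: "clinear f ==> f (sum h I) = (\<Sum>i\<in>I. f (h i))"
 by (induction I rule: infinite_finite_induct) (simp_all add: clinear_add clinear_zero)

lemma clinear_ident: "clinear (%x. x)"
 by (intro clinearI) auto

lemma clinear_const_zero: "clinear (%x. 0)"
 by (intro clinearI) auto

lemma clinear_plus: "clinear f ==> clinear g ==> clinear (%x. f x + g x)"
 by (intro clinearI) (simp_all add: clinear_add clinear_scale scaleC_add_right algebra_simps)

lemma clinear_scaleC: "clinear f ==> clinear (%x. a *\<^sub>C f x)"
 by (intro clinearI) (simp_all add: clinear_add clinear_scale scaleC_add_right scaleC_scaleC mult.commute)

lemma clinear_sum_fun: "(!!i. i \<in> I ==> clinear (f i)) ==> clinear (%x. \<Sum>i\<in>I. f i x)"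
 by (intro clinearI) (simp_all add: clinear_add clinear_scale sum.distrib cvec.scale_sum_right)

lemma clinear_comp: "clinear f ==> clinear g ==> clinear (%x. f (g x))"
 by (intro clinearI) (simp_all add: clinear_add clinear_scale)

definition cbilinear ::
  "('a::complex_vector => 'b::complex_vector => 'c::complex_vector) => bool" where
 "cbilinear b \<longleftrightarrow> (\<forall>x. clinear (b x)) \<and> (\<forall>y. clinear (%x. b x y))"

lemma cbilinear_right: "cbilinear b ==> clinear (b x)"
 and cbilinear_left: "cbilinear b ==> clinear (%x. b x y)"
 by (auto simp: cbilinear_def)

lemmas cbilinear_simps =
 cbilinear_right[THEN clinear_add] cbilinear_left[THEN clinear_add]
 cbilinear_right[THEN clinear_scale] cbilinear_left[THEN clinear_scale]
 cbilinear_right[THEN clinear_sum] cbilinear_left[THEN clinear_sum]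
 cbilinear_right[THEN clinear_zero] cbilinear_left[THEN clinear_zero]

lemma clinear_fold: "(!!k. clinear (f k)) ==> clinear (fold f w)"
proof (induction w)
 case (Cons k w)
 thus ?case using clinear_comp[of "fold f w" "f k"] by (simp add: comp_def)
qed (simp add: id_def clinear_ident)

lemma fold_take_drop: "fold f (drop j p) (fold f (take j p) y) = fold f p y"
 by (metis append_take_drop_id comp_apply fold_append)

text \<open>The contribution of one tensor factor to the integrand at fixed \<open>t\<close>: the
  variables in \<open>S\<close> are attached to the root \<open>x\<close> in all orders. Since
  \<open>fold\<close> applies the first letter first, the letter next to the root acts first on
  \<open>y\<close>.\<close>

definition wsum ::
  "(nat => complex) => nat set => complex => (nat => 'v => 'v) => 'v => 'v::complex_vector" where
 "wsum t S x f y = (\<Sum>w\<in>perms S. chain t w x *\<^sub>C fold f w y)"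

text \<open>The initial segments, with letters \<open>Q\<close>, of words that are cut at a letter
  \<open>b\<close> which is not itself applied. The factor \<open>t b - x\<close> cancels the pole
  of the chain for empty \<open>Q\<close>, where the value is \<open>y\<close>.\<close>

definition wtail ::
  "(nat => complex) => nat set => nat => complex => (nat => 'v => 'v) => 'v => 'v::complex_vector" where
 "wtail t Q b x f y = (\<Sum>q\<in>perms Q. ((t b - x) * chain t (q @ [b]) x) *\<^sub>C fold f q y)"

lemma clinear_wsum: "(!!k. clinear (f k)) ==> clinear (wsum t S x f)"
 unfolding wsum_def[abs_def] by (intro clinear_sum_fun clinear_scaleC clinear_fold)

text \<open>Each letter acts on exactly one of the two arguments, and \<open>A\<close> collects
  those acting on the left one. In the induction the subsets with and without the first letter give
  the two terms of the Leibniz rule.\<close>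

lemma fold_leibniz:
 assumes "!!k. clinear (c k)" "!!k x y. c k (b x y) = b (a k x) y + b x (a' k y)" "distinct w"
 shows "fold c w (b y y') = (\<Sum>A\<in>Pow (set w).
   b (fold a (filter (%k. k \<in> A) w) y) (fold a' (filter (%k. k \<notin> A) w) y'))"
 using assms(3)
proof (induction w arbitrary: y y')
 case (Cons k w)
 let ?G = "%A. b (fold a (filter (%k. k \<in> A) (k # w)) y) (fold a' (filter (%k. k \<notin> A) (k # w)) y')"
 have k: "k \<notin> set w" "distinct w" using Cons(2) by auto
 have f: "filter (%l. l ~= k --> l \<in> A) w = filter (%l. l \<in> A) w"
  "filter (%l. l = k \<or> l \<in> A) w = filter (%l. l \<in> A) w"
  "filter (%l. l ~= k \<and> l \<notin> A) w = filter (%l. l \<notin> A) w" for A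
  using k by (auto intro!: filter_cong)
 have "(\<Sum>A\<in>Pow (set (k # w)). ?G A) = sum ?G (Pow (set w)) + sum ?G (insert k ` Pow (set w))"
  using k by (simp add: Pow_insert, subst sum.union_disjoint) auto
 also have "sum ?G (insert k ` Pow (set w)) = (\<Sum>A\<in>Pow (set w). ?G (insert k A))"
  using k by (intro sum.reindex_cong[where l = "insert k"]) (auto simp: inj_on_def)
 also have "(\<Sum>A\<in>Pow (set w). ?G (insert k A)) = fold c w (b (a k y) y')"
  using k by (simp add: Cons.IH f)
 also have "sum ?G (Pow (set w)) = fold c w (b y (a' k y'))"
  unfolding Cons.IH[OF k(2)] using k by (intro sum.cong) auto
 also have "fold c w (b y (a' k y')) + fold c w (b (a k y) y') = fold c (k # w) (b y y')"
  using assms(1) by (simp add: assms(2) clinear_fold[THEN clinear_add] add.commute)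
 finally show ?case by simp
qed simp

text \<open>The sums \<open>wsum\<close> are group-like; this is the shuffle identity.\<close>

lemma wsum_leibniz:
 assumes c: "!!k. clinear (c k)" and b: "cbilinear b"
  and l: "!!k x y. c k (b x y) = b (a k x) y + b x (a' k y)"
  and X: "finite X" "inj_on t X" "x \<notin> t ` X"
 shows "wsum t X x c (b y y') = (\<Sum>A\<in>Pow X. b (wsum t A x a y) (wsum t (X - A) x a' y'))"
proof -
 let ?B = "%u v. b (fold a u y) (fold a' v y')"
 have "wsum t X x c (b y y') = (\<Sum>w\<in>perms X. \<Sum>A\<in>Pow X.
   chain t w x *\<^sub>C ?B (filter (%k. k \<in> A) w) (filter (%k. k \<notin> A) w))"
  unfolding wsum_def by (intro sum.cong refl)
   (simp add: fold_leibniz[where b = b, OF c l] permutations_of_set_def cvec.scale_sum_right)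
 also have "... = (\<Sum>A\<in>Pow X. \<Sum>w\<in>perms X.
   chain t w x *\<^sub>C ?B (filter (%k. k \<in> A) w) (filter (%k. k \<notin> A) w))"
  by (rule sum.swap)
 also have "... = (\<Sum>A\<in>Pow X. \<Sum>u\<in>perms A. \<Sum>v\<in>perms (X - A).
   (\<Sum>w\<in>shuffles u v. chain t w x) *\<^sub>C ?B u v)"
  using sum_permutations_partition[of X _ "%w u v. chain t w x *\<^sub>C ?B u v"] X(1)
  by (intro sum.cong[OF refl]) (simp add: cvec.scale_sum_left)
 also have "... = (\<Sum>A\<in>Pow X. \<Sum>u\<in>perms A. \<Sum>v\<in>perms (X - A).
   (chain t u x * chain t v x) *\<^sub>C ?B u v)"
 proof (intro sum.cong refl)
  fix A u v assume *: "A \<in> Pow X" "u \<in> perms A" "v \<in> perms (X - A)"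
  hence s: "set u = A" "set v = X - A" "distinct u" "distinct v" by (auto simp: permutations_of_set_def)
  hence "set u \<union> set v = X" using * by auto
  thus "(\<Sum>w\<in>shuffles u v. chain t w x) *\<^sub>C ?B u v = (chain t u x * chain t v x) *\<^sub>C ?B u v"
   using X s by (subst sum_chain_shuffles) auto
 qed
 also have "... = (\<Sum>A\<in>Pow X. b (wsum t A x a y) (wsum t (X - A) x a' y'))"
 proof (rule sum.cong[OF refl])
  fix A
  show "(\<Sum>u\<in>perms A. \<Sum>v\<in>perms (X - A). (chain t u x * chain t v x) *\<^sub>C ?B u v)
   = b (wsum t A x a y) (wsum t (X - A) x a' y')"
   unfolding wsum_def using b
   by (subst sum.swap) (simp add: cbilinear_simps scaleC_scaleC cvec.scale_sum_right mult.commute)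
 qed
 finally show ?thesis .
qed

text \<open>Change of root from \<open>x\<close> to \<open>t b\<close>:
  \<open>sum_chain_insert\<close> writes \<open>1\<close> as \<open>t b - x\<close> times an
  insertion of \<open>b\<close> in all positions, and each word is cut where \<open>b\<close> was
  inserted. Letters before the cut stay attached to \<open>x\<close>, those after it are attached to
  \<open>t b\<close>.\<close>

lemma wsum_insert:
 assumes f: "!!k. clinear (f k)" and P: "finite P" "b \<notin> P" "inj_on t (insert b P)" "x \<notin> t ` insert b P"
 shows "wsum t P x f y = (\<Sum>Q\<in>Pow P. wsum t (P - Q) (t b) f (wtail t Q b x f y))"
proof -
 have "wsum t P x f y = (\<Sum>p\<in>perms P. \<Sum>j\<le>length p.
   ((t b - x) * chain t (take j p @ [b]) x * chain t (drop j p) (t b)) *\<^sub>C fold f (drop j p) (fold f (take j p) y))"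
  unfolding wsum_def
 proof (intro sum.cong refl)
  fix p assume "p \<in> perms P"
  hence p: "set p = P" "distinct p" by (auto simp: permutations_of_set_def)
  have nz: "t b - x ~= 0" using P by auto
  have "chain t p x = (t b - x) * (\<Sum>j\<le>length p. chain t (take j p @ b # drop j p) x)"
   using P p nz by (subst sum_chain_insert) auto
  also have "... = (\<Sum>j\<le>length p. (t b - x) * chain t (take j p @ [b]) x * chain t (drop j p) (t b))"
   by (simp add: sum_distrib_left chain_append[where q = "take j p" and a = "drop j p" for j] mult.assoc)
  finally show "chain t p x *\<^sub>C fold f p y = (\<Sum>j\<le>length p.
   ((t b - x) * chain t (take j p @ [b]) x * chain t (drop j p) (t b)) *\<^sub>C fold f (drop j p) (fold f (take j p) y))"
   by (simp add: cvec.scale_sum_left fold_take_drop)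
 qed
 also have "... = (\<Sum>Q\<in>Pow P. \<Sum>q\<in>perms Q. \<Sum>a\<in>perms (P - Q).
   ((t b - x) * chain t (q @ [b]) x * chain t a (t b)) *\<^sub>C fold f a (fold f q y))"
  by (rule sum_permutations_split[OF P(1), of "%q a. ((t b - x) * chain t (q @ [b]) x * chain t a (t b)) *\<^sub>C fold f a (fold f q y)"])
 also have "... = (\<Sum>Q\<in>Pow P. wsum t (P - Q) (t b) f (wtail t Q b x f y))"
  unfolding wtail_def using f
  by (simp add: clinear_wsum[THEN clinear_sum] clinear_wsum[THEN clinear_scale])
    (simp add: wsum_def cvec.scale_sum_right scaleC_scaleC)
 finally show ?thesis .
qed

text \<open>The same cut as in \<open>wsum_insert\<close>, for words that do contain
  \<open>b\<close>; the only difference is that \<open>f b\<close> is applied between the two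
  pieces.\<close>

lemma sum_words_containing:
 assumes f: "!!k. clinear (f k)" and P: "finite P" "b \<notin> P"
 shows "(\<Sum>u\<in>perms (insert b P). ((t b - x) * chain t u x) *\<^sub>C fold f u y)
  = (\<Sum>Q\<in>Pow P. wsum t (P - Q) (t b) f (f b (wtail t Q b x f y)))"
proof -
 \<comment> \<open>The condition \<open>c = b\<close> restricts the cut at every letter in
   \<open>sum_permutations_split_at\<close> to the unique occurrence of \<open>b\<close>.\<close>
 let ?H = "%q c a. if c = b then ((t b - x) * chain t (q @ [b]) x * chain t a (t b)) *\<^sub>C fold f a (f b (fold f q y)) else 0"
 have "(\<Sum>u\<in>perms (insert b P). ((t b - x) * chain t u x) *\<^sub>C fold f u y)
  = (\<Sum>u\<in>perms (insert b P). \<Sum>j<length u. ?H (take j u) (u ! j) (drop (Suc j) u))"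
 proof (intro sum.cong refl)
  fix u assume "u \<in> perms (insert b P)"
  hence u: "set u = insert b P" "distinct u" by (auto simp: permutations_of_set_def)
  then obtain i where i: "i < length u" "u ! i = b" by (metis in_set_conv_nth insertI1)
  have "(\<Sum>j<length u. ?H (take j u) (u ! j) (drop (Suc j) u)) = (\<Sum>j\<in>{i}. ?H (take j u) (u ! j) (drop (Suc j) u))"
   using i u(2) by (intro sum.mono_neutral_right) (auto simp: nth_eq_iff_index_eq)
  also have "... = ((t b - x) * chain t (take i u @ b # drop (Suc i) u) x) *\<^sub>C fold f (take i u @ b # drop (Suc i) u) y"
   using i by (simp add: chain_append[where q = "take i u" and a = "drop (Suc i) u"] mult.assoc)
  also have "take i u @ b # drop (Suc i) u = u" using i id_take_nth_drop[of i u] by simp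
  finally show "((t b - x) * chain t u x) *\<^sub>C fold f u y = (\<Sum>j<length u. ?H (take j u) (u ! j) (drop (Suc j) u))" ..
 qed
 also have "... = (\<Sum>c\<in>insert b P. \<Sum>Q\<in>Pow (insert b P - {c}). \<Sum>q\<in>perms Q. \<Sum>a\<in>perms (insert b P - {c} - Q). ?H q c a)"
  using P by (intro sum_permutations_split_at) auto
 also have "... = (\<Sum>c\<in>{b}. \<Sum>Q\<in>Pow (insert b P - {c}). \<Sum>q\<in>perms Q. \<Sum>a\<in>perms (insert b P - {c} - Q). ?H q c a)"
  using P by (intro sum.mono_neutral_right ballI sum.neutral) auto
 also have "... = (\<Sum>Q\<in>Pow P. \<Sum>q\<in>perms Q. \<Sum>a\<in>perms (P - Q).
   ((t b - x) * chain t (q @ [b]) x * chain t a (t b)) *\<^sub>C fold f a (f b (fold f q y)))"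
  using P by simp
 also have "... = (\<Sum>Q\<in>Pow P. wsum t (P - Q) (t b) f (f b (wtail t Q b x f y)))"
  unfolding wtail_def using f
  by (simp add: clinear_sum clinear_scale clinear_wsum[THEN clinear_sum] clinear_wsum[THEN clinear_scale])
    (simp add: wsum_def cvec.scale_sum_right scaleC_scaleC)
 finally show ?thesis .
qed

text \<open>Both insertion lemmas at once: \<open>l\<close> goes with the plain insertion of
  \<open>b\<close>, \<open>g\<close> with the weighted one. The resulting coefficient
  \<open>l - (\<Sum>c\<leftarrow>w. g c)\<close> is the one with which \<open>b\<close> occurs in
  \<nu>_- of a word having \<open>w\<close> before \<open>b\<close>, while the left side already has
  the shape of a logarithmic derivative.\<close>

lemma sum_words_weighted:
 assumes f: "!!k. clinear (f k)" and P: "finite P" "b \<notin> P" "inj_on t (insert b P)" "x \<notin> t ` insert b P"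
 shows "(\<Sum>u\<in>perms P. (chain t u x * (l / (t b - x) - (\<Sum>c\<in>P. g c / (t b - t c)))) *\<^sub>C fold f u y)
  = (\<Sum>C\<in>Pow P. \<Sum>w\<in>perms C. ((l - (\<Sum>c\<leftarrow>w. g c)) * chain t (w @ [b]) x) *\<^sub>C wsum t (P - C) (t b) f (fold f w y))"
proof -
 let ?F = "%q a. ((l - (\<Sum>c\<leftarrow>q. g c)) * chain t (q @ [b]) x * chain t a (t b)) *\<^sub>C fold f a (fold f q y)"
 have "(\<Sum>u\<in>perms P. (chain t u x * (l / (t b - x) - (\<Sum>c\<in>P. g c / (t b - t c)))) *\<^sub>C fold f u y)
  = (\<Sum>p\<in>perms P. \<Sum>j\<le>length p. ?F (take j p) (drop j p))"
 proof (intro sum.cong refl)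
  fix p assume "p \<in> perms P"
  hence p: "set p = P" "distinct p" by (auto simp: permutations_of_set_def)
  have "chain t p x * (l / (t b - x) - (\<Sum>c\<in>P. g c / (t b - t c)))
    = l * (chain t p x / (t b - x)) - chain t p x * (\<Sum>c\<leftarrow>p. g c / (t b - t c))"
   unfolding p(1)[symmetric] by (simp add: sum_list_distinct_conv_sum_set p(2) algebra_simps)
  also have "... = (\<Sum>j\<le>length p. (l - (\<Sum>c\<leftarrow>take j p. g c)) * chain t (take j p @ [b]) x * chain t (drop j p) (t b))"
   using P p by (subst sum_chain_insert[symmetric], simp, simp, simp, subst sum_chain_insert_weighted[symmetric], simp, simp, simp)
    (simp add: sum_distrib_left ring_distribs sum_subtractf chain_append[where q = "take j p" and a = "drop j p" for j] mult.assoc)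
  finally show "(chain t p x * (l / (t b - x) - (\<Sum>c\<in>P. g c / (t b - t c)))) *\<^sub>C fold f p y
   = (\<Sum>j\<le>length p. ?F (take j p) (drop j p))"
   by (simp add: cvec.scale_sum_left fold_take_drop)
 qed
 also have "... = (\<Sum>Q\<in>Pow P. \<Sum>q\<in>perms Q. \<Sum>a\<in>perms (P - Q). ?F q a)"
  by (rule sum_permutations_split[OF P(1), of ?F])
 also have "... = (\<Sum>C\<in>Pow P. \<Sum>w\<in>perms C. ((l - (\<Sum>c\<leftarrow>w. g c)) * chain t (w @ [b]) x) *\<^sub>C wsum t (P - C) (t b) f (fold f w y))"
  by (simp add: wsum_def cvec.scale_sum_right scaleC_scaleC)
 finally show ?thesis .
qed

section \<open>The rational identity behind the KZ equations\<close>

text \<open>The hypothesis on \<open>nu\<close> is the abstract shape of \<nu>_- on words: one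
  letter is marked and enters through \<open>\<sigma>\<close>, the earlier letters act on the
  vector, the later ones act by \<open>fs\<close> on the whole tensor. Cutting at the marked letter
  \<open>b\<close> lets the later letters be summed freely, with root \<open>t b\<close>.\<close>

lemma sum_words_coproduct_terms:
 assumes fs: "!!k. clinear (fs k)" and S: "finite S"
  and nu: "!!w. nu w = (\<Sum>j<length w. (l (w ! j) - (\<Sum>c\<leftarrow>take j w. g (w ! j) c)) *\<^sub>C
    fold fs (drop (Suc j) w) (\<sigma> (w ! j) (fold f' (take j w) v')))"
 shows "(\<Sum>w\<in>perms S. chain t w x *\<^sub>C nu w)
  = (\<Sum>b\<in>S. \<Sum>C\<in>Pow (S - {b}). \<Sum>q\<in>perms C.
    ((l b - (\<Sum>c\<leftarrow>q. g b c)) * chain t (q @ [b]) x) *\<^sub>C wsum t (S - {b} - C) (t b) fs (\<sigma> b (fold f' q v')))"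
proof -
 let ?F = "%q b a. ((l b - (\<Sum>c\<leftarrow>q. g b c)) * chain t (q @ [b]) x * chain t a (t b)) *\<^sub>C
   fold fs a (\<sigma> b (fold f' q v'))"
 have "(\<Sum>w\<in>perms S. chain t w x *\<^sub>C nu w)
   = (\<Sum>w\<in>perms S. \<Sum>j<length w. ?F (take j w) (w ! j) (drop (Suc j) w))"
 proof (rule sum.cong[OF refl])
  fix w
  have "chain t w x = chain t (take j w @ [w ! j]) x * chain t (drop (Suc j) w) (t (w ! j))"
   if "j < length w" for j
   using chain_append[of t "take j w" "w ! j" "drop (Suc j) w" x] id_take_nth_drop[OF that] by simp
  thus "chain t w x *\<^sub>C nu w = (\<Sum>j<length w. ?F (take j w) (w ! j) (drop (Suc j) w))"
   unfolding nu cvec.scale_sum_right by (intro sum.cong) (simp_all add: scaleC_scaleC mult_ac)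
 qed
 also have "... = (\<Sum>b\<in>S. \<Sum>Q\<in>Pow (S - {b}). \<Sum>q\<in>perms Q.
   \<Sum>a\<in>perms (S - {b} - Q). ?F q b a)"
  by (rule sum_permutations_split_at[OF S])
 finally show ?thesis by (simp add: wsum_def cvec.scale_sum_right scaleC_scaleC)
qed

text \<open>The letter \<open>b\<close> and letters behind it change sides. Re-rooting the left word
  at \<open>t b\<close> by \<open>wsum_insert\<close> gives both arguments of \<open>T\<close> the
  same root, so group-likeness combines them into a sum for \<open>F\<close>. There \<open>T\<close>
  with second argument \<open>s\<close> is replaced by \<open>bb\<close> with \<open>f b\<close>
  applied on the left, and the sum is expanded again.\<close>

lemma sum_coproduct_transport:
 assumes f: "!!k. clinear (f k)" and fs: "!!k. clinear (fs k)" and F: "!!k. clinear (F k)"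
  and bb: "cbilinear bb" "cbilinear T"
  and FB: "!!k x y. F k (bb x y) = bb (f k x) y + bb x (f' k y)"
  and FT: "!!k x s. F k (T x s) = T (f k x) s + T x (fs k s)"
  and sig: "!!x. T x s = bb (f b x) y"
  and X: "finite X" "b \<notin> X" "inj_on t (insert b X)" "z \<notin> t ` insert b X"
 shows "(\<Sum>P\<in>Pow X. T (wsum t P z f v) (wsum t (X - P) (t b) fs s))
  = (\<Sum>Q\<in>Pow X. \<Sum>Y\<in>Pow (X - Q). bb (wsum t Y (t b) f (f b (wtail t Q b z f v))) (wsum t (X - Q - Y) (t b) f' y))"
proof -
 have lei: "wsum t Z (t b) F (B x y) = (\<Sum>A\<in>Pow Z. B (wsum t A (t b) f x) (wsum t (Z - A) (t b) h y))"
  if "Z \<subseteq> X" "cbilinear B" "!!k x y. F k (B x y) = B (f k x) y + B x (h k y)" for Z B x y h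
 proof (intro wsum_leibniz F that)
  show "finite Z" "inj_on t Z" "t b \<notin> t ` Z"
   using X that(1) by (auto intro: finite_subset inj_on_subset)
 qed
 have "(\<Sum>P\<in>Pow X. T (wsum t P z f v) (wsum t (X - P) (t b) fs s))
   = (\<Sum>P\<in>Pow X. \<Sum>Q\<in>Pow P. T (wsum t (P - Q) (t b) f (wtail t Q b z f v)) (wsum t (X - P) (t b) fs s))"
 proof (rule sum.cong[OF refl])
  fix P assume "P \<in> Pow X"
  hence "finite P" "b \<notin> P" "inj_on t (insert b P)" "z \<notin> t ` insert b P"
   using X by (auto intro: finite_subset inj_on_subset)
  from wsum_insert[where f = f, OF f this, of v]
  show "T (wsum t P z f v) (wsum t (X - P) (t b) fs s)
   = (\<Sum>Q\<in>Pow P. T (wsum t (P - Q) (t b) f (wtail t Q b z f v)) (wsum t (X - P) (t b) fs s))"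
   using bb(2) by (simp add: cbilinear_simps)
 qed
 also have "... = (\<Sum>Q\<in>Pow X. \<Sum>Y\<in>Pow (X - Q). T (wsum t (Q \<union> Y - Q) (t b) f (wtail t Q b z f v)) (wsum t (X - (Q \<union> Y)) (t b) fs s))"
  by (rule sum_Pow_Un[OF X(1)])
 \<comment> \<open>For fixed \<open>Q\<close> both words are now rooted at \<open>t b\<close>, so
   the sum over \<open>Y\<close> is the Leibniz expansion of \<open>F\<close> on \<open>T\<close>,
   read backwards.\<close>
 also have "... = (\<Sum>Q\<in>Pow X. wsum t (X - Q) (t b) F (T (wtail t Q b z f v) s))"
 proof (intro sum.cong[OF refl])
  fix Q
  have "Q \<union> Y - Q = Y" "X - (Q \<union> Y) = X - Q - Y" if "Y \<in> Pow (X - Q)" for Y using that by auto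
  thus "(\<Sum>Y\<in>Pow (X - Q). T (wsum t (Q \<union> Y - Q) (t b) f (wtail t Q b z f v)) (wsum t (X - (Q \<union> Y)) (t b) fs s))
   = wsum t (X - Q) (t b) F (T (wtail t Q b z f v) s)"
   using lei[OF _ bb(2) FT, of "X - Q"] by auto
 qed
 also have "... = (\<Sum>Q\<in>Pow X. \<Sum>Y\<in>Pow (X - Q). bb (wsum t Y (t b) f (f b (wtail t Q b z f v))) (wsum t (X - Q - Y) (t b) f' y))"
  using lei[OF _ bb(1) FB] by (intro sum.cong[OF refl]) (auto simp: sig)
 finally show ?thesis .
qed

text \<open>The nilpotent half of \<Omega>_+ on a pair of factors, in abstract form:
  \<open>T\<close> lets the Lie algebra part of its second argument act on the first factor. After
  transport the marked letter \<open>b\<close> lies in the left word, so the sum over marked letters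
  becomes a sum over \<open>b \<in> P\<close>, and the remaining sums reassemble into words by
  \<open>sum_words_containing\<close> and \<open>sum_words_weighted\<close>.\<close>

lemma sum_words_pair_transport:
 fixes f :: "nat => 'm::complex_vector => 'm" and f' :: "nat => 'n::complex_vector => 'n"
  and fs :: "nat => 's::complex_vector => 's" and F :: "nat => 't::complex_vector => 't"
 assumes f: "!!k. clinear (f k)" and f': "!!k. clinear (f' k)"
  and fs: "!!k. clinear (fs k)" and F: "!!k. clinear (F k)"
  and bb: "cbilinear bb" "cbilinear T"
  and FB: "!!k x y. F k (bb x y) = bb (f k x) y + bb x (f' k y)"
  and FT: "!!k x s. F k (T x s) = T (f k x) s + T x (fs k s)"
  and sig: "!!x b y. T x (\<sigma> b y) = bb (f b x) y"
  and nu: "!!w. nu w = (\<Sum>j<length w. (l (w ! j) - (\<Sum>c\<leftarrow>take j w. g (w ! j) c)) *\<^sub>C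
    fold fs (drop (Suc j) w) (\<sigma> (w ! j) (fold f' (take j w) v')))"
  and S: "finite S" "inj_on t S" "z \<notin> t ` S" "z' \<notin> t ` S"
 shows "(\<Sum>P\<in>Pow S. \<Sum>w\<in>perms P. \<Sum>w'\<in>perms (S - P).
   (chain t w z * chain t w' z') *\<^sub>C T (fold f w v) (nu w'))
  = (\<Sum>P\<in>Pow S. \<Sum>u\<in>perms P. \<Sum>u'\<in>perms (S - P).
   (chain t u z * chain t u' z' * (\<Sum>b\<in>P. (t b - z) * (l b / (t b - z') - (\<Sum>c\<in>S - P. g b c / (t b - t c)))))
    *\<^sub>C bb (fold f u v) (fold f' u' v'))" (is "?L = ?R")
proof -
 define cc where "cc b q = (l b - (\<Sum>c\<leftarrow>q. g b c)) * chain t (q @ [b]) z'" for b q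
 \<comment> \<open>\<open>C\<close> are the letters before \<open>b\<close> in the right word, still
   attached to \<open>z'\<close>; \<open>Q\<close> and \<open>Y\<close> are the letters before and
   after \<open>b\<close> in the new left word; the others follow \<open>C\<close> in the right
   word, attached to \<open>t b\<close>.\<close>
 define E where "E b C Q Y = (\<Sum>q\<in>perms C. cc b q *\<^sub>C
   bb (wsum t Y (t b) f (f b (wtail t Q b z f v))) (wsum t (S - {b} - C - Q - Y) (t b) f' (fold f' q v')))"
  for b C Q Y
 have sb: "finite N" "b \<notin> N" "inj_on t (insert b N)" "z \<notin> t ` insert b N" "z' \<notin> t ` insert b N"
  if "b \<in> S" "N \<subseteq> S - {b}" for b N
 proof -
  have sub: "insert b N \<subseteq> S" using that by auto
  show "inj_on t (insert b N)" by (rule inj_on_subset[OF S(2) sub])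
  show "finite N" "b \<notin> N" "z \<notin> t ` insert b N" "z' \<notin> t ` insert b N"
   using that S sub by (auto intro: finite_subset)
 qed
 have "?L = (\<Sum>P\<in>Pow S. T (wsum t P z f v) (\<Sum>w'\<in>perms (S - P). chain t w' z' *\<^sub>C nu w'))"
 proof (rule sum.cong[OF refl])
  fix P
  show "(\<Sum>w\<in>perms P. \<Sum>w'\<in>perms (S - P). (chain t w z * chain t w' z') *\<^sub>C T (fold f w v) (nu w'))
   = T (wsum t P z f v) (\<Sum>w'\<in>perms (S - P). chain t w' z' *\<^sub>C nu w')"
   unfolding wsum_def using bb(2)
   by (subst sum.swap) (simp add: cbilinear_simps scaleC_scaleC cvec.scale_sum_right mult.commute)
 qed
 also have "... = (\<Sum>P\<in>Pow S. \<Sum>b\<in>S - P. \<Sum>C\<in>Pow (S - P - {b}). \<Sum>q\<in>perms C.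
    cc b q *\<^sub>C T (wsum t P z f v) (wsum t (S - P - {b} - C) (t b) fs (\<sigma> b (fold f' q v'))))"
 proof (rule sum.cong[OF refl])
  fix P
  have "finite (S - P)" using S by auto
  from sum_words_coproduct_terms[where nu = nu, OF fs this nu]
  show "T (wsum t P z f v) (\<Sum>w'\<in>perms (S - P). chain t w' z' *\<^sub>C nu w')
   = (\<Sum>b\<in>S - P. \<Sum>C\<in>Pow (S - P - {b}). \<Sum>q\<in>perms C.
    cc b q *\<^sub>C T (wsum t P z f v) (wsum t (S - P - {b} - C) (t b) fs (\<sigma> b (fold f' q v'))))"
   using bb(2) by (simp add: cbilinear_simps cc_def)
 qed
 also have "... = (\<Sum>b\<in>S. \<Sum>P\<in>Pow (S - {b}). \<Sum>C\<in>Pow (S - P - {b}). \<Sum>q\<in>perms C.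
    cc b q *\<^sub>C T (wsum t P z f v) (wsum t (S - P - {b} - C) (t b) fs (\<sigma> b (fold f' q v'))))"
  by (rule sum_Pow_Diff_swap[OF S(1)])
 also have "... = (\<Sum>b\<in>S. \<Sum>C\<in>Pow (S - {b}). \<Sum>Q\<in>Pow (S - {b} - C). \<Sum>Y\<in>Pow (S - {b} - C - Q). E b C Q Y)"
 proof (rule sum.cong[OF refl])
  fix b assume b: "b \<in> S"
  let ?N = "S - {b}"
  have "(\<Sum>P\<in>Pow ?N. \<Sum>C\<in>Pow (S - P - {b}). \<Sum>q\<in>perms C.
    cc b q *\<^sub>C T (wsum t P z f v) (wsum t (S - P - {b} - C) (t b) fs (\<sigma> b (fold f' q v'))))
   = (\<Sum>P\<in>Pow ?N. \<Sum>C\<in>Pow (?N - P). \<Sum>q\<in>perms C.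
    cc b q *\<^sub>C T (wsum t P z f v) (wsum t (?N - C - P) (t b) fs (\<sigma> b (fold f' q v'))))"
  proof -
   have "S - P - {b} = ?N - P" "?N - P - C = ?N - C - P" for P C by auto
   thus ?thesis by simp
  qed
  also have "... = (\<Sum>C\<in>Pow ?N. \<Sum>P\<in>Pow (?N - C). \<Sum>q\<in>perms C.
    cc b q *\<^sub>C T (wsum t P z f v) (wsum t (?N - C - P) (t b) fs (\<sigma> b (fold f' q v'))))"
   using S by (intro sum_Pow_swap) auto
  also have "... = (\<Sum>C\<in>Pow ?N. \<Sum>q\<in>perms C. cc b q *\<^sub>C (\<Sum>P\<in>Pow (?N - C).
    T (wsum t P z f v) (wsum t (?N - C - P) (t b) fs (\<sigma> b (fold f' q v')))))"
   unfolding cvec.scale_sum_right by (rule sum.cong[OF refl], rule sum.swap)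
  also have "... = (\<Sum>C\<in>Pow ?N. \<Sum>q\<in>perms C. cc b q *\<^sub>C (\<Sum>Q\<in>Pow (?N - C). \<Sum>Y\<in>Pow (?N - C - Q).
    bb (wsum t Y (t b) f (f b (wtail t Q b z f v))) (wsum t (?N - C - Q - Y) (t b) f' (fold f' q v'))))"
  proof (intro sum.cong[OF refl])
   fix C q assume "C \<in> Pow ?N"
   have C: "finite (?N - C)" "b \<notin> ?N - C" "inj_on t (insert b (?N - C))" "z \<notin> t ` insert b (?N - C)"
    by (intro sb[OF b]; auto)+
   show "cc b q *\<^sub>C (\<Sum>P\<in>Pow (?N - C). T (wsum t P z f v) (wsum t (?N - C - P) (t b) fs (\<sigma> b (fold f' q v'))))
    = cc b q *\<^sub>C (\<Sum>Q\<in>Pow (?N - C). \<Sum>Y\<in>Pow (?N - C - Q).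
    bb (wsum t Y (t b) f (f b (wtail t Q b z f v))) (wsum t (?N - C - Q - Y) (t b) f' (fold f' q v')))"
    by (subst sum_coproduct_transport[where F = F and T = T and bb = bb and f' = f' and b = b and y = "fold f' q v'",
       OF f fs F bb FB FT sig C]) (rule refl)
  qed
  also have "... = (\<Sum>C\<in>Pow ?N. \<Sum>Q\<in>Pow (?N - C). \<Sum>Y\<in>Pow (?N - C - Q). E b C Q Y)"
  proof (rule sum.cong[OF refl])
   fix C
   show "(\<Sum>q\<in>perms C. cc b q *\<^sub>C (\<Sum>Q\<in>Pow (?N - C). \<Sum>Y\<in>Pow (?N - C - Q).
    bb (wsum t Y (t b) f (f b (wtail t Q b z f v))) (wsum t (?N - C - Q - Y) (t b) f' (fold f' q v'))))
    = (\<Sum>Q\<in>Pow (?N - C). \<Sum>Y\<in>Pow (?N - C - Q). E b C Q Y)"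
    unfolding E_def cvec.scale_sum_right
    by (subst sum.swap, rule sum.cong[OF refl], subst sum.swap, rule refl)
  qed
  finally show "(\<Sum>P\<in>Pow ?N. \<Sum>C\<in>Pow (S - P - {b}). \<Sum>q\<in>perms C.
    cc b q *\<^sub>C T (wsum t P z f v) (wsum t (S - P - {b} - C) (t b) fs (\<sigma> b (fold f' q v'))))
   = (\<Sum>C\<in>Pow ?N. \<Sum>Q\<in>Pow (?N - C). \<Sum>Y\<in>Pow (?N - C - Q). E b C Q Y)" .
 qed
 \<comment> \<open>The choices of \<open>C\<close>, \<open>Q\<close> and \<open>Y\<close> are
   reordered so that \<open>P\<close>, the union of \<open>Q\<close> and \<open>Y\<close>, comes
   first: \<open>insert b P\<close> is the set of letters of the left word.\<close>
 also have "... = (\<Sum>b\<in>S. \<Sum>P\<in>Pow (S - {b}). \<Sum>Q\<in>Pow P. \<Sum>C\<in>Pow (S - {b} - P). E b C Q (P - Q))"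
 proof (rule sum.cong[OF refl])
  fix b assume b: "b \<in> S"
  let ?N = "S - {b}"
  have fin: "finite ?N" using S by auto
  have "(\<Sum>C\<in>Pow ?N. \<Sum>Q\<in>Pow (?N - C). \<Sum>Y\<in>Pow (?N - C - Q). E b C Q Y)
   = (\<Sum>Q\<in>Pow ?N. \<Sum>C\<in>Pow (?N - Q). \<Sum>Y\<in>Pow (?N - C - Q). E b C Q Y)"
   by (rule sum_Pow_swap[OF fin])
  also have "... = (\<Sum>Q\<in>Pow ?N. \<Sum>C\<in>Pow (?N - Q). \<Sum>Y\<in>Pow (?N - Q - C). E b C Q Y)"
   by (simp add: Diff_eq Int_ac)
  also have "... = (\<Sum>Q\<in>Pow ?N. \<Sum>Y\<in>Pow (?N - Q). \<Sum>C\<in>Pow (?N - Q - Y). E b C Q Y)"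
   using fin by (intro sum.cong[OF refl] sum_Pow_swap) auto
  also have "... = (\<Sum>Q\<in>Pow ?N. \<Sum>Y\<in>Pow (?N - Q). \<Sum>C\<in>Pow (?N - (Q \<union> Y)). E b C Q (Q \<union> Y - Q))"
  proof (intro sum.cong[OF refl])
   fix Q Y assume "Y \<in> Pow (?N - Q)"
   hence "Q \<union> Y - Q = Y" "?N - (Q \<union> Y) = ?N - Q - Y" by auto
   thus "(\<Sum>C\<in>Pow (?N - Q - Y). E b C Q Y) = (\<Sum>C\<in>Pow (?N - (Q \<union> Y)). E b C Q (Q \<union> Y - Q))" by simp
  qed
  also have "... = (\<Sum>P\<in>Pow ?N. \<Sum>Q\<in>Pow P. \<Sum>C\<in>Pow (?N - P). E b C Q (P - Q))"
   by (rule sum_Pow_Un[OF fin, symmetric])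
  finally show "(\<Sum>C\<in>Pow ?N. \<Sum>Q\<in>Pow (?N - C). \<Sum>Y\<in>Pow (?N - C - Q). E b C Q Y)
   = (\<Sum>P\<in>Pow ?N. \<Sum>Q\<in>Pow P. \<Sum>C\<in>Pow (?N - P). E b C Q (P - Q))" .
 qed
 also have "... = (\<Sum>b\<in>S. \<Sum>P\<in>Pow (S - {b}). bb (\<Sum>u\<in>perms (insert b P). ((t b - z) * chain t u z) *\<^sub>C fold f u v)
   (\<Sum>u'\<in>perms (S - insert b P).
     (chain t u' z' * (l b / (t b - z') - (\<Sum>c\<in>S - insert b P. g b c / (t b - t c)))) *\<^sub>C fold f' u' v'))"
 proof (intro sum.cong[OF refl])
  fix b P assume b: "b \<in> S" and P: "P \<in> Pow (S - {b})"
  have eq: "S - insert b P = S - {b} - P" by auto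
  have "(\<Sum>u\<in>perms (insert b P). ((t b - z) * chain t u z) *\<^sub>C fold f u v)
   = (\<Sum>Q\<in>Pow P. wsum t (P - Q) (t b) f (f b (wtail t Q b z f v)))"
   using sb[OF b, of P] P by (intro sum_words_containing f) auto
  moreover have "(\<Sum>u'\<in>perms (S - {b} - P).
     (chain t u' z' * (l b / (t b - z') - (\<Sum>c\<in>S - {b} - P. g b c / (t b - t c)))) *\<^sub>C fold f' u' v')
   = (\<Sum>C\<in>Pow (S - {b} - P). \<Sum>q\<in>perms C. cc b q *\<^sub>C wsum t (S - {b} - P - C) (t b) f' (fold f' q v'))"
   unfolding cc_def using sb[OF b, of "S - {b} - P"] by (intro sum_words_weighted f') auto
  moreover have "S - {b} - C - Q - (P - Q) = S - {b} - P - C" if "Q \<in> Pow P" for Q C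
   using that by auto
  ultimately show "(\<Sum>Q\<in>Pow P. \<Sum>C\<in>Pow (S - {b} - P). E b C Q (P - Q))
   = bb (\<Sum>u\<in>perms (insert b P). ((t b - z) * chain t u z) *\<^sub>C fold f u v)
   (\<Sum>u'\<in>perms (S - insert b P).
     (chain t u' z' * (l b / (t b - z') - (\<Sum>c\<in>S - insert b P. g b c / (t b - t c)))) *\<^sub>C fold f' u' v')"
   unfolding eq using bb(1) by (simp add: E_def cbilinear_left[THEN clinear_sum])
    (simp add: cbilinear_simps)
 qed
 also have "... = (\<Sum>b\<in>S. \<Sum>P\<in>Pow (S - {b}). \<Sum>u\<in>perms (insert b P). \<Sum>u'\<in>perms (S - insert b P).
   (chain t u z * chain t u' z' * ((t b - z) * (l b / (t b - z') - (\<Sum>c\<in>S - insert b P. g b c / (t b - t c)))))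
    *\<^sub>C bb (fold f u v) (fold f' u' v'))"
  using bb(1) by (intro sum.cong[OF refl])
   (simp add: cbilinear_left[THEN clinear_sum], simp add: cbilinear_simps scaleC_scaleC cvec.scale_sum_right mult_ac)
 also have "... = (\<Sum>P\<in>Pow S. \<Sum>b\<in>P. \<Sum>u\<in>perms P. \<Sum>u'\<in>perms (S - P).
   (chain t u z * chain t u' z' * ((t b - z) * (l b / (t b - z') - (\<Sum>c\<in>S - P. g b c / (t b - t c)))))
    *\<^sub>C bb (fold f u v) (fold f' u' v'))"
  by (rule sum_Pow_insert_swap[OF S(1), symmetric])
 also have "... = ?R"
 proof (rule sum.cong[OF refl])
  fix P
  show "(\<Sum>b\<in>P. \<Sum>u\<in>perms P. \<Sum>u'\<in>perms (S - P).
   (chain t u z * chain t u' z' * ((t b - z) * (l b / (t b - z') - (\<Sum>c\<in>S - P. g b c / (t b - t c)))))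
    *\<^sub>C bb (fold f u v) (fold f' u' v'))
   = (\<Sum>u\<in>perms P. \<Sum>u'\<in>perms (S - P).
   (chain t u z * chain t u' z' * (\<Sum>b\<in>P. (t b - z) * (l b / (t b - z') - (\<Sum>c\<in>S - P. g b c / (t b - t c)))))
    *\<^sub>C bb (fold f u v) (fold f' u' v'))"
   unfolding sum_distrib_left cvec.scale_sum_left
   by (subst sum.swap, rule sum.cong[OF refl], rule sum.swap)
 qed
 finally show ?thesis .
qed

text \<open>Each term on the right is expanded by splitting \<open>z - z'\<close>: as (t_b - z') -
  (t_b - z) for the letters of \<open>P\<close>, correspondingly for those of \<open>R\<close>, and
  as (t_b - t_c) - (t_b - z) + (t_c - z') for pairs. The left side collects the weight form and the
  two nilpotent halves of \<Omega>_+, the right side the interaction terms of the logarithmic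
  derivative of \<Phi>.\<close>

lemma pair_coefficients:
 fixes t :: "nat => complex"
 assumes P: "P \<inter> R = {}" "inj_on t (P \<union> R)" "z \<notin> t ` (P \<union> R)" "z' \<notin> t ` (P \<union> R)" "z ~= z'"
  and g: "!!b c. g b c = g c b"
 shows "(L - (\<Sum>b\<in>P. l' b) - (\<Sum>c\<in>R. l c) + (\<Sum>b\<in>P. \<Sum>c\<in>R. g b c))
   + (\<Sum>b\<in>P. (t b - z) * (l' b / (t b - z') - (\<Sum>c\<in>R. g b c / (t b - t c))))
   + (\<Sum>c\<in>R. (t c - z') * (l c / (t c - z) - (\<Sum>b\<in>P. g c b / (t c - t b))))
  = (z - z') * (L / (z - z') - (\<Sum>b\<in>P. l' b / (t b - z')) - (\<Sum>c\<in>R. l c / (z - t c))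
    + (\<Sum>b\<in>P. \<Sum>c\<in>R. g b c / (t b - t c)))"
proof -
 have 1: "(z - z') * (l' b / (t b - z')) = l' b - (t b - z) * (l' b / (t b - z'))" if "b \<in> P" for b
 proof -
  have "t b - z' ~= 0" using that P by auto
  thus ?thesis by (simp add: divide_simps) (simp add: algebra_simps)
 qed
 have 2: "(z - z') * (l c / (z - t c)) = l c - (t c - z') * (l c / (t c - z))" if "c \<in> R" for c
 proof -
  have "t c - z ~= 0" "z - t c ~= 0" using that P by auto
  thus ?thesis by (simp add: divide_simps) (simp add: algebra_simps)
 qed
 have 3: "(z - z') * (g b c / (t b - t c)) = g b c - (t b - z) * (g b c / (t b - t c)) - (t c - z') * (g c b / (t c - t b))"
  if "b \<in> P" "c \<in> R" for b c
 proof -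
  have "t b - t c ~= 0" "t c - t b ~= 0" using that P by (auto simp: inj_on_def)
  thus ?thesis unfolding g[of c b] by (simp add: divide_simps) (simp add: algebra_simps)
 qed
 have sw: "(\<Sum>c\<in>R. \<Sum>b\<in>P. (t c - z') * (g c b / (t c - t b))) = (\<Sum>b\<in>P. \<Sum>c\<in>R. (t c - z') * (g c b / (t c - t b)))"
  by (rule sum.swap)
 have "(z - z') * (L / (z - z') - (\<Sum>b\<in>P. l' b / (t b - z')) - (\<Sum>c\<in>R. l c / (z - t c))
    + (\<Sum>b\<in>P. \<Sum>c\<in>R. g b c / (t b - t c)))
   = L - (\<Sum>b\<in>P. l' b - (t b - z) * (l' b / (t b - z'))) - (\<Sum>c\<in>R. l c - (t c - z') * (l c / (t c - z)))
    + (\<Sum>b\<in>P. \<Sum>c\<in>R. g b c - (t b - z) * (g b c / (t b - t c)) - (t c - z') * (g c b / (t c - t b)))"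
 proof -
  have "(z - z') * (\<Sum>b\<in>P. l' b / (t b - z')) = (\<Sum>b\<in>P. l' b - (t b - z) * (l' b / (t b - z')))"
   unfolding sum_distrib_left by (rule sum.cong[OF refl 1])
  moreover have "(z - z') * (\<Sum>c\<in>R. l c / (z - t c)) = (\<Sum>c\<in>R. l c - (t c - z') * (l c / (t c - z)))"
   unfolding sum_distrib_left by (rule sum.cong[OF refl 2])
  moreover have "(z - z') * (\<Sum>b\<in>P. \<Sum>c\<in>R. g b c / (t b - t c)) = (\<Sum>b\<in>P. \<Sum>c\<in>R.
    g b c - (t b - z) * (g b c / (t b - t c)) - (t c - z') * (g c b / (t c - t b)))"
   unfolding sum_distrib_left by (intro sum.cong refl 3)
  moreover have "(z - z') * (L / (z - z')) = L" using P(5) by simp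
  ultimately show ?thesis by (simp only: distrib_left right_diff_distrib[of "z - z'"])
 qed
 also have "... = (L - (\<Sum>b\<in>P. l' b) - (\<Sum>c\<in>R. l c) + (\<Sum>b\<in>P. \<Sum>c\<in>R. g b c))
   + (\<Sum>b\<in>P. (t b - z) * (l' b / (t b - z') - (\<Sum>c\<in>R. g b c / (t b - t c))))
   + (\<Sum>c\<in>R. (t c - z') * (l c / (t c - z) - (\<Sum>b\<in>P. g c b / (t c - t b))))"
  using sw by (simp add: right_diff_distrib sum_subtractf sum_distrib_left del: times_divide_eq_right times_divide_eq_left)
 finally show ?thesis ..
qed

section \<open>Integration over the standard simplex\<close>

abbreviation lebPi :: "nat set => (nat => real) measure" where
 "lebPi I \<equiv> Pi\<^sub>M I (%_. lborel)"

interpretation lebPi: product_sigma_finite "%_::nat. lborel :: real measure"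
 by standard

definition simplex_int :: "nat => ((nat => real) => complex) => complex" where
 "simplex_int p H = (LINT y : bary_dom p | lebPi {..<p}. H (bary p y))"

lemma compact_standard_simplex: "compact (std p)"
 using compactin_standard_simplex[of p] by (simp add: euclidean_product_topology)

lemma closed_standard_simplex: "closed (std p)"
 using closedin_standard_simplex[of p] by (simp add: euclidean_product_topology)

lemma continuous_on_coord: "continuous_on A (%x::nat => 'a::topological_space. x i)"
 by (rule continuous_on_subset[OF continuous_on_product_coordinates]) simp

lemma bary_in_standard_simplex:
 assumes "!!b. b < m ==> 0 \<le> y b" "(\<Sum>b<m. y b) \<le> 1"
 shows "bary m y \<in> std m"
proof -
 have "y b \<le> 1" if "b < m" for b
  using member_le_sum[of b "{..<m}" y] assms that by force
 moreover have "0 \<le> (\<Sum>b<m. y b)" using assms(1) by (intro sum_nonneg) auto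
 moreover have "(\<Sum>i\<le>m. bary m y i) = 1"
 proof -
  have "(\<Sum>i\<le>m. bary m y i) = bary m y 0 + (\<Sum>i<m. bary m y (Suc i))"
   by (simp add: sum.atMost_shift)
  thus ?thesis by (simp add: bary_def)
 qed
 ultimately show ?thesis using assms unfolding standard_simplex_def bary_def
  by (auto simp: Suc_le_eq)
qed

lemma bary_dom_in_std: "y \<in> bary_dom m ==> bary m y \<in> std m"
 by (intro bary_in_standard_simplex) (auto simp: bary_dom_def less_imp_le)

lemma measurable_bary: "bary p \<in> lebPi {..<p} \<rightarrow>\<^sub>M borel"
proof (rule measurable_coordinatewise_then_product)
 fix i
 have "(%y. bary p y i) = (%y. if i = 0 then 1 - (\<Sum>b<p. y b) else if i \<le> p then y (i - 1) else 0)"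
  by (auto simp: bary_def)
 also have "... \<in> borel_measurable (lebPi {..<p})"
 proof -
  have *: "(%y. y b) \<in> borel_measurable (lebPi {..<p})" if "b < p" for b
   using measurable_component_singleton[of b "{..<p}" "%_. lborel :: real measure"] that by simp
  show ?thesis by (cases "i = 0"; cases "i \<le> p") (auto intro!: borel_measurable_diff borel_measurable_sum *)
 qed
 finally show "(%y. bary p y i) \<in> borel_measurable (lebPi {..<p})" .
qed

lemma sets_bary_dom: "bary_dom p \<inter> space (lebPi {..<p}) \<in> sets (lebPi {..<p})"
proof -
 have [measurable]: "(%y. y b) \<in> borel_measurable (lebPi {..<p})" if "b < p" for b
  using measurable_component_singleton[of b "{..<p}" "%_. lborel :: real measure"] that by simp
 have "bary_dom p \<inter> space (lebPi {..<p}) = {y \<in> space (lebPi {..<p}). (\<forall>b\<in>{..<p}. 0 < y b) \<and> (\<Sum>b\<in>{..<p}. y b) < 1}"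
  by (auto simp: bary_dom_def)
 also have "... \<in> sets (lebPi {..<p})"
  by (intro sets.sets_Collect_conj sets.sets_Collect_finite_All borel_measurable_less borel_measurable_sum) auto
 finally show ?thesis .
qed

text \<open>A continuous function on the compact simplex is bounded, and the domain lies in the unit
  cube. Nothing is known about \<open>H\<close> off the simplex, so measurability is taken from its
  extension by zero.\<close>

lemma set_integrable_simplex:
 assumes "continuous_on (std p) H"
 shows "set_integrable (lebPi {..<p}) (bary_dom p) (%y. H (bary p y) :: complex)"
proof -
 let ?M = "lebPi {..<p}" let ?A = "bary_dom p \<inter> space ?M"
 have "compact (H ` std p)" by (intro compact_continuous_image assms compact_standard_simplex)
 then obtain C where C: "!!x. x \<in> std p ==> norm (H x) \<le> C"
  by (meson compact_imp_bounded bounded_iff imageI)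
 have "(%x. indicator (std p) x *\<^sub>R H x) \<in> borel_measurable borel"
  by (intro borel_measurable_continuous_on_indicator assms borel_closed closed_standard_simplex)
 hence meas: "(%y. indicator (std p) (bary p y) *\<^sub>R H (bary p y)) \<in> borel_measurable ?M"
  using measurable_compose[OF measurable_bary] by fast
 have em: "emeasure ?M ?A < \<infinity>"
 proof -
  have sub: "?A \<subseteq> Pi\<^sub>E {..<p} (%_. {0..1})"
  proof
   fix y assume y: "y \<in> ?A"
   have "y b \<le> 1" if "b < p" for b
    using member_le_sum[of b "{..<p}" y] y that by (auto simp: bary_dom_def less_imp_le intro: order.trans)
   thus "y \<in> Pi\<^sub>E {..<p} (%_. {0..1})" using y by (auto simp: bary_dom_def space_PiM PiE_def less_imp_le)
  qed
  have "emeasure ?M ?A \<le> emeasure ?M (Pi\<^sub>E {..<p} (%_. {0..1}))"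
   by (intro emeasure_mono sub sets_PiM_I_finite) auto
  also have "... = 1" by (subst lebPi.emeasure_PiM) auto
  finally show ?thesis by (rule order.strict_trans1) simp
 qed
 have "integrable ?M (%y. indicator ?A y *\<^sub>R (indicator (std p) (bary p y) *\<^sub>R H (bary p y)))"
 proof (rule integrableI_bounded_set[where A = ?A and B = C])
  show "?A \<in> sets ?M" by (rule sets_bary_dom)
  show "(%y. indicator ?A y *\<^sub>R (indicator (std p) (bary p y) *\<^sub>R H (bary p y))) \<in> borel_measurable ?M"
   by (rule borel_measurable_scaleR[OF borel_measurable_indicator[OF sets_bary_dom] meas])
  show "emeasure ?M ?A < \<infinity>" by (rule em)
  show "AE y in ?M. y \<in> ?A --> norm (indicator ?A y *\<^sub>R (indicator (std p) (bary p y) *\<^sub>R H (bary p y))) \<le> C"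
   using C bary_dom_in_std by (intro AE_I2) (auto simp: indicator_def)
 qed auto
 moreover have "integrable ?M (%y. indicator ?A y *\<^sub>R (indicator (std p) (bary p y) *\<^sub>R H (bary p y)))
   \<longleftrightarrow> integrable ?M (%y. indicator (bary_dom p) y *\<^sub>R H (bary p y))"
  by (rule Bochner_Integration.integrable_cong)
    (auto simp: indicator_def bary_dom_in_std)
 ultimately show ?thesis unfolding set_integrable_def by simp
qed

lemma simplex_int_cong:
 "(!!y. y \<in> bary_dom p ==> H (bary p y) = H' (bary p y)) ==> simplex_int p H = simplex_int p H'"
 unfolding simplex_int_def set_lebesgue_integral_def
 by (intro Bochner_Integration.integral_cong) (auto simp: indicator_def)

lemma simplex_int_diff:
 "continuous_on (std p) H ==> continuous_on (std p) H' ==>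
  simplex_int p (%x. H x - H' x) = simplex_int p H - simplex_int p H'"
 unfolding simplex_int_def by (intro set_integral_diff set_integrable_simplex)

lemma simplex_int_sum:
 "finite I ==> (!!i. i \<in> I ==> continuous_on (std p) (H i)) ==>
  simplex_int p (%x. \<Sum>i\<in>I. H i x) = (\<Sum>i\<in>I. simplex_int p (H i))"
 unfolding simplex_int_def set_lebesgue_integral_def scaleR_sum_right
 by (intro Bochner_Integration.integral_sum set_integrable_simplex[unfolded set_integrable_def])

lemma simplex_int_cmult: "simplex_int p (%x. c * H x) = c * simplex_int p H"
 unfolding simplex_int_def by simp

text \<open>A product of equal measures does not depend on the names of the coordinates, as is
  checked on boxes. This closes the gap in the index set after one coordinate has been integrated
  out.\<close>

lemma lebPi_reindex:
 assumes h: "bij_betw h J I" and fin: "finite J"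
 shows "distr (lebPi J) (lebPi I) (%y. \<lambda>i\<in>I. y (inv_into J h i)) = lebPi I"
proof (rule lebPi.PiM_eqI)
 let ?g = "inv_into J h"
 have g: "bij_betw ?g I J" by (rule bij_betw_inv_into[OF h])
 hence gJ: "?g i \<in> J" if "i \<in> I" for i using that by (auto simp: bij_betw_def)
 show finI: "finite I" using h fin bij_betw_finite by blast
 have meas: "(%y. \<lambda>i\<in>I. y (?g i)) \<in> lebPi J \<rightarrow>\<^sub>M lebPi I"
  by (rule measurable_restrict, rule measurable_component_singleton, rule gJ)
 fix A :: "nat => real set" assume A: "!!i. i \<in> I ==> A i \<in> sets lborel"
 have hI: "h j \<in> I" if "j \<in> J" for j using that h by (auto simp: bij_betw_def)
 have gh: "?g (h j) = j" if "j \<in> J" for j using that h by (auto simp: bij_betw_def)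
 have "emeasure (distr (lebPi J) (lebPi I) (%y. \<lambda>i\<in>I. y (?g i))) (Pi\<^sub>E I A)
   = emeasure (lebPi J) ((%y. \<lambda>i\<in>I. y (?g i)) -` Pi\<^sub>E I A \<inter> space (lebPi J))"
  by (intro emeasure_distr meas sets_PiM_I_finite finI A)
 also have "(%y. \<lambda>i\<in>I. y (?g i)) -` Pi\<^sub>E I A \<inter> space (lebPi J) = Pi\<^sub>E J (%j. A (h j))"
 proof (rule Set.set_eqI, rule iffI)
  fix y assume "y \<in> (%y. \<lambda>i\<in>I. y (?g i)) -` Pi\<^sub>E I A \<inter> space (lebPi J)"
  hence y: "!!i. i \<in> I ==> y (?g i) \<in> A i" "y \<in> extensional J"
   by (auto simp: PiE_iff space_PiM)
  thus "y \<in> Pi\<^sub>E J (%j. A (h j))" using hI gh by (auto simp: PiE_iff) (metis)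
 next
  fix y assume y: "y \<in> Pi\<^sub>E J (%j. A (h j))"
  have "y (?g i) \<in> A i" if "i \<in> I" for i
   using y gJ[OF that] f_inv_into_f[of i h J] that h by (auto simp: PiE_iff bij_betw_def)
  thus "y \<in> (%y. \<lambda>i\<in>I. y (?g i)) -` Pi\<^sub>E I A \<inter> space (lebPi J)" using y by (auto simp: PiE_iff space_PiM)
 qed
 also have "emeasure (lebPi J) (Pi\<^sub>E J (%j. A (h j))) = (\<Prod>j\<in>J. emeasure lborel (A (h j)))"
  using A hI fin by (intro lebPi.emeasure_PiM) auto
 also have "... = (\<Prod>i\<in>I. emeasure lborel (A i))"
  by (rule prod.reindex_bij_betw[OF h])
 finally show "emeasure (distr (lebPi J) (lebPi I) (%y. \<lambda>i\<in>I. y (?g i))) (Pi\<^sub>E I A) = (\<Prod>i\<in>I. emeasure lborel (A i))" .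
qed simp

lemma lebPi_integral_reindex:
 fixes F :: "(nat => real) => complex"
 assumes h: "bij_betw h J I" and fin: "finite J" and F: "F \<in> borel_measurable (lebPi I)"
 shows "(\<integral>x. F x \<partial>lebPi I) = (\<integral>y. F (\<lambda>i\<in>I. y (inv_into J h i)) \<partial>lebPi J)"
proof -
 have gJ: "inv_into J h i \<in> J" if "i \<in> I" for i using that bij_betw_inv_into[OF h] by (auto simp: bij_betw_def)
 have meas: "(%y. \<lambda>i\<in>I. y (inv_into J h i)) \<in> lebPi J \<rightarrow>\<^sub>M lebPi I"
  by (rule measurable_restrict, rule measurable_component_singleton, rule gJ)
 show ?thesis by (subst lebPi_reindex[OF h fin, symmetric], subst integral_distr[OF meas F]) simp
qed

lemma sum_fun_upd_lessThan:
 fixes y :: "nat => real"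
 assumes "b < p"
 shows "(\<Sum>c<p. (y(b := s)) c) = s + (\<Sum>c\<in>{..<p} - {b}. y c)"
proof -
 have "(\<Sum>c<p. (y(b := s)) c) = (y(b := s)) b + (\<Sum>c\<in>{..<p} - {b}. (y(b := s)) c)"
  using assms by (intro sum.remove) auto
 thus ?thesis by simp
qed

lemma bary_dom_upd:
 assumes "b < p"
 shows "y(b := s) \<in> bary_dom p \<longleftrightarrow> (\<forall>c\<in>{..<p} - {b}. 0 < y c) \<and> 0 < s \<and> s < 1 - (\<Sum>c\<in>{..<p} - {b}. y c)"
 unfolding bary_dom_def mem_Collect_eq sum_fun_upd_lessThan[OF assms] using assms by auto

text \<open>Fubini with the coordinate \<open>b\<close> innermost: once the others are fixed, it
  runs through an open interval, which is empty if they already add up to at least 1.\<close>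

lemma simplex_int_iterated:
 assumes "continuous_on (std p) H" "b < p"
 shows "simplex_int p H = (\<integral>x. (if \<forall>c\<in>{..<p} - {b}. 0 < x c then
   set_lebesgue_integral lborel {0<..<1 - (\<Sum>c\<in>{..<p} - {b}. x c)} (%s. H (bary p (x(b := s)))) else 0) \<partial>lebPi ({..<p} - {b}))"
proof -
 let ?I = "{..<p} - {b}"
 let ?f = "%y. indicator (bary_dom p) y *\<^sub>R H (bary p y)"
 have I: "insert b ?I = {..<p}" using assms by auto
 have "simplex_int p H = (\<integral>y. ?f y \<partial>lebPi (insert b ?I))"
  unfolding simplex_int_def set_lebesgue_integral_def I ..
 also have "... = (\<integral>x. (\<integral>s. ?f (x(b := s)) \<partial>lborel) \<partial>lebPi ?I)"
 proof (rule lebPi.product_integral_insert)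
  show "integrable (lebPi (insert b ?I)) ?f"
   using set_integrable_simplex[OF assms(1)] by (simp only: I set_integrable_def)
 qed auto
 also have "... = (\<integral>x. (if \<forall>c\<in>{..<p} - {b}. 0 < x c then
   set_lebesgue_integral lborel {0<..<1 - (\<Sum>c\<in>{..<p} - {b}. x c)} (%s. H (bary p (x(b := s)))) else 0) \<partial>lebPi ?I)"
 proof (rule Bochner_Integration.integral_cong[OF refl])
  fix x
  have "indicat_real (bary_dom p) (x(b := s)) = (if \<forall>c\<in>?I. 0 < x c
    then indicator {0<..<1 - (\<Sum>c\<in>?I. x c)} s else 0)" for s
   unfolding indicator_def bary_dom_upd[OF assms(2)] by auto
  thus "(\<integral>s. ?f (x(b := s)) \<partial>lborel) = (if \<forall>c\<in>?I. 0 < x c then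
   set_lebesgue_integral lborel {0<..<1 - (\<Sum>c\<in>?I. x c)} (%s. H (bary p (x(b := s)))) else 0)"
   by (cases "\<forall>c\<in>?I. 0 < x c") (simp_all add: set_lebesgue_integral_def, auto)
 qed
 finally show ?thesis .
qed

lemma continuous_on_simplical_face: "continuous_on A (sface k :: (nat => real) => _)"
 unfolding simplical_face_def[abs_def]
proof (rule continuous_on_coordinatewise_then_product)
 fix i
 show "continuous_on A (%x::nat => real. if i < k then x i else if i = k then 0 else x (i - 1))"
  by (cases "i < k"; cases "i = k") (simp_all add: continuous_on_coord)
qed

lemma continuous_on_face:
 assumes "continuous_on (std p) H" "1 \<le> p" "k \<le> p"
 shows "continuous_on (std (p - 1)) (%x. H (sface k x))"
 by (rule continuous_on_compose2[OF assms(1) continuous_on_simplical_face])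
   (use assms simplical_face_in_standard_simplex in auto)

lemma continuous_on_perm_coords: "continuous_on A (%x::nat => real. x \<circ> f)"
 unfolding comp_def by (intro continuous_on_coordinatewise_then_product continuous_on_coord)

lemma standard_simplex_transpose:
 assumes "x \<in> std p" "i \<le> p" "j \<le> p"
 shows "x \<circ> Transposition.transpose i j \<in> std p"
proof -
 have "(\<Sum>k\<le>p. (x \<circ> Transposition.transpose i j) k) = (\<Sum>k\<le>p. x k)"
  using assms by (intro sum.permute[symmetric] permutes_swap_id) auto
 thus ?thesis using assms unfolding standard_simplex_def
  by (auto simp: Transposition.transpose_def)
qed

lemma bary_reflect:
 assumes "b < p"
 shows "bary p (y(b := 1 - (\<Sum>c\<in>{..<p} - {b}. y c) - s)) = bary p (y(b := s)) \<circ> Transposition.transpose 0 (Suc b)"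
proof
 fix i
 show "bary p (y(b := 1 - (\<Sum>c\<in>{..<p} - {b}. y c) - s)) i = (bary p (y(b := s)) \<circ> Transposition.transpose 0 (Suc b)) i"
  unfolding bary_def comp_def sum_fun_upd_lessThan[OF assms]
  using assms by (auto simp: Transposition.transpose_def)
qed

text \<open>On each line in the direction of the coordinate \<open>b\<close>, the reflection of the
  parameter interval exchanges the barycentric coordinates 0 and b+1.\<close>

lemma simplex_int_transpose:
 assumes H: "continuous_on (std p) H" and b: "b < p"
 shows "simplex_int p (%x. H (x \<circ> Transposition.transpose 0 (Suc b))) = simplex_int p H"
proof -
 have H': "continuous_on (std p) (%x. H (x \<circ> Transposition.transpose 0 (Suc b)))"
  by (rule continuous_on_compose2[OF H continuous_on_perm_coords])
    (use b standard_simplex_transpose in auto)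
 let ?S = "%x. 1 - (\<Sum>c\<in>{..<p} - {b}. x c)"
 have "set_lebesgue_integral lborel {0<..<?S x} (%s. H (bary p (x(b := s)) \<circ> Transposition.transpose 0 (Suc b)))
   = set_lebesgue_integral lborel {0<..<?S x} (%s. H (bary p (x(b := s))))" for x
 proof -
  have "set_lebesgue_integral lborel {0<..<?S x} (%s. H (bary p (x(b := s))))
   = (\<integral>s. indicator {0<..<?S x} (?S x - s) *\<^sub>R H (bary p (x(b := ?S x - s))) \<partial>lborel)"
   unfolding set_lebesgue_integral_def
   by (subst lborel_integral_real_affine[where c = "-1" and t = "?S x"]) auto
  also have "... = set_lebesgue_integral lborel {0<..<?S x} (%s. H (bary p (x(b := s)) \<circ> Transposition.transpose 0 (Suc b)))"
   unfolding set_lebesgue_integral_def bary_reflect[OF b]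
   by (intro Bochner_Integration.integral_cong) (auto simp: indicator_def)
  finally show ?thesis ..
 qed
 hence "(%x. if \<forall>c\<in>{..<p} - {b}. 0 < x c then
   set_lebesgue_integral lborel {0<..<?S x} (%s. H (bary p (x(b := s)) \<circ> Transposition.transpose 0 (Suc b))) else 0)
  = (%x. if \<forall>c\<in>{..<p} - {b}. 0 < x c then
   set_lebesgue_integral lborel {0<..<?S x} (%s. H (bary p (x(b := s)))) else 0)" by (simp only:)
 thus ?thesis unfolding simplex_int_iterated[OF H b] simplex_int_iterated[OF H' b] by (simp only:)
qed

text \<open>The end point of a line parallel to \<open>e\<^bsub>b+1\<^esub> - e\<^sub>0\<close> on the face opposite to the vertex \<open>0\<close> has
  the barycentric coordinates \<open>x\<^sub>1, \<dots>, x\<^sub>b, x\<^sub>0, x\<^bsub>b+1\<^esub>, \<dots>\<close> on that face; this rotation of the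
  coordinates does not affect integrals.\<close>

definition rot :: "nat => (nat => real) => nat => real" where
 "rot b x = (%i. if i < b then x (Suc i) else if i = b then x 0 else x i)"

lemma rot_in_standard_simplex: "b \<le> q ==> x \<in> std q ==> rot b x \<in> std q"
 and continuous_on_rot: "continuous_on A (rot b)"
 and rot_Suc: "rot (Suc b) x = rot b (x \<circ> Transposition.transpose 0 (Suc b))"
proof -
 show R: "rot (Suc b) x = rot b (x \<circ> Transposition.transpose 0 (Suc b))" for b x
  by (rule ext) (auto simp: rot_def Transposition.transpose_def less_Suc_eq)
 show "b \<le> q ==> x \<in> std q ==> rot b x \<in> std q"
 proof (induction b arbitrary: x)
  case 0
  have "rot 0 x = x" by (rule ext) (auto simp: rot_def)
  thus ?case using 0 by simp
 next
  case (Suc b)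
  thus ?case unfolding R by (intro Suc.IH standard_simplex_transpose) auto
 qed
 show "continuous_on A (rot b)"
  unfolding rot_def[abs_def]
 proof (rule continuous_on_coordinatewise_then_product)
  fix i
  show "continuous_on A (%x. if i < b then x (Suc i) else if i = b then x 0 else x i)"
   by (cases "i < b"; cases "i = b") (simp_all add: continuous_on_coord)
 qed
qed

text \<open>By \<open>rot_Suc\<close> the rotation is a composition of transpositions with the
  vertex 0, each of which preserves the integral.\<close>

lemma simplex_int_rot:
 assumes "continuous_on (std q) H" "b \<le> q"
 shows "simplex_int q (%x. H (rot b x)) = simplex_int q H"
 using assms(2)
proof (induction b)
 case 0
 have "rot 0 x = x" for x by (rule ext) (auto simp: rot_def)
 thus ?case by simp
next
 case (Suc b)
 have "continuous_on (std q) (%x. H (rot b x))"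
  by (rule continuous_on_compose2[OF assms(1) continuous_on_rot])
    (use Suc.prems rot_in_standard_simplex in auto)
 from simplex_int_transpose[OF this, of b] Suc show ?case by (simp add: rot_Suc)
qed

text \<open>The two ends of a line in the direction of the coordinate \<open>b\<close>: at the lower
  end the barycentric coordinate b+1 vanishes, at the upper end the coordinate 0. The index shift
  renames the remaining coordinates to \<open>{..<p - 1}\<close>.\<close>

lemma bary_lower:
 assumes "b < p"
 shows "bary p ((\<lambda>i\<in>{..<p} - {b}. y (if i < b then i else i - 1))(b := 0)) = sface (Suc b) (bary (p - 1) y)"
  and "bary p ((\<lambda>i\<in>{..<p} - {b}. y (if i < b then i else i - 1))(b := 1 - (\<Sum>c\<in>{..<p} - {b}. (\<lambda>i\<in>{..<p} - {b}. y (if i < b then i else i - 1)) c)))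
    = sface 0 (rot b (bary (p - 1) y))"
  and "(\<Sum>c\<in>{..<p} - {b}. (\<lambda>i\<in>{..<p} - {b}. y (if i < b then i else i - 1)) c) = (\<Sum>c<p - 1. y c)"
proof -
 let ?x = "\<lambda>i\<in>{..<p} - {b}. y (if i < b then i else i - 1)"
 show S: "(\<Sum>c\<in>{..<p} - {b}. ?x c) = (\<Sum>c<p - 1. y c)"
  by (rule sum.reindex_bij_witness[where i = "%i. if i < b then i else Suc i" and j = "%i. if i < b then i else i - 1"])
    (use assms in auto)
 show "bary p (?x(b := 0)) = sface (Suc b) (bary (p - 1) y)"
 proof
  fix i show "bary p (?x(b := 0)) i = sface (Suc b) (bary (p - 1) y) i"
   unfolding bary_def sum_fun_upd_lessThan[OF assms] S simplical_face_def
   using assms by auto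
 qed
 show "bary p (?x(b := 1 - (\<Sum>c\<in>{..<p} - {b}. ?x c))) = sface 0 (rot b (bary (p - 1) y))"
 proof
  fix i show "bary p (?x(b := 1 - (\<Sum>c\<in>{..<p} - {b}. ?x c))) i = sface 0 (rot b (bary (p - 1) y)) i"
   unfolding bary_def sum_fun_upd_lessThan[OF assms] S simplical_face_def rot_def
   using assms by auto
 qed
qed

text \<open>The fundamental theorem of calculus on each line, integrated over the lines. It needs
  the derivative only inside the simplex and continuity up to the boundary, which is all that
  simplices provide. The rotation met at the upper end is removed by
  \<open>simplex_int_rot\<close>.\<close>

lemma simplex_int_FTC:
 assumes H: "continuous_on (std p) H" and H': "continuous_on (std p) H'" and b: "b < p"
  and der: "!!y. y \<in> bary_dom p ==> ((%s. H (bary p (y(b := s)))) has_vector_derivative H' (bary p y)) (at (y b))"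
 shows "simplex_int p H' = simplex_int (p - 1) (%x. H (sface 0 x)) - simplex_int (p - 1) (%x. H (sface (Suc b) x))"
proof -
 let ?I = "{..<p} - {b}"
 let ?S = "%x. 1 - (\<Sum>c\<in>?I. x c)"
 \<comment> \<open>\<open>P\<close> describes the lines that meet the open simplex; on the others
   the inner integral is zero.\<close>
 define P where "P x \<longleftrightarrow> (\<forall>c\<in>?I. 0 < x c) \<and> 0 < ?S x" for x :: "nat => real"
 define F where "F x = (if P x then H (bary p (x(b := ?S x))) - H (bary p (x(b := 0))) else 0)" for x
 have inner: "(if \<forall>c\<in>?I. 0 < x c then set_lebesgue_integral lborel {0<..<?S x} (%s. H' (bary p (x(b := s)))) else 0) = F x" for x
 proof (cases "P x")
  case True
  have dom: "bary p (x(b := s)) \<in> std p" if "s \<in> {0..?S x}" for s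
   using True that b by (intro bary_in_standard_simplex) (auto simp: P_def sum_fun_upd_lessThan less_imp_le simp del: fun_upd_apply; auto simp: P_def less_imp_le)+
  have cont: "continuous_on {0..?S x} (%s. K (bary p (x(b := s))))" if "continuous_on (std p) K" for K :: "_ => complex"
  proof (rule continuous_on_compose2[OF that])
   show "continuous_on {0..?S x} (%s. bary p (x(b := s)))"
   proof (rule continuous_on_coordinatewise_then_product)
    fix i
    show "continuous_on {0..?S x} (%s. bary p (x(b := s)) i)"
     unfolding bary_def sum_fun_upd_lessThan[OF b]
     by (cases "i = 0"; cases "i \<le> p"; cases "i - 1 = b") (auto intro!: continuous_intros)
   qed
  qed (use dom in auto)
  have "((%s. H' (bary p (x(b := s)))) has_integral (H (bary p (x(b := ?S x))) - H (bary p (x(b := 0))))) {0..?S x}"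
  proof (rule fundamental_theorem_of_calculus_interior)
   show "0 \<le> ?S x" using True by (auto simp: P_def)
   fix s assume s: "s \<in> {0<..<?S x}"
   have "x(b := s) \<in> bary_dom p" unfolding bary_dom_upd[OF b] using True s by (auto simp: P_def)
   from der[OF this] show "((%s. H (bary p (x(b := s)))) has_vector_derivative H' (bary p (x(b := s)))) (at s)" by simp
  qed (rule cont[OF H])
  hence "integral {0..?S x} (%s. H' (bary p (x(b := s)))) = H (bary p (x(b := ?S x))) - H (bary p (x(b := 0)))"
   by (rule integral_unique)
  moreover have "set_lebesgue_integral lborel {0..?S x} (%s. H' (bary p (x(b := s)))) = integral {0..?S x} (%s. H' (bary p (x(b := s))))"
   by (rule set_borel_integral_eq_integral(2)[OF borel_integrable_atLeastAtMost'[OF cont[OF H']]])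
  moreover have "set_lebesgue_integral lborel {0<..<?S x} (%s. H' (bary p (x(b := s)))) = set_lebesgue_integral lborel {0..?S x} (%s. H' (bary p (x(b := s))))"
  proof (rule set_integral_cong_set)
   have i: "set_integrable lborel {0..?S x} (%s. H' (bary p (x(b := s))))"
    by (rule borel_integrable_atLeastAtMost'[OF cont[OF H']])
   thus "set_borel_measurable lborel {0..?S x} (%s. H' (bary p (x(b := s))))"
    unfolding set_integrable_def set_borel_measurable_def by (rule borel_measurable_integrable)
   have "set_integrable lborel {0<..<?S x} (%s. H' (bary p (x(b := s))))"
    by (rule set_integrable_subset[OF i]) auto
   thus "set_borel_measurable lborel {0<..<?S x} (%s. H' (bary p (x(b := s))))"
    unfolding set_integrable_def set_borel_measurable_def by (rule borel_measurable_integrable)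
   show "AE s in lborel. (s \<in> {0..?S x}) = (s \<in> {0<..<?S x})"
    using AE_lborel_singleton[of 0] AE_lborel_singleton[of "?S x"] by eventually_elim auto
  qed
  ultimately show ?thesis using True by (simp add: F_def P_def)
 qed (auto simp: F_def P_def set_lebesgue_integral_def)
 have "simplex_int p H' = (\<integral>x. F x \<partial>lebPi ?I)"
  unfolding simplex_int_iterated[OF H' b] inner ..
 also have "... = simplex_int (p - 1) (%x. H (sface 0 (rot b x)) - H (sface (Suc b) x))"
 proof -
  let ?h = "%i. if i < b then i else Suc i"
  have h: "bij_betw ?h {..<p - 1} ?I"
   by (rule bij_betw_byWitness[where f' = "%i. if i < b then i else i - 1"]) (use b in auto)
  have inv: "inv_into {..<p - 1} ?h i = (if i < b then i else i - 1)" if "i \<in> ?I" for i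
   by (rule inv_into_f_eq[OF bij_betw_imp_inj_on[OF h]]) (use that b in auto)
  have m: "(%x. x c) \<in> borel_measurable (lebPi ?I)" if "c \<in> ?I" for c
   using measurable_component_singleton[of c ?I "%_. lborel :: real measure"] that by simp
  have mS: "?S \<in> borel_measurable (lebPi ?I)"
   by (intro borel_measurable_diff borel_measurable_sum m) auto
  have mK: "(%x. bary p (x(b := K x))) \<in> lebPi ?I \<rightarrow>\<^sub>M borel" if "K \<in> borel_measurable (lebPi ?I)" for K
  proof (rule measurable_coordinatewise_then_product)
   fix i
   have "(%x. bary p (x(b := K x)) i) = (%x. if i = 0 then 1 - (K x + (\<Sum>c\<in>?I. x c))
     else if i \<le> p then if i - 1 = b then K x else x (i - 1) else 0)"
    unfolding bary_def sum_fun_upd_lessThan[OF b] by auto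
   also have "... \<in> borel_measurable (lebPi ?I)"
    using that by (cases "i = 0"; cases "i \<le> p"; cases "i - 1 = b")
     (auto intro!: borel_measurable_diff borel_measurable_add borel_measurable_sum m)
   finally show "(%x. bary p (x(b := K x)) i) \<in> borel_measurable (lebPi ?I)" .
  qed
  \<comment> \<open>The extension of \<open>H\<close> by zero is Borel measurable on the whole
    space, and the end points of the lines in \<open>P\<close> lie in the simplex, where it agrees
    with \<open>H\<close>.\<close>
  define E where "E x = indicator (std p) x *\<^sub>R H x" for x
  have mE: "E \<in> borel_measurable borel"
   unfolding E_def[abs_def] by (intro borel_measurable_continuous_on_indicator H borel_closed closed_standard_simplex)
  have eqF: "F x = (if P x then E (bary p (x(b := ?S x))) - E (bary p (x(b := 0))) else 0)" for x
  proof (cases "P x")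
   case True
   have "bary p (x(b := ?S x)) \<in> std p" "bary p (x(b := 0)) \<in> std p"
    using True b by (intro bary_in_standard_simplex; auto simp: P_def sum_fun_upd_lessThan less_imp_le simp del: fun_upd_apply;
      auto simp: P_def less_imp_le)+
   thus ?thesis by (simp add: F_def E_def True)
  qed (simp add: F_def)
  have mP: "Measurable.pred (lebPi ?I) P"
  proof -
   have "{x \<in> space (lebPi ?I). P x} \<in> sets (lebPi ?I)" unfolding P_def
    by (intro sets.sets_Collect_conj sets.sets_Collect_finite_All borel_measurable_less m mS) auto
   thus ?thesis by (simp add: pred_def)
  qed
  have mF: "F \<in> borel_measurable (lebPi ?I)"
   unfolding eqF[abs_def]
   by (intro measurable_If borel_measurable_diff measurable_compose[OF mK mE] mS mP[unfolded pred_def]) auto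
  have "(\<integral>x. F x \<partial>lebPi ?I) = (\<integral>y. F (\<lambda>i\<in>?I. y (inv_into {..<p - 1} ?h i)) \<partial>lebPi {..<p - 1})"
   by (rule lebPi_integral_reindex[OF h _ mF]) simp
  also have "... = simplex_int (p - 1) (%x. H (sface 0 (rot b x)) - H (sface (Suc b) x))"
   unfolding simplex_int_def set_lebesgue_integral_def
  proof (rule Bochner_Integration.integral_cong[OF refl])
   fix y :: "nat => real"
   have r: "(\<lambda>i\<in>?I. y (inv_into {..<p - 1} ?h i)) = (\<lambda>i\<in>?I. y (if i < b then i else i - 1))"
    by (rule restrict_ext) (simp only: inv)
   have "(\<forall>c\<in>?I. 0 < (\<lambda>i\<in>?I. y (if i < b then i else i - 1)) c) \<longleftrightarrow> (\<forall>c<p - 1. 0 < y c)"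
   proof
    assume *: "\<forall>c\<in>?I. 0 < (\<lambda>i\<in>?I. y (if i < b then i else i - 1)) c"
    show "\<forall>c<p - 1. 0 < y c"
    proof (intro allI impI)
     fix c assume "c < p - 1"
     thus "0 < y c" using *[rule_format, of "?h c"] b by (cases "c < b") auto
    qed
   qed (use b in auto)
   hence Py: "P (\<lambda>i\<in>?I. y (if i < b then i else i - 1)) \<longleftrightarrow> y \<in> bary_dom (p - 1)"
    unfolding P_def bary_lower(3)[OF b] bary_dom_def by auto
   show "F (\<lambda>i\<in>?I. y (inv_into {..<p - 1} ?h i)) = indicator (bary_dom (p - 1)) y *\<^sub>R
     (H (sface 0 (rot b (bary (p - 1) y))) - H (sface (Suc b) (bary (p - 1) y)))"
    unfolding F_def r Py bary_lower(1,2)[OF b] by (cases "y \<in> bary_dom (p - 1)") simp_all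
  qed
  finally show ?thesis .
 qed
 also have "... = simplex_int (p - 1) (%x. H (sface 0 x)) - simplex_int (p - 1) (%x. H (sface (Suc b) x))"
 proof -
  have 0: "continuous_on (std (p - 1)) (%x. H (sface 0 x))"
   and 1: "continuous_on (std (p - 1)) (%x. H (sface (Suc b) x))"
   by (rule continuous_on_face[OF H]; use b in simp)+
  have "continuous_on (std (p - 1)) (%x. H (sface 0 (rot b x)))"
   by (rule continuous_on_compose2[OF 0 continuous_on_rot]) (use b rot_in_standard_simplex in auto)
  thus ?thesis using simplex_int_rot[OF 0, of b] b 1 by (simp add: simplex_int_diff)
 qed
 finally show ?thesis .
qed

section \<open>Determinants of functions on pairs of indices\<close>

text \<open>The determinant in the Leibniz form in which \<open>wedge\<close> is stated, free of
  matrix types and dimensions. Matrices only serve to import multiplicativity and expansion.\<close>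

definition pdet :: "nat => (nat => nat => complex) => complex" where
 "pdet p M = (\<Sum>\<pi> | \<pi> permutes {..<p}. of_int (sign \<pi>) * (\<Prod>a<p. M a (\<pi> a)))"

lemma pdet_eq_det: "pdet p M = Determinant.det (mat p p (%(i, j). M i j))"
proof -
 have "(\<Prod>i = 0..<p. mat p p (%(i, j). M i j) $$ (i, \<pi> i)) = (\<Prod>a<p. M a (\<pi> a))"
  if "\<pi> permutes {0..<p}" for \<pi>
  unfolding atLeast0LessThan using that permutes_in_image[OF that]
  by (intro prod.cong refl) auto
 thus ?thesis unfolding pdet_def Determinant.det_def by (simp add: atLeast0LessThan)
qed

lemma pdet_cong: "(!!a b. a < p ==> b < p ==> M a b = N a b) ==> pdet p M = pdet p N"
 unfolding pdet_eq_det by (intro arg_cong[where f = Determinant.det]) auto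

lemma pdet_mult: "pdet p (%a b. \<Sum>c<p. M a c * N c b) = pdet p M * pdet p N"
proof -
 have "mat p p (%(a, b). \<Sum>c<p. M a c * N c b) = mat p p (%(i, j). M i j) * mat p p (%(i, j). N i j)"
  by (rule eq_matI) (auto simp: scalar_prod_def atLeast0LessThan)
 thus ?thesis unfolding pdet_eq_det by (simp add: Determinant.det_mult[of _ p])
qed

text \<open>The determinant whose row 0 is the \<open>b\<close>-th unit vector, evaluated both by
  the Leibniz formula and by Laplace expansion. The index \<open>if c < b then c else Suc c\<close>
  skips the column \<open>b\<close>.\<close>

lemma sum_permutes_first:
 assumes "b \<le> q"
 shows "(\<Sum>\<pi> | \<pi> permutes {..<Suc q} \<and> \<pi> 0 = b. of_int (sign \<pi>) * (\<Prod>a<q. M a (\<pi> (Suc a))))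
   = (-1) ^ b * pdet q (%a c. M a (if c < b then c else Suc c))"
proof -
 let ?N = "%a c. if a = 0 then (if c = b then 1 else 0) else M (a - 1) c"
 let ?A = "mat (Suc q) (Suc q) (%(i, j). ?N i j)"
 have "pdet (Suc q) ?N = (\<Sum>\<pi> | \<pi> permutes {..<Suc q}. if \<pi> 0 = b then of_int (sign \<pi>) * (\<Prod>a<q. M a (\<pi> (Suc a))) else 0)"
  unfolding pdet_def by (intro sum.cong refl) (simp add: prod.lessThan_Suc_shift del: prod.lessThan_Suc)
 also have "... = (\<Sum>\<pi> | \<pi> permutes {..<Suc q} \<and> \<pi> 0 = b. of_int (sign \<pi>) * (\<Prod>a<q. M a (\<pi> (Suc a))))"
  using finite_permutations[of "{..<Suc q}"] by (simp add: sum.If_cases Int_def conj_ac)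
 finally have 1: "pdet (Suc q) ?N = (\<Sum>\<pi> | \<pi> permutes {..<Suc q} \<and> \<pi> 0 = b. of_int (sign \<pi>) * (\<Prod>a<q. M a (\<pi> (Suc a))))" .
 have "pdet (Suc q) ?N = (\<Sum>j<Suc q. ?A $$ (0, j) * cofactor ?A 0 j)"
  unfolding pdet_eq_det by (rule laplace_expansion_row[of _ "Suc q"]) auto
 also have "... = (\<Sum>j<Suc q. if j = b then cofactor ?A 0 j else 0)"
  by (intro sum.cong refl) auto
 also have "... = cofactor ?A 0 b" using assms by simp
 also have "mat_delete ?A 0 b = mat q q (%(a, c). M a (if c < b then c else Suc c))"
  using assms by (intro eq_matI) (auto simp: mat_delete_def)
 hence "cofactor ?A 0 b = (-1) ^ b * pdet q (%a c. M a (if c < b then c else Suc c))"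
  unfolding cofactor_def pdet_eq_det by simp
 finally show ?thesis using 1 by simp
qed

text \<open>Subtracting column 0 from all others leaves a unit vector as row 0. The differences of
  columns are the edge vectors that span the face opposite to the vertex 0.\<close>

lemma pdet_first_row_ones:
 "pdet (Suc q) (%a b. if a = 0 then 1 else M (a - 1) b) = pdet q (%a c. M a (Suc c) - M a 0)"
proof -
 let ?N = "%a b. if a = 0 then 1 else M (a - 1) b"
 \<comment> \<open>The column operation as right multiplication by a unitriangular matrix.\<close>
 let ?E = "%c b. if c = b then 1 else if c = 0 then -1 else (0::complex)"
 let ?R = "%a b. if a = 0 then (if b = 0 then 1 else 0) else if b = 0 then M (a - 1) 0 else M (a - 1) b - M (a - 1) 0"
 have "Determinant.det (mat (Suc q) (Suc q) (%(i, j). ?E i j)) = prod_list (diag_mat (mat (Suc q) (Suc q) (%(i, j). ?E i j)))"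
  by (rule det_upper_triangular) (auto simp: upper_triangular_def)
 also have "diag_mat (mat (Suc q) (Suc q) (%(i, j). ?E i j)) = map (%_. 1) [0..<Suc q]"
  unfolding diag_mat_def by (intro map_cong) auto
 also have "prod_list (map (%_. 1) [0..<Suc q]) = (1::complex)" by (induction q) auto
 finally have E: "pdet (Suc q) ?E = 1" unfolding pdet_eq_det .
 have "(\<Sum>c<Suc q. ?N a c * ?E c b) = ?R a b" if "a < Suc q" "b < Suc q" for a b
 proof -
  have "(\<Sum>c<Suc q. ?N a c * ?E c b) = ?N a 0 * ?E 0 b + (\<Sum>c<q. ?N a (Suc c) * ?E (Suc c) b)"
   by (rule sum.lessThan_Suc_shift)
  also have "(\<Sum>c<q. ?N a (Suc c) * ?E (Suc c) b) = (\<Sum>c<q. if Suc c = b then ?N a (Suc c) else 0)"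
   by (intro sum.cong) auto
  also have "... = (if b = 0 then 0 else ?N a b)"
   using that by (cases b) auto
  finally show ?thesis by auto
 qed
 hence "pdet (Suc q) ?N * pdet (Suc q) ?E = pdet (Suc q) ?R"
  unfolding pdet_mult[symmetric] by (intro pdet_cong) blast
 hence "pdet (Suc q) ?N = pdet (Suc q) ?R" using E by simp
 also have "... = (\<Sum>\<pi> | \<pi> permutes {..<Suc q}. if \<pi> 0 = 0 then of_int (sign \<pi>) * (\<Prod>a<q. ?R (Suc a) (\<pi> (Suc a))) else 0)"
  unfolding pdet_def by (intro sum.cong refl) (simp add: prod.lessThan_Suc_shift del: prod.lessThan_Suc)
 also have "... = (\<Sum>\<pi> | \<pi> permutes {..<Suc q} \<and> \<pi> 0 = 0. of_int (sign \<pi>) * (\<Prod>a<q. ?R (Suc a) (\<pi> (Suc a))))"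
  using finite_permutations[of "{..<Suc q}"] by (simp add: sum.If_cases Int_def conj_ac)
 also have "... = (-1) ^ 0 * pdet q (%a c. ?R (Suc a) (if c < 0 then c else Suc c))"
  by (rule sum_permutes_first) simp
 finally show ?thesis by simp
qed

section \<open>Stokes' theorem on a simplex\<close>

lemma has_vector_derivative_prod:
 fixes f :: "'i => real => complex"
 assumes "!!i. i \<in> I ==> (f i has_vector_derivative f' i) (at s)"
 shows "((%s. \<Prod>i\<in>I. f i s) has_vector_derivative (\<Sum>i\<in>I. f' i * (\<Prod>j\<in>I - {i}. f j s))) (at s)"
 using has_derivative_prod[of I f "%i h. h *\<^sub>R f' i" s UNIV] assms
 unfolding has_vector_derivative_def by (simp add: scaleR_sum_right)

text \<open>\<open>D a b\<close> is the derivative of the \<open>a\<close>-th function in the direction \<open>e\<^bsub>b+1\<^esub> - e\<^sub>0\<close>;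
  \<open>face_deriv k D a c\<close> is the derivative of its restriction to the \<open>k\<close>-th face.\<close>

definition face_deriv :: "nat => (nat => nat => 'x => complex) => nat => nat => 'x => complex" where
 "face_deriv k D a c x = (if k = 0 then D a (Suc c) x - D a 0 x else D a (if c < k - 1 then c else Suc c) x)"

text \<open>Composing with the transposition of 0 and a+1 changes the sign of the permutation and,
  by the symmetry of \<open>S\<close>, nothing else. This is the cancellation of second derivatives
  behind d d = 0.\<close>

lemma sum_permutes_symmetric_zero:
 fixes S :: "nat => nat => complex"
 assumes a: "a < q" and S: "!!b c. b < Suc q ==> c < Suc q ==> S b c = S c b"
 shows "(\<Sum>\<pi> | \<pi> permutes {..<Suc q}. of_int (sign \<pi>) * (S (\<pi> (Suc a)) (\<pi> 0) * (\<Prod>j\<in>{..<q} - {a}. M j (\<pi> (Suc j))))) = 0"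
  (is "sum ?F ?P = 0")
proof -
 let ?\<tau> = "Transposition.transpose 0 (Suc a)"
 have tau: "?\<tau> permutes {..<Suc q}" using a by (intro permutes_swap_id) auto
 have sg: "sign (\<pi> \<circ> ?\<tau>) = - sign \<pi>" if "\<pi> permutes {..<Suc q}" for \<pi>
 proof -
  have "permutation \<pi>" "permutation ?\<tau>" using that tau by (auto simp: permutation_permutes)
  thus ?thesis by (simp add: sign_compose sign_swap_id)
 qed
 have "sum ?F ?P = sum (%\<pi>. ?F (\<pi> \<circ> ?\<tau>)) ?P"
  by (rule sum.reindex_bij_witness[where i = "%\<pi>. \<pi> \<circ> ?\<tau>" and j = "%\<pi>. \<pi> \<circ> ?\<tau>"])
    (auto simp: comp_assoc permutes_compose[OF tau])
 also have "... = - sum ?F ?P"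
  unfolding sum_negf[symmetric]
 proof (intro sum.cong refl)
  fix \<pi> assume "\<pi> \<in> ?P"
  hence p: "\<pi> permutes {..<Suc q}" by simp
  have "(\<Prod>j\<in>{..<q} - {a}. M j ((\<pi> \<circ> ?\<tau>) (Suc j))) = (\<Prod>j\<in>{..<q} - {a}. M j (\<pi> (Suc j)))"
   by (intro prod.cong) (auto simp: Transposition.transpose_def)
  moreover have "\<pi> 0 < Suc q" "\<pi> (Suc a) < Suc q" using permutes_in_image[OF p] a by auto
  ultimately show "?F (\<pi> \<circ> ?\<tau>) = - ?F \<pi>"
   using S[of "\<pi> 0" "\<pi> (Suc a)"] by (simp add: sg[OF p])
 qed
 finally show ?thesis by simp
qed

text \<open>The Leibniz formula expands the form into products, one for each permutation
  \<open>\<pi>\<close>, and \<open>\<pi> 0\<close> is the direction of differentiation. For each of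
  them \<open>simplex_int_FTC\<close> gives a term on face 0 and one on face
  \<open>Suc (\<pi> 0)\<close>; the terms belonging to a face are then reassembled into a
  determinant.\<close>

lemma simplex_stokes:
 fixes D :: "nat => nat => (nat => real) => complex"
 assumes g0: "continuous_on (std (Suc q)) g0"
  and D0: "!!b. b < Suc q ==> continuous_on (std (Suc q)) (D0 b)"
  and D: "!!a b. a < q ==> b < Suc q ==> continuous_on (std (Suc q)) (D a b)"
  and DD: "!!a b c. a < q ==> b < Suc q ==> c < Suc q ==> continuous_on (std (Suc q)) (DD a b c)"
  and der0: "!!b y. b < Suc q ==> y \<in> bary_dom (Suc q) ==>
    ((%s. g0 (bary (Suc q) (y(b := s)))) has_vector_derivative D0 b (bary (Suc q) y)) (at (y b))"
  and der: "!!a b c y. a < q ==> b < Suc q ==> c < Suc q ==> y \<in> bary_dom (Suc q) ==>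
    ((%s. D a b (bary (Suc q) (y(c := s)))) has_vector_derivative DD a b c (bary (Suc q) y)) (at (y c))"
  and sym: "!!a b c y. a < q ==> b < Suc q ==> c < Suc q ==> y \<in> bary_dom (Suc q) ==>
    DD a b c (bary (Suc q) y) = DD a c b (bary (Suc q) y)"
 shows "simplex_int (Suc q) (%x. pdet (Suc q) (%a b. if a = 0 then D0 b x else D (a - 1) b x))
  = (\<Sum>k\<le>Suc q. (-1) ^ k * simplex_int q (%x. g0 (sface k x) *
    pdet q (%a c. face_deriv k D a c (sface k x))))"
proof -
 let ?P = "{\<pi>. \<pi> permutes {..<Suc q}}"
 let ?\<Delta> = "std (Suc q)"
 define H where "H \<pi> x = g0 x * (\<Prod>a<q. D a (\<pi> (Suc a)) x)" for \<pi> x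
 define H' where "H' \<pi> x = D0 (\<pi> 0) x * (\<Prod>a<q. D a (\<pi> (Suc a)) x)
   + g0 x * (\<Sum>a<q. DD a (\<pi> (Suc a)) (\<pi> 0) x * (\<Prod>j\<in>{..<q} - {a}. D j (\<pi> (Suc j)) x))" for \<pi> x
 have fin: "finite ?P" by (rule finite_permutations) simp
 have lt: "\<pi> i < Suc q" if "\<pi> \<in> ?P" "i < Suc q" for \<pi> i
  using that permutes_in_image[of \<pi> "{..<Suc q}" i] by auto
 have cH: "continuous_on ?\<Delta> (H \<pi>)" if "\<pi> \<in> ?P" for \<pi>
  unfolding H_def[abs_def] using lt[OF that] by (intro continuous_intros g0 D) auto
 have cH': "continuous_on ?\<Delta> (H' \<pi>)" if "\<pi> \<in> ?P" for \<pi>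
  unfolding H'_def[abs_def] using lt[OF that] by (intro continuous_intros g0 D0 D DD) auto
 have dH: "((%s. H \<pi> (bary (Suc q) (y(\<pi> 0 := s)))) has_vector_derivative H' \<pi> (bary (Suc q) y)) (at (y (\<pi> 0)))"
  if "\<pi> \<in> ?P" "y \<in> bary_dom (Suc q)" for \<pi> y
 proof -
  have "((%s. g0 (bary (Suc q) (y(\<pi> 0 := s))) * (\<Prod>a<q. D a (\<pi> (Suc a)) (bary (Suc q) (y(\<pi> 0 := s)))))
   has_vector_derivative (g0 (bary (Suc q) (y(\<pi> 0 := y (\<pi> 0)))) *
     (\<Sum>a<q. DD a (\<pi> (Suc a)) (\<pi> 0) (bary (Suc q) y) * (\<Prod>j\<in>{..<q} - {a}. D j (\<pi> (Suc j)) (bary (Suc q) (y(\<pi> 0 := y (\<pi> 0))))))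
    + D0 (\<pi> 0) (bary (Suc q) y) * (\<Prod>a<q. D a (\<pi> (Suc a)) (bary (Suc q) (y(\<pi> 0 := y (\<pi> 0))))))) (at (y (\<pi> 0)))"
   using lt[OF that(1)] that(2) by (intro has_vector_derivative_mult has_vector_derivative_prod der0 der) auto
  thus ?thesis unfolding H_def H'_def by (simp add: add.commute)
 qed
 have FTC: "simplex_int (Suc q) (H' \<pi>) = simplex_int q (%x. H \<pi> (sface 0 x)) - simplex_int q (%x. H \<pi> (sface (Suc (\<pi> 0)) x))"
  if "\<pi> \<in> ?P" for \<pi>
  using simplex_int_FTC[OF cH[OF that] cH'[OF that] _ dH[OF that]] lt[OF that, of 0] by simp
 have face: "continuous_on (std q) (%x. H \<pi> (sface k x))" if "\<pi> \<in> ?P" "k \<le> Suc q" for \<pi> k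
  using continuous_on_face[OF cH[OF that(1)], of k] that(2) by simp
 have "simplex_int (Suc q) (%x. pdet (Suc q) (%a b. if a = 0 then D0 b x else D (a - 1) b x))
  = simplex_int (Suc q) (%x. \<Sum>\<pi>\<in>?P. of_int (sign \<pi>) * H' \<pi> x)"
 proof (rule simplex_int_cong)
  fix y assume y: "y \<in> bary_dom (Suc q)"
  let ?x = "bary (Suc q) y"
  have "(\<Sum>\<pi>\<in>?P. of_int (sign \<pi>) * H' \<pi> ?x) = (\<Sum>\<pi>\<in>?P. of_int (sign \<pi>) * (D0 (\<pi> 0) ?x * (\<Prod>a<q. D a (\<pi> (Suc a)) ?x)))
   + g0 ?x * (\<Sum>a<q. \<Sum>\<pi>\<in>?P. of_int (sign \<pi>) * (DD a (\<pi> (Suc a)) (\<pi> 0) ?x * (\<Prod>j\<in>{..<q} - {a}. D j (\<pi> (Suc j)) ?x)))"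
   unfolding H'_def sum.swap[where A = "{..<q}" and B = ?P] by (simp add: ring_distribs sum.distrib sum_distrib_left mult_ac)
  also have "(\<Sum>a<q. \<Sum>\<pi>\<in>?P. of_int (sign \<pi>) * (DD a (\<pi> (Suc a)) (\<pi> 0) ?x * (\<Prod>j\<in>{..<q} - {a}. D j (\<pi> (Suc j)) ?x))) = 0"
   using sym y by (intro sum.neutral ballI sum_permutes_symmetric_zero) auto
  also have "(\<Sum>\<pi>\<in>?P. of_int (sign \<pi>) * (D0 (\<pi> 0) ?x * (\<Prod>a<q. D a (\<pi> (Suc a)) ?x)))
   = pdet (Suc q) (%a b. if a = 0 then D0 b ?x else D (a - 1) b ?x)"
   unfolding pdet_def by (intro sum.cong refl) (simp add: prod.lessThan_Suc_shift del: prod.lessThan_Suc)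
  finally show "pdet (Suc q) (%a b. if a = 0 then D0 b ?x else D (a - 1) b ?x) = (\<Sum>\<pi>\<in>?P. of_int (sign \<pi>) * H' \<pi> ?x)"
   by simp
 qed
 also have "... = (\<Sum>\<pi>\<in>?P. of_int (sign \<pi>) * simplex_int (Suc q) (H' \<pi>))"
  using fin cH' by (subst simplex_int_sum) (auto intro!: continuous_intros simp: simplex_int_cmult)
 also have "... = (\<Sum>\<pi>\<in>?P. of_int (sign \<pi>) * simplex_int q (%x. H \<pi> (sface 0 x)))
   - (\<Sum>\<pi>\<in>?P. of_int (sign \<pi>) * simplex_int q (%x. H \<pi> (sface (Suc (\<pi> 0)) x)))"
  by (simp add: FTC right_diff_distrib sum_subtractf)
 also have "(\<Sum>\<pi>\<in>?P. of_int (sign \<pi>) * simplex_int q (%x. H \<pi> (sface 0 x)))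
   = simplex_int q (%x. \<Sum>\<pi>\<in>?P. of_int (sign \<pi>) * H \<pi> (sface 0 x))"
  using fin face by (subst simplex_int_sum) (auto intro!: continuous_intros simp: simplex_int_cmult)
 \<comment> \<open>Every permutation contributes to face 0, whatever its value at 0; this is the
   determinant with a row of ones.\<close>
 also have "(%x. \<Sum>\<pi>\<in>?P. of_int (sign \<pi>) * H \<pi> (sface 0 x))
   = (%x. g0 (sface 0 x) * pdet q (%a c. face_deriv 0 D a c (sface 0 x)))"
 proof
  fix x :: "nat => real"
  let ?x = "sface 0 x"
  have "(\<Sum>\<pi>\<in>?P. of_int (sign \<pi>) * H \<pi> ?x) = g0 ?x * pdet (Suc q) (%a b. if a = 0 then 1 else D (a - 1) b ?x)"
   unfolding pdet_def sum_distrib_left H_def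
   by (intro sum.cong refl) (simp add: prod.lessThan_Suc_shift mult_ac del: prod.lessThan_Suc)
  thus "(\<Sum>\<pi>\<in>?P. of_int (sign \<pi>) * H \<pi> ?x) = g0 ?x * pdet q (%a c. face_deriv 0 D a c ?x)"
   using pdet_first_row_ones[of q "%a b. D a b ?x"] by (simp add: face_deriv_def)
 qed
 \<comment> \<open>To face b+1 only the permutations with value \<open>b\<close> at 0 contribute;
   they form a cofactor.\<close>
 also have "(\<Sum>\<pi>\<in>?P. of_int (sign \<pi>) * simplex_int q (%x. H \<pi> (sface (Suc (\<pi> 0)) x)))
   = (\<Sum>b\<le>q. \<Sum>\<pi>\<in>{\<pi> \<in> ?P. \<pi> 0 = b}. of_int (sign \<pi>) * simplex_int q (%x. H \<pi> (sface (Suc (\<pi> 0)) x)))"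
  using lt fin by (intro sum.group[symmetric]) (auto simp: less_Suc_eq_le)
 also have "... = (\<Sum>b\<le>q. - ((-1) ^ Suc b * simplex_int q (%x. g0 (sface (Suc b) x) *
    pdet q (%a c. face_deriv (Suc b) D a c (sface (Suc b) x)))))"
 proof (intro sum.cong refl)
  fix b assume b: "b \<in> {..q}"
  let ?Q = "{\<pi> \<in> ?P. \<pi> 0 = b}"
  have "(\<Sum>\<pi>\<in>?Q. of_int (sign \<pi>) * simplex_int q (%x. H \<pi> (sface (Suc (\<pi> 0)) x)))
   = (\<Sum>\<pi>\<in>?Q. of_int (sign \<pi>) * simplex_int q (%x. H \<pi> (sface (Suc b) x)))"
   by (intro sum.cong) auto
  also have "... = simplex_int q (%x. \<Sum>\<pi>\<in>?Q. of_int (sign \<pi>) * H \<pi> (sface (Suc b) x))"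
   using fin face b by (subst simplex_int_sum) (auto intro!: continuous_intros simp: simplex_int_cmult)
  also have "(%x. \<Sum>\<pi>\<in>?Q. of_int (sign \<pi>) * H \<pi> (sface (Suc b) x))
   = (%x. (-1) ^ b * (g0 (sface (Suc b) x) * pdet q (%a c. face_deriv (Suc b) D a c (sface (Suc b) x))))"
  proof
   fix x :: "nat => real"
   let ?x = "sface (Suc b) x"
   have "(\<Sum>\<pi>\<in>?Q. of_int (sign \<pi>) * H \<pi> ?x) = g0 ?x * (\<Sum>\<pi> | \<pi> permutes {..<Suc q} \<and> \<pi> 0 = b. of_int (sign \<pi>) * (\<Prod>a<q. D a (\<pi> (Suc a)) ?x))"
    unfolding H_def sum_distrib_left by (intro sum.cong) (auto simp: mult_ac)
   also have "... = g0 ?x * ((-1) ^ b * pdet q (%a c. D a (if c < b then c else Suc c) ?x))"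
    using sum_permutes_first[of b q "%a c. D a c ?x"] b by simp
   finally show "(\<Sum>\<pi>\<in>?Q. of_int (sign \<pi>) * H \<pi> ?x) = (-1) ^ b * (g0 ?x * pdet q (%a c. face_deriv (Suc b) D a c ?x))"
    by (simp add: face_deriv_def mult_ac)
  qed
  finally show "(\<Sum>\<pi>\<in>?Q. of_int (sign \<pi>) * simplex_int q (%x. H \<pi> (sface (Suc (\<pi> 0)) x)))
   = - ((-1) ^ Suc b * simplex_int q (%x. g0 (sface (Suc b) x) *
    pdet q (%a c. face_deriv (Suc b) D a c (sface (Suc b) x))))"
   by (simp add: simplex_int_cmult)
 qed
 finally show ?thesis by (simp add: sum.atMost_Suc_shift sum_negf del: sum.atMost_Suc)
qed

section \<open>Directional derivatives of smooth simplices\<close>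

lemma continuous_on_fun_upd2: "continuous_on A (%(u, v). (x::nat => real)(i := u, j := v))"
proof (rule continuous_on_coordinatewise_then_product)
 fix k
 show "continuous_on A (%w. (case w of (u, v) => x(i := u, j := v)) k)"
  by (cases "k = j"; cases "k = i") (auto simp: case_prod_beta' intro!: continuous_intros)
qed

lemma open_box:
 fixes x :: "nat => real"
 assumes "open W" "x \<in> W" "i ~= j"
 obtains e where "e > 0" "!!u v. u \<in> cball (x i) e ==> v \<in> cball (x j) e ==> x(i := u, j := v) \<in> W"
proof -
 let ?h = "%(u, v). x(i := u, j := v)"
 have "open (?h -` W)"
  using open_vimage[OF assms(1)] continuous_on_fun_upd2[of UNIV x i j] by (simp add: continuous_on_open_vimage)
 moreover have "(x i, x j) \<in> ?h -` W" using assms by simp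
 ultimately obtain A B where AB: "open A" "open B" "(x i, x j) \<in> A \<times> B" "A \<times> B \<subseteq> ?h -` W"
  by (rule open_prod_elim)
 obtain e1 where "e1 > 0" "cball (x i) e1 \<subseteq> A" using AB by (auto simp: open_contains_cball)
 moreover obtain e2 where "e2 > 0" "cball (x j) e2 \<subseteq> B" using AB by (auto simp: open_contains_cball)
 ultimately show thesis using AB(4) by (intro that[of "min e1 e2"]) (auto simp: subset_iff)
qed

text \<open>Lines in barycentric coordinates move two coordinates in opposite directions, whereas
  smoothness of a simplex speaks of single partial derivatives. In a plane, existence of one partial
  derivative at the point and continuity of the other near it give a total derivative, to which the
  chain rule applies.\<close>

lemma has_vector_derivative_two_coords:
 fixes g :: "(nat => real) => complex"
 assumes W: "open W" "x \<in> W" and ij: "i ~= j"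
  and gi: "!!x. x \<in> W ==> ((%s. g (x(i := s))) has_vector_derivative gi x) (at (x i))"
  and gj: "!!x. x \<in> W ==> ((%s. g (x(j := s))) has_vector_derivative gj x) (at (x j))"
  and cj: "continuous_on W gj"
 shows "((%s. g (x(i := x i + (s - s0), j := x j - (s - s0)))) has_vector_derivative (gi x - gj x)) (at s0)"
proof -
 obtain e where e: "e > 0" "!!u v. u \<in> cball (x i) e ==> v \<in> cball (x j) e ==> x(i := u, j := v) \<in> W"
  using open_box[OF W ij] by blast
 let ?X = "ball (x i) e" and ?Y = "ball (x j) e"
 let ?f = "%u v. g (x(i := u, j := v))"
 have inW: "x(i := u, j := v) \<in> W" if "u \<in> ?X" "v \<in> ?Y" for u v using e(2)[of u v] that by (auto simp: ball_def cball_def)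
 have "((%(u, v). ?f u v) has_derivative (%(tx, ty). tx *\<^sub>R gi x + blinfun_apply (blinfun_scaleR_left (gj (x(i := x i, j := x j)))) ty))
   (at (x i, x j) within ?X \<times> ?Y)"
 proof (rule has_derivative_partialsI)
  have "((%u. ?f u (x j)) has_derivative (%tx. tx *\<^sub>R gi x)) (at (x i))"
  proof -
   have "?f u (x j) = g (x(i := u))" for u using ij by (metis fun_upd_twist fun_upd_triv)
   thus ?thesis using gi[OF W(2)] unfolding has_vector_derivative_def by simp
  qed
  thus "((%u. ?f u (x j)) has_derivative (%tx. tx *\<^sub>R gi x)) (at (x i) within ?X)"
   by (rule has_derivative_at_withinI)
  fix u v assume uv: "u \<in> ?X" "v \<in> ?Y"
  have "((%v. ?f u v) has_derivative blinfun_apply (blinfun_scaleR_left (gj (x(i := u, j := v))))) (at v)"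
   using gj[OF inW[OF uv]] unfolding has_vector_derivative_def by simp
  thus "((%v. ?f u v) has_derivative blinfun_apply (blinfun_scaleR_left (gj (x(i := u, j := v))))) (at v within ?Y)"
   by (rule has_derivative_at_withinI)
 next
  have "continuous_on (?X \<times> ?Y) (%(u, v). gj (x(i := u, j := v)))"
  proof -
   have "continuous_on (?X \<times> ?Y) (gj \<circ> (%(u, v). x(i := u, j := v)))"
    by (rule continuous_on_compose[OF continuous_on_fun_upd2 continuous_on_subset[OF cj]]) (use inW in auto)
   thus ?thesis by (simp add: comp_def case_prod_beta')
  qed
  hence "continuous_on (?X \<times> ?Y) (%w. blinfun_scaleR_left ((%(u, v). gj (x(i := u, j := v))) w))"
   by (rule bounded_linear.continuous_on[OF bounded_linear_blinfun_scaleR_left])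
  thus "continuous (at (x i, x j) within ?X \<times> ?Y) (%(u, v). blinfun_scaleR_left (gj (x(i := u, j := v))))"
   using e(1) by (auto simp: continuous_on_eq_continuous_within case_prod_beta')
 qed (use e in auto)
 hence *: "((%(u, v). ?f u v) has_derivative (%(tx, ty). tx *\<^sub>R gi x + ty *\<^sub>R gj x)) (at (x i + (s0 - s0), x j - (s0 - s0)))"
  using at_within_open[of "(x i, x j)" "?X \<times> ?Y"] e(1) by (simp add: open_Times)
 have "((%s. (x i + (s - s0), x j - (s - s0))) has_derivative (%h. (h, - h))) (at s0)"
  by (auto intro!: derivative_eq_intros)
 from has_derivative_compose[OF this *]
 show ?thesis unfolding has_vector_derivative_def by (simp add: case_prod_beta' scaleR_diff_right)
qed

text \<open>Differentiation under the integral sign gives \<open>fv u b - fv a b\<close> as the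
  integral of \<open>fuv s b\<close> over \<open>s\<close> from \<open>a\<close> to
  \<open>u\<close>; the derivative in \<open>u\<close> of both sides is then compared at
  \<open>a\<close>.\<close>

lemma mixed_partials_symmetric:
 fixes f :: "real => real => complex"
 assumes e: "e > 0"
  and fu: "!!u v. u \<in> cball a e ==> v \<in> cball b e ==> ((%u. f u v) has_vector_derivative fu u v) (at u)"
  and fv: "!!u v. u \<in> cball a e ==> v \<in> cball b e ==> ((%v. f u v) has_vector_derivative fv u v) (at v)"
  and fuv: "!!u v. u \<in> cball a e ==> v \<in> cball b e ==> ((%v. fu u v) has_vector_derivative fuv u v) (at v)"
  and fvu: "!!u v. u \<in> cball a e ==> v \<in> cball b e ==> ((%u. fv u v) has_vector_derivative fvu u v) (at u)"
  and cuv: "continuous_on (cball a e \<times> cball b e) (%(u, v). fuv u v)"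
  and cu: "continuous_on (cball a e \<times> cball b e) (%(u, v). fu u v)"
 shows "fuv a b = fvu a b"
proof -
 have sub: "{a..u} \<subseteq> cball a e" if "u \<in> {a..a + e}" for u using that by (auto simp: dist_real_def)
 have I: "fv u b - fv a b = integral {a..u} (%s. fuv s b)" if u: "u \<in> {a..a + e}" for u
 proof -
  have int: "((%s. fu s v) has_integral (f u v - f a v)) {a..u}" if "v \<in> cball b e" for v
  proof (rule fundamental_theorem_of_calculus)
   fix s assume "s \<in> {a..u}"
   hence "s \<in> cball a e" using sub[OF u] by auto
   thus "((%s. f s v) has_vector_derivative fu s v) (at s within {a..u})"
    by (rule has_vector_derivative_at_within[OF fu[OF _ that]])
  qed (use u in auto)
  have "((%v. integral (cbox a u) (%s. fu s v)) has_vector_derivative integral (cbox a u) (%s. fuv s b)) (at b within cball b e)"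
  proof (rule leibniz_rule_vector_derivative)
   show "continuous_on (cball b e \<times> cbox a u) (%(v, s). fuv s v)"
   proof -
    have "continuous_on (cball b e \<times> cbox a u) ((%(u, v). fuv u v) \<circ> prod.swap)"
     by (rule continuous_on_compose[OF continuous_on_swap continuous_on_subset[OF cuv]]) (use sub[OF u] in auto)
    thus ?thesis by (simp add: comp_def case_prod_beta')
   qed
   show "(%s. fu s v) integrable_on cbox a u" if "v \<in> cball b e" for v
    using int[OF that] by (auto simp: integrable_on_def)
   show "((%v. fu s v) has_vector_derivative fuv s v) (at v within cball b e)"
    if "v \<in> cball b e" "s \<in> cbox a u" for v s
   proof -
    have "s \<in> cball a e" using that(2) sub[OF u] by auto
    thus ?thesis by (rule has_vector_derivative_at_within[OF fuv[OF _ that(1)]])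
   qed
  qed (use e in auto)
  moreover have "at b within cball b e = at b" using e by (intro at_within_interior) auto
  ultimately have 1: "((%v. integral {a..u} (%s. fu s v)) has_vector_derivative integral {a..u} (%s. fuv s b)) (at b)" by simp
  have "((%v. f u v - f a v) has_vector_derivative integral {a..u} (%s. fuv s b)) (at b)"
   by (rule has_vector_derivative_transform_within_open[OF 1, of "ball b e"])
     (use e int in \<open>auto intro!: integral_unique\<close>)
  moreover have "((%v. f u v - f a v) has_vector_derivative fv u b - fv a b) (at b)"
   using e u sub[OF u] by (intro has_vector_derivative_diff fv) auto
  ultimately show ?thesis by (rule vector_derivative_unique_at[symmetric])
 qed
 have c: "continuous_on {a..a + e} (%s. fuv s b)"
 proof -
  have "continuous_on {a..a + e} ((%(u, v). fuv u v) \<circ> (%s. (s, b)))"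
   by (rule continuous_on_compose[OF _ continuous_on_subset[OF cuv]]) (use e in \<open>auto intro!: continuous_intros simp: dist_real_def\<close>)
  thus ?thesis by (simp add: comp_def)
 qed
 \<comment> \<open>The formula is available for u \<ge> a only, so the comparison uses one-sided
   derivatives, which are unique as well.\<close>
 have "((%u. integral {a..u} (%s. fuv s b)) has_vector_derivative fuv a b) (at a within {a..a + e})"
  by (rule integral_has_vector_derivative[OF c]) (use e in auto)
 moreover have "((%u. integral {a..u} (%s. fuv s b)) has_vector_derivative fvu a b) (at a within {a..a + e})"
 proof (rule has_vector_derivative_transform)
  show "((%u. fv u b - fv a b) has_vector_derivative fvu a b) (at a within {a..a + e})"
   using has_vector_derivative_at_within[OF has_vector_derivative_diff[OF fvu[of a b] has_vector_derivative_const]] e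
   by auto
 qed (use I e in auto)
 moreover have "at a within {a..a + e} ~= bot" using e by (simp add: trivial_limit_within islimpt_Icc)
 ultimately show ?thesis by (metis vector_derivative_unique_within)
qed

lemma partial_derivatives_commute:
 fixes g :: "(nat => real) => complex"
 assumes W: "open W" "x \<in> W" and ij: "i ~= j"
  and gi: "!!x. x \<in> W ==> ((%s. g (x(i := s))) has_vector_derivative gi x) (at (x i))"
  and gj: "!!x. x \<in> W ==> ((%s. g (x(j := s))) has_vector_derivative gj x) (at (x j))"
  and gij: "!!x. x \<in> W ==> ((%s. gi (x(j := s))) has_vector_derivative gij x) (at (x j))"
  and gji: "!!x. x \<in> W ==> ((%s. gj (x(i := s))) has_vector_derivative gji x) (at (x i))"
  and c: "continuous_on W gi" "continuous_on W gij"
 shows "gij x = gji x"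
proof -
 obtain e where e: "e > 0" "!!u v. u \<in> cball (x i) e ==> v \<in> cball (x j) e ==> x(i := u, j := v) \<in> W"
  using open_box[OF W ij] by blast
 let ?c = "%u v. x(i := u, j := v)"
 have tw: "(?c u v)(i := s) = ?c s v" "(?c u v)(j := s) = ?c u s" "?c u v i = u" "?c u v j = v" for u v s
  using ij by auto
 have cont: "continuous_on (cball (x i) e \<times> cball (x j) e) (%(u, v). h (?c u v))" if "continuous_on W h" for h :: "_ => complex"
 proof -
  have "continuous_on (cball (x i) e \<times> cball (x j) e) (h \<circ> (%(u, v). ?c u v))"
   by (rule continuous_on_compose[OF continuous_on_fun_upd2 continuous_on_subset[OF that]]) (use e in auto)
  thus ?thesis by (simp add: comp_def case_prod_beta')
 qed
 have "gij (?c (x i) (x j)) = gji (?c (x i) (x j))"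
 proof (rule mixed_partials_symmetric[where f = "%u v. g (?c u v)" and fu = "%u v. gi (?c u v)" and fv = "%u v. gj (?c u v)"
    and fuv = "%u v. gij (?c u v)" and fvu = "%u v. gji (?c u v)" and a = "x i" and b = "x j", OF e(1)])
  fix u v assume uv: "u \<in> cball (x i) e" "v \<in> cball (x j) e"
  note w = e(2)[OF uv]
  show "((%u. g (?c u v)) has_vector_derivative gi (?c u v)) (at u)" using gi[OF w] by (simp only: tw)
  show "((%v. g (?c u v)) has_vector_derivative gj (?c u v)) (at v)" using gj[OF w] by (simp only: tw)
  show "((%v. gi (?c u v)) has_vector_derivative gij (?c u v)) (at v)" using gij[OF w] by (simp only: tw)
  show "((%u. gj (?c u v)) has_vector_derivative gji (?c u v)) (at u)" using gji[OF w] by (simp only: tw)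
 qed (use cont c in auto)
 thus ?thesis by simp
qed

lemma Ck_on_2_partials:
 assumes "Ck_on (Suc (Suc 0)) p W g"
 obtains g1 g2 where
  "!!i x. i \<le> p ==> x \<in> W ==> ((%s. g (x(i := s))) has_vector_derivative g1 i x) (at (x i))"
  "!!i. i \<le> p ==> continuous_on W (g1 i)"
  "!!i j x. i \<le> p ==> j \<le> p ==> x \<in> W ==> ((%s. g1 i (x(j := s))) has_vector_derivative g2 i j x) (at (x j))"
  "!!i j. i \<le> p ==> j \<le> p ==> continuous_on W (g2 i j)"
proof -
 have "\<forall>i\<le>p. \<exists>g'. (\<forall>x\<in>W. ((%s. g (x(i := s))) has_vector_derivative g' x) (at (x i))) \<and> Ck_on (Suc 0) p W g'"
  using assms by simp
 then obtain g1 where g1: "!!i x. i \<le> p ==> x \<in> W ==> ((%s. g (x(i := s))) has_vector_derivative g1 i x) (at (x i))"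
  "!!i. i \<le> p ==> Ck_on (Suc 0) p W (g1 i)" by metis
 have "\<forall>i\<le>p. \<forall>j\<le>p. \<exists>g'. (\<forall>x\<in>W. ((%s. g1 i (x(j := s))) has_vector_derivative g' x) (at (x j))) \<and> continuous_on W g'"
  using g1(2) by simp
 then obtain g2 where "!!i j x. i \<le> p ==> j \<le> p ==> x \<in> W ==> ((%s. g1 i (x(j := s))) has_vector_derivative g2 i j x) (at (x j))"
  "!!i j. i \<le> p ==> j \<le> p ==> continuous_on W (g2 i j)" by metis
 thus thesis using g1(2) by (intro that[of g1 g2] g1(1)) auto
qed

lemma bary_upd:
 assumes "b < p"
 shows "bary p (y(b := s)) = (bary p y)(Suc b := bary p y (Suc b) + (s - y b), 0 := bary p y 0 - (s - y b))"
proof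
 fix i
 have "(\<Sum>c<p. y c) = y b + (\<Sum>c\<in>{..<p} - {b}. y c)" using assms by (intro sum.remove) auto
 thus "bary p (y(b := s)) i = ((bary p y)(Suc b := bary p y (Suc b) + (s - y b), 0 := bary p y 0 - (s - y b))) i"
  unfolding bary_def sum_fun_upd_lessThan[OF assms] using assms by auto
qed

text \<open>On a face, too, exactly two ambient coordinates move oppositely. They are the images of
  c+1 and of 0 under the enumeration of the vertices that skips \<open>f\<close>.\<close>

lemma face_bary_upd:
 assumes "c < q"
 shows "sface f (bary q (y(c := s))) = (sface f (bary q y))
   ((if Suc c < f then Suc c else Suc (Suc c)) := sface f (bary q y) (if Suc c < f then Suc c else Suc (Suc c)) + (s - y c),
   (if f = 0 then 1 else 0) := sface f (bary q y) (if f = 0 then 1 else 0) - (s - y c))"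
 unfolding bary_upd[OF assms] by (rule ext) (auto simp: simplical_face_def)

lemma open_line_bary_dom:
 assumes "b < p" "y \<in> bary_dom p"
 shows "open {s. y(b := s) \<in> bary_dom p}" "y b \<in> {s. y(b := s) \<in> bary_dom p}"
proof -
 have "{s. y(b := s) \<in> bary_dom p} = (if \<forall>c\<in>{..<p} - {b}. 0 < y c then {0<..<1 - (\<Sum>c\<in>{..<p} - {b}. y c)} else {})"
  unfolding bary_dom_upd[OF assms(1)] by auto
 thus "open {s. y(b := s) \<in> bary_dom p}" by simp
 show "y b \<in> {s. y(b := s) \<in> bary_dom p}" using assms(2) by simp
qed

text \<open>What Stokes' theorem takes from a smooth simplex: \<open>D b\<close> and
  \<open>DD b c\<close> are first and second derivatives in the directions e_{b+1} - e_0 and extend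
  continuously to the closed simplex. The derivatives of the restrictions to faces are a separate
  clause, since the interior says nothing about derivatives on the boundary.\<close>

definition simplex_derivs ::
  "nat => ((nat => real) => complex) => (nat => (nat => real) => complex) => (nat => nat => (nat => real) => complex) => bool" where
 "simplex_derivs p g D DD \<longleftrightarrow>
   continuous_on (std p) g \<and>
   (\<forall>b<p. continuous_on (std p) (D b)) \<and>
   (\<forall>b<p. \<forall>c<p. continuous_on (std p) (DD b c)) \<and>
   (\<forall>b<p. \<forall>y\<in>bary_dom p. ((%s. g (bary p (y(b := s)))) has_vector_derivative D b (bary p y)) (at (y b))) \<and>
   (\<forall>b<p. \<forall>c<p. \<forall>y\<in>bary_dom p. ((%s. D b (bary p (y(c := s)))) has_vector_derivative DD b c (bary p y)) (at (y c))) \<and>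
   (\<forall>b<p. \<forall>c<p. \<forall>y\<in>bary_dom p. DD b c (bary p y) = DD c b (bary p y)) \<and>
   (\<forall>f\<le>p. \<forall>c<p - 1. \<forall>y\<in>bary_dom (p - 1). 
    ((%s. g (sface f (bary (p - 1) (y(c := s))))) has_vector_derivative
     face_deriv f (%_. D) 0 c (sface f (bary (p - 1) y))) (at (y c)))"

text \<open>The derivatives are differences of partial derivatives of the extension \<open>g\<close>
  to an open set. The function \<open>h\<close> agrees with \<open>g\<close> only on the simplex,
  but small pieces of the lines in question stay inside it or inside a face.\<close>

lemma Ck_on_simplex_derivs:
 assumes W: "open W" "std p \<subseteq> W" and g: "Ck_on (Suc (Suc 0)) p W g"
  and h: "!!x. x \<in> std p ==> h x = g x"
 shows "\<exists>D DD. simplex_derivs p h D DD"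
proof -
 obtain g1 g2 where
  g1: "!!i x. i \<le> p ==> x \<in> W ==> ((%s. g (x(i := s))) has_vector_derivative g1 i x) (at (x i))"
  and c1: "!!i. i \<le> p ==> continuous_on W (g1 i)"
  and g2: "!!i j x. i \<le> p ==> j \<le> p ==> x \<in> W ==> ((%s. g1 i (x(j := s))) has_vector_derivative g2 i j x) (at (x j))"
  and c2: "!!i j. i \<le> p ==> j \<le> p ==> continuous_on W (g2 i j)"
  using Ck_on_2_partials[OF g] by blast
 have sym: "g2 i j x = g2 j i x" if "i \<le> p" "j \<le> p" "x \<in> W" for i j x
 proof (cases "i = j")
  case False
  show ?thesis by (rule partial_derivatives_commute[OF W(1) that(3) False g1[OF that(1)] g1[OF that(2)] g2[OF that(1,2)] g2[OF that(2,1)] c1[OF that(1)] c2[OF that(1,2)]])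
 qed simp
 define D where "D b x = g1 (Suc b) x - g1 0 x" for b x
 define DD where "DD b c x = (g2 (Suc b) (Suc c) x - g2 (Suc b) 0 x) - (g2 0 (Suc c) x - g2 0 0 x)" for b c x
 have inW: "bary p y \<in> W" if "y \<in> bary_dom p" for y
  using bary_dom_in_std[OF that] W by auto
 have two: "((%s. G (x(i := x i + (s - a), j := x j - (s - a)))) has_vector_derivative (G' i x - G' j x)) (at a)"
  if "i \<le> p" "j \<le> p" "i ~= j" "x \<in> W"
   "!!i x. i \<le> p ==> x \<in> W ==> ((%s. G (x(i := s))) has_vector_derivative G' i x) (at (x i))"
   "!!i. i \<le> p ==> continuous_on W (G' i)" for i j x a and G :: "(nat => real) => complex" and G'
  by (rule has_vector_derivative_two_coords[OF W(1) that(4,3) that(5)[OF that(1)] that(5)[OF that(2)] that(6)[OF that(2)]])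
 have cont: "continuous_on W g" using g by simp
 have dD: "((%s. D b (bary p (y(c := s)))) has_vector_derivative DD b c (bary p y)) (at (y c))"
  if "b < p" "c < p" "y \<in> bary_dom p" for b c y
 proof -
  have "((%s. g1 k ((bary p y)(Suc c := bary p y (Suc c) + (s - y c), 0 := bary p y 0 - (s - y c))))
    has_vector_derivative (g2 k (Suc c) (bary p y) - g2 k 0 (bary p y))) (at (y c))" if "k \<le> p" for k
  proof (rule two)
   fix i x assume "i \<le> p" "x \<in> W"
   with that show "((%s. g1 k (x(i := s))) has_vector_derivative g2 k i x) (at (x i))" by (intro g2)
  qed (use \<open>c < p\<close> \<open>y \<in> bary_dom p\<close> inW c2 that in auto)
  thus ?thesis unfolding D_def DD_def bary_upd[OF that(2)]
   using that(1) by (intro has_vector_derivative_diff) auto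
 qed
 have dg: "((%s. h (bary p (y(b := s)))) has_vector_derivative D b (bary p y)) (at (y b))"
  if b: "b < p" and y: "y \<in> bary_dom p" for b y
 proof (rule has_vector_derivative_transform_within_open[OF _ open_line_bary_dom[OF b y]])
  show "((%s. g (bary p (y(b := s)))) has_vector_derivative D b (bary p y)) (at (y b))"
   unfolding D_def bary_upd[OF b]
   by (rule two[where G = g and i = "Suc b" and j = 0 and x = "bary p y" and a = "y b"]) (use b y inW g1 c1 in auto)
 qed (use h bary_dom_in_std in auto)
 have df: "((%s. h (sface f (bary (p - 1) (y(c := s))))) has_vector_derivative
     face_deriv f (%_. D) 0 c (sface f (bary (p - 1) y))) (at (y c))"
  if f: "f \<le> p" and c: "c < p - 1" and y: "y \<in> bary_dom (p - 1)" for f c y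
 proof (rule has_vector_derivative_transform_within_open[OF _ open_line_bary_dom[OF c y]])
  have x: "sface f (bary (p - 1) y) \<in> std p" if "y \<in> bary_dom (p - 1)" for y
   using simplical_face_in_standard_simplex[of p f] bary_dom_in_std[OF that] f c by simp
  let ?i = "if Suc c < f then Suc c else Suc (Suc c)" and ?j = "if f = 0 then 1 else (0::nat)"
  have "((%s. g (sface f (bary (p - 1) (y(c := s))))) has_vector_derivative
     g1 ?i (sface f (bary (p - 1) y)) - g1 ?j (sface f (bary (p - 1) y))) (at (y c))"
   unfolding face_bary_upd[OF c]
   by (rule two[where G = g and i = ?i and j = ?j and x = "sface f (bary (p - 1) y)" and a = "y c"])
    (use c f x[OF y] W(2) g1 c1 in auto)
  moreover have "g1 ?i X - g1 ?j X = face_deriv f (%_. D) 0 c X" for X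
   using c f by (auto simp: face_deriv_def D_def)
  ultimately show "((%s. g (sface f (bary (p - 1) (y(c := s))))) has_vector_derivative
     face_deriv f (%_. D) 0 c (sface f (bary (p - 1) y))) (at (y c))" by simp
  fix s assume "s \<in> {s. y(c := s) \<in> bary_dom (p - 1)}"
  thus "g (sface f (bary (p - 1) (y(c := s)))) = h (sface f (bary (p - 1) (y(c := s))))"
   using h x by simp
 qed
 have ch: "continuous_on (std p) h"
  using continuous_on_subset[OF cont W(2)] h by (simp cong: continuous_on_cong)
 have cD: "continuous_on (std p) (D b)" if "b < p" for b
  unfolding D_def[abs_def] using that by (intro continuous_on_diff continuous_on_subset[OF c1 W(2)]) auto
 have cDD: "continuous_on (std p) (DD b c)" if "b < p" "c < p" for b c
  unfolding DD_def[abs_def] using that by (intro continuous_on_diff continuous_on_subset[OF c2 W(2)]) auto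
 have symD: "DD b c (bary p y) = DD c b (bary p y)" if "b < p" "c < p" "y \<in> bary_dom p" for b c y
  unfolding DD_def using that sym[of _ _ "bary p y"] inW by simp
 have "simplex_derivs p h D DD" unfolding simplex_derivs_def
  by (intro conjI allI impI ballI ch cD cDD symD dD dg df)
 thus ?thesis by blast
qed

lemma smooth_simplex_derivs:
 assumes "smooth_simplex p \<sigma>"
 shows "\<exists>D DD. \<forall>k. simplex_derivs p (%x. \<sigma> x k) (D k) (DD k)"
proof -
 have "\<exists>D DD. simplex_derivs p (%x. \<sigma> x k) D DD" for k
  using assms unfolding smooth_simplex_def by (metis Ck_on_simplex_derivs)
 thus ?thesis by metis
qed

section \<open>Branches of the master function\<close>

lemma flat_sectionE:
 assumes "flat_section A S P \<phi>"
 obtains C Lzz Ltz Ltt where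
  "!!i j. j < npts A ==> i < j ==> continuous_on S (Lzz i j)"
  "!!i j s. j < npts A ==> i < j ==> s \<in> S ==> exp (Lzz i j s) = zz i j (P s)"
  "!!k j. k < nvars A ==> j < npts A ==> continuous_on S (Ltz k j)"
  "!!k j s. k < nvars A ==> j < npts A ==> s \<in> S ==> exp (Ltz k j s) = tz k j (P s)"
  "!!k l. l < nvars A ==> k < l ==> continuous_on S (Ltt k l)"
  "!!k l s. l < nvars A ==> k < l ==> s \<in> S ==> exp (Ltt k l s) = tt k l (P s)"
  "!!s. s \<in> S ==> \<phi> s = C * exp (1 / kap A * ((\<Sum>k<nvars A. coef_t A k * fst (P s) k) + (\<Sum>j<npts A. coef_z A j * snd (P s) j) +
       (\<Sum>j<npts A. \<Sum>i<j. exp_zz A i j * Lzz i j s) +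
       (\<Sum>k<nvars A. \<Sum>j<npts A. exp_tz A k j * Ltz k j s) +
       (\<Sum>l<nvars A. \<Sum>k<l. exp_tt A k l * Ltt k l s)))"
proof -
 obtain C Lzz Ltz Ltt where
  L: "\<forall>j<npts A. \<forall>i<j. continuous_on S (Lzz i j) \<and> (\<forall>s\<in>S. exp (Lzz i j s) = zz i j (P s))"
   "\<forall>k<nvars A. \<forall>j<npts A. continuous_on S (Ltz k j) \<and> (\<forall>s\<in>S. exp (Ltz k j s) = tz k j (P s))"
   "\<forall>l<nvars A. \<forall>k<l. continuous_on S (Ltt k l) \<and> (\<forall>s\<in>S. exp (Ltt k l s) = tt k l (P s))"
   "\<forall>s\<in>S. \<phi> s = C * exp (1 / kap A * ((\<Sum>k<nvars A. coef_t A k * fst (P s) k) + (\<Sum>j<npts A. coef_z A j * snd (P s) j) +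
       (\<Sum>j<npts A. \<Sum>i<j. exp_zz A i j * Lzz i j s) +
       (\<Sum>k<nvars A. \<Sum>j<npts A. exp_tz A k j * Ltz k j s) +
       (\<Sum>l<nvars A. \<Sum>k<l. exp_tt A k l * Ltt k l s)))"
  using assms unfolding flat_section_def
  by (elim exE conjE) (rule that; assumption)
 show thesis
 proof (rule that[of Lzz Ltz Ltt C])
  fix s assume "s \<in> S"
  with L(4) show "\<phi> s = C * exp (1 / kap A * ((\<Sum>k<nvars A. coef_t A k * fst (P s) k) + (\<Sum>j<npts A. coef_z A j * snd (P s) j) +
       (\<Sum>j<npts A. \<Sum>i<j. exp_zz A i j * Lzz i j s) +
       (\<Sum>k<nvars A. \<Sum>j<npts A. exp_tz A k j * Ltz k j s) +
       (\<Sum>l<nvars A. \<Sum>k<l. exp_tt A k l * Ltt k l s)))" by (rule bspec)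
 qed (use L(1-3) in \<open>simp_all\<close>)
qed

lemma flat_section_compose:
 assumes "flat_section A S P \<phi>" "continuous_on T h" "h ` T \<subseteq> S"
 shows "flat_section A T (%s. P (h s)) (%s. \<phi> (h s))"
proof -
 obtain C Lzz Ltz Ltt where L:
  "!!i j. j < npts A ==> i < j ==> continuous_on S (Lzz i j)"
  "!!i j s. j < npts A ==> i < j ==> s \<in> S ==> exp (Lzz i j s) = zz i j (P s)"
  "!!k j. k < nvars A ==> j < npts A ==> continuous_on S (Ltz k j)"
  "!!k j s. k < nvars A ==> j < npts A ==> s \<in> S ==> exp (Ltz k j s) = tz k j (P s)"
  "!!k l. l < nvars A ==> k < l ==> continuous_on S (Ltt k l)"
  "!!k l s. l < nvars A ==> k < l ==> s \<in> S ==> exp (Ltt k l s) = tt k l (P s)"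
  "!!s. s \<in> S ==> \<phi> s = C * exp (1 / kap A * ((\<Sum>k<nvars A. coef_t A k * fst (P s) k) + (\<Sum>j<npts A. coef_z A j * snd (P s) j) +
       (\<Sum>j<npts A. \<Sum>i<j. exp_zz A i j * Lzz i j s) +
       (\<Sum>k<nvars A. \<Sum>j<npts A. exp_tz A k j * Ltz k j s) +
       (\<Sum>l<nvars A. \<Sum>k<l. exp_tt A k l * Ltt k l s)))"
  by (rule flat_sectionE[OF assms(1)]) blast
 have c: "continuous_on T (%s. M (h s))" if "continuous_on S M" for M :: "_ => complex"
  by (rule continuous_on_compose2[OF that assms(2,3)])
 have hS: "h s \<in> S" if "s \<in> T" for s using assms(3) that by auto
 show ?thesis unfolding flat_section_def
  by (rule exI[of _ C], rule exI[of _ "%i j s. Lzz i j (h s)"], rule exI[of _ "%i j s. Ltz i j (h s)"],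
    rule exI[of _ "%i j s. Ltt i j (h s)"], intro conjI allI impI ballI c L hS)
qed

lemma continuous_on_flat_section:
 assumes "flat_section A S P \<phi>" "!!k. k < nvars A ==> continuous_on S (%s. fst (P s) k)"
  "!!j. j < npts A ==> continuous_on S (%s. snd (P s) j)"
 shows "continuous_on S \<phi>"
proof -
 obtain C Lzz Ltz Ltt where L:
  "!!i j. j < npts A ==> i < j ==> continuous_on S (Lzz i j)"
  "!!k j. k < nvars A ==> j < npts A ==> continuous_on S (Ltz k j)"
  "!!k l. l < nvars A ==> k < l ==> continuous_on S (Ltt k l)"
  and phi: "!!s. s \<in> S ==> \<phi> s = C * exp (1 / kap A * ((\<Sum>k<nvars A. coef_t A k * fst (P s) k) + (\<Sum>j<npts A. coef_z A j * snd (P s) j) +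
       (\<Sum>j<npts A. \<Sum>i<j. exp_zz A i j * Lzz i j s) +
       (\<Sum>k<nvars A. \<Sum>j<npts A. exp_tz A k j * Ltz k j s) +
       (\<Sum>l<nvars A. \<Sum>k<l. exp_tt A k l * Ltt k l s)))"
  by (rule flat_sectionE[OF assms(1)]) blast
 have "continuous_on S (%s. C * exp (1 / kap A * ((\<Sum>k<nvars A. coef_t A k * fst (P s) k) + (\<Sum>j<npts A. coef_z A j * snd (P s) j) +
       (\<Sum>j<npts A. \<Sum>i<j. exp_zz A i j * Lzz i j s) +
       (\<Sum>k<nvars A. \<Sum>j<npts A. exp_tz A k j * Ltz k j s) +
       (\<Sum>l<nvars A. \<Sum>k<l. exp_tt A k l * Ltt k l s))))"
  by (intro continuous_intros assms(2,3) L) auto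
 thus ?thesis by (subst continuous_on_cong[OF refl phi])
qed

text \<open>By continuity \<open>L s - L x\<close> has imaginary part of modulus less than \<pi> for
  \<open>s\<close> near \<open>x\<close>. There \<open>L\<close> equals
  \<open>L x + Ln (g s / g x)\<close>, with the principal branch used near 1.\<close>

lemma continuous_log_has_derivative:
 fixes L g :: "'p::real_normed_vector => complex"
 assumes T: "open T" "x \<in> T" and L: "continuous_on T L" and e: "!!s. s \<in> T ==> exp (L s) = g s"
  and g: "(g has_derivative g') (at x)"
 shows "(L has_derivative (%h. g' h / g x)) (at x)"
proof -
 have nz: "g x ~= 0" using e[OF T(2)] by (metis exp_not_eq_zero)
 have "((%s. L s - L x) \<longlongrightarrow> L x - L x) (at x)"
  using L T by (intro tendsto_intros) (auto simp: continuous_on_eq_continuous_at isCont_def)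
 hence ev: "\<forall>\<^sub>F s in at x. norm (L s - L x) < pi"
  using pi_gt_zero by (auto dest: tendstoD[where e = pi] simp: dist_norm)
 have ev2: "\<forall>\<^sub>F s in at x. s \<in> T" using T by (rule eventually_at_in_open')
 have eq: "\<forall>\<^sub>F s in at x. L x + Ln (g s / g x) = L s"
  using ev ev2
 proof eventually_elim
  case (elim s)
  have "g s / g x = exp (L s - L x)" using e[OF elim(2)] e[OF T(2)] by (simp add: exp_diff)
  moreover have "\<bar>Im (L s - L x)\<bar> < pi" using elim(1) abs_Im_le_cmod[of "L s - L x"] by linarith
  ultimately show ?case by (simp add: Ln_exp)
 qed
 have d1: "((%s. g s / g x) has_derivative (%h. g' h / g x)) (at x)"
  unfolding divide_inverse by (rule has_derivative_mult_left[OF g])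
 have "(Ln has_field_derivative inverse 1) (at 1)" by (rule has_field_derivative_Ln) auto
 hence "(Ln has_derivative (*) 1) (at (g x / g x))" using nz by (simp add: has_field_derivative_def)
 from has_derivative_compose[OF d1 this]
 have "((%s. L x + Ln (g s / g x)) has_derivative (%h. 0 + g' h / g x)) (at x)"
  by (intro has_derivative_add has_derivative_const) simp
 hence "((%s. L x + Ln (g s / g x)) has_derivative (%h. g' h / g x)) (at x)" by simp
 thus ?thesis
  by (rule has_derivative_transform_eventually) (use eq nz in auto)
qed

text \<open>All linear functions that occur in \<Phi>. The differences of the points
  \<open>z\<close> are included although they are constant on the fibres: they enter
  \<open>dlog_Phi\<close> through the derivatives in \<open>z\<close>.\<close>

definition lforms :: "master => (point => complex) set" where
 "lforms A = {tz k j | k j. k < nvars A \<and> j < npts A} \<union>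
   {tt k l | k l. k < nvars A \<and> l < nvars A \<and> k ~= l} \<union>
   {zz i j | i j. i < npts A \<and> j < npts A \<and> i ~= j}"

lemma lforms_memI:
 "k < nvars A ==> j < npts A ==> tz k j \<in> lforms A"
 "k < nvars A ==> l < nvars A ==> k ~= l ==> tt k l \<in> lforms A"
 "i < npts A ==> j < npts A ==> i ~= j ==> zz i j \<in> lforms A"
 unfolding lforms_def by blast+

lemma lforms_nonzero:
 assumes "f \<in> lforms A" "z \<in> base A" "t \<in> fibre A z"
 shows "f (t, z) ~= 0"
 using assms unfolding lforms_def fibre_def base_def
 by (auto simp: tz_def tt_def zz_def inj_on_def)

lemma lforms_has_derivative:
 assumes "f \<in> lforms A"
  and "!!k. k < nvars A ==> ((%s. fst (P s) k) has_derivative (%h. fst (P' h) k)) (at x)"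
  and "!!j. j < npts A ==> ((%s. snd (P s) j) has_derivative (%h. snd (P' h) j)) (at x)"
 shows "((%s. f (P s)) has_derivative (%h. f (P' h))) (at x)"
 using assms(1) unfolding lforms_def
 by (auto simp: tz_def tt_def zz_def case_prod_beta intro!: has_derivative_diff assms(2,3))

lemma continuous_on_lforms:
 assumes "f \<in> lforms A"
  and "!!k. k < nvars A ==> continuous_on S (%s. fst (P s) k)"
  and "!!j. j < npts A ==> continuous_on S (%s. snd (P s) j)"
 shows "continuous_on S (%s. f (P s))"
 using assms(1) unfolding lforms_def
 by (auto simp: tz_def tt_def zz_def case_prod_beta intro!: continuous_on_diff assms(2,3))

text \<open>A section is a constant times the exponential of a combination of continuous logarithms,
  and these are differentiable with derivative \<open>dlog\<close>. The map \<open>P\<close> is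
  arbitrary, so that the same statement covers motion inside a simplex and variation of
  \<open>z\<close>.\<close>

lemma flat_section_has_derivative:
 fixes P :: "'p::real_normed_vector => point"
 assumes fl: "flat_section A T P \<phi>" and T: "open T" "x \<in> T"
  and dt: "!!k. k < nvars A ==> ((%s. fst (P s) k) has_derivative (%h. fst (P' h) k)) (at x)"
  and dz: "!!j. j < npts A ==> ((%s. snd (P s) j) has_derivative (%h. snd (P' h) j)) (at x)"
 shows "(\<phi> has_derivative (%h. \<phi> x * (1 / kap A * dlog_Phi A (P x) (P' h)))) (at x)"
proof -
 obtain C Lzz Ltz Ltt where L:
  "!!i j. j < npts A ==> i < j ==> continuous_on T (Lzz i j)"
  "!!i j s. j < npts A ==> i < j ==> s \<in> T ==> exp (Lzz i j s) = zz i j (P s)"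
  "!!k j. k < nvars A ==> j < npts A ==> continuous_on T (Ltz k j)"
  "!!k j s. k < nvars A ==> j < npts A ==> s \<in> T ==> exp (Ltz k j s) = tz k j (P s)"
  "!!k l. l < nvars A ==> k < l ==> continuous_on T (Ltt k l)"
  "!!k l s. l < nvars A ==> k < l ==> s \<in> T ==> exp (Ltt k l s) = tt k l (P s)"
  and phi: "!!s. s \<in> T ==> \<phi> s = C * exp (1 / kap A * ((\<Sum>k<nvars A. coef_t A k * fst (P s) k) + (\<Sum>j<npts A. coef_z A j * snd (P s) j) +
       (\<Sum>j<npts A. \<Sum>i<j. exp_zz A i j * Lzz i j s) +
       (\<Sum>k<nvars A. \<Sum>j<npts A. exp_tz A k j * Ltz k j s) +
       (\<Sum>l<nvars A. \<Sum>k<l. exp_tt A k l * Ltt k l s)))"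
  by (rule flat_sectionE[OF fl]) blast
 have dL: "(M has_derivative (%h. dlog f (P x) (P' h))) (at x)"
  if "f \<in> lforms A" "continuous_on T M" "!!s. s \<in> T ==> exp (M s) = f (P s)" for f M
  unfolding dlog_def
  by (rule continuous_log_has_derivative[OF T that(2,3) lforms_has_derivative[OF that(1)]])
   (assumption, rule dt, assumption, rule dz, assumption)
 let ?E = "%s. (\<Sum>k<nvars A. coef_t A k * fst (P s) k) + (\<Sum>j<npts A. coef_z A j * snd (P s) j) +
       (\<Sum>j<npts A. \<Sum>i<j. exp_zz A i j * Lzz i j s) +
       (\<Sum>k<nvars A. \<Sum>j<npts A. exp_tz A k j * Ltz k j s) +
       (\<Sum>l<nvars A. \<Sum>k<l. exp_tt A k l * Ltt k l s)"
 have d1: "(?E has_derivative (%h. dlog_Phi A (P x) (P' h))) (at x)"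
 proof -
  have 1: "((%s. \<Sum>k<nvars A. coef_t A k * fst (P s) k) has_derivative (%h. \<Sum>k<nvars A. coef_t A k * fst (P' h) k)) (at x)"
   by (rule has_derivative_sum, rule has_derivative_mult_right, rule dt) simp
  have 2: "((%s. \<Sum>j<npts A. coef_z A j * snd (P s) j) has_derivative (%h. \<Sum>j<npts A. coef_z A j * snd (P' h) j)) (at x)"
   by (rule has_derivative_sum, rule has_derivative_mult_right, rule dz) simp
  have 3: "((%s. \<Sum>j<npts A. \<Sum>i<j. exp_zz A i j * Lzz i j s) has_derivative
    (%h. \<Sum>j<npts A. \<Sum>i<j. exp_zz A i j * dlog (zz i j) (P x) (P' h))) (at x)"
   by (rule has_derivative_sum, rule has_derivative_sum, rule has_derivative_mult_right, rule dL)
    (auto intro!: lforms_memI L)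
  have 4: "((%s. \<Sum>k<nvars A. \<Sum>j<npts A. exp_tz A k j * Ltz k j s) has_derivative
    (%h. \<Sum>k<nvars A. \<Sum>j<npts A. exp_tz A k j * dlog (tz k j) (P x) (P' h))) (at x)"
   by (rule has_derivative_sum, rule has_derivative_sum, rule has_derivative_mult_right, rule dL)
    (auto intro!: lforms_memI L)
  have 5: "((%s. \<Sum>l<nvars A. \<Sum>k<l. exp_tt A k l * Ltt k l s) has_derivative
    (%h. \<Sum>l<nvars A. \<Sum>k<l. exp_tt A k l * dlog (tt k l) (P x) (P' h))) (at x)"
   by (rule has_derivative_sum, rule has_derivative_sum, rule has_derivative_mult_right, rule dL)
    (auto intro!: lforms_memI L)
  show ?thesis unfolding dlog_Phi_def
   by (rule has_derivative_add[OF has_derivative_add[OF has_derivative_add[OF has_derivative_add[OF 1 2] 3] 4] 5])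
 qed
 have "((%s. C * exp (1 / kap A * ?E s)) has_derivative
   (%h. C * ((1 / kap A * dlog_Phi A (P x) (P' h)) * exp (1 / kap A * ?E x)))) (at x)"
 proof -
  have dE: "(exp has_derivative (%y. y * exp e)) (at e)" for e :: complex
   using DERIV_exp[of e] by (simp add: has_field_derivative_def mult_commute_abs)
  show ?thesis
   by (rule has_derivative_mult_right[OF has_derivative_compose[OF has_derivative_mult_right[OF d1] dE]])
 qed
 hence "((%s. C * exp (1 / kap A * ?E s)) has_derivative
   (%h. \<phi> x * (1 / kap A * dlog_Phi A (P x) (P' h)))) (at x)"
  unfolding phi[OF T(2)] by (simp only: mult_ac)
 thus ?thesis
  by (rule has_derivative_transform_within_open[OF _ T]) (rule phi[symmetric])
qed

text \<open>The scalar factor of a wedge of \<open>dlog\<close>s once the numerators have been split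
  off as a constant form. Its logarithmic differential is the negative of
  \<open>dlog_sum\<close>.\<close>

definition lmono :: "(point => complex) list => point => complex" where
 "lmono L p = (\<Prod>f\<leftarrow>L. 1 / f p)"

definition dlog_sum :: "(point => complex) list => one_form" where
 "dlog_sum L p v = (\<Sum>f\<leftarrow>L. dlog f p v)"

lemma lmono_simps [simp]: "lmono [] p = 1" "lmono (f # L) p = 1 / f p * lmono L p"
 and lmono_append: "lmono (L @ L') p = lmono L p * lmono L' p"
 by (simp_all add: lmono_def)

lemma continuous_on_lmono:
 assumes "set L \<subseteq> lforms A"
  and "!!k. k < nvars A ==> continuous_on S (%s. fst (P s) k)"
  and "!!j. j < npts A ==> continuous_on S (%s. snd (P s) j)"
  and "!!s f. s \<in> S ==> f \<in> lforms A ==> f (P s) ~= 0"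
 shows "continuous_on S (%s. lmono L (P s))"
 using assms(1)
proof (induction L)
 case (Cons f L)
 have f: "f \<in> lforms A" using Cons.prems by simp
 have "continuous_on S (%s. f (P s))" by (rule continuous_on_lforms[OF f]) (rule assms(2,3), assumption)+
 thus ?case using Cons f assms(4) by (auto intro!: continuous_on_mult continuous_on_divide continuous_on_const)
qed simp

lemma lmono_has_derivative:
 assumes "set L \<subseteq> lforms A"
  and "!!k. k < nvars A ==> ((%s. fst (P s) k) has_derivative (%h. fst (P' h) k)) (at x)"
  and "!!j. j < npts A ==> ((%s. snd (P s) j) has_derivative (%h. snd (P' h) j)) (at x)"
  and "!!f. f \<in> lforms A ==> f (P x) ~= 0"
 shows "((%s. lmono L (P s)) has_derivative (%h. - (lmono L (P x) * dlog_sum L (P x) (P' h)))) (at x)"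
 using assms(1)
proof (induction L)
 case Nil thus ?case by (simp add: dlog_sum_def)
next
 case (Cons f L)
 have fA: "f \<in> lforms A" using Cons.prems by simp
 have nz: "f (P x) ~= 0" by (rule assms(4)[OF fA])
 have f: "((%s. f (P s)) has_derivative (%h. f (P' h))) (at x)"
  by (rule lforms_has_derivative[OF fA]) (rule assms(2,3), assumption)+
 have IH: "((%s. lmono L (P s)) has_derivative (%h. - (lmono L (P x) * dlog_sum L (P x) (P' h)))) (at x)"
  using Cons by simp
 have "((%s. inverse (f (P s)) * lmono L (P s)) has_derivative
  (%h. inverse (f (P x)) * - (lmono L (P x) * dlog_sum L (P x) (P' h)) +
     - (inverse (f (P x)) * f (P' h) * inverse (f (P x))) * lmono L (P x))) (at x)"
  by (rule has_derivative_mult[OF Deriv.has_derivative_inverse[OF nz f] IH])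
 also have "(%h. inverse (f (P x)) * - (lmono L (P x) * dlog_sum L (P x) (P' h)) +
     - (inverse (f (P x)) * f (P' h) * inverse (f (P x))) * lmono L (P x))
  = (%h. - (lmono (f # L) (P x) * dlog_sum (f # L) (P x) (P' h)))"
  using nz by (intro ext) (simp add: dlog_sum_def dlog_def field_simps)
 finally show ?case by (simp add: divide_inverse)
qed

lemma flat_mono_has_derivative:
 fixes P :: "'p::real_normed_vector => point"
 assumes fl: "flat_section A T P \<phi>" and T: "open T" "x \<in> T" and L: "set L \<subseteq> lforms A"
  and dt: "!!k. k < nvars A ==> ((%s. fst (P s) k) has_derivative (%h. fst (P' h) k)) (at x)"
  and dz: "!!j. j < npts A ==> ((%s. snd (P s) j) has_derivative (%h. snd (P' h) j)) (at x)"
  and nz: "!!f. f \<in> lforms A ==> f (P x) ~= 0"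
 shows "((%s. \<phi> s * lmono L (P s)) has_derivative
  (%h. \<phi> x * lmono L (P x) * (1 / kap A * dlog_Phi A (P x) (P' h) - dlog_sum L (P x) (P' h)))) (at x)"
proof -
 have "((%s. \<phi> s * lmono L (P s)) has_derivative
  (%h. \<phi> x * - (lmono L (P x) * dlog_sum L (P x) (P' h)) + \<phi> x * (1 / kap A * dlog_Phi A (P x) (P' h)) * lmono L (P x))) (at x)"
 proof (rule has_derivative_mult)
  show "(\<phi> has_derivative (%h. \<phi> x * (1 / kap A * dlog_Phi A (P x) (P' h)))) (at x)"
   by (rule flat_section_has_derivative[OF fl T]) (rule dt dz, assumption)+
  show "((%s. lmono L (P s)) has_derivative (%h. - (lmono L (P x) * dlog_sum L (P x) (P' h)))) (at x)"
   by (rule lmono_has_derivative[OF L]) (rule dt dz nz, assumption)+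
 qed
 thus ?thesis by (simp add: algebra_simps)
qed

text \<open>The logarithmic derivative of \<open>\<Phi>\<^bsup>1/\<kappa>\<^esup> \<cdot> lmono L\<close>.\<close>

definition theta :: "master => (point => complex) list => one_form" where
 "theta A L p v = 1 / kap A * dlog_Phi A p v - dlog_sum L p v"

definition unit_t :: "nat => point" where
 "unit_t k = ((%l. if l = k then 1 else 0), (%_. 0))"

definition unit_z :: "nat => point" where
 "unit_z i = ((%_. 0), (%j. if j = i then 1 else 0))"

text \<open>Linearity on vertical tangent vectors, in the form in which it is applied: expansion
  along the \<open>m\<close> coordinate directions. Further entries of \<open>u\<close> do not
  influence the value.\<close>

definition tlinear :: "nat => (point => complex) => bool" where
 "tlinear m f \<longleftrightarrow> (\<forall>u. f (u, %_. 0) = (\<Sum>k<m. u k * f (unit_t k)))"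

lemma tlinear_add: "tlinear m f ==> tlinear m g ==> tlinear m (%v. f v + g v)"
 and tlinear_diff: "tlinear m f ==> tlinear m g ==> tlinear m (%v. f v - g v)"
 and tlinear_cmult: "tlinear m f ==> tlinear m (%v. c * f v)"
 and tlinear_div: "tlinear m f ==> tlinear m (%v. f v / c)"
 by (simp_all add: tlinear_def sum.distrib sum_subtractf sum_distrib_left sum_divide_distrib ring_distribs mult_ac)

lemma tlinear_zero: "tlinear m (%v. 0)"
 by (simp add: tlinear_def)

lemma tlinear_sum: "(!!i. i \<in> I ==> tlinear m (f i)) ==> tlinear m (%v. \<Sum>i\<in>I. f i v)"
 by (induction I rule: infinite_finite_induct) (auto simp: tlinear_zero tlinear_add)

lemma tlinear_fst: "k < m ==> tlinear m (%v. fst v k)"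
 and tlinear_snd: "tlinear m (%v. snd v j)"
 by (simp_all add: tlinear_def unit_t_def if_distrib[of "(*) _"] cong: if_cong)

lemma tlinear_lforms: "f \<in> lforms A ==> tlinear (nvars A) f"
 unfolding lforms_def tz_def tt_def zz_def case_prod_beta
 by (auto intro!: tlinear_diff tlinear_fst tlinear_snd)

lemma tlinear_dlog: "f \<in> lforms A ==> tlinear (nvars A) (dlog f p)"
 unfolding dlog_def[abs_def] by (intro tlinear_div tlinear_lforms)

lemma tlinear_dlog_Phi: "tlinear (nvars A) (dlog_Phi A p)"
 unfolding dlog_Phi_def
 by (intro tlinear_add tlinear_sum tlinear_cmult tlinear_dlog tlinear_fst tlinear_snd) (auto intro: lforms_memI)

lemma tlinear_dlog_sum: "set L \<subseteq> lforms A ==> tlinear (nvars A) (dlog_sum L p)"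
 unfolding dlog_sum_def[abs_def] by (induction L) (auto intro!: tlinear_zero tlinear_add tlinear_dlog)

lemma tlinear_theta: "set L \<subseteq> lforms A ==> tlinear (nvars A) (theta A L p)"
 unfolding theta_def[abs_def] by (intro tlinear_diff tlinear_cmult tlinear_dlog_Phi tlinear_dlog_sum)

lemma theta_tangent:
 "set L \<subseteq> lforms A ==> theta A L p (u, %_. 0) = (\<Sum>k<nvars A. u k * theta A L p (unit_t k))"
 using tlinear_theta by (simp add: tlinear_def)

section \<open>Stokes' theorem for twisted chains\<close>

text \<open>The form F dt_{\<iota> 0} wedge ... wedge dt_{\<iota> (q-1)}. For top degree forms
  \<open>\<iota>\<close> is the identity, for forms of degree one less it is an enumeration that
  leaves out one variable.\<close>

definition iform :: "nat => (nat => nat) => (point => complex) => point => (nat => point) => complex" where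
 "iform q \<iota> F p w = F p * pdet q (%a b. fst (w b) (\<iota> a))"

lemma continuous_on_bary_line: "b < p ==> continuous_on A (%s. bary p (y(b := s)))"
proof (rule continuous_on_coordinatewise_then_product)
 fix i assume b: "b < p"
 show "continuous_on A (%s. bary p (y(b := s)) i)"
  unfolding bary_def sum_fun_upd_lessThan[OF b]
  by (cases "i = 0"; cases "i \<le> p"; cases "i - 1 = b") (auto intro!: continuous_intros)
qed

lemma singular_simplex_fibre:
 assumes "singular_simplex p (top_of_set S) (\<sigma> :: (nat => real) => nat => complex)"
 shows "continuous_on (std p) \<sigma>" "\<sigma> ` std p \<subseteq> S"
 using assms unfolding singular_simplex_def euclidean_product_topology[symmetric]
 by (auto simp: continuous_map_in_subtopology euclidean_product_topology)

definition branch_simplex ::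
  "master => nat => (nat => complex) => tsimplex => ((nat => real) => complex) => bool" where
 "branch_simplex A p z \<sigma> \<phi> \<longleftrightarrow>
   singular_simplex p (top_of_set (fibre A z)) \<sigma> \<and> smooth_simplex p \<sigma> \<and>
   flat_section A (std p) (%x. (\<sigma> x, z)) \<phi>"

lemma twisted_chain_branch: "twisted_chain A p z c ==> \<sigma> \<in> supp c ==> branch_simplex A p z \<sigma> (c \<sigma>)"
 by (simp add: twisted_chain_def branch_simplex_def)

lemma branch_simplex_continuous:
 assumes "branch_simplex A p z \<sigma> \<phi>" "z \<in> base A"
 shows "continuous_on (std p) (%x. \<sigma> x k)"
  and "continuous_on (std p) \<phi>"
  and "x \<in> std p ==> \<sigma> x \<in> fibre A z"
  and "x \<in> std p ==> f \<in> lforms A ==> f (\<sigma> x, z) ~= 0"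
proof -
 have s: "continuous_on (std p) \<sigma>" "\<sigma> ` std p \<subseteq> fibre A z"
  using singular_simplex_fibre[of p "fibre A z" \<sigma>] assms(1) by (auto simp: branch_simplex_def)
 show c: "continuous_on (std p) (%x. \<sigma> x k)" for k
  by (rule continuous_on_product_then_coordinatewise[OF s(1)])
 show "continuous_on (std p) \<phi>"
  using assms(1) unfolding branch_simplex_def
  by (elim conjE) (rule continuous_on_flat_section, assumption, auto intro: c continuous_on_const)
 show "x \<in> std p ==> \<sigma> x \<in> fibre A z" using s by auto
 thus "x \<in> std p ==> f \<in> lforms A ==> f (\<sigma> x, z) ~= 0"
  using lforms_nonzero[OF _ assms(2)] by blast
qed

lemma continuous_on_dlog_sum:
 assumes "set L \<subseteq> lforms A" "!!f. f \<in> lforms A ==> continuous_on S (%s. f (P s))"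
  "!!s f. s \<in> S ==> f \<in> lforms A ==> f (P s) ~= 0"
 shows "continuous_on S (%s. dlog_sum L (P s) v)"
 using assms(1)
proof (induction L)
 case (Cons f L)
 hence f: "f \<in> lforms A" and IH: "continuous_on S (%s. dlog_sum L (P s) v)" by simp_all
 have "continuous_on S (%s. f v / f (P s) + dlog_sum L (P s) v)"
  by (rule continuous_on_add[OF continuous_on_divide[OF continuous_on_const assms(2)[OF f]] IH])
    (use assms(3) f in blast)
 thus ?case by (simp add: dlog_sum_def dlog_def)
qed (simp add: dlog_sum_def)

lemma continuous_on_dlog_Phi:
 assumes "!!f. f \<in> lforms A ==> continuous_on S (%s. f (P s))"
  "!!s f. s \<in> S ==> f \<in> lforms A ==> f (P s) ~= 0"
 shows "continuous_on S (%s. dlog_Phi A (P s) v)"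
 unfolding dlog_Phi_def dlog_def
 by (intro continuous_on_add continuous_on_sum continuous_on_mult continuous_on_divide continuous_on_const assms ballI)
   (auto intro!: lforms_memI dest: assms(2)[OF _ lforms_memI(1)] assms(2)[OF _ lforms_memI(2)] assms(2)[OF _ lforms_memI(3)])

lemma continuous_on_theta:
 assumes "set L \<subseteq> lforms A" "!!f. f \<in> lforms A ==> continuous_on S (%s. f (P s))"
  "!!s f. s \<in> S ==> f \<in> lforms A ==> f (P s) ~= 0"
 shows "continuous_on S (%s. theta A L (P s) v)"
 unfolding theta_def
 by (intro continuous_on_diff continuous_on_mult continuous_on_const
   continuous_on_dlog_Phi[OF assms(2,3)] continuous_on_dlog_sum[OF assms])

lemma branch_simplex_lmono:
 assumes "branch_simplex A p z \<sigma> \<phi>" "z \<in> base A" "set L \<subseteq> lforms A"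
 shows "continuous_on (std p) (%x. lmono L (\<sigma> x, z))"
  and "continuous_on (std p) (%x. theta A L (\<sigma> x, z) v)"
proof -
 note c = branch_simplex_continuous[OF assms(1,2)]
 show "continuous_on (std p) (%x. lmono L (\<sigma> x, z))"
  by (rule continuous_on_lmono[OF assms(3)]) (auto intro: c(1) continuous_on_const dest: c(4))
 have f: "continuous_on (std p) (%x. f (\<sigma> x, z))" if "f \<in> lforms A" for f
  by (rule continuous_on_lforms[OF that]) (auto intro: c continuous_on_const)
 show "continuous_on (std p) (%x. theta A L (\<sigma> x, z) v)"
  by (rule continuous_on_theta[OF assms(3) f]) (auto dest: c(4))
qed

lemma simplex_integral_iform:
 assumes D: "!!k. simplex_derivs p (%x. \<sigma> x k) (D k) (DD k)"
 shows "sint p z \<sigma> \<phi> (iform p \<iota> F)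
  = simplex_int p (%x. \<phi> x * (F (\<sigma> x, z) * pdet p (%a b. D (\<iota> a) b x)))"
 unfolding simplex_integral_def simplex_int_def set_lebesgue_integral_def
proof (rule Bochner_Integration.integral_cong[OF refl])
 fix y :: "nat => real"
 show "indicator (bary_dom p) y *\<^sub>R (\<phi> (bary p y) * iform p \<iota> F (\<sigma> (bary p y), z)
     (%b. ((%k. vector_derivative (%s. \<sigma> (bary p (y(b := s))) k) (at (y b))), (%_. 0))))
   = indicator (bary_dom p) y *\<^sub>R (\<phi> (bary p y) * (F (\<sigma> (bary p y), z) * pdet p (%a b. D (\<iota> a) b (bary p y))))"
 proof (cases "y \<in> bary_dom p")
  case True
  have "vector_derivative (%s. \<sigma> (bary p (y(b := s))) k) (at (y b)) = D k b (bary p y)" if "b < p" for k b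
   using D[of k] True that unfolding simplex_derivs_def by (intro vector_derivative_at) blast
  hence "pdet p (%a b. vector_derivative (%s. \<sigma> (bary p (y(b := s))) (\<iota> a)) (at (y b))) = pdet p (%a b. D (\<iota> a) b (bary p y))"
   by (intro pdet_cong) simp
  thus ?thesis by (simp add: iform_def)
 qed simp
qed

text \<open>The tangent vectors of a face are expressed by directional derivatives of the whole
  simplex, so that the boundary term of \<open>simplex_stokes\<close> becomes an integral over a
  singular simplex.\<close>

lemma simplex_integral_face:
 assumes D: "!!k. simplex_derivs (Suc q) (%x. \<sigma> x k) (D k) (DD k)" and f: "f \<le> Suc q"
 shows "sint q z (singular_face (Suc q) f \<sigma>) \<phi> (iform q \<iota> F)
  = simplex_int q (%x. \<phi> x * (F (\<sigma> (sface f x), z) *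
    pdet q (%a b. face_deriv f (%a. D (\<iota> a)) a b (sface f x))))"
 unfolding simplex_integral_def simplex_int_def set_lebesgue_integral_def
proof (rule Bochner_Integration.integral_cong[OF refl])
 fix y :: "nat => real"
 let ?\<tau> = "singular_face (Suc q) f \<sigma>"
 show "indicator (bary_dom q) y *\<^sub>R (\<phi> (bary q y) * iform q \<iota> F (?\<tau> (bary q y), z)
     (%b. ((%k. vector_derivative (%s. ?\<tau> (bary q (y(b := s))) k) (at (y b))), (%_. 0))))
   = indicator (bary_dom q) y *\<^sub>R (\<phi> (bary q y) * (F (\<sigma> (sface f (bary q y)), z) *
    pdet q (%a b. face_deriv f (%a. D (\<iota> a)) a b (sface f (bary q y)))))"
 proof (cases "y \<in> bary_dom q")
  case True
  have t: "?\<tau> (bary q y) = \<sigma> (sface f (bary q y))" if "y \<in> bary_dom q" for y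
   using bary_dom_in_std[OF that] by (simp add: singular_face_def)
  have "vector_derivative (%s. ?\<tau> (bary q (y(b := s))) k) (at (y b)) = face_deriv f (%_. D k) 0 b (sface f (bary q y))"
   if b: "b < q" for k b
  proof (rule vector_derivative_at, rule has_vector_derivative_transform_within_open[OF _ open_line_bary_dom[OF b True]])
   show "((%s. \<sigma> (sface f (bary q (y(b := s)))) k) has_vector_derivative
     face_deriv f (%_. D k) 0 b (sface f (bary q y))) (at (y b))"
    using D[of k] True b f unfolding simplex_derivs_def by simp
  qed (simp add: t)
  hence "pdet q (%a b. vector_derivative (%s. ?\<tau> (bary q (y(b := s))) (\<iota> a)) (at (y b)))
    = pdet q (%a b. face_deriv f (%a. D (\<iota> a)) a b (sface f (bary q y)))"
   by (intro pdet_cong) (simp add: face_deriv_def)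
  thus ?thesis by (simp add: iform_def t[OF True])
 qed simp
qed

lemma continuous_on_pdet:
 "(!!a b. a < q ==> b < q ==> continuous_on S (%x. M a b x)) ==> continuous_on S (%x. pdet q (%a b. M a b x))"
 unfolding pdet_def
 by (intro continuous_on_sum continuous_on_mult continuous_on_const continuous_on_prod)
   (auto dest: permutes_in_image)

text \<open>For a fixed simplex and form the integral depends on the section through a continuous
  density \<open>K\<close>. This makes it additive in continuous sections, as is needed when several
  chains have coefficients on one simplex.\<close>

lemma simplex_density:
 assumes b: "branch_simplex A p z \<sigma> \<phi>'" "z \<in> base A"
  and F: "continuous_on (std p) (%x. F (\<sigma> x, z))"
 obtains K where "continuous_on (std p) K"
  "!!\<phi>. sint p z \<sigma> \<phi> (iform p \<iota> F) = simplex_int p (%x. \<phi> x * K x)"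
proof -
 obtain D DD where D: "!!k. simplex_derivs p (%x. \<sigma> x k) (D k) (DD k)"
  using smooth_simplex_derivs[of p \<sigma>] b unfolding branch_simplex_def by blast
 have "continuous_on (std p) (%x. F (\<sigma> x, z) * pdet p (%a b. D (\<iota> a) b x))"
  using D by (intro continuous_on_mult F continuous_on_pdet) (auto simp: simplex_derivs_def)
 thus thesis using simplex_integral_iform[OF D] by (intro that) auto
qed

lemma face_density:
 assumes b: "branch_simplex A (Suc q) z \<sigma> \<phi>'" "z \<in> base A" and f: "f \<le> Suc q"
  and F: "continuous_on (std (Suc q)) (%x. F (\<sigma> x, z))"
 obtains K where "continuous_on (std q) K"
  "!!\<phi>. sint q z (singular_face (Suc q) f \<sigma>) \<phi> (iform q \<iota> F) = simplex_int q (%x. \<phi> x * K x)"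
proof -
 obtain D DD where D: "!!k. simplex_derivs (Suc q) (%x. \<sigma> x k) (D k) (DD k)"
  using smooth_simplex_derivs[of "Suc q" \<sigma>] b unfolding branch_simplex_def by blast
 have fd: "continuous_on (std (Suc q)) (face_deriv f (%a. D (\<iota> a)) a b)" if "b < q" for a b
  using D that unfolding face_deriv_def[abs_def] simplex_derivs_def
  by (cases "f = 0") (auto intro!: continuous_on_diff)
 have "continuous_on (std (Suc q)) (%x. F (\<sigma> x, z) * pdet q (%a b. face_deriv f (%a. D (\<iota> a)) a b x))"
  by (intro continuous_on_mult F continuous_on_pdet fd)
 from continuous_on_face[OF this _ f] simplex_integral_face[OF D f]
 show thesis by (intro that[of "%x. F (\<sigma> (sface f x), z) * pdet q (%a b. face_deriv f (%a. D (\<iota> a)) a b (sface f x))"]) auto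
qed

text \<open>Stokes for the form obtained by multiplying a branch and \<open>lmono L\<close> with a
  constant form. By the chain rule row 0, the differential of the scalar factor, is a combination of
  the rows \<open>D k\<close> with coefficients given by \<open>theta\<close>.\<close>

lemma branch_simplex_stokes:
 assumes b: "branch_simplex A (Suc q) z \<sigma> \<phi>" and z: "z \<in> base A" and L: "set L \<subseteq> lforms A"
  and D: "!!k. simplex_derivs (Suc q) (%x. \<sigma> x k) (D k) (DD k)"
 shows "(\<Sum>f\<le>Suc q. (-1) ^ f * sint q z (singular_face (Suc q) f \<sigma>) (%x. \<phi> (sface f x)) (iform q \<iota> (lmono L)))
  = simplex_int (Suc q) (%x. pdet (Suc q) (%a b. if a = 0
     then \<phi> x * lmono L (\<sigma> x, z) * (\<Sum>k<nvars A. D k b x * theta A L (\<sigma> x, z) (unit_t k)) else D (\<iota> (a - 1)) b x))"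
proof -
 let ?\<Delta> = "std (Suc q)"
 note c = branch_simplex_continuous[OF b z] branch_simplex_lmono[OF b z L]
 have fl: "flat_section A ?\<Delta> (%x. (\<sigma> x, z)) \<phi>" using b by (simp add: branch_simplex_def)
 have D': "!!k b. b < Suc q ==> continuous_on ?\<Delta> (D k b)"
  "!!k b c. b < Suc q ==> c < Suc q ==> continuous_on ?\<Delta> (DD k b c)"
  "!!k b y. b < Suc q ==> y \<in> bary_dom (Suc q) ==>
    ((%s. \<sigma> (bary (Suc q) (y(b := s))) k) has_vector_derivative D k b (bary (Suc q) y)) (at (y b))"
  "!!k b c y. b < Suc q ==> c < Suc q ==> y \<in> bary_dom (Suc q) ==>
    ((%s. D k b (bary (Suc q) (y(c := s)))) has_vector_derivative DD k b c (bary (Suc q) y)) (at (y c))"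
  "!!k b c y. b < Suc q ==> c < Suc q ==> y \<in> bary_dom (Suc q) ==>
    DD k b c (bary (Suc q) y) = DD k c b (bary (Suc q) y)"
  using D unfolding simplex_derivs_def by simp_all
 have der0: "((%s. \<phi> (bary (Suc q) (y(b := s))) * lmono L (\<sigma> (bary (Suc q) (y(b := s))), z)) has_vector_derivative
   \<phi> (bary (Suc q) y) * lmono L (\<sigma> (bary (Suc q) y), z) * (\<Sum>k<nvars A. D k b (bary (Suc q) y) * theta A L (\<sigma> (bary (Suc q) y), z) (unit_t k))) (at (y b))"
  if b: "b < Suc q" and y: "y \<in> bary_dom (Suc q)" for b y
 proof -
  let ?T = "{s. y(b := s) \<in> bary_dom (Suc q)}"
  let ?x = "bary (Suc q) y"
  let ?P = "%s. (\<sigma> (bary (Suc q) (y(b := s))), z)"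
  let ?P' = "%h::real. ((%k. h *\<^sub>R D k b ?x), (%_::nat. 0::complex))"
  have inj: "bary (Suc q) (y(b := s)) \<in> ?\<Delta>" if "s \<in> ?T" for s
   using that bary_dom_in_std by simp
  have "((%s. \<phi> (bary (Suc q) (y(b := s))) * lmono L (?P s)) has_derivative
   (%h. \<phi> (bary (Suc q) (y(b := y b))) * lmono L (?P (y b)) *
     (1 / kap A * dlog_Phi A (?P (y b)) (?P' h) - dlog_sum L (?P (y b)) (?P' h)))) (at (y b))"
  proof (rule flat_mono_has_derivative[where T = ?T])
   show "flat_section A ?T ?P (%s. \<phi> (bary (Suc q) (y(b := s))))"
    by (rule flat_section_compose[OF fl continuous_on_bary_line[OF b]]) (use inj in auto)
   show "open ?T" "y b \<in> ?T" by (rule open_line_bary_dom[OF b y])+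
   show "((%s. fst (?P s) k) has_derivative (%h. fst (?P' h) k)) (at (y b))" for k
    using D'(3)[OF b y] by (simp add: has_vector_derivative_def)
   show "((%s. snd (?P s) j) has_derivative (%h. snd (?P' h) j)) (at (y b))" for j by simp
   show "f (?P (y b)) ~= 0" if "f \<in> lforms A" for f
    using c(4)[OF bary_dom_in_std[OF y] that] by simp
  qed (rule L)
  also have "(%h. \<phi> (bary (Suc q) (y(b := y b))) * lmono L (?P (y b)) *
     (1 / kap A * dlog_Phi A (?P (y b)) (?P' h) - dlog_sum L (?P (y b)) (?P' h)))
    = (%h. h *\<^sub>R (\<phi> ?x * lmono L (\<sigma> ?x, z) * (\<Sum>k<nvars A. D k b ?x * theta A L (\<sigma> ?x, z) (unit_t k))))"
  proof
   fix h
   have "1 / kap A * dlog_Phi A (?P (y b)) (?P' h) - dlog_sum L (?P (y b)) (?P' h) = theta A L (\<sigma> ?x, z) (?P' h)"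
    by (simp add: theta_def)
   also have "... = (\<Sum>k<nvars A. (h *\<^sub>R D k b ?x) * theta A L (\<sigma> ?x, z) (unit_t k))"
    by (rule theta_tangent[OF L])
   also have "... = h *\<^sub>R (\<Sum>k<nvars A. D k b ?x * theta A L (\<sigma> ?x, z) (unit_t k))"
    by (simp add: scaleR_sum_right)
   finally show "\<phi> (bary (Suc q) (y(b := y b))) * lmono L (?P (y b)) *
     (1 / kap A * dlog_Phi A (?P (y b)) (?P' h) - dlog_sum L (?P (y b)) (?P' h))
    = h *\<^sub>R (\<phi> ?x * lmono L (\<sigma> ?x, z) * (\<Sum>k<nvars A. D k b ?x * theta A L (\<sigma> ?x, z) (unit_t k)))"
    by simp
  qed
  finally show ?thesis by (simp only: has_vector_derivative_def)
 qed
 have c0: "continuous_on ?\<Delta> (%x. \<phi> x * lmono L (\<sigma> x, z))"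
  by (intro continuous_on_mult c(2) c(5))
 have cD0: "continuous_on ?\<Delta> (%x. \<phi> x * lmono L (\<sigma> x, z) * (\<Sum>k<nvars A. D k b x * theta A L (\<sigma> x, z) (unit_t k)))"
  if "b < Suc q" for b
  by (intro continuous_on_mult continuous_on_sum c(2) c(5) c(6) D'(1) that)
 have "simplex_int (Suc q) (%x. pdet (Suc q) (%a b. if a = 0
     then \<phi> x * lmono L (\<sigma> x, z) * (\<Sum>k<nvars A. D k b x * theta A L (\<sigma> x, z) (unit_t k)) else D (\<iota> (a - 1)) b x))
  = (\<Sum>f\<le>Suc q. (-1) ^ f * simplex_int q (%x. \<phi> (sface f x) * lmono L (\<sigma> (sface f x), z) *
    pdet q (%a b. face_deriv f (%a. D (\<iota> a)) a b (sface f x))))"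
  by (rule simplex_stokes[of q "%x. \<phi> x * lmono L (\<sigma> x, z)"
    "%b x. \<phi> x * lmono L (\<sigma> x, z) * (\<Sum>k<nvars A. D k b x * theta A L (\<sigma> x, z) (unit_t k))"
    "%a. D (\<iota> a)" "%a. DD (\<iota> a)"])
    (use c0 cD0 D' der0 in auto)
 also have "... = (\<Sum>f\<le>Suc q. (-1) ^ f * sint q z (singular_face (Suc q) f \<sigma>) (%x. \<phi> (sface f x)) (iform q \<iota> (lmono L)))"
  by (intro sum.cong refl) (simp add: simplex_integral_face[OF D] mult.assoc)
 finally show ?thesis ..
qed

text \<open>There are m+1 rows and row 0 is a combination of the others, so the matrix factors
  through one with a zero row. Geometrically, a form of degree m+1 in m variables t
  vanishes.\<close>

lemma pdet_dependent_row:
 "pdet (Suc m) (%a b. if a = 0 then C * (\<Sum>k<m. D k b * e k) else D (a - 1) b) = 0"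
proof -
 let ?X = "%a c. if c = 0 then 0 else if a = 0 then C * e (c - 1) else if a = c then 1 else (0::complex)"
 let ?N = "%c b. if c = 0 then 0 else D (c - 1) b"
 have N: "pdet (Suc m) ?N = 0"
  unfolding pdet_def by (rule sum.neutral) (simp add: prod.lessThan_Suc_shift del: prod.lessThan_Suc)
 have "(\<Sum>c<Suc m. ?X a c * ?N c b) = (if a = 0 then C * (\<Sum>k<m. D k b * e k) else D (a - 1) b)" if "a < Suc m" for a b
 proof -
  have "(\<Sum>c<Suc m. ?X a c * ?N c b) = (\<Sum>c<m. ?X a (Suc c) * D c b)"
   by (subst sum.lessThan_Suc_shift) simp
  also have "... = (if a = 0 then C * (\<Sum>k<m. D k b * e k) else D (a - 1) b)"
  proof (cases a)
   case (Suc a')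
   hence "(\<Sum>c<m. ?X a (Suc c) * D c b) = (\<Sum>c<m. if c = a' then D c b else 0)" by (intro sum.cong) auto
   thus ?thesis using Suc that by simp
  qed (simp add: sum_distrib_left mult_ac)
  finally show ?thesis .
 qed
 hence "pdet (Suc m) (%a b. if a = 0 then C * (\<Sum>k<m. D k b * e k) else D (a - 1) b)
   = pdet (Suc m) (%a b. \<Sum>c<Suc m. ?X a c * ?N c b)"
  by (intro pdet_cong) simp
 also have "... = pdet (Suc m) ?X * pdet (Suc m) ?N" by (rule pdet_mult)
 finally show ?thesis using N by simp
qed

lemma pdet_expand_first:
 "pdet (Suc q) (%a b. if a = 0 then r b else M (a - 1) b)
  = (\<Sum>j\<le>q. r j * ((-1) ^ j * pdet q (%a c. M a (if c < j then c else Suc c))))"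
proof -
 let ?P = "{\<pi>. \<pi> permutes {..<Suc q}}"
 have "pdet (Suc q) (%a b. if a = 0 then r b else M (a - 1) b)
  = (\<Sum>\<pi>\<in>?P. r (\<pi> 0) * (of_int (sign \<pi>) * (\<Prod>a<q. M a (\<pi> (Suc a)))))"
  unfolding pdet_def by (intro sum.cong refl) (simp add: prod.lessThan_Suc_shift mult_ac del: prod.lessThan_Suc)
 also have "... = (\<Sum>j\<le>q. \<Sum>\<pi>\<in>{\<pi> \<in> ?P. \<pi> 0 = j}. r (\<pi> 0) * (of_int (sign \<pi>) * (\<Prod>a<q. M a (\<pi> (Suc a)))))"
 proof (rule sum.group[symmetric])
  show "(%\<pi>. \<pi> 0) ` ?P \<subseteq> {..q}"
   using permutes_in_image[of _ "{..<Suc q}" 0] by (auto simp: less_Suc_eq_le)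
 qed (auto intro: finite_permutations)
 also have "... = (\<Sum>j\<le>q. r j * (\<Sum>\<pi> | \<pi> permutes {..<Suc q} \<and> \<pi> 0 = j. of_int (sign \<pi>) * (\<Prod>a<q. M a (\<pi> (Suc a)))))"
  unfolding sum_distrib_left by (intro sum.cong refl) auto
 also have "... = (\<Sum>j\<le>q. r j * ((-1) ^ j * pdet q (%a c. M a (if c < j then c else Suc c))))"
  by (intro sum.cong refl) (simp add: sum_permutes_first)
 finally show ?thesis .
qed

lemma pdet_identity: "pdet q (%a c. if a = c then 1 else 0) = 1"
proof -
 have "mat q q (%(a, c). if a = c then 1 else 0) = (1\<^sub>m q :: complex Matrix.mat)"
  by (rule eq_matI) auto
 thus ?thesis unfolding pdet_eq_det by simp
qed

lemma pdet_zero_row: "a < q ==> (!!c. c < q ==> M a c = 0) ==> pdet q M = 0"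
 unfolding pdet_def by (intro sum.neutral ballI)
  (auto intro!: bexI[of _ a] simp: prod_zero_iff dest: permutes_in_image)

text \<open>In the differential of a function times the product of all dt's except dt_k, only the
  derivative in t_k survives; moving dt_k to its place gives the sign. The matrix is factored
  through the rows of \<open>D\<close>, and the coefficient matrix is expanded along row 0.\<close>

lemma pdet_replace_row:
 assumes k: "k \<le> q"
 shows "pdet (Suc q) (%a b. if a = 0 then C * (\<Sum>l<Suc q. D l b * e l) else D (if a - 1 < k then a - 1 else Suc (a - 1)) b)
  = (-1) ^ k * (C * e k * pdet (Suc q) (%a b. D a b))"
proof -
 let ?s = "%a. if a < k then a else Suc a"
 let ?M = "%a c. if c = ?s a then 1 else (0::complex)"
 let ?X = "%a c. if a = 0 then C * e c else ?M (a - 1) c"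
 have XN: "(\<Sum>c<Suc q. ?X a c * D c b) = (if a = 0 then C * (\<Sum>l<Suc q. D l b * e l) else D (?s (a - 1)) b)" if "a < Suc q" for a b
 proof (cases a)
  case (Suc a')
  have "(\<Sum>c<Suc q. ?X a c * D c b) = (\<Sum>c<Suc q. if c = ?s a' then D c b else 0)"
   using Suc by (intro sum.cong) auto
  also have "... = D (?s a') b" using Suc that by (subst sum.delta) auto
  finally show ?thesis using Suc by simp
 qed (simp add: sum_distrib_left mult_ac del: sum.lessThan_Suc)
 have "pdet (Suc q) (%a b. if a = 0 then C * (\<Sum>l<Suc q. D l b * e l) else D (?s (a - 1)) b)
   = pdet (Suc q) (%a b. \<Sum>c<Suc q. ?X a c * D c b)"
  by (rule pdet_cong) (rule XN[symmetric])
 also have "... = pdet (Suc q) ?X * pdet (Suc q) (%a b. D a b)" by (rule pdet_mult)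
 also have "pdet (Suc q) ?X = (\<Sum>j\<le>q. C * e j * ((-1) ^ j * pdet q (%a c. ?M a (if c < j then c else Suc c))))"
  by (rule pdet_expand_first)
 also have "... = (\<Sum>j\<le>q. if j = k then C * e k * (-1) ^ k else 0)"
 proof (intro sum.cong refl)
  fix j assume j: "j \<in> {..q}"
  show "C * e j * ((-1) ^ j * pdet q (%a c. ?M a (if c < j then c else Suc c))) = (if j = k then C * e k * (-1) ^ k else 0)"
  proof (cases "j = k")
   case True
   have "pdet q (%a c. ?M a (if c < j then c else Suc c)) = pdet q (%a c. if a = c then 1 else 0)"
    using True by (intro pdet_cong) auto
   thus ?thesis using True by (simp add: pdet_identity)
  next
   case False
   have "pdet q (%a c. ?M a (if c < j then c else Suc c)) = 0"
    by (rule pdet_zero_row[of "if j < k then j else j - 1"]) (use False j k in auto)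
   thus ?thesis using False by simp
  qed
 qed
 also have "... = C * e k * (-1) ^ k" using k by simp
 finally show ?thesis by (simp add: mult_ac)
qed

lemma twisted_integral_finite:
 "finite (supp \<gamma>) ==> tint A z \<gamma> \<omega> = (\<Sum>\<sigma>\<in>supp \<gamma>. sint (nvars A) z \<sigma> (\<gamma> \<sigma>) \<omega>)"
 unfolding twisted_integral_def by (rule infsum_finite)

lemma simplex_integral_zero: "sint q z \<tau> (%_. 0) \<omega> = 0"
 by (simp add: simplex_integral_def set_lebesgue_integral_def)

lemma simplex_integral_cong:
 assumes "!!x. x \<in> std q ==> \<phi> x = \<psi> x"
 shows "sint q z \<tau> \<phi> \<omega> = sint q z \<tau> \<psi> \<omega>"
 unfolding simplex_integral_def set_lebesgue_integral_def
 using assms bary_dom_in_std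
 by (intro Bochner_Integration.integral_cong) (auto simp: indicator_def)

text \<open>Faces are grouped by the simplex they represent; over it, \<open>tboundary\<close> adds
  up the sections. The integral respects this addition since all sections are integrated against one
  density. Members of \<open>T\<close> that are not faces contribute zero.\<close>

lemma sum_faces_eq_boundary:
 assumes c: "twisted_chain A (Suc q) z c" "finite (supp c)" and z: "z \<in> base A" and L: "set L \<subseteq> lforms A"
  and T: "finite T" "!!\<sigma> f. \<sigma> \<in> supp c ==> f \<le> Suc q ==> singular_face (Suc q) f \<sigma> \<in> T"
 shows "(\<Sum>\<sigma>\<in>supp c. \<Sum>f\<le>Suc q. (-1) ^ f * sint q z (singular_face (Suc q) f \<sigma>)
    (%x. c \<sigma> (sface f x)) (iform q \<iota> (lmono L)))
  = (\<Sum>\<tau>\<in>T. sint q z \<tau> (tboundary (Suc q) c \<tau>) (iform q \<iota> (lmono L)))"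
proof -
 let ?\<omega> = "iform q \<iota> (lmono L)"
 let ?S = "supp c \<times> {..Suc q}"
 let ?h = "%(\<sigma>, f). (-1) ^ f * sint q z (singular_face (Suc q) f \<sigma>) (%x. c \<sigma> (sface f x)) ?\<omega>"
 let ?g = "%(\<sigma>, f). singular_face (Suc q) f \<sigma>"
 have finS: "finite ?S" using c by simp
 have tau: "sint q z \<tau> (tboundary (Suc q) c \<tau>) ?\<omega> = (\<Sum>s\<in>{s \<in> ?S. ?g s = \<tau>}. ?h s)" for \<tau>
 proof -
  have S: "{(\<sigma>, k). \<sigma> \<in> supp c \<and> k \<le> Suc q \<and> singular_face (Suc q) k \<sigma> = \<tau>} = {s \<in> ?S. ?g s = \<tau>}" by auto
  have tb: "tboundary (Suc q) c \<tau> x = (\<Sum>s\<in>{s \<in> ?S. ?g s = \<tau>}. case s of (\<sigma>, f) => (-1) ^ f * c \<sigma> (sface f x))"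
   if "x \<in> std q" for x
   using that unfolding tboundary_def S by simp
  show ?thesis
  proof (cases "{s \<in> ?S. ?g s = \<tau>} = {}")
   case True
   have "sint q z \<tau> (tboundary (Suc q) c \<tau>) ?\<omega> = sint q z \<tau> (%_. 0) ?\<omega>"
    by (rule simplex_integral_cong) (simp only: tb True sum.empty)
   thus ?thesis by (simp only: True sum.empty simplex_integral_zero)
  next
   case False
   \<comment> \<open>Any one of the faces equal to \<open>\<tau>\<close> supplies the density, which
     does not depend on the section.\<close>
   then obtain \<sigma>0 f0 where s0: "\<sigma>0 \<in> supp c" "f0 \<le> Suc q" "singular_face (Suc q) f0 \<sigma>0 = \<tau>" by auto
   note b0 = twisted_chain_branch[OF c(1) s0(1)]
   obtain K where K: "continuous_on (std q) K"
    "!!\<phi>. sint q z \<tau> \<phi> ?\<omega> = simplex_int q (%x. \<phi> x * K x)"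
    using face_density[OF b0 z s0(2) branch_simplex_lmono(1)[OF b0 z L]] s0(3) by metis
   have cont: "continuous_on (std q) (%x. c \<sigma> (sface f x))" if "\<sigma> \<in> supp c" "f \<le> Suc q" for \<sigma> f
    using continuous_on_face[OF branch_simplex_continuous(2)[OF twisted_chain_branch[OF c(1) that(1)] z] _ that(2)] by simp
   have "sint q z \<tau> (tboundary (Suc q) c \<tau>) ?\<omega>
    = simplex_int q (%x. \<Sum>s\<in>{s \<in> ?S. ?g s = \<tau>}. case s of (\<sigma>, f) => (-1) ^ f * (c \<sigma> (sface f x) * K x))"
    unfolding K(2)
    by (rule simplex_int_cong) (simp only: tb bary_dom_in_std sum_distrib_right case_prod_beta mult.assoc)
   also have "... = (\<Sum>s\<in>{s \<in> ?S. ?g s = \<tau>}. simplex_int q (%x. case s of (\<sigma>, f) => (-1) ^ f * (c \<sigma> (sface f x) * K x)))"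
    using finS by (rule_tac simplex_int_sum) (auto intro!: continuous_on_mult continuous_on_const cont K(1))
   also have "... = (\<Sum>s\<in>{s \<in> ?S. ?g s = \<tau>}. ?h s)"
    by (intro sum.cong refl) (auto simp: simplex_int_cmult K(2)[symmetric])
   finally show ?thesis .
  qed
 qed
 have "(\<Sum>\<sigma>\<in>supp c. \<Sum>f\<le>Suc q. (-1) ^ f * sint q z (singular_face (Suc q) f \<sigma>)
    (%x. c \<sigma> (sface f x)) ?\<omega>) = (\<Sum>s\<in>?S. ?h s)"
  by (simp add: sum.cartesian_product del: sum.atMost_Suc)
 also have "... = (\<Sum>\<tau>\<in>T. \<Sum>s\<in>{s \<in> ?S. ?g s = \<tau>}. ?h s)"
  by (rule sum.group[symmetric]) (use finS T in auto)
 finally show ?thesis by (simp only: tau)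
qed

text \<open>Stokes for the form with coefficient \<open>lmono L\<close> in which dt_k is left out:
  the boundary of the cycle is zero, and by \<open>pdet_replace_row\<close> the differential is the
  integrand up to the sign (-1)^k.\<close>

lemma twisted_integral_exact:
 assumes c: "compact_twisted_cycle A z c" and z: "z \<in> base A" and L: "set L \<subseteq> lforms A" and k: "k < nvars A"
 shows "tint A z c (iform (nvars A) id (%p. lmono L p * theta A L p (unit_t k))) = 0"
proof -
 obtain q where q: "nvars A = Suc q" using k by (cases "nvars A") auto
 have ch: "twisted_chain A (Suc q) z c" and fin: "finite (supp c)" and cyc: "tboundary (Suc q) c = (%_ _. 0)"
  using c unfolding compact_twisted_cycle_def q by auto
 \<comment> \<open>The increasing enumeration of all variables except \<open>k\<close>.\<close>
 let ?s = "%a. if a < k then a else Suc a"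
 let ?T = "(%(\<sigma>, f). singular_face (Suc q) f \<sigma>) ` (supp c \<times> {..Suc q})"
 have "(\<Sum>\<sigma>\<in>supp c. \<Sum>f\<le>Suc q. (-1) ^ f * sint q z (singular_face (Suc q) f \<sigma>)
    (%x. c \<sigma> (sface f x)) (iform q ?s (lmono L)))
  = (\<Sum>\<tau>\<in>?T. sint q z \<tau> (tboundary (Suc q) c \<tau>) (iform q ?s (lmono L)))"
  by (rule sum_faces_eq_boundary[OF ch fin z L]) (use fin in auto)
 also have "... = 0" by (simp add: cyc simplex_integral_zero)
 finally have 0: "(\<Sum>\<sigma>\<in>supp c. \<Sum>f\<le>Suc q. (-1) ^ f * sint q z (singular_face (Suc q) f \<sigma>)
    (%x. c \<sigma> (sface f x)) (iform q ?s (lmono L))) = 0" .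
 have st: "(\<Sum>f\<le>Suc q. (-1) ^ f * sint q z (singular_face (Suc q) f \<sigma>)
    (%x. c \<sigma> (sface f x)) (iform q ?s (lmono L)))
   = (-1) ^ k * sint (Suc q) z \<sigma> (c \<sigma>) (iform (Suc q) id (%p. lmono L p * theta A L p (unit_t k)))"
  if "\<sigma> \<in> supp c" for \<sigma>
 proof -
  note b = twisted_chain_branch[OF ch that]
  obtain D DD where D: "!!k. simplex_derivs (Suc q) (%x. \<sigma> x k) (D k) (DD k)"
   using smooth_simplex_derivs[of "Suc q" \<sigma>] b unfolding branch_simplex_def by blast
  have kq: "k \<le> q" using k q by simp
  have "pdet (Suc q) (%a b. if a = 0
     then c \<sigma> x * lmono L (\<sigma> x, z) * (\<Sum>k<nvars A. D k b x * theta A L (\<sigma> x, z) (unit_t k)) else D (?s (a - 1)) b x)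
    = (-1) ^ k * (c \<sigma> x * lmono L (\<sigma> x, z) * theta A L (\<sigma> x, z) (unit_t k) * pdet (Suc q) (%a b. D a b x))" for x
   using pdet_replace_row[OF kq, of "c \<sigma> x * lmono L (\<sigma> x, z)" "%k b. D k b x" "%k. theta A L (\<sigma> x, z) (unit_t k)"]
   unfolding q .
  thus ?thesis
   unfolding branch_simplex_stokes[OF b z L D] simplex_integral_iform[OF D]
   by (simp add: simplex_int_cmult mult.assoc)
 qed
 have "(-1) ^ k * tint A z c (iform (nvars A) id (%p. lmono L p * theta A L p (unit_t k))) = 0"
  using 0 unfolding twisted_integral_finite[OF fin] q sum_distrib_left
  by (simp only: st cong: sum.cong)
 thus ?thesis by simp
qed

text \<open>Stokes on a chain bounding the difference. The form has top degree in the variables t,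
  so it is closed by \<open>pdet_dependent_row\<close>.\<close>

lemma twisted_integral_homologous:
 assumes c: "compact_twisted_cycle A z c" "compact_twisted_cycle A z c'" and h: "twisted_homologous A z c c'"
  and z: "z \<in> base A" and L: "set L \<subseteq> lforms A"
 shows "tint A z c (iform (nvars A) id (lmono L)) = tint A z c' (iform (nvars A) id (lmono L))"
proof -
 let ?m = "nvars A" let ?\<omega> = "iform ?m id (lmono L)"
 obtain d where d: "twisted_chain A (Suc ?m) z d" "finite (supp d)" "tboundary (Suc ?m) d = (%\<tau> x. c \<tau> x - c' \<tau> x)"
  using h unfolding twisted_homologous_def by auto
 have fin: "finite (supp c)" "finite (supp c')" and ch: "twisted_chain A ?m z c" "twisted_chain A ?m z c'"
  using c by (auto simp: compact_twisted_cycle_def)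
 \<comment> \<open>One finite index set for the faces of \<open>d\<close> and both cycles;
   cancellation may remove simplices from some of the supports.\<close>
 let ?T = "(%(\<sigma>, f). singular_face (Suc ?m) f \<sigma>) ` (supp d \<times> {..Suc ?m}) \<union> supp c \<union> supp c'"
 have finT: "finite ?T" using d(2) fin by simp
 have st: "(\<Sum>f\<le>Suc ?m. (-1) ^ f * sint ?m z (singular_face (Suc ?m) f \<sigma>)
    (%x. d \<sigma> (sface f x)) ?\<omega>) = 0" if "\<sigma> \<in> supp d" for \<sigma>
 proof -
  note b = twisted_chain_branch[OF d(1) that]
  obtain D DD where D: "!!k. simplex_derivs (Suc ?m) (%x. \<sigma> x k) (D k) (DD k)"
   using smooth_simplex_derivs[of "Suc ?m" \<sigma>] b unfolding branch_simplex_def by blast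
  have "pdet (Suc ?m) (%a b. if a = 0
     then d \<sigma> x * lmono L (\<sigma> x, z) * (\<Sum>k<?m. D k b x * theta A L (\<sigma> x, z) (unit_t k)) else D (id (a - 1)) b x) = 0" for x
   using pdet_dependent_row[of ?m "d \<sigma> x * lmono L (\<sigma> x, z)" "%k b. D k b x" "%k. theta A L (\<sigma> x, z) (unit_t k)"]
   by (simp only: id_apply)
  thus ?thesis unfolding branch_simplex_stokes[OF b z L D]
   by (simp add: simplex_int_def set_lebesgue_integral_def)
 qed
 have "0 = (\<Sum>\<tau>\<in>?T. sint ?m z \<tau> (tboundary (Suc ?m) d \<tau>) ?\<omega>)"
 proof -
  have "(\<Sum>\<sigma>\<in>supp d. \<Sum>f\<le>Suc ?m. (-1) ^ f * sint ?m z (singular_face (Suc ?m) f \<sigma>)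
    (%x. d \<sigma> (sface f x)) ?\<omega>) = (\<Sum>\<tau>\<in>?T. sint ?m z \<tau> (tboundary (Suc ?m) d \<tau>) ?\<omega>)"
  proof (rule sum_faces_eq_boundary[OF d(1,2) z L finT])
   fix \<sigma> f assume "\<sigma> \<in> supp d" "f \<le> Suc ?m"
   thus "singular_face (Suc ?m) f \<sigma> \<in> ?T" by (intro UnI1) (auto intro!: image_eqI[where x = "(\<sigma>, f)"])
  qed
  moreover have "(\<Sum>\<sigma>\<in>supp d. \<Sum>f\<le>Suc ?m. (-1) ^ f * sint ?m z (singular_face (Suc ?m) f \<sigma>)
    (%x. d \<sigma> (sface f x)) ?\<omega>) = 0"
   by (rule sum.neutral) (use st in blast)
  ultimately show ?thesis by simp
 qed
 also have "... = (\<Sum>\<tau>\<in>?T. sint ?m z \<tau> (c \<tau>) ?\<omega> - sint ?m z \<tau> (c' \<tau>) ?\<omega>)"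
 proof (rule sum.cong[OF refl])
  fix \<tau>
  have cont: "continuous_on (std ?m) (e \<tau>)" if "twisted_chain A ?m z e" for e
  proof (cases "\<tau> \<in> supp e")
   case True
   show ?thesis by (rule branch_simplex_continuous(2)[OF twisted_chain_branch[OF that True] z])
  next
   case False
   hence "e \<tau> = (%_. 0)" by (simp add: supp_def)
   thus ?thesis by simp
  qed
  show "sint ?m z \<tau> (tboundary (Suc ?m) d \<tau>) ?\<omega> = sint ?m z \<tau> (c \<tau>) ?\<omega> - sint ?m z \<tau> (c' \<tau>) ?\<omega>"
  proof (cases "\<tau> \<in> supp c \<or> \<tau> \<in> supp c'")
   case True
   then obtain e where e: "twisted_chain A ?m z e" "\<tau> \<in> supp e" using ch by auto
   note b = twisted_chain_branch[OF e]
   obtain K where K: "continuous_on (std ?m) K"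
    "!!\<phi>. sint ?m z \<tau> \<phi> ?\<omega> = simplex_int ?m (%x. \<phi> x * K x)"
    using simplex_density[OF b z branch_simplex_lmono(1)[OF b z L]] by metis
   have "simplex_int ?m (%x. c \<tau> x * K x - c' \<tau> x * K x) = simplex_int ?m (%x. c \<tau> x * K x) - simplex_int ?m (%x. c' \<tau> x * K x)"
    by (intro simplex_int_diff continuous_on_mult K(1) cont ch)
   thus ?thesis unfolding K(2) d(3) by (simp add: left_diff_distrib)
  next
   case False
   hence "c \<tau> = (%_. 0)" "c' \<tau> = (%_. 0)" by (auto simp: supp_def)
   thus ?thesis by (simp add: d(3) simplex_integral_zero)
  qed
 qed
 also have "... = (\<Sum>\<tau>\<in>?T. sint ?m z \<tau> (c \<tau>) ?\<omega>) - (\<Sum>\<tau>\<in>?T. sint ?m z \<tau> (c' \<tau>) ?\<omega>)"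
  by (rule sum_subtractf)
 also have "(\<Sum>\<tau>\<in>?T. sint ?m z \<tau> (c \<tau>) ?\<omega>) = (\<Sum>\<tau>\<in>supp c. sint ?m z \<tau> (c \<tau>) ?\<omega>)"
 proof (rule sum.mono_neutral_right[OF finT])
  show "\<forall>\<tau>\<in>?T - supp c. sint ?m z \<tau> (c \<tau>) ?\<omega> = 0"
  proof
   fix \<tau> assume "\<tau> \<in> ?T - supp c"
   hence "c \<tau> = (%_. 0)" unfolding supp_def by blast
   thus "sint ?m z \<tau> (c \<tau>) ?\<omega> = 0" by (simp only: simplex_integral_zero)
  qed
 qed blast
 also have "(\<Sum>\<tau>\<in>?T. sint ?m z \<tau> (c' \<tau>) ?\<omega>) = (\<Sum>\<tau>\<in>supp c'. sint ?m z \<tau> (c' \<tau>) ?\<omega>)"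
 proof (rule sum.mono_neutral_right[OF finT])
  show "\<forall>\<tau>\<in>?T - supp c'. sint ?m z \<tau> (c' \<tau>) ?\<omega> = 0"
  proof
   fix \<tau> assume "\<tau> \<in> ?T - supp c'"
   hence "c' \<tau> = (%_. 0)" unfolding supp_def by blast
   thus "sint ?m z \<tau> (c' \<tau>) ?\<omega> = 0" by (simp only: simplex_integral_zero)
  qed
 qed blast
 finally show ?thesis unfolding twisted_integral_finite[OF fin(1)] twisted_integral_finite[OF fin(2)]
  by (simp only: right_minus_eq eq_commute[of 0])
qed

section \<open>Differentiation under the integral sign\<close>

text \<open>Difference quotients along sequences converge by dominated convergence. The mean value
  inequality on the disc bounds them by the maximum of the derivative over the compact product of
  simplex and disc.\<close>

lemma simplex_int_has_field_derivative:
 fixes h h' :: "complex => (nat => real) => complex"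
 assumes e: "e > 0"
  and h: "!!w. w \<in> cball a e ==> continuous_on (std m) (h w)"
  and h': "continuous_on (std m \<times> cball a e) (%(x, w). h' w x)"
  and der: "!!x w. x \<in> std m ==> w \<in> cball a e ==> ((%w. h w x) has_field_derivative h' w x) (at w)"
 shows "((%w. simplex_int m (h w)) has_field_derivative simplex_int m (h' a)) (at a)"
proof -
 let ?\<Delta> = "std m" let ?M = "lebPi {..<m}"
 have "compact ((%(x, w). h' w x) ` (?\<Delta> \<times> cball a e))"
  by (intro compact_continuous_image h' compact_Times compact_standard_simplex compact_cball)
 then obtain C where "!!y. y \<in> (%(x, w). h' w x) ` (?\<Delta> \<times> cball a e) ==> norm y \<le> C"
  by (meson compact_imp_bounded bounded_iff)
 hence C: "norm (h' w x) \<le> C" if "x \<in> ?\<Delta>" "w \<in> cball a e" for w x using that by force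
 have bound: "norm (h w x - h a x) \<le> C * norm (w - a)" if "x \<in> ?\<Delta>" "w \<in> cball a e" for w x
 proof (rule field_differentiable_bound[of "cball a e" "%w. h w x" "%w. h' w x"])
  fix v assume "v \<in> cball a e"
  thus "((%w. h w x) has_field_derivative h' v x) (at v within cball a e)"
   by (intro has_field_derivative_at_within[OF der] that)
 qed (use that e C in auto)
 have ca: "a \<in> cball a e" using e by simp
 have "((%w. (simplex_int m (h w) - simplex_int m (h a)) / (w - a)) \<longlongrightarrow> simplex_int m (h' a)) (at a)"
  unfolding tendsto_at_iff_sequentially comp_def
 proof (intro allI impI)
  fix X :: "nat => complex"
  assume X: "\<forall>i. X i \<in> UNIV - {a}" "X \<longlonglongrightarrow> a"
  \<comment> \<open>Setting the quotient to zero while \<open>X n\<close> is outside the disc makes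
    the uniform bound hold for every \<open>n\<close>; the sequence enters the disc
    eventually.\<close>
  define Q where "Q n x = (if X n \<in> cball a e then (h (X n) x - h a x) / (X n - a) else 0)" for n x
  have Qc: "continuous_on ?\<Delta> (Q n)" for n
   unfolding Q_def[abs_def] using X(1) ca
   by (cases "X n \<in> cball a e") (auto intro!: continuous_on_divide continuous_on_diff h continuous_on_const)
  have ev: "\<forall>\<^sub>F n in sequentially. X n \<in> cball a e"
   using X(2) e by (auto simp: lim_sequentially eventually_sequentially dist_commute less_imp_le) (meson less_imp_le)
  have meas: "(%y. indicator (bary_dom m) y *\<^sub>R H (bary m y)) \<in> borel_measurable ?M"
   if "continuous_on ?\<Delta> H" for H :: "(nat => real) => complex"
   using set_integrable_simplex[OF that] unfolding set_integrable_def by (rule borel_measurable_integrable)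
  have ch'a: "continuous_on ?\<Delta> (h' a)"
  proof -
   have "continuous_on ?\<Delta> ((%(x, w). h' w x) \<circ> (%x. (x, a)))"
    by (rule continuous_on_compose[OF _ continuous_on_subset[OF h']])
      (use ca in \<open>auto intro!: continuous_on_Pair continuous_on_id continuous_on_const\<close>)
   thus ?thesis by (simp add: comp_def)
  qed
  have "(%n. simplex_int m (Q n)) \<longlonglongrightarrow> simplex_int m (h' a)"
   unfolding simplex_int_def set_lebesgue_integral_def
  proof (rule integral_dominated_convergence[where w = "%y. indicator (bary_dom m) y *\<^sub>R C"])
   have "set_integrable ?M (bary_dom m) (%y. of_real C :: complex)"
    by (rule set_integrable_simplex[where H = "%_. of_real C"]) (rule continuous_on_const)
   from integrable_norm[OF this[unfolded set_integrable_def]]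
   have "integrable ?M (%y. indicator (bary_dom m) y * \<bar>C\<bar>)" by simp
   moreover have "bary m (%_. 0) \<in> ?\<Delta>" by (rule bary_in_standard_simplex) auto
   hence "0 \<le> C" using C[OF _ ca] norm_ge_zero order_trans by blast
   ultimately show "integrable ?M (%y. indicator (bary_dom m) y *\<^sub>R C)" by simp
   show "AE y in ?M. (%n. indicator (bary_dom m) y *\<^sub>R Q n (bary m y)) \<longlonglongrightarrow> indicator (bary_dom m) y *\<^sub>R h' a (bary m y)"
   proof (rule AE_I2)
    fix y
    show "(%n. indicator (bary_dom m) y *\<^sub>R Q n (bary m y)) \<longlonglongrightarrow> indicator (bary_dom m) y *\<^sub>R h' a (bary m y)"
    proof (cases "y \<in> bary_dom m")
     case True
     let ?x = "bary m y"
     have "((%w. (h w ?x - h a ?x) / (w - a)) \<longlongrightarrow> h' a ?x) (at a)"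
      using der[OF bary_dom_in_std[OF True] ca] by (simp add: has_field_derivative_iff)
     hence "(%n. (h (X n) ?x - h a ?x) / (X n - a)) \<longlonglongrightarrow> h' a ?x"
      using X unfolding tendsto_at_iff_sequentially comp_def by blast
     moreover have "\<forall>\<^sub>F n in sequentially. (h (X n) ?x - h a ?x) / (X n - a) = Q n ?x"
      using ev by eventually_elim (simp add: Q_def)
     ultimately have "(%n. Q n ?x) \<longlonglongrightarrow> h' a ?x" by (rule Lim_transform_eventually)
     thus ?thesis using True by simp
    qed simp
   qed
   show "AE y in ?M. norm (indicator (bary_dom m) y *\<^sub>R Q n (bary m y)) \<le> indicator (bary_dom m) y *\<^sub>R C" for n
   proof (rule AE_I2)
    fix y
    show "norm (indicator (bary_dom m) y *\<^sub>R Q n (bary m y)) \<le> indicator (bary_dom m) y *\<^sub>R C"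
    proof (cases "y \<in> bary_dom m")
     case True
     note x = bary_dom_in_std[OF True]
     have "0 \<le> C" using C[OF x ca] norm_ge_zero order_trans by blast
     moreover have "norm (h (X n) (bary m y) - h a (bary m y)) / norm (X n - a) \<le> C" if "X n \<in> cball a e"
      using bound[OF x that] X(1) by (simp add: divide_le_eq)
     ultimately have "norm (Q n (bary m y)) \<le> C" by (auto simp: Q_def norm_divide)
     thus ?thesis using True by simp
    qed simp
   qed
  qed (rule meas[OF ch'a] meas[OF Qc])+
  moreover have "\<forall>\<^sub>F n in sequentially. simplex_int m (Q n) = (simplex_int m (h (X n)) - simplex_int m (h a)) / (X n - a)"
   using ev
  proof eventually_elim
   case (elim n)
   have "Q n = (%x. (1 / (X n - a)) * (h (X n) x - h a x))" using elim by (auto simp: Q_def)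
   thus ?case using h[OF elim] h[OF ca] by (simp only: simplex_int_cmult simplex_int_diff) simp
  qed
  ultimately show "(%n. (simplex_int m (h (X n)) - simplex_int m (h a)) / (X n - a)) \<longlonglongrightarrow> simplex_int m (h' a)"
   by (rule Lim_transform_eventually)
 qed
 thus ?thesis by (simp add: has_field_derivative_iff)
qed

lemma simplex_int_add:
 "continuous_on (std p) H ==> continuous_on (std p) H' ==>
  simplex_int p (%x. H x + H' x) = simplex_int p H + simplex_int p H'"
 unfolding simplex_int_def by (intro set_integral_add set_integrable_simplex)

text \<open>Continuity is required only along smooth simplices carrying a branch, which suffices for
  additivity of their integrals. It follows from the nonvanishing of the linear forms there.\<close>

definition fibre_cont :: "master => (nat => complex) => (point => complex) => bool" where
 "fibre_cont A z F \<longleftrightarrow>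
   (\<forall>p \<sigma> \<phi>. branch_simplex A p z \<sigma> \<phi> --> continuous_on (std p) (%x. F (\<sigma> x, z)))"

lemma fibre_cont_lmono: "z \<in> base A ==> set L \<subseteq> lforms A ==> fibre_cont A z (lmono L)"
 and fibre_cont_theta: "z \<in> base A ==> set L \<subseteq> lforms A ==> fibre_cont A z (%p. theta A L p v)"
 unfolding fibre_cont_def using branch_simplex_lmono by blast+

lemma fibre_cont_const: "fibre_cont A z (%_. a)"
 unfolding fibre_cont_def by (blast intro: continuous_on_const)

lemma fibre_cont_add: "fibre_cont A z F ==> fibre_cont A z G ==> fibre_cont A z (%p. F p + G p)"
 unfolding fibre_cont_def by (intro allI impI continuous_on_add) blast+

lemma fibre_cont_mult: "fibre_cont A z F ==> fibre_cont A z G ==> fibre_cont A z (%p. F p * G p)"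
 unfolding fibre_cont_def by (intro allI impI continuous_on_mult) blast+

lemma fibre_cont_sum: "(!!i. i \<in> I ==> fibre_cont A z (F i)) ==> fibre_cont A z (%p. \<Sum>i\<in>I. F i p)"
 by (induction I rule: infinite_finite_induct) (auto intro: fibre_cont_const fibre_cont_add)

lemma simplex_integral_add:
 assumes b: "branch_simplex A p z \<sigma> \<phi>" and z: "z \<in> base A" and F: "fibre_cont A z F" and G: "fibre_cont A z G"
 shows "sint p z \<sigma> \<phi> (iform p \<iota> (%x. F x + G x))
  = sint p z \<sigma> \<phi> (iform p \<iota> F) + sint p z \<sigma> \<phi> (iform p \<iota> G)"
proof -
 obtain D DD where D: "!!k. simplex_derivs p (%x. \<sigma> x k) (D k) (DD k)"
  using smooth_simplex_derivs[of p \<sigma>] b unfolding branch_simplex_def by blast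
 have c: "continuous_on (std p) (%x. \<phi> x * (H (\<sigma> x, z) * pdet p (%a b. D (\<iota> a) b x)))"
  if "fibre_cont A z H" for H
  using that b D branch_simplex_continuous(2)[OF b z] unfolding fibre_cont_def
  by (intro continuous_on_mult continuous_on_pdet) (auto simp: simplex_derivs_def)
 show ?thesis unfolding simplex_integral_iform[OF D] distrib_left distrib_right
  by (rule simplex_int_add[OF c[OF F] c[OF G]])
qed

lemma simplex_integral_cmult:
 "sint p z \<sigma> \<phi> (%x w. a * \<omega> x w) = a * sint p z \<sigma> \<phi> \<omega>"
 unfolding simplex_integral_def by (simp add: mult.left_commute)

lemma twisted_integral_add:
 assumes c: "compact_twisted_cycle A z c" and z: "z \<in> base A" and F: "fibre_cont A z F" and G: "fibre_cont A z G"
 shows "tint A z c (iform (nvars A) \<iota> (%x. F x + G x))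
  = tint A z c (iform (nvars A) \<iota> F) + tint A z c (iform (nvars A) \<iota> G)"
proof -
 have fin: "finite (supp c)" and ch: "twisted_chain A (nvars A) z c"
  using c by (auto simp: compact_twisted_cycle_def)
 show ?thesis unfolding twisted_integral_finite[OF fin] sum.distrib[symmetric]
  by (intro sum.cong refl simplex_integral_add[OF twisted_chain_branch[OF ch] z F G])
qed

lemma twisted_integral_cmult:
 assumes c: "compact_twisted_cycle A z c"
 shows "tint A z c (iform q \<iota> (%x. a * F x)) = a * tint A z c (iform q \<iota> F)"
proof -
 have fin: "finite (supp c)" using c by (auto simp: compact_twisted_cycle_def)
 have "iform q \<iota> (%x. a * F x) = (%x w. a * iform q \<iota> F x w)" by (intro ext) (simp add: iform_def)
 thus ?thesis unfolding twisted_integral_finite[OF fin] sum_distrib_left by (simp add: simplex_integral_cmult)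
qed

lemma twisted_integral_sum:
 assumes c: "compact_twisted_cycle A z c" and z: "z \<in> base A" and I: "finite I" and F: "!!i. i \<in> I ==> fibre_cont A z (F i)"
 shows "tint A z c (iform (nvars A) \<iota> (%x. \<Sum>i\<in>I. F i x)) = (\<Sum>i\<in>I. tint A z c (iform (nvars A) \<iota> (F i)))"
 using I F
proof (induction I rule: finite_induct)
 case empty
 show ?case using twisted_integral_cmult[OF c, of "nvars A" \<iota> 0 "%_. 0"] by simp
next
 case (insert i I)
 thus ?case using twisted_integral_add[OF c z, of "F i" "%x. \<Sum>i\<in>I. F i x" \<iota>]
  by (simp add: fibre_cont_sum)
qed

text \<open>Functions whose integrals only depend on homology classes: linear combinations of the \<open>lmono L\<close>.\<close>

definition lincomb :: "master => (point => complex) => bool" where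
 "lincomb A F \<longleftrightarrow> (\<exists>xs. (\<forall>x\<in>set xs. set (snd x) \<subseteq> lforms A) \<and> F = (%p. \<Sum>x\<leftarrow>xs. fst x * lmono (snd x) p))"

lemma lincomb_lmono: "set L \<subseteq> lforms A ==> lincomb A (lmono L)"
 unfolding lincomb_def by (rule exI[of _ "[(1, L)]"]) simp

lemma lincomb_zero: "lincomb A (%_. 0)"
 unfolding lincomb_def by (rule exI[of _ "[]"]) simp

lemma lincomb_add: "lincomb A F ==> lincomb A G ==> lincomb A (%p. F p + G p)"
 unfolding lincomb_def
proof (elim exE conjE)
 fix xs ys assume "\<forall>x\<in>set xs. set (snd x) \<subseteq> lforms A" "F = (%p. \<Sum>x\<leftarrow>xs. fst x * lmono (snd x) p)"
  "\<forall>x\<in>set ys. set (snd x) \<subseteq> lforms A" "G = (%p. \<Sum>x\<leftarrow>ys. fst x * lmono (snd x) p)"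
 thus "\<exists>xs. (\<forall>x\<in>set xs. set (snd x) \<subseteq> lforms A) \<and> (%p. F p + G p) = (%p. \<Sum>x\<leftarrow>xs. fst x * lmono (snd x) p)"
  by (intro exI[of _ "xs @ ys"]) auto
qed

lemma lincomb_cmult: "lincomb A F ==> lincomb A (%p. a * F p)"
 unfolding lincomb_def
proof (elim exE conjE)
 fix xs assume "\<forall>x\<in>set xs. set (snd x) \<subseteq> lforms A" "F = (%p. \<Sum>x\<leftarrow>xs. fst x * lmono (snd x) p)"
 thus "\<exists>xs. (\<forall>x\<in>set xs. set (snd x) \<subseteq> lforms A) \<and> (%p. a * F p) = (%p. \<Sum>x\<leftarrow>xs. fst x * lmono (snd x) p)"
  by (intro exI[of _ "map (%x. (a * fst x, snd x)) xs"]) (auto simp: comp_def sum_list_const_mult mult.assoc)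
qed

lemma lincomb_sum: "(!!i. i \<in> I ==> lincomb A (F i)) ==> lincomb A (%p. \<Sum>i\<in>I. F i p)"
 by (induction I rule: infinite_finite_induct) (auto intro: lincomb_zero lincomb_add)

text \<open>Multiplying \<open>lmono L\<close> by the coefficient of \<open>dlog f\<close> on a
  fixed vector gives a multiple of \<open>lmono (f # L)\<close>. Multiplication by
  \<open>dlog_Phi\<close> therefore stays in the class whose integrals respect homology.\<close>

lemma lincomb_dlog_Phi:
 assumes L: "set L \<subseteq> lforms A"
 shows "lincomb A (%p. dlog_Phi A p v * lmono L p)"
proof -
 have d: "lincomb A (%p. a * dlog f p v * lmono L p)" if "f \<in> lforms A" for a f
 proof -
  have "lincomb A (%p. (a * f v) * lmono (f # L) p)" using that L by (intro lincomb_cmult lincomb_lmono) auto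
  thus ?thesis by (simp add: dlog_def mult_ac)
 qed
 have l: "lincomb A (lmono L)" by (rule lincomb_lmono[OF L])
 show ?thesis unfolding dlog_Phi_def distrib_right sum_distrib_right
  by (intro lincomb_add lincomb_sum lincomb_cmult[OF l] d lforms_memI) auto
qed

lemma fibre_cont_lincomb: "lincomb A F ==> z \<in> base A ==> fibre_cont A z F"
 unfolding lincomb_def
proof (elim exE conjE)
 fix xs assume z: "z \<in> base A" and "\<forall>x\<in>set xs. set (snd x) \<subseteq> lforms A" "F = (%p. \<Sum>x\<leftarrow>xs. fst x * lmono (snd x) p)"
 thus "fibre_cont A z F"
  by (induction xs arbitrary: F) (auto intro!: fibre_cont_const fibre_cont_add fibre_cont_mult fibre_cont_lmono)
qed

lemma twisted_integral_homologous_lincomb: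
 assumes c: "compact_twisted_cycle A z c" "compact_twisted_cycle A z c'" and h: "twisted_homologous A z c c'"
  and z: "z \<in> base A" and F: "lincomb A F"
 shows "tint A z c (iform (nvars A) id F) = tint A z c' (iform (nvars A) id F)"
proof -
 obtain xs where xs: "\<forall>x\<in>set xs. set (snd x) \<subseteq> lforms A" and F: "F = (%p. \<Sum>x\<leftarrow>xs. fst x * lmono (snd x) p)"
  using F unfolding lincomb_def by blast
 show ?thesis unfolding F using xs
 proof (induction xs)
  case Nil
  show ?case using twisted_integral_cmult[OF c(1), of "nvars A" id 0 "%_. 0"] twisted_integral_cmult[OF c(2), of "nvars A" id 0 "%_. 0"]
   by (simp add: id_def)
 next
  case (Cons x xs)
  have x: "set (snd x) \<subseteq> lforms A" and xs: "\<forall>x\<in>set xs. set (snd x) \<subseteq> lforms A" using Cons.prems by auto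
  have "lincomb A (%p. \<Sum>x\<leftarrow>xs. fst x * lmono (snd x) p)" unfolding lincomb_def using xs by blast
  note f = fibre_cont_mult[OF fibre_cont_const fibre_cont_lmono[OF z x]] fibre_cont_lincomb[OF this z]
  show ?case unfolding list.map sum_list.Cons
   unfolding twisted_integral_add[OF c(1) z f] twisted_integral_add[OF c(2) z f]
    twisted_integral_cmult[OF c(1)] twisted_integral_cmult[OF c(2)]
    twisted_integral_homologous[OF c h z x] Cons.IH[OF xs] ..
 qed
qed

definition zhom :: "nat => (point => complex) => bool" where
 "zhom i f \<longleftrightarrow> (\<forall>h. f ((%_. 0), (%j. if j = i then h else 0)) = h * f (unit_z i))"

lemma zhom_theta: "set L \<subseteq> lforms A ==> zhom i (theta A L p)"
proof -
 assume L: "set L \<subseteq> lforms A"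
 have a: "zhom i (%v. f v + g v)" "zhom i (%v. f v - g v)" "zhom i (%v. a * f v)" "zhom i (%v. f v / a)"
  if "zhom i f" "zhom i g" for f g a
  using that by (simp_all add: zhom_def ring_distribs)
 have c: "zhom i (%v. fst v j)" "zhom i (%v. snd v j)" "zhom i (%v. 0)" for j by (simp_all add: zhom_def unit_z_def)
 have f: "zhom i f" if "f \<in> lforms A" for f
  using that unfolding lforms_def tz_def tt_def zz_def case_prod_beta by (auto intro: a c)
 have d: "zhom i (dlog f p)" if "f \<in> lforms A" for f
  unfolding dlog_def[abs_def] by (rule a(4)[OF f[OF that] f[OF that]])
 have "zhom i (dlog_Phi A p)"
 proof -
  have "zhom i (%v. \<Sum>k<nvars A. coef_t A k * fst v k)" "zhom i (%v. \<Sum>j<npts A. coef_z A j * snd v j)"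
   unfolding zhom_def unit_z_def sum_distrib_left by (auto intro!: sum.cong)
  moreover have "zhom i (%v. \<Sum>j<npts A. \<Sum>i<j. exp_zz A i j * dlog (zz i j) p v)"
   "zhom i (%v. \<Sum>k<nvars A. \<Sum>j<npts A. exp_tz A k j * dlog (tz k j) p v)"
   "zhom i (%v. \<Sum>l<nvars A. \<Sum>k<l. exp_tt A k l * dlog (tt k l) p v)"
   using d[OF lforms_memI(1)] d[OF lforms_memI(2)] d[OF lforms_memI(3)]
   unfolding zhom_def sum_distrib_left by (auto intro!: sum.cong simp: mult_ac)
  ultimately show ?thesis unfolding dlog_Phi_def zhom_def by (simp add: ring_distribs)
 qed
 moreover have "zhom i (dlog_sum L p)"
  using L d unfolding dlog_sum_def zhom_def by (induction L) (auto simp: ring_distribs)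
 ultimately show "zhom i (theta A L p)"
  unfolding theta_def[abs_def] zhom_def by (simp add: ring_distribs mult_ac)
qed

text \<open>The simplex is held fixed while \<open>z i\<close> moves, so its Jacobian
  \<open>J\<close> is constant in \<open>w\<close> and only the branch and the rational factor are
  differentiated.\<close>

lemma simplex_integral_has_field_derivative:
 fixes b :: "(nat => complex) => (nat => real) => complex"
 assumes e: "e > 0" "!!w. w \<in> ball (z i) (2 * e) ==> z(i := w) \<in> N" and N: "N \<subseteq> base A"
  and i: "i < npts A"
  and sm: "smooth_simplex (nvars A) \<sigma>"
  and sing: "!!z. z \<in> N ==> singular_simplex (nvars A) (top_of_set (fibre A z)) \<sigma>"
  and fl: "flat_section A (std (nvars A) \<times> N) (%(x, z). (\<sigma> x, z)) (%(x, z). b z x)"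
  and L: "set L \<subseteq> lforms A"
 shows "((%w. sint (nvars A) (z(i := w)) \<sigma> (b (z(i := w))) (iform (nvars A) id (lmono L)))
   has_field_derivative sint (nvars A) z \<sigma> (b z) (iform (nvars A) id (%p. lmono L p * theta A L p (unit_z i)))) (at (z i))"
proof -
 let ?m = "nvars A" let ?\<Delta> = "std ?m"
 obtain D DD where D: "!!k. simplex_derivs ?m (%x. \<sigma> x k) (D k) (DD k)"
  using smooth_simplex_derivs[OF sm] by blast
 define J where "J x = pdet ?m (%a b. D (id a) b x)" for x
 have J: "continuous_on ?\<Delta> J"
  unfolding J_def[abs_def] using D by (intro continuous_on_pdet) (auto simp: simplex_derivs_def)
 let ?P = "%x w. (\<sigma> x, z(i := w))"
 define h where "h w x = b (z(i := w)) x * (lmono L (?P x w) * J x)" for w x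
 define h' where "h' w x = b (z(i := w)) x * (lmono L (?P x w) * theta A L (?P x w) (unit_z i) * J x)" for w x
 \<comment> \<open>The hypotheses hold on a disc of radius 2e, so that the closed disc of radius e,
   on which bounds are taken, has an open neighbourhood inside it.\<close>
 have sub: "cball (z i) e \<subseteq> ball (z i) (2 * e)" using e(1) by auto
 have inN: "z(i := w) \<in> N" if "w \<in> cball (z i) e" for w using e(2) sub that by blast
 have zN: "z \<in> N" using inN[of "z i"] e(1) by simp
 have inF: "\<sigma> x \<in> fibre A (z(i := w))" if "x \<in> ?\<Delta>" "w \<in> ball (z i) (2 * e)" for x w
  using singular_simplex_fibre(2)[OF sing[OF e(2)[OF that(2)]]] that(1) by blast
 have nz: "f (?P x w) ~= 0" if "x \<in> ?\<Delta>" "w \<in> ball (z i) (2 * e)" "f \<in> lforms A" for x w f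
  using lforms_nonzero[OF that(3) _ inF[OF that(1,2)]] e(2)[OF that(2)] N by blast
 have cs: "continuous_on (?\<Delta> \<times> B) (%s. \<sigma> (fst s) k)" for B :: "complex set" and k
 proof -
  have "continuous_on ?\<Delta> (%x. \<sigma> x k)"
   by (rule continuous_on_product_then_coordinatewise[OF singular_simplex_fibre(1)[OF sing[OF zN]]])
  thus ?thesis by (rule continuous_on_compose2[OF _ continuous_on_fst[OF continuous_on_id]]) auto
 qed
 have cz: "continuous_on S (%s. (z(i := g s)) j)" if "continuous_on S g" for S :: "'q::topological_space set" and g j
  using that by (cases "j = i") (auto intro: continuous_on_const)
 have flc: "flat_section A (?\<Delta> \<times> cball (z i) e) (%s. ?P (fst s) (snd s)) (%s. b (z(i := snd s)) (fst s))"
 proof -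
  have "flat_section A (?\<Delta> \<times> cball (z i) e) (%s. (%(x, z). (\<sigma> x, z)) (fst s, z(i := snd s))) (%s. (%(x, z). b z x) (fst s, z(i := snd s)))"
  proof (rule flat_section_compose[OF fl])
   show "continuous_on (?\<Delta> \<times> cball (z i) e) (%s. (fst s, z(i := snd s)))"
    by (intro continuous_on_Pair continuous_on_fst continuous_on_id
      continuous_on_coordinatewise_then_product cz continuous_on_snd)
  qed (use inN in auto)
  thus ?thesis by simp
 qed
 have cb: "continuous_on (?\<Delta> \<times> cball (z i) e) (%s. b (z(i := snd s)) (fst s))"
  by (rule continuous_on_flat_section[OF flc]) (auto intro!: cs cz continuous_on_snd continuous_on_id simp del: fun_upd_apply)
 have clf: "continuous_on (?\<Delta> \<times> cball (z i) e) (%s. f (?P (fst s) (snd s)))" if "f \<in> lforms A" for f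
  by (rule continuous_on_lforms[OF that]) (auto intro!: cs cz continuous_on_snd continuous_on_id simp del: fun_upd_apply)
 have nz': "f (?P (fst s) (snd s)) ~= 0" if "s \<in> ?\<Delta> \<times> cball (z i) e" "f \<in> lforms A" for s f
  by (rule nz[OF _ _ that(2)]) (use that(1) sub in auto)
 have clm: "continuous_on (?\<Delta> \<times> cball (z i) e) (%s. lmono L (?P (fst s) (snd s)))"
  by (rule continuous_on_lmono[OF L]) (auto intro!: cs cz continuous_on_snd continuous_on_id simp del: fun_upd_apply dest: nz'[rotated])
 have cth: "continuous_on (?\<Delta> \<times> cball (z i) e) (%s. theta A L (?P (fst s) (snd s)) (unit_z i))"
  by (rule continuous_on_theta[OF L clf nz'])
 have cJ: "continuous_on (?\<Delta> \<times> cball (z i) e) (%s. J (fst s))"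
  by (rule continuous_on_compose2[OF J continuous_on_fst[OF continuous_on_id]]) auto
 have ch': "continuous_on (?\<Delta> \<times> cball (z i) e) (%(x, w). h' w x)"
  unfolding h'_def case_prod_beta by (intro continuous_on_mult cb clm cth cJ)
 have chw: "continuous_on ?\<Delta> (h w)" if "w \<in> cball (z i) e" for w
 proof -
  have "continuous_on (?\<Delta> \<times> cball (z i) e) (%s. h (snd s) (fst s))"
   unfolding h_def by (intro continuous_on_mult cb clm cJ)
  hence "continuous_on ?\<Delta> (%x. h (snd (x, w)) (fst (x, w)))"
   by (rule continuous_on_compose2) (use that in \<open>auto intro!: continuous_on_Pair continuous_on_id continuous_on_const\<close>)
  thus ?thesis by simp
 qed
 have der: "((%w. h w x) has_field_derivative h' w x) (at w)" if x: "x \<in> ?\<Delta>" and w: "w \<in> cball (z i) e" for x w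
 proof -
  let ?T = "ball (z i) (2 * e)"
  let ?P' = "%d::complex. ((%_. 0), (%j. if j = i then d else 0)) :: point"
  have wT: "w \<in> ?T" using w sub by blast
  have "((%w. b (z(i := w)) x * lmono L (?P x w)) has_derivative
   (%d. b (z(i := w)) x * lmono L (?P x w) * (1 / kap A * dlog_Phi A (?P x w) (?P' d) - dlog_sum L (?P x w) (?P' d)))) (at w)"
  proof (rule flat_mono_has_derivative[where T = ?T])
   have "flat_section A ?T (%w. (%(x, z). (\<sigma> x, z)) (x, z(i := w))) (%w. (%(x, z). b z x) (x, z(i := w)))"
   proof (rule flat_section_compose[OF fl])
    show "continuous_on ?T (%w. (x, z(i := w)))"
     by (intro continuous_on_Pair continuous_on_const continuous_on_coordinatewise_then_product cz continuous_on_id)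
   qed (use x e(2) in auto)
   thus "flat_section A ?T (?P x) (%w. b (z(i := w)) x)" by simp
   show "((%w. fst (?P x w) k) has_derivative (%h. fst (?P' h) k)) (at w)" for k by simp
   show "((%w. snd (?P x w) j) has_derivative (%h. snd (?P' h) j)) (at w)" for j by (cases "j = i") simp_all
  qed (use wT nz x L in auto)
  also have "(%d. b (z(i := w)) x * lmono L (?P x w) * (1 / kap A * dlog_Phi A (?P x w) (?P' d) - dlog_sum L (?P x w) (?P' d)))
   = (%d. (b (z(i := w)) x * lmono L (?P x w) * theta A L (?P x w) (unit_z i)) * d)"
   using zhom_theta[OF L, of i "?P x w"] unfolding zhom_def theta_def[symmetric] by (auto simp: mult_ac)
  finally have "((%w. b (z(i := w)) x * lmono L (?P x w)) has_field_derivative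
    b (z(i := w)) x * lmono L (?P x w) * theta A L (?P x w) (unit_z i)) (at w)"
   by (simp only: has_field_derivative_def)
  from DERIV_cmult_right[OF this, of "J x"] show ?thesis unfolding h_def h'_def by (simp add: mult_ac)
 qed
 have "((%w. simplex_int ?m (h w)) has_field_derivative simplex_int ?m (h' (z i))) (at (z i))"
  by (rule simplex_int_has_field_derivative[OF e(1) chw ch' der])
 thus ?thesis unfolding simplex_integral_iform[OF D] h_def[abs_def] h'_def[abs_def] J_def by simp
qed

lemma base_open_line:
 assumes N: "openin (top_of_set (base A)) N" and z: "z \<in> N" and i: "i < npts A"
 obtains e where "e > 0" "!!w. w \<in> ball (z i) (2 * e) ==> z(i := w) \<in> N"
proof -
 obtain O' where O': "open O'" "N = base A \<inter> O'" using N by (auto simp: openin_open)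
 have zb: "z \<in> base A" using z O' by auto
 have "open ((%w. z(i := w)) -` O')"
 proof (rule open_vimage[OF O'(1)])
  show "continuous_on UNIV (%w. z(i := w))"
  proof (rule continuous_on_coordinatewise_then_product)
   fix j show "continuous_on UNIV (%w. (z(i := w)) j)" by (cases "j = i") auto
  qed
 qed
 moreover have "z i \<in> (%w. z(i := w)) -` O'" using z O' by simp
 ultimately obtain e1 where e1: "e1 > 0" "ball (z i) e1 \<subseteq> (%w. z(i := w)) -` O'"
  by (meson open_contains_ball)
 have "open (- z ` ({..<npts A} - {i}))" by (intro open_Compl finite_imp_closed) auto
 moreover have "z i \<in> - z ` ({..<npts A} - {i})"
  using zb i by (auto simp: base_def inj_on_def)
 ultimately obtain e2 where e2: "e2 > 0" "ball (z i) e2 \<subseteq> - z ` ({..<npts A} - {i})"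
  by (meson open_contains_ball)
 have inb: "z(i := w) \<in> base A" if w: "w \<in> ball (z i) e2" for w
 proof -
  have w': "w ~= z j" if "j < npts A" "j ~= i" for j using w e2(2) that by auto
  have "inj_on (z(i := w)) {..<npts A}"
  proof (rule inj_onI)
   fix a b assume "a \<in> {..<npts A}" "b \<in> {..<npts A}" "(z(i := w)) a = (z(i := w)) b"
   thus "a = b" using w' zb by (auto simp: base_def inj_on_def split: if_splits)
  qed
  thus ?thesis using zb i by (auto simp: base_def)
 qed
 show thesis
 proof (rule that[of "min e1 e2 / 2"])
  fix w assume "w \<in> ball (z i) (2 * (min e1 e2 / 2))"
  hence w: "w \<in> ball (z i) e1" "w \<in> ball (z i) e2" by auto
  thus "z(i := w) \<in> N" using e1(2) inb O'(2) by auto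
 qed (use e1 e2 in auto)
qed

text \<open>The homologous family \<open>b\<close> lives on finitely many fixed simplices and can be
  differentiated term by term. Adding the vanishing integrals of the derivatives in t_k for
  \<open>k \<in> S\<close> removes the derivative of \<open>lmono L\<close> by \<open>kill\<close>,
  and what remains is a class for which \<open>b z\<close> may be exchanged for
  \<open>\<gamma> z\<close> again.\<close>

lemma horizontal_compact_derivative:
 assumes hc: "horizontal_compact A U \<gamma>" and U: "openin (top_of_set (base A)) U" and z: "z \<in> U" and i: "i < npts A"
  and L: "set L \<subseteq> lforms A" and S: "S \<subseteq> {..<nvars A}"
  and kill: "!!f. f \<in> set L ==> f (unit_z i) + (\<Sum>k\<in>S. f (unit_t k)) = 0"
 shows "((%w. tint A (z(i := w)) (\<gamma> (z(i := w))) (iform (nvars A) id (lmono L)))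
   has_field_derivative tint A z (\<gamma> z) (iform (nvars A) id
    (%p. 1 / kap A * ((dlog_Phi A p (unit_z i) + (\<Sum>k\<in>S. dlog_Phi A p (unit_t k))) * lmono L p)))) (at (z i))"
proof -
 let ?m = "nvars A" let ?\<omega> = "iform (nvars A) id (lmono L)" let ?\<Delta> = "std (nvars A)"
 have "\<exists>N K b. openin (top_of_set U) N \<and> z \<in> N \<and> finite K \<and>
    (\<forall>z\<in>N. compact_twisted_cycle A z (b z) \<and> supp (b z) \<subseteq> K \<and> twisted_homologous A z (\<gamma> z) (b z)) \<and>
    (\<forall>\<sigma>\<in>K. flat_section A (?\<Delta> \<times> N) (%(x, z). (\<sigma> x, z)) (%(x, z). b z \<sigma> x))"
  using hc[unfolded horizontal_compact_def, THEN conjunct2] z by (rule bspec)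
 then obtain N K b where N: "openin (top_of_set U) N" "z \<in> N" "finite K"
  and bN: "\<forall>z\<in>N. compact_twisted_cycle A z (b z) \<and> supp (b z) \<subseteq> K \<and> twisted_homologous A z (\<gamma> z) (b z)"
  and flN: "\<forall>\<sigma>\<in>K. flat_section A (?\<Delta> \<times> N) (%(x, z). (\<sigma> x, z)) (%(x, z). b z \<sigma> x)"
  by (elim exE conjE) (rule that; assumption)
 have b: "!!z. z \<in> N ==> compact_twisted_cycle A z (b z)" "!!z. z \<in> N ==> supp (b z) \<subseteq> K"
   "!!z. z \<in> N ==> twisted_homologous A z (\<gamma> z) (b z)"
  using bN by blast+
 have fl: "flat_section A (?\<Delta> \<times> N) (%(x, z). (\<sigma> x, z)) (%(x, z). b z \<sigma> x)" if "\<sigma> \<in> K" for \<sigma>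
  using flN that by (rule bspec)
 have cyc: "compact_twisted_cycle A z (\<gamma> z)" if "z \<in> U" for z using hc that by (simp add: horizontal_compact_def)
 have Nb: "openin (top_of_set (base A)) N" by (rule openin_trans[OF N(1) U])
 have NU: "N \<subseteq> U" and NB: "N \<subseteq> base A" using openin_imp_subset[OF N(1)] openin_imp_subset[OF Nb] by auto
 have zB: "z \<in> base A" using N NB by auto
 obtain e where e: "e > 0" "!!w. w \<in> ball (z i) (2 * e) ==> z(i := w) \<in> N"
  using base_open_line[OF Nb N(2) i] by blast
 have fin: "finite (supp (b z))" if "z \<in> N" for z using finite_subset[OF b(2)[OF that] N(3)] .
 have TK: "tint A z' (b z') \<omega> = (\<Sum>\<sigma>\<in>K. sint ?m z' \<sigma> (b z' \<sigma>) \<omega>)" if "z' \<in> N" for z' \<omega>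
  unfolding twisted_integral_finite[OF fin[OF that]]
 proof (rule sum.mono_neutral_left[OF N(3) b(2)[OF that]], rule ballI)
  fix \<sigma> assume "\<sigma> \<in> K - supp (b z')"
  hence "b z' \<sigma> = (%_. 0)" by (simp add: supp_def)
  thus "sint ?m z' \<sigma> (b z' \<sigma>) \<omega> = 0" by (simp only: simplex_integral_zero)
 qed
 have der: "((%w. sint ?m (z(i := w)) \<sigma> (b (z(i := w)) \<sigma>) ?\<omega>)
   has_field_derivative sint ?m z \<sigma> (b z \<sigma>) (iform ?m id (%p. lmono L p * theta A L p (unit_z i)))) (at (z i))"
  if \<sigma>: "\<sigma> \<in> K" for \<sigma>
 proof -
  have ne: "bary ?m (%_. 0) \<in> ?\<Delta>" by (rule bary_in_standard_simplex) auto
  \<comment> \<open>Over the whole family the branch on \<open>\<sigma>\<close> is a constant times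
    an exponential. So either it vanishes identically, or \<open>\<sigma>\<close> lies in the
    support for every \<open>z\<close> in \<open>N\<close> and is a simplex in every fibre.\<close>
  obtain C E where E: "!!s. s \<in> ?\<Delta> \<times> N ==> (case s of (x, z) => b z \<sigma> x) = C * exp (E s)"
  proof (rule flat_sectionE[OF fl[OF \<sigma>]], goal_cases)
   case (1 C Lzz Ltz Ltt)
   show ?case by (rule that[OF 1(8)])
  qed
  show ?thesis
  proof (cases "C = 0")
   case True
   have 0: "sint ?m z' \<sigma> (b z' \<sigma>) \<omega> = 0" if "z' \<in> N" for z' \<omega>
   proof -
    have "b z' \<sigma> x = 0" if "x \<in> ?\<Delta>" for x using E[of "(x, z')"] \<open>z' \<in> N\<close> that True by simp
    hence "sint ?m z' \<sigma> (b z' \<sigma>) \<omega> = sint ?m z' \<sigma> (%_. 0) \<omega>"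
     by (rule simplex_integral_cong)
    thus ?thesis by (simp only: simplex_integral_zero)
   qed
   have "((%w. 0 :: complex) has_field_derivative 0) (at (z i))" by simp
   hence "((%w. sint ?m (z(i := w)) \<sigma> (b (z(i := w)) \<sigma>) ?\<omega>) has_field_derivative 0) (at (z i))"
    by (rule has_field_derivative_transform_within_open[of _ _ _ "ball (z i) (2 * e)"]) (use e 0 in auto)
   thus ?thesis by (simp only: 0[OF N(2)])
  next
   case False
   have su: "\<sigma> \<in> supp (b z')" if "z' \<in> N" for z'
   proof -
    have "b z' \<sigma> (bary ?m (%_. 0)) ~= 0" using E[of "(bary ?m (%_. 0), z')"] that ne False by simp
    thus ?thesis unfolding supp_def by auto
   qed
   have ch: "branch_simplex A ?m z' \<sigma> (b z' \<sigma>)" if "z' \<in> N" for z'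
    using b(1)[OF that] su[OF that] by (intro twisted_chain_branch) (simp_all add: compact_twisted_cycle_def)
   show ?thesis
    by (rule simplex_integral_has_field_derivative[where b = "%z. b z \<sigma>", OF e NB i _ _ fl[OF \<sigma>] L])
      (use ch N(2) in \<open>auto simp: branch_simplex_def\<close>)
  qed
 qed
 have "((%w. \<Sum>\<sigma>\<in>K. sint ?m (z(i := w)) \<sigma> (b (z(i := w)) \<sigma>) ?\<omega>)
   has_field_derivative (\<Sum>\<sigma>\<in>K. sint ?m z \<sigma> (b z \<sigma>) (iform ?m id (%p. lmono L p * theta A L p (unit_z i))))) (at (z i))"
  by (rule DERIV_sum[OF der])
 hence "((%w. \<Sum>\<sigma>\<in>K. sint ?m (z(i := w)) \<sigma> (b (z(i := w)) \<sigma>) ?\<omega>)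
   has_field_derivative tint A z (b z) (iform ?m id (%p. lmono L p * theta A L p (unit_z i)))) (at (z i))"
  by (simp only: TK[OF N(2)])
 hence main: "((%w. tint A (z(i := w)) (\<gamma> (z(i := w))) ?\<omega>)
   has_field_derivative tint A z (b z) (iform ?m id (%p. lmono L p * theta A L p (unit_z i)))) (at (z i))"
 proof (rule has_field_derivative_transform_within_open[of _ _ _ "ball (z i) (2 * e)"])
  fix w assume "w \<in> ball (z i) (2 * e)"
  hence w: "z(i := w) \<in> N" by (rule e(2))
  have "tint A (z(i := w)) (\<gamma> (z(i := w))) ?\<omega> = tint A (z(i := w)) (b (z(i := w))) ?\<omega>"
   using w NU NB by (intro twisted_integral_homologous cyc b L) auto
  thus "(\<Sum>\<sigma>\<in>K. sint ?m (z(i := w)) \<sigma> (b (z(i := w)) \<sigma>) ?\<omega>) = tint A (z(i := w)) (\<gamma> (z(i := w))) ?\<omega>"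
   by (simp only: TK[OF w])
 qed (use e in auto)
 define F where "F p = 1 / kap A * ((dlog_Phi A p (unit_z i) + (\<Sum>k\<in>S. dlog_Phi A p (unit_t k))) * lmono L p)" for p
 \<comment> \<open>Translating \<open>z i\<close> together with the variables in \<open>S\<close>
   leaves all forms in \<open>L\<close> unchanged, so their logarithmic derivatives cancel in the
   sum and only \<open>dlog_Phi\<close> is left.\<close>
 have Feq: "F p = lmono L p * theta A L p (unit_z i) + (\<Sum>k\<in>S. lmono L p * theta A L p (unit_t k))" for p
 proof -
  have "dlog_sum L p (unit_z i) + (\<Sum>k\<in>S. dlog_sum L p (unit_t k)) = 0"
   using kill unfolding dlog_sum_def dlog_def
  proof (induction L)
   case (Cons f L)
   have "f (unit_z i) / f p + (\<Sum>k\<in>S. f (unit_t k) / f p) = 0"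
    using Cons.prems[of f] by (simp add: sum_divide_distrib[symmetric] add_divide_distrib[symmetric])
   thus ?case using Cons by (simp add: sum.distrib algebra_simps)
  qed simp
  hence "theta A L p (unit_z i) + (\<Sum>k\<in>S. theta A L p (unit_t k)) = 1 / kap A * (dlog_Phi A p (unit_z i) + (\<Sum>k\<in>S. dlog_Phi A p (unit_t k)))"
   unfolding theta_def by (simp add: sum_subtractf sum_distrib_left[symmetric] algebra_simps add_divide_distrib flip: sum_divide_distrib)
  thus ?thesis unfolding F_def sum_distrib_left[symmetric] distrib_left[symmetric] by (simp add: mult_ac)
 qed
 have finS: "finite S" using S finite_subset by blast
 have fc: "fibre_cont A z (%p. lmono L p * theta A L p v)" for v
  by (intro fibre_cont_mult fibre_cont_lmono fibre_cont_theta zB L)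
 \<comment> \<open>This is what allows the return from \<open>b z\<close> to the given cycle
   \<open>\<gamma> z\<close>.\<close>
 have lin: "lincomb A F"
 proof -
  have eqF: "F = (%p. 1 / kap A * (dlog_Phi A p (unit_z i) * lmono L p + (\<Sum>k\<in>S. dlog_Phi A p (unit_t k) * lmono L p)))"
   unfolding F_def[abs_def] by (simp add: distrib_right sum_distrib_right)
  show ?thesis unfolding eqF by (intro lincomb_cmult lincomb_add lincomb_sum lincomb_dlog_Phi L)
 qed
 have "tint A z (b z) (iform ?m id (%p. lmono L p * theta A L p (unit_z i))) = tint A z (b z) (iform ?m id F)"
 proof -
  have "tint A z (b z) (iform ?m id F) = tint A z (b z) (iform ?m id (%p. lmono L p * theta A L p (unit_z i)))
    + (\<Sum>k\<in>S. tint A z (b z) (iform ?m id (%p. lmono L p * theta A L p (unit_t k))))"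
   unfolding Feq[abs_def] twisted_integral_add[OF b(1)[OF N(2)] zB fc fibre_cont_sum[OF fc]]
   by (simp only: twisted_integral_sum[OF b(1)[OF N(2)] zB finS fc])
  moreover have "tint A z (b z) (iform ?m id (%p. lmono L p * theta A L p (unit_t k))) = 0" if "k \<in> S" for k
   using S that by (intro twisted_integral_exact[OF b(1)[OF N(2)] zB L]) auto
  ultimately show ?thesis by simp
 qed
 also have "... = tint A z (\<gamma> z) (iform ?m id F)"
  by (rule twisted_integral_homologous_lincomb[OF cyc[OF z] b(1)[OF N(2)] b(3)[OF N(2)] zB lin, symmetric])
 finally show ?thesis using main unfolding F_def[abs_def] by simp
qed

section \<open>The forms attached to words\<close>

fun block_forms :: "nat list => nat => (point => complex) list" where
 "block_forms [] j = []"
| "block_forms [k] j = [tz k j]"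
| "block_forms (k # l # ks) j = tt k l # block_forms (l # ks) j"

definition word_forms :: "nat list list => (point => complex) list" where
 "word_forms W = concat (map (%j. block_forms (W ! j) j) [0..<length W])"

lemma omega_block_eq: "omega_block w j = map dlog (block_forms w j)"
 by (induction w j rule: block_forms.induct) simp_all

lemma omega_eq: "omega I \<sigma> = map dlog (word_forms (map (block I \<sigma>) [0..<length I]))"
 unfolding omega_def word_forms_def map_concat
 by (auto simp: omega_block_eq comp_def intro!: arg_cong[where f = concat] map_cong)

lemma pdet_permute_rows:
 assumes "\<sigma> permutes {..<m}"
 shows "pdet m (%a b. N (\<sigma> a) b) = of_int (sign \<sigma>) * pdet m N"
proof -
 have s: "\<sigma> permutes {0..<m}" using assms by (simp add: atLeast0LessThan)
 have "mat m m (%(i, j). N (\<sigma> i) j) = mat m m (%(i, j). mat m m (%(i, j). N i j) $$ (\<sigma> i, j))"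
  using permutes_in_image[OF s] by (intro eq_matI) auto
 thus ?thesis unfolding pdet_eq_det using det_permute_rows[OF _ s, of "mat m m (%(i, j). N i j)"] by simp
qed

lemma pdet_transpose: "pdet m (%a b. M b a) = pdet m M"
proof -
 have "mat m m (%(i, j). M j i) = transpose_mat (mat m m (%(i, j). M i j))" by (intro eq_matI) auto
 thus ?thesis unfolding pdet_eq_det using det_transpose[of "mat m m (%(i, j). M i j)" m] by simp
qed

lemma pdet_unitriangular:
 assumes "!!a. a < m ==> X a a = 1" "!!a c. c < a ==> a < m ==> X a c = 0"
 shows "pdet m X = 1"
proof -
 have "Determinant.det (mat m m (%(i, j). X i j)) = prod_list (diag_mat (mat m m (%(i, j). X i j)))"
  by (rule det_upper_triangular) (use assms in \<open>auto simp: upper_triangular_def\<close>)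
 also have "diag_mat (mat m m (%(i, j). X i j)) = map (%_. 1) [0..<m]"
  unfolding diag_mat_def using assms by (intro map_cong) auto
 also have "prod_list (map (%_. 1) [0..<m]) = (1::complex)" by (induction m) auto
 finally show ?thesis unfolding pdet_eq_det .
qed

text \<open>On vertical tangent vectors the forms of a word are \<open>dt\<^bsub>\<kappa> a\<^esub>\<close>, up to a multiple of the next one.\<close>

definition triangular_forms :: "(point => complex) list => nat list => bool" where
 "triangular_forms L ks \<longleftrightarrow> length L = length ks \<and>
   (\<exists>e. \<forall>a<length ks. (e a --> Suc a < length ks) \<and>
    (\<forall>u. (L ! a) (u, %_. 0) = u (ks ! a) - (if e a then u (ks ! Suc a) else 0)))"

lemma triangular_forms_append:
 assumes "triangular_forms L ks" "triangular_forms L' ks'"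
 shows "triangular_forms (L @ L') (ks @ ks')"
proof -
 obtain e e' where l: "length L = length ks" "length L' = length ks'"
  and e: "!!a. a < length ks ==> e a ==> Suc a < length ks"
   "!!a u. a < length ks ==> (L ! a) (u, %_. 0) = u (ks ! a) - (if e a then u (ks ! Suc a) else 0)"
  and e': "!!a. a < length ks' ==> e' a ==> Suc a < length ks'"
   "!!a u. a < length ks' ==> (L' ! a) (u, %_. 0) = u (ks' ! a) - (if e' a then u (ks' ! Suc a) else 0)"
  using assms unfolding triangular_forms_def by metis
 define E where "E a = (if a < length ks then e a else e' (a - length ks))" for a
 have "(E a --> Suc a < length (ks @ ks')) \<and>
   (\<forall>u. ((L @ L') ! a) (u, %_. 0) = u ((ks @ ks') ! a) - (if E a then u ((ks @ ks') ! Suc a) else 0))"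
  if a: "a < length (ks @ ks')" for a
 proof (cases "a < length ks")
  case True
  thus ?thesis using e[of a] l by (auto simp: E_def nth_append)
 next
  case False
  then obtain a' where a': "a = length ks + a'" "a' < length ks'" using a by (metis add_diff_inverse_nat length_append nat_add_left_cancel_less)
  thus ?thesis using e'[of a'] l by (auto simp: E_def nth_append Suc_diff_le)
 qed
 thus ?thesis unfolding triangular_forms_def using l by auto
qed

lemma triangular_block_forms: "triangular_forms (block_forms w j) w"
proof (induction w j rule: block_forms.induct)
 case (1 j) show ?case by (simp add: triangular_forms_def)
next
 case (2 k j) show ?case unfolding triangular_forms_def
  by (auto simp: tz_def intro!: exI[of _ "%_. False"])
next
 case (3 k l ks j)
 obtain e where l: "length (block_forms (l # ks) j) = length (l # ks)"
  and e: "!!a. a < length (l # ks) ==> e a ==> Suc a < length (l # ks)"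
   "!!a u. a < length (l # ks) ==> (block_forms (l # ks) j ! a) (u, %_. 0) = u ((l # ks) ! a) - (if e a then u ((l # ks) ! Suc a) else 0)"
  using 3 unfolding triangular_forms_def by metis
 have "((case a of 0 => True | Suc a => e a) --> Suc a < length (k # l # ks)) \<and>
   (\<forall>u. (block_forms (k # l # ks) j ! a) (u, %_. 0) = u ((k # l # ks) ! a) -
    (if (case a of 0 => True | Suc a => e a) then u ((k # l # ks) ! Suc a) else 0))"
  if "a < length (k # l # ks)" for a
 proof (cases a)
  case 0 thus ?thesis by (simp add: tt_def)
 next
  case (Suc a') thus ?thesis using that e[of a'] by auto
 qed
 thus ?case unfolding triangular_forms_def using l
  by (intro conjI exI[of _ "%a. case a of 0 => True | Suc a => e a"]) auto
qed

lemma triangular_word_forms: "triangular_forms (word_forms W) (concat W)"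
proof -
 have "triangular_forms (concat (map (%j. block_forms (W ! j) j) [0..<i])) (concat (map (%j. W ! j) [0..<i]))" for i
 proof (induction i)
  case 0 show ?case by (simp add: triangular_forms_def)
 next
  case (Suc i)
  thus ?case using triangular_forms_append[OF Suc triangular_block_forms[of "W ! i" i]] by simp
 qed
 from this[of "length W"] show ?thesis by (simp add: word_forms_def map_nth)
qed

lemma length_word_forms: "length (word_forms W) = length (concat W)"
 using triangular_word_forms unfolding triangular_forms_def by blast

lemma wedge_eq_pdet: "wedge \<theta>s p w = pdet (length \<theta>s) (%a b. (\<theta>s ! a) p (w b))"
 by (simp add: wedge_def pdet_def)

lemma lmono_nth: "lmono L p = (\<Prod>a<length L. 1 / (L ! a) p)"
 unfolding lmono_def by (simp add: prod.list_conv_set_nth atLeast0LessThan)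

lemma wedge_dlog: "wedge (map dlog L) p w = lmono L p * pdet (length L) (%a b. (L ! a) (w b))"
proof -
 have "wedge (map dlog L) p w = (\<Sum>\<pi> | \<pi> permutes {..<length L}. of_int (sign \<pi>) *
   ((\<Prod>a<length L. 1 / (L ! a) p) * (\<Prod>a<length L. (L ! a) (w (\<pi> a)))))"
  unfolding wedge_eq_pdet pdet_def
  unfolding length_map
 proof (rule sum.cong[OF refl])
  fix \<pi>
  have "(\<Prod>a<length L. (map dlog L ! a) p (w (\<pi> a))) = (\<Prod>a<length L. 1 / (L ! a) p * (L ! a) (w (\<pi> a)))"
   by (intro prod.cong) (auto simp: dlog_def)
  thus "of_int (sign \<pi>) * (\<Prod>a<length L. (map dlog L ! a) p (w (\<pi> a)))
   = of_int (sign \<pi>) * ((\<Prod>a<length L. 1 / (L ! a) p) * (\<Prod>a<length L. (L ! a) (w (\<pi> a))))"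
   by (simp only: prod.distrib)
 qed
 thus ?thesis by (simp add: lmono_nth pdet_def sum_distrib_left mult_ac)
qed

text \<open>The forms of the concatenated word are unitriangular in the dt's taken in the order of
  \<open>\<sigma>\<close>. Their wedge is thus the product of the dt's in this order, and the sign
  of \<open>\<sigma>\<close> restores the natural order.\<close>

lemma wedge_word_forms:
 assumes \<sigma>: "\<sigma> permutes {..<m}" and W: "concat W = map \<sigma> [0..<m]"
 shows "of_int (sign \<sigma>) * wedge (map dlog (word_forms W)) p (%b. (u b, %_. 0)) = iform m id (lmono (word_forms W)) p (%b. (u b, %_. 0))"
proof -
 let ?L = "word_forms W"
 have m: "length ?L = m" "length (concat W) = m" using W by (simp_all add: length_word_forms)
 obtain e where e: "!!a. a < m ==> e a ==> Suc a < m"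
  "!!a u. a < m ==> (?L ! a) (u, %_. 0) = u (concat W ! a) - (if e a then u (concat W ! Suc a) else 0)"
  using triangular_word_forms[of W] unfolding triangular_forms_def m by metis
 let ?X = "%a c. if c = a then 1 else if e a \<and> c = Suc a then -1 else (0::complex)"
 have "pdet m (%a b. (?L ! a) (u b, %_. 0)) = pdet m (%a b. \<Sum>c<m. ?X a c * u b (\<sigma> c))"
 proof (rule pdet_cong)
  fix a b assume a: "a < m"
  have "(\<Sum>c<m. ?X a c * u b (\<sigma> c)) = (\<Sum>c<m. (if c = a then u b (\<sigma> c) else 0) + (if c = Suc a then (if e a then - u b (\<sigma> c) else 0) else 0))"
   by (intro sum.cong) auto
  also have "... = u b (\<sigma> a) - (if e a then u b (\<sigma> (Suc a)) else 0)"
   unfolding sum.distrib using a e(1)[OF a] by (simp add: sum.delta)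
  finally show "(?L ! a) (u b, %_. 0) = (\<Sum>c<m. ?X a c * u b (\<sigma> c))"
   unfolding e(2)[OF a] W using a e(1)[OF a] by auto
 qed
 also have "... = pdet m ?X * pdet m (%c b. u b (\<sigma> c))" by (rule pdet_mult)
 also have "pdet m ?X = 1" by (rule pdet_unitriangular) auto
 also have "pdet m (%c b. u b (\<sigma> c)) = of_int (sign \<sigma>) * pdet m (%c b. u b c)"
  by (rule pdet_permute_rows[OF \<sigma>])
 finally have "wedge (map dlog ?L) p (%b. (u b, %_. 0)) = lmono ?L p * (of_int (sign \<sigma>) * pdet m (%c b. u b c))"
  by (simp add: wedge_dlog m)
 moreover have "of_int (sign \<sigma>) * of_int (sign \<sigma>) = (1::complex)"
  by (metis of_int_1 of_int_mult sign_idempotent)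
 ultimately show ?thesis by (simp add: iform_def mult.left_commute mult.assoc[symmetric])
qed

text \<open>The translation differs from d/dz_i by vertical vectors, and a form of degree m+1
  vanishes on m+1 vertical vectors; hence d/dz_i may be replaced by the translation. All forms of
  \<open>L\<close> vanish on it, so only the value of \<open>dlog_Phi\<close> splits off.\<close>

lemma insert_dz_twisted_d:
 assumes L: "set L \<subseteq> lforms A" "length L = nvars A" and S: "S \<subseteq> {..<nvars A}"
  and kill: "!!f. f \<in> set L ==> f (unit_z i) + (\<Sum>k\<in>S. f (unit_t k)) = 0"
 shows "insert_dz i (twisted_d A (map dlog L)) p (%b. (u b, %_. 0))
  = 1 / kap A * ((dlog_Phi A p (unit_z i) + (\<Sum>k\<in>S. dlog_Phi A p (unit_t k))) * wedge (map dlog L) p (%b. (u b, %_. 0)))"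
proof -
 let ?m = "nvars A"
 let ?\<theta> = "%a. (dlog_Phi A # map dlog L) ! a"
 let ?v = "%b. case b of 0 => unit_z i | Suc b' => (u b', %_. 0)"
 let ?V = "%f. f (unit_z i) + (\<Sum>k\<in>S. f (unit_t k)) :: complex"
 \<comment> \<open>\<open>?N\<close> holds the values of the forms on the translation (column 0) and
   on the unit vectors in t. \<open>?Y\<close> holds the coordinates of the actual vectors in this
   system: d/dz_i is the translation minus the unit vectors with index in \<open>S\<close>.\<close>
 let ?N = "%a c. if c = 0 then ?V (?\<theta> a p) else ?\<theta> a p (unit_t (c - 1))"
 let ?Y = "%c b. if b = 0 then (if c = 0 then 1 else if c - 1 \<in> S then -1 else 0)
   else if c = 0 then 0 else u (b - 1) (c - 1)"
 have tl: "tlinear ?m (?\<theta> a p)" if "a < Suc ?m" for a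
 proof (cases a)
  case 0 thus ?thesis using tlinear_dlog_Phi by simp
 next
  case (Suc a')
  hence "L ! a' \<in> lforms A" "a' < length L" using that L by auto
  thus ?thesis using Suc tlinear_dlog by simp
 qed
 have "insert_dz i (twisted_d A (map dlog L)) p (%b. (u b, %_. 0)) = 1 / kap A * pdet (Suc ?m) (%a b. ?\<theta> a p (?v b))"
  unfolding insert_dz_def twisted_d_def wedge_eq_pdet using L(2) by (simp add: unit_z_def cong: nat.case_cong)
 also have "pdet (Suc ?m) (%a b. ?\<theta> a p (?v b)) = pdet (Suc ?m) (%a b. \<Sum>c<Suc ?m. ?N a c * ?Y c b)"
 proof (rule pdet_cong)
  fix a b assume a: "a < Suc ?m" and "b < Suc ?m"
  have "(\<Sum>c<Suc ?m. ?N a c * ?Y c b) = ?N a 0 * ?Y 0 b + (\<Sum>k<?m. ?\<theta> a p (unit_t k) * ?Y (Suc k) b)"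
   by (subst sum.lessThan_Suc_shift) simp
  also have "... = ?\<theta> a p (?v b)"
  proof (cases b)
   case 0
   have "(\<Sum>k<?m. ?\<theta> a p (unit_t k) * ?Y (Suc k) b) = (\<Sum>k<?m. if k \<in> S then - ?\<theta> a p (unit_t k) else 0)"
    using 0 by (intro sum.cong) auto
   also have "... = - (\<Sum>k\<in>S. ?\<theta> a p (unit_t k))"
    using S by (simp add: sum.If_cases Int_absorb1 sum_negf)
   finally show ?thesis using 0 by simp
  next
   case (Suc b')
   thus ?thesis using tl[OF a] unfolding tlinear_def by (simp add: mult.commute)
  qed
  finally show "?\<theta> a p (?v b) = (\<Sum>c<Suc ?m. ?N a c * ?Y c b)" ..
 qed
 also have "... = pdet (Suc ?m) ?N * pdet (Suc ?m) ?Y" by (rule pdet_mult)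
 also have "pdet (Suc ?m) ?Y = pdet (Suc ?m) (%a b. if a = 0 then (if b = 0 then 1 else 0) else ?Y (Suc (a - 1)) b)"
  by (rule pdet_cong) auto
 also have "... = (\<Sum>j\<le>?m. (if j = 0 then 1 else 0) * ((-1) ^ j * pdet ?m (%a c. ?Y (Suc a) (if c < j then c else Suc c))))"
  by (rule pdet_expand_first)
 also have "... = pdet ?m (%a c. u c a)"
  by (subst sum.atMost_shift) simp
 also have "pdet (Suc ?m) ?N = pdet (Suc ?m) (%a b. ?N b a)" by (rule pdet_transpose[symmetric])
 also have "... = pdet (Suc ?m) (%a b. if a = 0 then (if b = 0 then ?V (dlog_Phi A p) else 0) else ?\<theta> b p (unit_t (a - 1)))"
 proof (rule pdet_cong)
  fix a b assume "b < Suc ?m"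
  have "?V (?\<theta> b p) = 0" if b0: "b ~= 0"
  proof -
   obtain b' where b': "b = Suc b'" "b' < length L" using b0 \<open>b < Suc ?m\<close> L(2) by (cases b) auto
   have "?V (dlog (L ! b') p) = ?V (L ! b') / (L ! b') p"
    by (simp add: dlog_def sum_divide_distrib add_divide_distrib)
   thus ?thesis using b' kill[of "L ! b'"] by simp
  qed
  thus "?N b a = (if a = 0 then (if b = 0 then ?V (dlog_Phi A p) else 0) else ?\<theta> b p (unit_t (a - 1)))"
   by auto
 qed
 also have "... = (\<Sum>j\<le>?m. (if j = 0 then ?V (dlog_Phi A p) else 0) * ((-1) ^ j * pdet ?m (%a c. ?\<theta> (if c < j then c else Suc c) p (unit_t a))))"
  by (rule pdet_expand_first)
 also have "... = ?V (dlog_Phi A p) * pdet ?m (%a c. dlog (L ! c) p (unit_t a))"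
 proof -
  have "pdet ?m (%a c. ?\<theta> (Suc c) p (unit_t a)) = pdet ?m (%a c. dlog (L ! c) p (unit_t a))"
   using L(2) by (intro pdet_cong) simp
  thus ?thesis by (subst sum.atMost_shift) simp
 qed
 also have "pdet ?m (%a c. dlog (L ! c) p (unit_t a)) = pdet ?m (%a c. dlog (L ! a) p (unit_t c))"
  by (rule pdet_transpose[symmetric])
 finally have "insert_dz i (twisted_d A (map dlog L)) p (%b. (u b, %_. 0))
  = 1 / kap A * (?V (dlog_Phi A p) * (pdet ?m (%a c. dlog (L ! a) p (unit_t c)) * pdet ?m (%a c. u c a)))"
  by (simp add: mult.assoc)
 also have "pdet ?m (%a c. dlog (L ! a) p (unit_t c)) * pdet ?m (%a c. u c a)
   = pdet ?m (%a b. \<Sum>c<?m. dlog (L ! a) p (unit_t c) * u b c)"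
  by (rule pdet_mult[symmetric])
 also have "... = wedge (map dlog L) p (%b. (u b, %_. 0))"
  unfolding wedge_eq_pdet length_map L(2)
 proof (rule pdet_cong)
  fix a b assume a: "a < ?m"
  hence "L ! a \<in> lforms A" using L by auto
  from tlinear_dlog[OF this, of p] show "(\<Sum>c<?m. dlog (L ! a) p (unit_t c) * u b c) = (map dlog L ! a) p (u b, %_. 0)"
   using a L(2) unfolding tlinear_def by (simp add: mult.commute)
 qed
 finally show ?thesis .
qed

lemma block_forms_memD:
 "f \<in> set (block_forms w j) ==> distinct w ==>
   (\<exists>k\<in>set w. f = tz k j) \<or> (\<exists>k\<in>set w. \<exists>l\<in>set w. k ~= l \<and> f = tt k l)"
proof (induction w j rule: block_forms.induct)
 case (3 k l ks j)
 show ?case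
 proof (cases "f = tt k l")
  case True
  thus ?thesis using 3(3) by auto
 next
  case False
  hence "(\<exists>a\<in>set (l # ks). f = tz a j) \<or> (\<exists>a\<in>set (l # ks). \<exists>b\<in>set (l # ks). a ~= b \<and> f = tt a b)"
   using 3 by simp
  thus ?thesis by (meson list.set_intros(2))
 qed
qed auto

lemma word_forms_lforms:
 assumes W: "distinct (concat W)" "set (concat W) \<subseteq> {..<nvars A}" "length W = npts A"
 shows "set (word_forms W) \<subseteq> lforms A"
proof
 fix f assume "f \<in> set (word_forms W)"
 then obtain j where j: "j < length W" "f \<in> set (block_forms (W ! j) j)" by (auto simp: word_forms_def)
 have "W ! j \<in> set W" using j(1) by simp
 hence "distinct (W ! j)" "set (W ! j) \<subseteq> {..<nvars A}" using W by (auto simp: distinct_concat_iff)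
 thus "f \<in> lforms A" using block_forms_memD[OF j(2)] j(1) W(3) by (auto intro: lforms_memI)
qed

lemma distinct_concat_disjoint:
 assumes "distinct (concat W)" "i < length W" "j < length W" "i ~= j"
 shows "set (W ! i) \<inter> set (W ! j) = {}"
 using assms
proof (induction W arbitrary: i j)
 case (Cons w W)
 show ?case
 proof (cases i; cases j)
  fix i' assume i: "i = 0" and j: "j = Suc i'"
  hence "W ! i' \<in> set W" using Cons.prems by simp
  hence "set (W ! i') \<subseteq> \<Union> (set ` set W)" by blast
  thus ?thesis using Cons.prems i j by auto
 next
  fix i' assume j: "j = 0" and i: "i = Suc i'"
  hence "W ! i' \<in> set W" using Cons.prems by simp
  hence "set (W ! i') \<subseteq> \<Union> (set ` set W)" by blast
  thus ?thesis using Cons.prems i j by auto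
 next
  fix i' j' assume "i = Suc i'" "j = Suc j'"
  thus ?thesis using Cons.IH[of i' j'] Cons.prems by simp
 qed (use Cons.prems in auto)
qed simp

text \<open>The forms of the word \<open>i\<close> are differences of two points that are both
  translated, those of the other words involve no moving point, because the words are
  disjoint.\<close>

lemma word_forms_kill:
 assumes W: "distinct (concat W)" and i: "i < length W" and f: "f \<in> set (word_forms W)"
 shows "f (unit_z i) + (\<Sum>k\<in>set (W ! i). f (unit_t k)) = 0"
proof -
 obtain j where j: "j < length W" "f \<in> set (block_forms (W ! j) j)" using f by (auto simp: word_forms_def)
 have d: "distinct (W ! j)" using W j by (auto simp: distinct_concat_iff)
 have mem: "k \<in> set (W ! i) \<longleftrightarrow> i = j" if "k \<in> set (W ! j)" for k
  using distinct_concat_disjoint[OF W i j(1)] that by auto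
 have delta: "(\<Sum>l\<in>set (W ! i). if k = l then 1 else 0 :: complex) = (if i = j then 1 else 0)" if "k \<in> set (W ! j)" for k
  using mem[OF that] by (simp add: sum.delta')
 show ?thesis using block_forms_memD[OF j(2) d] delta
  by (auto simp: tz_def tt_def unit_z_def unit_t_def sum_subtractf)
qed

text \<open>The reversal is due to the two reading directions: the forms start at the letter
  farthest from z_j, \<open>chain\<close> starts at the root.\<close>

lemma lmono_block_forms: "lmono (block_forms w j) (t, z) = chain t (rev w) (z j)"
proof (induction w j rule: block_forms.induct)
 case (3 k l ks j)
 have "chain t (rev (k # l # ks)) (z j) = chain t (rev ks @ l # [k]) (z j)" by simp
 also have "... = chain t (rev (l # ks)) (z j) * (1 / (t k - t l))" by (subst chain_append) simp
 finally show ?case using 3 by (simp add: tt_def)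
qed (simp_all add: tz_def)

lemma lmono_word_forms: "lmono (word_forms W) (t, z) = (\<Prod>j<length W. chain t (rev (W ! j)) (z j))"
proof -
 have "lmono (concat (map (%j. block_forms (W ! j) j) [0..<i])) (t, z) = (\<Prod>j<i. chain t (rev (W ! j)) (z j))" for i
  by (induction i) (simp_all add: lmono_append lmono_block_forms)
 thus ?thesis by (simp add: word_forms_def)
qed

section \<open>Presentations of vector spaces\<close>

lemma keys_scaleC_subset: "Poly_Mapping.keys (a *\<^sub>C p) \<subseteq> Poly_Mapping.keys (p :: 'x \<Rightarrow>\<^sub>0 complex)"
 by (auto simp: in_keys_iff lookup_scaleC)

lemma lin_ext_superset:
 assumes "finite S" "Poly_Mapping.keys p \<subseteq> S"
 shows "lin_ext g p = (\<Sum>x\<in>S. Poly_Mapping.lookup p x *\<^sub>C g x)"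
 unfolding lin_ext_def using assms by (intro sum.mono_neutral_left) (auto simp: in_keys_iff)

lemma clinear_lin_ext: "clinear (lin_ext g)"
proof (rule clinearI)
 fix p q :: "'a \<Rightarrow>\<^sub>0 complex"
 let ?S = "Poly_Mapping.keys p \<union> Poly_Mapping.keys q"
 have "Poly_Mapping.keys (p + q) \<subseteq> ?S" by (rule Poly_Mapping.keys_add)
 hence "lin_ext g (p + q) = (\<Sum>x\<in>?S. Poly_Mapping.lookup (p + q) x *\<^sub>C g x)" by (intro lin_ext_superset) auto
 moreover have "lin_ext g p = (\<Sum>x\<in>?S. Poly_Mapping.lookup p x *\<^sub>C g x)" by (intro lin_ext_superset) auto
 moreover have "lin_ext g q = (\<Sum>x\<in>?S. Poly_Mapping.lookup q x *\<^sub>C g x)" by (intro lin_ext_superset) auto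
 ultimately show "lin_ext g (p + q) = lin_ext g p + lin_ext g q"
  by (simp add: lookup_add scaleC_add_left sum.distrib)
next
 fix a and p :: "'a \<Rightarrow>\<^sub>0 complex"
 have "lin_ext g (a *\<^sub>C p) = (\<Sum>x\<in>Poly_Mapping.keys p. Poly_Mapping.lookup (a *\<^sub>C p) x *\<^sub>C g x)"
  by (intro lin_ext_superset keys_scaleC_subset) auto
 thus "lin_ext g (a *\<^sub>C p) = a *\<^sub>C lin_ext g p"
  by (simp add: lin_ext_def lookup_scaleC scaleC_complex_def cvec.scale_sum_right scaleC_scaleC)
qed

lemma lin_ext_fgen [simp]: "lin_ext g (fgen x) = g x"
 by (simp add: lin_ext_def)

lemmas lin_ext_add = clinear_add[OF clinear_lin_ext]
 and lin_ext_diff = clinear_diff[OF clinear_lin_ext]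
 and lin_ext_scale = clinear_scale[OF clinear_lin_ext]
 and lin_ext_zero = clinear_zero[OF clinear_lin_ext]
 and lin_ext_sum = clinear_sum[OF clinear_lin_ext]

lemma single_eq_scale_fgen: "Poly_Mapping.single x a = a *\<^sub>C fgen x"
 by (rule poly_mapping_eqI) (simp add: lookup_scaleC lookup_single scaleC_complex_def when_def)

lemma lin_ext_single [simp]: "lin_ext g (Poly_Mapping.single x a) = a *\<^sub>C g x"
 by (simp only: single_eq_scale_fgen[of x a] lin_ext_scale lin_ext_fgen)

lemma lin_ext_eq_fgen: "p = lin_ext fgen p"
proof (rule poly_mapping_eqI)
 fix k
 have "Poly_Mapping.lookup (lin_ext fgen p) k = (\<Sum>x\<in>Poly_Mapping.keys p. Poly_Mapping.lookup (Poly_Mapping.lookup p x *\<^sub>C fgen x) k)"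
  unfolding lin_ext_def by (rule lookup_sum)
 also have "... = (\<Sum>x\<in>Poly_Mapping.keys p. if x = k then Poly_Mapping.lookup p x else 0)"
  by (intro sum.cong) (simp_all add: lookup_scaleC lookup_single scaleC_complex_def when_def)
 finally show "Poly_Mapping.lookup p k = Poly_Mapping.lookup (lin_ext fgen p) k"
  by (simp add: in_keys_iff)
qed

lemma clinear_poly_mapping_eqI:
 fixes f g :: "('x \<Rightarrow>\<^sub>0 complex) => 'v::complex_vector"
 assumes "clinear f" "clinear g" "!!x. f (fgen x) = g (fgen x)"
 shows "f p = g p"
proof -
 have "f (lin_ext fgen p) = g (lin_ext fgen p)"
  unfolding lin_ext_def clinear_sum[OF assms(1)] clinear_sum[OF assms(2)]
  by (simp add: clinear_scale[OF assms(1)] clinear_scale[OF assms(2)] assms(3))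
 thus ?thesis by (simp only: lin_ext_eq_fgen[symmetric])
qed

lemma lin_ext_comp: "clinear L ==> L (lin_ext g p) = lin_ext (%x. L (g x)) p"
 by (rule clinear_poly_mapping_eqI[where f = "%p. L (lin_ext g p)"])
   (auto intro: clinear_comp clinear_lin_ext)

lemma clinear_eq_on_span:
 assumes "clinear f" "clinear g" "!!x. x \<in> S ==> f x = g x" "x \<in> cvec.span S"
 shows "f x = g x"
 using assms(4)
proof (induction rule: cvec.span_induct_alt)
 case base show ?case by (simp add: clinear_zero assms)
next
 case (step c x y) thus ?case by (simp add: clinear_add clinear_scale assms)
qed

text \<open>The universal property of a quotient of a free space. \<open>q\<close> chooses a
  preimage of each vector, and two choices differ by a relation.\<close>

lemma presented_lift:
 fixes g :: "'x => 'v::complex_vector" and f :: "'x => 'w::complex_vector"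
 assumes P: "presented_by X g R" and f: "!!p. p \<in> R ==> lin_ext f p = 0"
 obtains L where "clinear L" "!!x. x \<in> X ==> L (g x) = f x"
proof -
 define q where "q v = (SOME p. Poly_Mapping.keys p \<subseteq> X \<and> lin_ext g p = v)" for v
 have "\<exists>p. Poly_Mapping.keys p \<subseteq> X \<and> lin_ext g p = v" for v
  using P unfolding presented_by_def by (metis (mono_tags, lifting) UNIV_I imageE mem_Collect_eq)
 hence q: "Poly_Mapping.keys (q v) \<subseteq> X" "lin_ext g (q v) = v" for v
  unfolding q_def by (metis (mono_tags, lifting) someI_ex)+
 have wd: "lin_ext f p = lin_ext f p'" if "Poly_Mapping.keys p \<subseteq> X" "Poly_Mapping.keys p' \<subseteq> X" "lin_ext g p = lin_ext g p'" for p p'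
 proof -
  have "Poly_Mapping.keys (p - p') \<subseteq> X" using that Poly_Mapping.keys_diff[of p p'] by blast
  moreover have "lin_ext g (p - p') = 0" using that by (simp add: lin_ext_diff)
  ultimately have "p - p' \<in> R" using P unfolding presented_by_def by blast
  from f[OF this] show ?thesis by (simp add: lin_ext_diff)
 qed
 have "clinear (%v. lin_ext f (q v))"
 proof (rule clinearI)
  fix v w
  have "Poly_Mapping.keys (q v + q w) \<subseteq> X" using q Poly_Mapping.keys_add[of "q v" "q w"] by blast
  hence "lin_ext f (q (v + w)) = lin_ext f (q v + q w)" by (intro wd q) (simp_all add: q lin_ext_add)
  thus "lin_ext f (q (v + w)) = lin_ext f (q v) + lin_ext f (q w)" by (simp add: lin_ext_add)
 next
  fix a v
  have "Poly_Mapping.keys (a *\<^sub>C q v) \<subseteq> X" using q keys_scaleC_subset[of a "q v"] by blast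
  hence "lin_ext f (q (a *\<^sub>C v)) = lin_ext f (a *\<^sub>C q v)" by (intro wd q) (simp_all add: q lin_ext_scale)
  thus "lin_ext f (q (a *\<^sub>C v)) = a *\<^sub>C lin_ext f (q v)" by (simp add: lin_ext_scale)
 qed
 moreover have "lin_ext f (q (g x)) = f x" if "x \<in> X" for x
 proof -
  have "lin_ext f (q (g x)) = lin_ext f (fgen x)" using that by (intro wd q) (simp_all add: q)
  thus ?thesis by simp
 qed
 ultimately show thesis by (rule that)
qed

lemma presented_span: "presented_by X g R ==> cvec.span (g ` X) = UNIV"
proof -
 assume P: "presented_by X g R"
 have "v \<in> cvec.span (g ` X)" for v
 proof -
  obtain p where p: "Poly_Mapping.keys p \<subseteq> X" "v = lin_ext g p"
   using P unfolding presented_by_def by (metis (mono_tags, lifting) UNIV_I imageE mem_Collect_eq)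
  show ?thesis unfolding p(2) lin_ext_def
   using p(1) by (intro cvec.span_sum cvec.span_scale cvec.span_base) auto
 qed
 thus ?thesis by auto
qed

lemma presented_unique:
 assumes "presented_by X g R" "clinear L" "clinear L'" "!!x. x \<in> X ==> L (g x) = L' (g x)"
 shows "L = L'"
 by (rule ext, rule clinear_eq_on_span[OF assms(2,3), of "g ` X"]) (use assms presented_span[OF assms(1)] in auto)

lemma presented_rel: "presented_by X g R ==> p \<in> R ==> lin_ext g p = 0"
 unfolding presented_by_def by blast

section \<open>The Cartan datum\<close>

lemma cartan_linear:
 assumes "cartan_datum D"
 shows "clinear (bil D x)" "bil D x y = bil D y x" "i < rk D ==> clinear (sroot D i)" "clinear (%x. bil D x y)"
proof -
 show 1: "clinear (bil D x)" "bil D x y = bil D y x" "i < rk D ==> clinear (sroot D i)" for x y i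
  using assms by (auto simp: cartan_datum_def)
 have "(%x. bil D x y) = bil D y" by (rule ext) (rule 1(2))
 thus "clinear (%x. bil D x y)" using 1(1) by simp
qed

lemma cartan_basis:
 fixes D :: "'h::complex_vector cartan"
 assumes "cartan_datum D"
 obtains Bh :: "'h set" where "finite Bh" "cvec.independent Bh" "cvec.span Bh = UNIV"
proof -
 obtain B0 :: "'h set" where B0: "finite B0" "cvec.span B0 = UNIV" using assms by (auto simp: cartan_datum_def)
 obtain B where "B \<subseteq> B0" "cvec.independent B" "B0 \<subseteq> cvec.span B"
  using cvec.maximal_independent_subset[of B0] by blast
 moreover have "cvec.span B = UNIV"
  using \<open>B0 \<subseteq> cvec.span B\<close> B0(2) cvec.span_minimal[of B0 "cvec.span B"] by (auto simp: cvec.subspace_span)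
 ultimately show thesis using that B0(1) finite_subset by metis
qed

lemma bil_nondegenerate: "cartan_datum D ==> (!!y. bil D x y = 0) ==> x = 0"
 unfolding cartan_datum_def by blast

text \<open>The definite description in \<open>binv\<close> is legitimate: \<open>?T\<close> records
  the functional \<open>bil D x\<close> by its values on a basis, is injective by nondegeneracy, and
  hence surjective in finite dimension.\<close>

lemma bil_binv:
 fixes D :: "'h::complex_vector cartan"
 assumes D: "cartan_datum D" and xi: "clinear \<xi>"
 shows "bil D (binv D \<xi>) = \<xi>"
proof -
 obtain Bh :: "'h set" where Bh: "finite Bh" "cvec.independent Bh" "cvec.span Bh = UNIV" by (rule cartan_basis[OF D])
 interpret fd: finite_dimensional_vector_space "scaleC :: complex => 'h => 'h" Bh
  by unfold_locales (use Bh in auto)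
 let ?T = "%x. \<Sum>b\<in>Bh. bil D x b *\<^sub>C b"
 have T: "clinear ?T"
  by (intro clinearI)
   (simp_all add: clinear_add[OF cartan_linear(4)[OF D]] clinear_scale[OF cartan_linear(4)[OF D]]
    scaleC_add_left sum.distrib cvec.scale_sum_right scaleC_scaleC scaleC_complex_def)
 have coeff: "(\<Sum>b\<in>Bh. a b *\<^sub>C b) = (\<Sum>b\<in>Bh. a' b *\<^sub>C b) ==> \<forall>b\<in>Bh. a b = a' b" for a a'
 proof -
  assume "(\<Sum>b\<in>Bh. a b *\<^sub>C b) = (\<Sum>b\<in>Bh. a' b *\<^sub>C b)"
  hence "(\<Sum>b\<in>Bh. (a b - a' b) *\<^sub>C b) = 0" by (simp add: cvec.scale_left_diff_distrib sum_subtractf)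
  hence "a b - a' b = 0" if "b \<in> Bh" for b using cvec.independentD[OF Bh(2,1) order_refl _ that, of "%b. a b - a' b"] by simp
  thus ?thesis by simp
 qed
 have eqB: "f = g" if "clinear f" "clinear g" "!!b. b \<in> Bh ==> f b = g b" for f g :: "'h => complex"
  by (rule ext, rule clinear_eq_on_span[OF that(1,2), of Bh]) (use that Bh in auto)
 have "inj ?T"
 proof (rule injI)
  fix x y assume "?T x = ?T y"
  hence "\<forall>b\<in>Bh. bil D x b = bil D y b" by (rule coeff)
  hence "bil D x = bil D y" by (intro eqB cartan_linear[OF D]) auto
  hence "bil D (x - y) z = 0" for z using clinear_diff[OF cartan_linear(4)[OF D], of x y z] by simp
  hence "x - y = 0" by (rule bil_nondegenerate[OF D])
  thus "x = y" by simp
 qed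
 hence "surj ?T" by (rule fd.linear_inj_imp_surj[OF T])
 then obtain x where "?T x = (\<Sum>b\<in>Bh. \<xi> b *\<^sub>C b)" unfolding surj_def by metis
 hence "\<forall>b\<in>Bh. bil D x b = \<xi> b" by (rule coeff)
 hence x: "bil D x = \<xi>" by (intro eqB cartan_linear[OF D] xi) auto
 have "y = x" if "bil D y = \<xi>" for y
 proof -
  have "bil D (y - x) z = 0" for z using clinear_diff[OF cartan_linear(4)[OF D], of y x z] that x by simp
  hence "y - x = 0" by (rule bil_nondegenerate[OF D])
  thus "y = x" by simp
 qed
 thus ?thesis unfolding binv_def using theI[of "%y. bil D y = \<xi>", OF x] by blast
qed

lemma dform_right: "cartan_datum D ==> clinear \<xi> ==> dform D \<xi> \<eta> = \<xi> (binv D \<eta>)"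
 by (simp add: dform_def bil_binv)

lemma dform_left: "cartan_datum D ==> clinear \<eta> ==> dform D \<xi> \<eta> = \<eta> (binv D \<xi>)"
 unfolding dform_def by (subst cartan_linear(2)) (simp_all add: bil_binv)

lemma dform_commute: "cartan_datum D ==> dform D \<xi> \<eta> = dform D \<eta> \<xi>"
 unfolding dform_def by (rule cartan_linear(2))

text \<open>The form on the dual space as an element of \<h> \<otimes> \<h>: \<open>y b\<close>
  corresponds under the form to the coordinate functional of \<open>b\<close>. Evaluating it on two
  weights becomes a combination of products of Cartan elements acting on two factors.\<close>

lemma dform_decomposition:
 fixes D :: "'h::complex_vector cartan"
 assumes D: "cartan_datum D"
 obtains Bh :: "'h set" and y where "finite Bh"
  "!!\<xi> \<eta>. clinear \<xi> ==> clinear \<eta> ==> dform D \<xi> \<eta> = (\<Sum>b\<in>Bh. \<xi> b * \<eta> (y b))"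
proof -
 obtain Bh :: "'h set" where Bh: "finite Bh" "cvec.independent Bh" "cvec.span Bh = UNIV" by (rule cartan_basis[OF D])
 let ?r = "%b x. cvec.representation Bh x b"
 have r: "clinear (?r b)" for b
  using Bh by (intro clinearI) (auto simp: cvec.representation_add cvec.representation_scale scaleC_complex_def)
 have x: "x = (\<Sum>b\<in>Bh. ?r b x *\<^sub>C b)" for x
  using cvec.sum_representation_eq[of Bh x Bh] Bh by simp
 have "dform D \<xi> \<eta> = (\<Sum>b\<in>Bh. \<xi> b * \<eta> (binv D (?r b)))" if xi: "clinear \<xi>" and eta: "clinear \<eta>" for \<xi> \<eta>
 proof -
  have "dform D \<xi> \<eta> = \<xi> (\<Sum>b\<in>Bh. ?r b (binv D \<eta>) *\<^sub>C b)"
   unfolding dform_right[OF D xi] using x[of "binv D \<eta>"] by simp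
  also have "... = (\<Sum>b\<in>Bh. \<xi> b * ?r b (binv D \<eta>))"
   by (simp add: clinear_sum[OF xi] clinear_scale[OF xi] scaleC_complex_def mult.commute)
  also have "... = (\<Sum>b\<in>Bh. \<xi> b * \<eta> (binv D (?r b)))"
   using dform_right[OF D r, of _ \<eta>] dform_left[OF D eta] by simp
  finally show ?thesis .
 qed
 thus thesis using that[OF Bh(1), of "%b. binv D (?r b)"] by blast
qed

section \<open>Verma modules are free over the words in the generators\<close>

lemma lin_ext_fprod:
 fixes mv :: "'x magma => 'v::complex_vector"
 assumes b: "cbilinear br" and mv: "!!x y. mv (Br x y) = br (mv x) (mv y)"
 shows "lin_ext mv (fprod p q) = br (lin_ext mv p) (lin_ext mv q)"
 unfolding fprod_def lin_ext_sum lin_ext_single mv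
 unfolding lin_ext_def using b
 by (subst sum.swap) (simp add: cbilinear_simps scaleC_scaleC cvec.scale_sum_right mult.commute)

text \<open>The weight of the vector f_w v. Letters beyond the rank, for which no simple root is
  available, are given weight zero; this keeps the function linear in \<open>h\<close> for arbitrary
  words.\<close>

definition wt_word :: "'h cartan => ('h => complex) => nat list => 'h => complex" where
 "wt_word D \<Lambda> w h = \<Lambda> h - (\<Sum>i\<leftarrow>w. if i < rk D then sroot D i h else 0)"

text \<open>The action of e_i that is forced on words: e_i is commuted past the leading f_j, and the
  commutator is the coroot acting by the weight of the remaining word.\<close>

fun opE_word :: "'h cartan => ('h => complex) => nat => nat list => (nat list \<Rightarrow>\<^sub>0 complex)" where
 "opE_word D \<Lambda> i [] = 0"
| "opE_word D \<Lambda> i (j # w) = lin_ext (%w. fgen (j # w)) (opE_word D \<Lambda> i w)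
   + (if i = j then wt_word D \<Lambda> w (hcor D i) *\<^sub>C fgen w else 0)"

fun gen_op :: "'h cartan => ('h => complex) => 'h km_gen => nat list => (nat list \<Rightarrow>\<^sub>0 complex)" where
 "gen_op D \<Lambda> (GenH h) = (%w. wt_word D \<Lambda> w h *\<^sub>C fgen w)"
| "gen_op D \<Lambda> (GenE i) = opE_word D \<Lambda> i"
| "gen_op D \<Lambda> (GenF i) = (%w. fgen (i # w))"

primrec magma_op :: "'h cartan => ('h => complex) => 'h km_gen magma => (nat list \<Rightarrow>\<^sub>0 complex) => (nat list \<Rightarrow>\<^sub>0 complex)" where
 "magma_op D \<Lambda> (Leaf x) = lin_ext (gen_op D \<Lambda> x)"
| "magma_op D \<Lambda> (Br a b) = (%x. magma_op D \<Lambda> a (magma_op D \<Lambda> b x) - magma_op D \<Lambda> b (magma_op D \<Lambda> a x))"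

lemma clinear_minus: "clinear f ==> clinear g ==> clinear (%x. f x - g x)"
 by (intro clinearI) (simp_all add: clinear_add clinear_scale cvec.scale_right_diff_distrib)

lemma clinear_magma_op: "clinear (magma_op D \<Lambda> w)"
proof (induction w)
 case (Leaf x) show ?case by (simp add: clinear_lin_ext)
next
 case (Br a b) thus ?case by (auto intro: clinear_minus clinear_comp)
qed

definition free_op :: "'h cartan => ('h => complex) => ('h km_gen magma \<Rightarrow>\<^sub>0 complex) => (nat list \<Rightarrow>\<^sub>0 complex) => (nat list \<Rightarrow>\<^sub>0 complex)" where
 "free_op D \<Lambda> p x = lin_ext (%w. magma_op D \<Lambda> w x) p"

lemma clinear_free_op: "clinear (free_op D \<Lambda> p)"
 unfolding free_op_def[abs_def] lin_ext_def by (intro clinear_sum_fun clinear_scaleC clinear_magma_op)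

lemma clinear_free_op_left: "clinear (%p. free_op D \<Lambda> p x)"
 unfolding free_op_def by (rule clinear_lin_ext)

lemma free_op_fgen [simp]: "free_op D \<Lambda> (fgen w) = magma_op D \<Lambda> w"
 by (rule ext) (simp add: free_op_def)

lemma free_op_fprod:
 "free_op D \<Lambda> (fprod p q) x = free_op D \<Lambda> p (free_op D \<Lambda> q x) - free_op D \<Lambda> q (free_op D \<Lambda> p x)"
proof -
 have "free_op D \<Lambda> (fprod p q) x = (\<Sum>a\<in>Poly_Mapping.keys p. \<Sum>b\<in>Poly_Mapping.keys q.
   (Poly_Mapping.lookup p a * Poly_Mapping.lookup q b) *\<^sub>C
    (magma_op D \<Lambda> a (magma_op D \<Lambda> b x) - magma_op D \<Lambda> b (magma_op D \<Lambda> a x)))"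
  unfolding free_op_def fprod_def lin_ext_sum lin_ext_single magma_op.simps ..
 also have "... = (\<Sum>a\<in>Poly_Mapping.keys p. \<Sum>b\<in>Poly_Mapping.keys q. (Poly_Mapping.lookup p a * Poly_Mapping.lookup q b) *\<^sub>C magma_op D \<Lambda> a (magma_op D \<Lambda> b x))
   - (\<Sum>b\<in>Poly_Mapping.keys q. \<Sum>a\<in>Poly_Mapping.keys p. (Poly_Mapping.lookup p a * Poly_Mapping.lookup q b) *\<^sub>C magma_op D \<Lambda> b (magma_op D \<Lambda> a x))"
  by (subst (2) sum.swap) (simp add: cvec.scale_right_diff_distrib sum_subtractf)
 also have "... = free_op D \<Lambda> p (free_op D \<Lambda> q x) - free_op D \<Lambda> q (free_op D \<Lambda> p x)"
  unfolding free_op_def lin_ext_def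
  by (simp add: clinear_sum[OF clinear_magma_op] clinear_scale[OF clinear_magma_op] cvec.scale_sum_right scaleC_scaleC mult.commute)
 finally show ?thesis .
qed

lemma wt_word_Cons: "wt_word D \<Lambda> (j # w) h = wt_word D \<Lambda> w h - (if j < rk D then sroot D j h else 0)"
 by (simp add: wt_word_def)

text \<open>Along the word, prefixing f_j lowers the weight by the root of j, and in the term where
  e_i removes its letter exactly the root of i is missing. This is the only defining relation that
  does not hold at sight.\<close>

lemma magma_op_HE:
 assumes i: "i < rk D"
 shows "lin_ext (%w. wt_word D \<Lambda> w h *\<^sub>C fgen w) (opE_word D \<Lambda> i w)
   = (wt_word D \<Lambda> w h + sroot D i h) *\<^sub>C opE_word D \<Lambda> i w"
proof (induction w)
 case Nil show ?case by (simp add: lin_ext_zero)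
next
 case (Cons j w)
 let ?H = "lin_ext (%w. wt_word D \<Lambda> w h *\<^sub>C fgen w)"
 let ?F = "lin_ext (%w. fgen (j # w)) :: (nat list \<Rightarrow>\<^sub>0 complex) => (nat list \<Rightarrow>\<^sub>0 complex)"
 let ?r = "if j < rk D then sroot D j h else 0"
 have HF: "?H (?F p) = ?F (?H p) - ?r *\<^sub>C ?F p" for p
 proof (rule clinear_poly_mapping_eqI[of "%p. ?H (?F p)" "%p. ?F (?H p) - ?r *\<^sub>C ?F p" p])
  show "clinear (%p. ?H (?F p))" by (rule clinear_comp[OF clinear_lin_ext clinear_lin_ext])
  show "clinear (%p. ?F (?H p) - ?r *\<^sub>C ?F p)"
   by (rule clinear_minus[OF clinear_comp[OF clinear_lin_ext clinear_lin_ext] clinear_scaleC[OF clinear_lin_ext]])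
  show "?H (?F (fgen x)) = ?F (?H (fgen x)) - ?r *\<^sub>C ?F (fgen x)" for x
   by (simp only: lin_ext_fgen lin_ext_scale wt_word_Cons cvec.scale_left_diff_distrib)
 qed
 let ?u = "wt_word D \<Lambda> w (hcor D i)"
 have "?H (opE_word D \<Lambda> i (j # w)) = ?F (?H (opE_word D \<Lambda> i w)) - ?r *\<^sub>C ?F (opE_word D \<Lambda> i w)
   + (if i = j then (?u * wt_word D \<Lambda> w h) *\<^sub>C fgen w else 0)"
  by (simp only: opE_word.simps lin_ext_add HF) (simp add: lin_ext_scale lin_ext_zero scaleC_scaleC)
 also have "... = (wt_word D \<Lambda> w h + sroot D i h - ?r) *\<^sub>C ?F (opE_word D \<Lambda> i w)
   + (if i = j then (?u * wt_word D \<Lambda> w h) *\<^sub>C fgen w else 0)"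
  by (simp only: Cons lin_ext_scale cvec.scale_left_diff_distrib)
 also have "... = (wt_word D \<Lambda> (j # w) h + sroot D i h) *\<^sub>C opE_word D \<Lambda> i (j # w)"
  using i by (auto simp: wt_word_Cons scaleC_add_right scaleC_scaleC algebra_simps)
 finally show ?case .
qed

text \<open>Brackets act as commutators, so the Lie axioms hold automatically; linearity in
  \<open>h\<close> comes from \<open>wt_word\<close>, and the relations of the generators are built
  into their actions on words. No Serre relation has to be respected, which is why the space of all
  words can carry the action.\<close>

lemma km_ideal_free_op:
 fixes D :: "'h::complex_vector cartan"
 assumes D: "cartan_datum D" and L: "clinear \<Lambda>" and p: "p \<in> km_ideal D"
 shows "free_op D \<Lambda> p x = 0"
 using p
proof (induction arbitrary: x rule: km_ideal.induct)
 case zero show ?case by (simp add: free_op_def lin_ext_zero)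
next
 case (add p q) thus ?case by (simp add: clinear_add[OF clinear_free_op_left])
next
 case (scale p c) thus ?case by (simp add: clinear_scale[OF clinear_free_op_left])
next
 case (left p a) thus ?case by (simp add: free_op_fprod clinear_zero[OF clinear_free_op])
next
 case (right p a) thus ?case by (simp add: free_op_fprod clinear_zero[OF clinear_free_op])
next
 case (alternating a) show ?case by (simp add: free_op_fprod)
next
 case (jacobi a b c)
 show ?case by (simp add: free_op_fprod clinear_add[OF clinear_free_op_left] clinear_diff[OF clinear_free_op])
next
 case (H_add h h')
 have w: "wt_word D \<Lambda> w (h + h') = wt_word D \<Lambda> w h + wt_word D \<Lambda> w h'" for w
  unfolding wt_word_def using clinear_add[OF L] clinear_add[OF cartan_linear(3)[OF D]]
  by (induction w) (auto simp: algebra_simps)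
 show ?case
  by (rule clinear_poly_mapping_eqI[where g = "%x. 0", OF clinear_free_op clinear_const_zero])
    (simp add: clinear_diff[OF clinear_free_op_left] w scaleC_add_left)
next
 case (H_scale c h)
 have w: "wt_word D \<Lambda> w (c *\<^sub>C h) = c * wt_word D \<Lambda> w h" for w
  unfolding wt_word_def using clinear_scale[OF L] clinear_scale[OF cartan_linear(3)[OF D]]
  by (induction w) (auto simp: algebra_simps scaleC_complex_def)
 show ?case
  by (rule clinear_poly_mapping_eqI[where g = "%x. 0", OF clinear_free_op clinear_const_zero])
    (simp add: clinear_diff[OF clinear_free_op_left] clinear_scale[OF clinear_free_op_left] w scaleC_scaleC)
next
 case (H_E i h)
 show ?case
  by (rule clinear_poly_mapping_eqI[where g = "%x. 0", OF clinear_free_op clinear_const_zero])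
    (use magma_op_HE[OF H_E] in \<open>simp add: clinear_diff[OF clinear_free_op_left] clinear_scale[OF clinear_free_op_left]
     free_op_fprod lin_ext_scale scaleC_add_left\<close>)
next
 case (H_F i h)
 show ?case
  by (rule clinear_poly_mapping_eqI[where g = "%x. 0", OF clinear_free_op clinear_const_zero])
    (use H_F in \<open>simp add: clinear_add[OF clinear_free_op_left] clinear_scale[OF clinear_free_op_left]
     free_op_fprod lin_ext_scale wt_word_Cons cvec.scale_left_diff_distrib\<close>)
next
 case (E_F i j)
 show ?case
  by (rule clinear_poly_mapping_eqI[where g = "%x. 0", OF clinear_free_op clinear_const_zero])
    (simp add: clinear_diff[OF clinear_free_op_left] clinear_zero[OF clinear_free_op_left] free_op_fprod)
next
 case (H_H h h')
 show ?case
  by (rule clinear_poly_mapping_eqI[where g = "%x. 0", OF clinear_free_op clinear_const_zero])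
    (simp add: free_op_fprod lin_ext_scale scaleC_scaleC mult.commute)
qed

section \<open>The logarithmic derivative of the master function along a translation\<close>

lemma divide_diff_flip: "x / (b - a) = - (x / (a - b :: complex))"
 unfolding minus_divide_right by simp

text \<open>The products \<open>e k * e l\<close> cancel in pairs by antisymmetry. For an indicator
  function \<open>e\<close>, a sum over unordered pairs becomes a sum over the ordered pairs leading
  from the set to its complement.\<close>

lemma sum_triangle_antisymmetric:
 fixes G :: "nat => nat => complex"
 assumes G: "!!a b. G b a = - G a b"
 shows "(\<Sum>l<m. \<Sum>k<l. (e k - e l) * G k l) = (\<Sum>k<m. \<Sum>l<m. e k * (1 - e l) * G k l)"
proof (induction m)
 case (Suc m)
 have "G m m = 0" using G[of m m] by simp
 moreover have "(\<Sum>k<m. (e k - e m) * G k m) = (\<Sum>k<m. e k * (1 - e m) * G k m) + (\<Sum>l<m. e m * (1 - e l) * G m l)"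
  unfolding sum.distrib[symmetric] by (intro sum.cong refl) (simp add: G[of m] algebra_simps)
 ultimately show ?case using Suc by (simp add: sum.distrib)
qed simp

text \<open>Differences of points that move together, or that both rest, contribute nothing. The
  surviving factors join z_i or a variable of \<open>R i\<close> to a resting point and are sorted
  by the index \<open>j\<close> of the group containing the latter.\<close>

lemma dlog_Phi_translation:
 assumes i: "i < npts A" and R: "!!j. j < npts A ==> R j \<subseteq> {..<nvars A}" "(\<Union>j<npts A. R j) = {..<nvars A}"
   "!!j k. j < npts A ==> k < npts A ==> j ~= k ==> R j \<inter> R k = {}"
  and sym: "!!a b. exp_zz A a b = exp_zz A b a" "!!a b. exp_tt A a b = exp_tt A b a"
 shows "dlog_Phi A (t, z) (unit_z i) + (\<Sum>k\<in>R i. dlog_Phi A (t, z) (unit_t k))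
  = (coef_z A i + (\<Sum>k\<in>R i. coef_t A k)) + (\<Sum>j\<in>{..<npts A} - {i}. exp_zz A i j / (z i - z j)
    + (\<Sum>b\<in>R i. exp_tz A b j / (t b - z j)) + (\<Sum>a\<in>R j. exp_tz A a i / (z i - t a))
    + (\<Sum>b\<in>R i. \<Sum>a\<in>R j. exp_tt A b a / (t b - t a)))"
proof -
 let ?n = "npts A" and ?m = "nvars A"
 let ?c = "%k. if k \<in> R i then 1 else 0 :: complex" and ?\<delta> = "%j. if j = i then 1 else 0 :: complex"
 have fin: "finite (R i)" using R(1)[OF i] finite_subset by blast
 have delta: "(\<Sum>k\<in>R i. if a = k then 1 else 0 :: complex) = ?c a" for a using fin by (simp add: sum.delta')
 have lin1: "(\<Sum>k\<in>R i. \<Sum>l<?m. x l * fst (unit_t k) l) = (\<Sum>l<?m. x l * ?c l)" for x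
  by (subst sum.swap) (simp add: sum_distrib_left[symmetric] unit_t_def delta)
 have zs: "snd (unit_t k) = (%_. 0)" "fst (unit_z i) = (%_. 0)" "snd (unit_z i) = ?\<delta>" for k
  by (simp_all add: unit_t_def unit_z_def)
 have ft: "fst (unit_t k) a = (if a = k then 1 else 0)" for k a by (simp add: unit_t_def)
 have tzk: "(\<Sum>k\<in>R i. dlog (tz a j) (t, z) (unit_t k)) = ?c a / (t a - z j)" for a j
  unfolding dlog_def tz_def unit_t_def by (simp add: sum_divide_distrib[symmetric] delta)
 have ttk: "(\<Sum>k\<in>R i. dlog (tt a b) (t, z) (unit_t k)) = (?c a - ?c b) / (t a - t b)" for a b
  unfolding dlog_def tt_def unit_t_def by (simp add: sum_divide_distrib[symmetric] sum_subtractf delta)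
 have zzk: "dlog (zz a b) (t, z) (unit_t k) = 0" for a b k by (simp add: dlog_def zz_def unit_t_def)
 have zzi: "dlog (zz a b) (t, z) (unit_z i) = (?\<delta> a - ?\<delta> b) / (z a - z b)" for a b by (simp add: dlog_def zz_def unit_z_def)
 have tzi: "dlog (tz a b) (t, z) (unit_z i) = - ?\<delta> b / (t a - z b)" for a b by (simp add: dlog_def tz_def unit_z_def)
 have tti: "dlog (tt a b) (t, z) (unit_z i) = 0" for a b by (simp add: dlog_def tt_def unit_z_def)
 have sw: "(\<Sum>k\<in>R i. \<Sum>a\<in>X. \<Sum>b\<in>Y a. e a b * d a b k) = (\<Sum>a\<in>X. \<Sum>b\<in>Y a. e a b * (\<Sum>k\<in>R i. d a b k))"
  for X and Y :: "nat => nat set" and e :: "nat => nat => complex" and d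
  unfolding sum.swap[of _ X "R i"] sum.swap[of _ "Y _" "R i"] sum_distrib_left ..
 have 1: "dlog_Phi A (t, z) (unit_z i) = coef_z A i + (\<Sum>j<?n. \<Sum>a<j. (?\<delta> a - ?\<delta> j) * (exp_zz A a j / (z a - z j)))
   + (\<Sum>k<?m. \<Sum>j<?n. exp_tz A k j * (- ?\<delta> j / (t k - z j)))"
  unfolding dlog_Phi_def zzi tzi tti zs using i by (simp add: if_distrib[of "(*) _"] mult.commute cong: if_cong)
 have "(\<Sum>k\<in>R i. dlog_Phi A (t, z) (unit_t k)) = (\<Sum>l<?m. coef_t A l * ?c l)
   + (\<Sum>k<?m. \<Sum>j<?n. exp_tz A k j * (?c k / (t k - z j)))
   + (\<Sum>l<?m. \<Sum>k<l. exp_tt A k l * ((?c k - ?c l) / (t k - t l)))"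
  unfolding dlog_Phi_def zzk zs by (simp only: sum.distrib lin1 sw tzk ttk) simp
 also have "(\<Sum>l<?m. \<Sum>k<l. exp_tt A k l * ((?c k - ?c l) / (t k - t l))) = (\<Sum>l<?m. \<Sum>k<l. (?c k - ?c l) * (exp_tt A k l / (t k - t l)))"
  by (intro sum.cong refl) (simp add: mult.commute)
 also have "... = (\<Sum>k<?m. \<Sum>l<?m. ?c k * (1 - ?c l) * (exp_tt A k l / (t k - t l)))"
 proof (rule sum_triangle_antisymmetric)
  show "exp_tt A b a / (t b - t a) = - (exp_tt A a b / (t a - t b))" for a b
   unfolding sym(2)[of b a] by (rule divide_diff_flip)
 qed
 also have "... = (\<Sum>k\<in>R i. \<Sum>l\<in>{..<?m} - R i. exp_tt A k l / (t k - t l))"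
 proof -
  have "(\<Sum>l<?m. ?c k * (1 - ?c l) * (exp_tt A k l / (t k - t l))) = (if k \<in> R i then \<Sum>l\<in>{..<?m} - R i. exp_tt A k l / (t k - t l) else 0)" for k
  proof (cases "k \<in> R i")
   case True
   have "(\<Sum>l<?m. ?c k * (1 - ?c l) * (exp_tt A k l / (t k - t l))) = (\<Sum>l<?m. if l \<in> - R i then exp_tt A k l / (t k - t l) else 0)"
    using True by (intro sum.cong) auto
   also have "... = (\<Sum>l\<in>{..<?m} \<inter> - R i. exp_tt A k l / (t k - t l))" by (rule sum.inter_restrict[symmetric]) simp
   finally show ?thesis using True by (simp add: Diff_eq)
  qed simp
  hence "(\<Sum>k<?m. \<Sum>l<?m. ?c k * (1 - ?c l) * (exp_tt A k l / (t k - t l)))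
   = (\<Sum>k\<in>{..<?m} \<inter> R i. \<Sum>l\<in>{..<?m} - R i. exp_tt A k l / (t k - t l))"
   by (simp only: sum.inter_restrict finite_lessThan)
  thus ?thesis using R(1)[OF i] by (simp add: inf.absorb2)
 qed
 also have "(\<Sum>l<?m. coef_t A l * ?c l) = (\<Sum>k\<in>R i. coef_t A k)"
  using R(1)[OF i] by (simp add: sum.inter_restrict[symmetric] inf.absorb2 if_distrib cong: if_cong)
 finally have 2: "(\<Sum>k\<in>R i. dlog_Phi A (t, z) (unit_t k)) = (\<Sum>k\<in>R i. coef_t A k)
   + (\<Sum>k<?m. \<Sum>j<?n. exp_tz A k j * (?c k / (t k - z j)))
   + (\<Sum>k\<in>R i. \<Sum>l\<in>{..<?m} - R i. exp_tt A k l / (t k - t l))" .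
 have 3: "(\<Sum>j<?n. \<Sum>a<j. (?\<delta> a - ?\<delta> j) * (exp_zz A a j / (z a - z j))) = (\<Sum>j\<in>{..<?n} - {i}. exp_zz A i j / (z i - z j))"
 proof -
  have "(\<Sum>j<?n. \<Sum>a<j. (?\<delta> a - ?\<delta> j) * (exp_zz A a j / (z a - z j))) = (\<Sum>a<?n. \<Sum>j<?n. ?\<delta> a * (1 - ?\<delta> j) * (exp_zz A a j / (z a - z j)))"
  proof (rule sum_triangle_antisymmetric)
   show "exp_zz A b a / (z b - z a) = - (exp_zz A a b / (z a - z b))" for a b
    unfolding sym(1)[of b a] by (rule divide_diff_flip)
  qed
  also have "... = (\<Sum>a<?n. if a = i then \<Sum>j<?n. (1 - ?\<delta> j) * (exp_zz A i j / (z i - z j)) else 0)"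
   by (intro sum.cong refl) simp
  also have "... = (\<Sum>j<?n. (1 - ?\<delta> j) * (exp_zz A i j / (z i - z j)))" using i by (simp add: sum.delta)
  also have "... = (\<Sum>j\<in>{..<?n} - {i}. (1 - ?\<delta> j) * (exp_zz A i j / (z i - z j)))"
   using i by (subst sum.remove[of _ i]) auto
  also have "... = (\<Sum>j\<in>{..<?n} - {i}. exp_zz A i j / (z i - z j))" by (intro sum.cong) auto
  finally show ?thesis .
 qed
 have part: "(\<Sum>k\<in>{..<?m} - R i. h k) = (\<Sum>j\<in>{..<?n} - {i}. \<Sum>k\<in>R j. h k)" for h :: "nat => complex"
 proof -
  have "{..<?m} - R i = (\<Union>j\<in>{..<?n} - {i}. R j)"
  proof (intro equalityI subsetI)
   fix k assume "k \<in> {..<?m} - R i" thus "k \<in> (\<Union>j\<in>{..<?n} - {i}. R j)" unfolding R(2)[symmetric] by blast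
  next
   fix k assume "k \<in> (\<Union>j\<in>{..<?n} - {i}. R j)"
   then obtain j where "j < ?n" "j ~= i" "k \<in> R j" by auto
   thus "k \<in> {..<?m} - R i" using R(1)[of j] R(3)[of j i] i by auto
  qed
  thus ?thesis using R(3) finite_subset[OF R(1)] by (simp only:) (rule sum.UNION_disjoint, auto)
 qed
 have 4: "(\<Sum>k<?m. \<Sum>j<?n. exp_tz A k j * (- ?\<delta> j / (t k - z j))) + (\<Sum>k<?m. \<Sum>j<?n. exp_tz A k j * (?c k / (t k - z j)))
  = (\<Sum>j\<in>{..<?n} - {i}. \<Sum>b\<in>R i. exp_tz A b j / (t b - z j)) + (\<Sum>j\<in>{..<?n} - {i}. \<Sum>a\<in>R j. exp_tz A a i / (z i - t a))"
 proof -
  have "(\<Sum>k<?m. \<Sum>j<?n. exp_tz A k j * (- ?\<delta> j / (t k - z j))) + (\<Sum>k<?m. \<Sum>j<?n. exp_tz A k j * (?c k / (t k - z j)))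
   = (\<Sum>k<?m. \<Sum>j<?n. exp_tz A k j * ((?c k - ?\<delta> j) / (t k - z j)))"
   unfolding sum.distrib[symmetric] distrib_left[symmetric]
   by (intro sum.cong refl) (simp add: diff_divide_distrib right_diff_distrib)
  also have "... = (\<Sum>k<?m. (if k \<in> R i then 0 else exp_tz A k i / (z i - t k)) + (if k \<in> R i then \<Sum>j\<in>{..<?n} - {i}. exp_tz A k j / (t k - z j) else 0))"
  proof (rule sum.cong[OF refl])
   fix k
   have m: "- (x / (t k - z i)) = x / (z i - t k)" for x by (rule divide_diff_flip[symmetric])
   have "(\<Sum>j<?n. exp_tz A k j * ((?c k - ?\<delta> j) / (t k - z j)))
    = exp_tz A k i * ((?c k - 1) / (t k - z i)) + (\<Sum>j\<in>{..<?n} - {i}. exp_tz A k j * ((?c k - ?\<delta> j) / (t k - z j)))"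
    using i by (subst sum.remove[of _ i]) auto
   also have "(\<Sum>j\<in>{..<?n} - {i}. exp_tz A k j * ((?c k - ?\<delta> j) / (t k - z j))) = (if k \<in> R i then \<Sum>j\<in>{..<?n} - {i}. exp_tz A k j / (t k - z j) else 0)"
    by (cases "k \<in> R i") (auto intro!: sum.cong sum.neutral)
   also have "exp_tz A k i * ((?c k - 1) / (t k - z i)) = (if k \<in> R i then 0 else exp_tz A k i / (z i - t k))"
    using m by (simp add: divide_inverse)
   finally show "(\<Sum>j<?n. exp_tz A k j * ((?c k - ?\<delta> j) / (t k - z j)))
    = (if k \<in> R i then 0 else exp_tz A k i / (z i - t k)) + (if k \<in> R i then \<Sum>j\<in>{..<?n} - {i}. exp_tz A k j / (t k - z j) else 0)" .
  qed
  also have "... = (\<Sum>k\<in>{..<?m} - R i. exp_tz A k i / (z i - t k)) + (\<Sum>k\<in>R i. \<Sum>j\<in>{..<?n} - {i}. exp_tz A k j / (t k - z j))"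
  proof -
   have a: "(\<Sum>k<?m. if k \<in> R i then 0 else h k) = (\<Sum>k\<in>{..<?m} - R i. h k)" for h :: "nat => complex"
   proof -
    have "(\<Sum>k<?m. if k \<in> R i then 0 else h k) = (\<Sum>k<?m. if k \<in> - R i then h k else 0)" by (intro sum.cong) auto
    also have "... = (\<Sum>k\<in>{..<?m} \<inter> - R i. h k)" by (rule sum.inter_restrict[symmetric]) simp
    finally show ?thesis by (simp add: Diff_eq)
   qed
   have b: "(\<Sum>k<?m. if k \<in> R i then h k else 0) = (\<Sum>k\<in>R i. h k)" for h :: "nat => complex"
    using R(1)[OF i] by (simp add: sum.inter_restrict[symmetric] inf.absorb2)
   show ?thesis unfolding sum.distrib a b ..
  qed
  finally show ?thesis unfolding part by (simp add: sum.swap[of _ "R i"] add.commute)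
 qed
 have 5: "(\<Sum>k\<in>R i. \<Sum>l\<in>{..<?m} - R i. exp_tt A k l / (t k - t l)) = (\<Sum>j\<in>{..<?n} - {i}. \<Sum>b\<in>R i. \<Sum>a\<in>R j. exp_tt A b a / (t b - t a))"
  unfolding part by (rule sum.swap)
 show ?thesis unfolding 1 2 3 5 sum.distrib using 4 by (simp add: algebra_simps)
qed

lemma dlog_Phi_kz_master:
 fixes D :: "'h::complex_vector cartan" and c n \<Lambda> \<mu>
 defines "al \<equiv> %k. sroot D (c k)"
 assumes D: "cartan_datum D" and i: "i < n" and R: "!!j. j < n ==> R j \<subseteq> {..<m}" "(\<Union>j<n. R j) = {..<m}"
   "!!j k. j < n ==> k < n ==> j ~= k ==> R j \<inter> R k = {}"
 shows "dlog_Phi (kz_master D n \<Lambda> m c \<mu> \<kappa>) (t, z) (unit_z i) + (\<Sum>k\<in>R i. dlog_Phi (kz_master D n \<Lambda> m c \<mu> \<kappa>) (t, z) (unit_t k))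
  = (\<Lambda> i \<mu> - (\<Sum>k\<in>R i. al k \<mu>)) + (\<Sum>j\<in>{..<n} - {i}. dform D (\<Lambda> i) (\<Lambda> j) / (z i - z j)
    - (\<Sum>b\<in>R i. dform D (al b) (\<Lambda> j) / (t b - z j)) - (\<Sum>a\<in>R j. dform D (al a) (\<Lambda> i) / (z i - t a))
    + (\<Sum>b\<in>R i. \<Sum>a\<in>R j. dform D (al b) (al a) / (t b - t a)))"
 using dlog_Phi_translation[of i "kz_master D n \<Lambda> m c \<mu> \<kappa>" R t z] i R dform_commute[OF D]
 by (simp add: kz_master_def al_def sum_negf)

section \<open>The Lie algebra, its action on words, and Verma modules\<close>

locale km_algebra =
 fixes D :: "'h::complex_vector cartan" and G :: "('h, 'g::complex_vector) km_lie"
 assumes cartan: "cartan_datum D" and km: "km_lie_algebra D G"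
begin

lemma presented_G: "presented_by (km_words D) (magma_val G) (km_ideal D)"
 using km by (simp add: km_lie_algebra_def)

lemma brk_bilinear: "cbilinear (brk G)"
 using km by (auto simp: km_lie_algebra_def lie_bracket_def cbilinear_def)

lemmas brk_simps = cbilinear_simps[OF brk_bilinear]
 and brk_linear_right = cbilinear_right[OF brk_bilinear]
 and brk_linear_left = cbilinear_left[OF brk_bilinear]

lemma brk_self: "brk G x x = 0" and
 brk_jacobi: "brk G x (brk G y z) + brk G y (brk G z x) + brk G z (brk G x y) = 0"
 using km by (auto simp: km_lie_algebra_def lie_bracket_def)

lemma brk_commute: "brk G x y = - brk G y x"
proof -
 have "brk G (x + y) (x + y) = brk G x x + brk G y x + (brk G x y + brk G y y)"
  by (simp only: brk_simps)
 hence "brk G y x + brk G x y = 0" by (simp add: brk_self)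
 thus ?thesis by (rule minus_unique[symmetric])
qed

lemma brk_derivation: "brk G h (brk G x y) = brk G (brk G h x) y + brk G x (brk G h y)"
 using brk_jacobi[of h x y] brk_commute[of y "brk G h x"] brk_commute[of y h]
 by (simp add: clinear_neg[OF brk_linear_right] add_eq_0_iff2 algebra_simps)

lemma G_rel: "p \<in> km_ideal D ==> lin_ext (magma_val G) p = 0"
 by (rule presented_rel[OF presented_G])

lemma G_fprod: "lin_ext (magma_val G) (fprod p q) = brk G (lin_ext (magma_val G) p) (lin_ext (magma_val G) q)"
 by (rule lin_ext_fprod[OF brk_bilinear]) simp

lemma inH_linear: "clinear (inH G)"
proof (rule clinearI)
 show "inH G (x + y) = inH G x + inH G y" for x y
 proof -
  have "lin_ext (magma_val G) (gH (x + y) - gH x - gH y) = inH G (x + y) - inH G x - inH G y"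
   by (simp add: lin_ext_diff)
  thus ?thesis using G_rel[OF km_ideal.H_add[of x y D]] by (simp add: algebra_simps)
 qed
 show "inH G (a *\<^sub>C x) = a *\<^sub>C inH G x" for a x
  using G_rel[OF km_ideal.H_scale[of a x]] by (simp add: lin_ext_diff lin_ext_scale)
qed

lemma brk_HF: "i < rk D ==> brk G (inH G h) (geF G i) = - (sroot D i h *\<^sub>C geF G i)"
 using G_rel[OF km_ideal.H_F[of i D h]] by (simp add: lin_ext_add lin_ext_scale G_fprod add_eq_0_iff2)

lemma brk_EF: "i < rk D ==> j < rk D ==> brk G (geE G i) (geF G j) = (if i = j then inH G (hcor D i) else 0)"
 using G_rel[OF km_ideal.E_F[of i D j]] by (simp add: lin_ext_diff lin_ext_zero G_fprod split: if_splits)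

lemma span_magma: "cvec.span (magma_val G ` km_words D) = UNIV"
 by (rule presented_span[OF presented_G])

text \<open>For each word vector separately the operators lift through the presentation. Linearity
  in the vector and compatibility with the bracket are then verified on iterated brackets of
  generators, which span.\<close>

lemma word_representation:
 assumes L: "clinear \<Lambda>"
 obtains \<rho> where "cbilinear \<rho>"
  "!!x y w. \<rho> (brk G x y) w = \<rho> x (\<rho> y w) - \<rho> y (\<rho> x w)"
  "!!a w. a \<in> km_words D ==> \<rho> (magma_val G a) w = magma_op D \<Lambda> a w"
proof -
 have "\<exists>L. clinear L \<and> (\<forall>a\<in>km_words D. L (magma_val G a) = magma_op D \<Lambda> a w)" for w
 proof -
  have "lin_ext (%a. magma_op D \<Lambda> a w) p = 0" if "p \<in> km_ideal D" for p
   using km_ideal_free_op[OF cartan L that] unfolding free_op_def .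
  from presented_lift[OF presented_G this] show ?thesis by metis
 qed
 then obtain R where R: "clinear (R w)" "!!a. a \<in> km_words D ==> R w (magma_val G a) = magma_op D \<Lambda> a w" for w
  by metis
 define \<rho> where "\<rho> g w = R w g" for g w
 have rl: "clinear (%g. \<rho> g w)" for w unfolding \<rho>_def by (rule R(1))
 have rm: "\<rho> (magma_val G a) w = magma_op D \<Lambda> a w" if "a \<in> km_words D" for a w
  unfolding \<rho>_def by (rule R(2)[OF that])
 have ext: "f g = f' g" if "clinear f" "clinear f'" "!!a. a \<in> km_words D ==> f (magma_val G a) = f' (magma_val G a)"
  for f f' :: "'g => (nat list \<Rightarrow>\<^sub>0 complex)" and g
  using clinear_eq_on_span[OF that(1,2), of "magma_val G ` km_words D" g] that(3) span_magma by auto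
 have rr: "clinear (\<rho> g)" for g
 proof (rule clinearI)
  show "\<rho> g (x + y) = \<rho> g x + \<rho> g y" for x y
   by (rule ext[of "%g. \<rho> g (x + y)" "%g. \<rho> g x + \<rho> g y"])
     (auto intro: rl clinear_plus simp: rm clinear_add[OF clinear_magma_op])
  show "\<rho> g (a *\<^sub>C x) = a *\<^sub>C \<rho> g x" for a x
   by (rule ext[of "%g. \<rho> g (a *\<^sub>C x)" "%g. a *\<^sub>C \<rho> g x"])
     (auto intro: rl clinear_scaleC simp: rm clinear_scale[OF clinear_magma_op])
 qed
 have 1: "\<rho> (brk G (magma_val G a) y) w = \<rho> (magma_val G a) (\<rho> y w) - \<rho> y (\<rho> (magma_val G a) w)" if a: "a \<in> km_words D" for a y w
 proof (rule ext[of "%y. \<rho> (brk G (magma_val G a) y) w" "%y. \<rho> (magma_val G a) (\<rho> y w) - \<rho> y (\<rho> (magma_val G a) w)"])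
  show "clinear (%y. \<rho> (brk G (magma_val G a) y) w)" by (rule clinear_comp[OF rl brk_linear_right])
  show "clinear (%y. \<rho> (magma_val G a) (\<rho> y w) - \<rho> y (\<rho> (magma_val G a) w))"
   by (rule clinear_minus[OF clinear_comp[OF rr rl] rl])
  fix b assume b: "b \<in> km_words D"
  have ab: "Br a b \<in> km_words D" using a b by (auto simp: km_words_def)
  show "\<rho> (brk G (magma_val G a) (magma_val G b)) w
    = \<rho> (magma_val G a) (\<rho> (magma_val G b) w) - \<rho> (magma_val G b) (\<rho> (magma_val G a) w)"
   using rm[OF ab, of w] by (simp add: rm a b)
 qed
 have 2: "\<rho> (brk G x y) w = \<rho> x (\<rho> y w) - \<rho> y (\<rho> x w)" for x y w
  by (rule ext[of "%x. \<rho> (brk G x y) w" "%x. \<rho> x (\<rho> y w) - \<rho> y (\<rho> x w)"])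
    (auto intro!: 1 clinear_minus clinear_comp[OF rl brk_linear_left] clinear_comp[OF rr rl] rl)
 show thesis by (rule that[of \<rho>]) (auto simp: cbilinear_def rl rr 2 rm)
qed

end

locale km_verma = km_algebra D G
 for D :: "'h::complex_vector cartan" and G :: "('h, 'g::complex_vector) km_lie" +
 fixes \<Lambda> :: "'h => complex" and act :: "'g => 'm => 'm::complex_vector" and v :: 'm
 assumes weight_linear: "clinear \<Lambda>" and verma: "verma_module D G \<Lambda> act v"
begin

lemma presented_M: "presented_by UNIV (%w. foldr act w v) (verma_rel D G \<Lambda>)"
 using verma by (simp add: verma_module_def)

lemma act_bilinear: "cbilinear act"
 using verma by (auto simp: verma_module_def lie_module_def cbilinear_def)

lemmas act_simps = cbilinear_simps[OF act_bilinear]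
 and act_linear = cbilinear_right[OF act_bilinear]
 and act_linear_left = cbilinear_left[OF act_bilinear]

lemma act_brk: "act (brk G x y) w = act x (act y w) - act y (act x w)"
 using verma by (auto simp: verma_module_def lie_module_def)

lemma act_E_highest: "i < rk D ==> act (geE G i) v = 0"
 using presented_rel[OF presented_M verma_rel.highest[of i]] by simp

lemma act_H_highest: "act (inH G h) v = \<Lambda> h *\<^sub>C v"
 using presented_rel[OF presented_M verma_rel.weight[of G h]] by (simp add: lin_ext_diff lin_ext_scale)

definition fw :: "nat list => 'm" where
 "fw w = foldr (%i. act (geF G i)) w v"

lemma fw_Nil [simp]: "fw [] = v" and fw_Cons: "fw (i # w) = act (geF G i) (fw w)"
 by (simp_all add: fw_def)

lemma act_H_fw: "set w \<subseteq> {..<rk D} ==> act (inH G h) (fw w) = wt_word D \<Lambda> w h *\<^sub>C fw w"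
proof (induction w)
 case Nil show ?case by (simp add: act_H_highest wt_word_def)
next
 case (Cons i w)
 have i: "i < rk D" and w: "set w \<subseteq> {..<rk D}" using Cons by auto
 have "act (inH G h) (fw (i # w)) = act (brk G (inH G h) (geF G i)) (fw w) + act (geF G i) (act (inH G h) (fw w))"
  by (simp add: act_brk fw_Cons)
 thus ?case using i Cons.IH[OF w]
  by (simp add: brk_HF fw_Cons clinear_neg[OF act_linear_left] act_simps wt_word_Cons cvec.scale_left_diff_distrib)
qed

text \<open>The span is stable under the generators: f_i prefixes a letter, h acts by a scalar, and
  e_i is moved through the word until it meets the highest weight vector. It is then stable under
  the Lie algebra and contains \<open>v\<close>, which generates the module.\<close>

lemma span_fw: "cvec.span (fw ` {w. set w \<subseteq> {..<rk D}}) = UNIV" (is "cvec.span ?S = UNIV")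
proof -
 have H: "act (inH G h) (fw w) \<in> cvec.span ?S" if "set w \<subseteq> {..<rk D}" for h w
  unfolding act_H_fw[OF that] using that by (intro cvec.span_scale cvec.span_base) auto
 have F: "act (geF G i) (fw w) \<in> cvec.span ?S" if "set w \<subseteq> {..<rk D}" "i < rk D" for i w
  using that by (intro cvec.span_base) (auto simp: fw_Cons[symmetric] intro!: imageI)
 have ext: "act g x \<in> cvec.span ?S" if "!!w. set w \<subseteq> {..<rk D} ==> act g (fw w) \<in> cvec.span ?S" "x \<in> cvec.span ?S" for g x
  using that(2)
  by (induction rule: cvec.span_induct_alt)
    (auto simp: act_simps clinear_zero[OF act_linear] intro!: cvec.span_add cvec.span_scale that(1) cvec.span_zero)
 have E: "act (geE G i) (fw w) \<in> cvec.span ?S" if "set w \<subseteq> {..<rk D}" "i < rk D" for i w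
  using that(1)
 proof (induction w)
  case Nil show ?case using that by (simp add: act_E_highest cvec.span_zero)
 next
  case (Cons j w)
  hence j: "j < rk D" and w: "set w \<subseteq> {..<rk D}" by auto
  have "act (geE G i) (fw (j # w)) = act (brk G (geE G i) (geF G j)) (fw w) + act (geF G j) (act (geE G i) (fw w))"
   by (simp add: act_brk fw_Cons)
  also have "... \<in> cvec.span ?S"
   using ext[OF F[OF _ j] Cons.IH[OF w]] H[OF w] that(2) j
   by (auto simp: brk_EF clinear_zero[OF act_linear_left] intro: cvec.span_add)
  finally show ?case .
 qed
 have mag: "a \<in> km_words D ==> x \<in> cvec.span ?S ==> act (magma_val G a) x \<in> cvec.span ?S" for a x
 proof (induction a arbitrary: x)
  case (Leaf y)
  show ?case
   by (rule ext[OF _ Leaf(2)]) (use Leaf(1) in \<open>cases y; auto simp: km_words_def intro: H F E\<close>)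
 next
  case (Br a b)
  hence "a \<in> km_words D" "b \<in> km_words D" by (auto simp: km_words_def)
  thus ?case using Br by (auto simp: act_brk intro!: cvec.span_diff)
 qed
 have all: "act g x \<in> cvec.span ?S" if x: "x \<in> cvec.span ?S" for g x
 proof -
  have "g \<in> cvec.span (magma_val G ` km_words D)" by (simp add: span_magma)
  thus ?thesis
   by (induction rule: cvec.span_induct_alt)
     (auto simp: act_simps clinear_zero[OF act_linear_left] intro!: cvec.span_add cvec.span_scale mag x cvec.span_zero)
 qed
 have "v \<in> cvec.span ?S" by (rule cvec.span_base, rule image_eqI[of _ _ "[]"]) auto
 hence "foldr act w v \<in> cvec.span ?S" for w by (induction w) (auto intro: all)
 hence "range (%w. foldr act w v) \<subseteq> cvec.span ?S" by auto
 hence "cvec.span (range (%w. foldr act w v)) \<subseteq> cvec.span ?S" by (rule cvec.span_minimal) (rule cvec.subspace_span)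
 thus ?thesis unfolding presented_span[OF presented_M] by auto
qed

text \<open>Mapping words of the Lie algebra through the representation on \<open>nat list \<Rightarrow>\<^sub>0 complex\<close> shows that
  the vectors \<open>fw w\<close> are linearly independent.\<close>

lemma fw_lift:
 fixes f :: "nat list => 'w::complex_vector"
 obtains L where "clinear L" "!!w. set w \<subseteq> {..<rk D} ==> L (fw w) = f w"
proof -
 obtain \<rho> where r: "cbilinear \<rho>"
  "!!x y w. \<rho> (brk G x y) w = \<rho> x (\<rho> y w) - \<rho> y (\<rho> x w)"
  "!!a w. a \<in> km_words D ==> \<rho> (magma_val G a) w = magma_op D \<Lambda> a w"
  by (rule word_representation[OF weight_linear]) blast
 have rg: "\<rho> (inH G h) = lin_ext (gen_op D \<Lambda> (GenH h))" for h
  using r(3)[of "Leaf (GenH h)"] by (intro ext) (simp add: km_words_def)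
 have rf: "\<rho> (geF G i) = lin_ext (gen_op D \<Lambda> (GenF i))" if "i < rk D" for i
  using r(3)[of "Leaf (GenF i)"] that by (intro ext) (simp add: km_words_def)
 have re: "\<rho> (geE G i) = lin_ext (gen_op D \<Lambda> (GenE i))" if "i < rk D" for i
  using r(3)[of "Leaf (GenE i)"] that by (intro ext) (simp add: km_words_def)
 let ?f = "%w. foldr \<rho> w (fgen [])"
 \<comment> \<open>The empty word satisfies the highest weight relations in the representation on
   words, so the Verma module maps to it; this map sends \<open>fw w\<close> to the basis element of
   \<open>w\<close>.\<close>
 have rel: "lin_ext ?f p = 0" if "p \<in> verma_rel D G \<Lambda>" for p
  using that
 proof (induction rule: verma_rel.induct)
  case (left p x)
  have "lin_ext ?f (prep x p) = \<rho> x (lin_ext ?f p)"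
   unfolding prep_def lin_ext_comp[OF clinear_lin_ext] lin_ext_comp[OF cbilinear_right[OF r(1)]] by simp
  thus ?case using left by (simp add: cbilinear_simps[OF r(1)] clinear_zero[OF cbilinear_right[OF r(1)]])
 next
  case (comm x y w) show ?case by (simp add: lin_ext_add lin_ext_diff r(2))
 next
  case (highest i) thus ?case by (simp add: re)
 next
  case (weight h) show ?case by (simp add: lin_ext_diff lin_ext_scale rg wt_word_def)
 qed (simp_all add: lin_ext_zero lin_ext_add lin_ext_diff lin_ext_scale cbilinear_simps[OF r(1)])
 obtain P where P: "clinear P" "!!w. P (foldr act w v) = ?f w"
  using presented_lift[OF presented_M rel] by auto
 have Pf: "P (fw w) = fgen w" if "set w \<subseteq> {..<rk D}" for w
 proof -
  have "P (fw w) = ?f (map (geF G) w)" using P(2)[of "map (geF G) w"] by (simp add: fw_def foldr_map comp_def)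
  also have "... = fgen w" using that by (induction w) (auto simp: rf)
  finally show ?thesis .
 qed
 show thesis by (rule that[of "%x. lin_ext f (P x)"]) (auto intro: clinear_comp[OF clinear_lin_ext P(1)] simp: Pf)
qed

lemma fw_ext:
 assumes "clinear f" "clinear f'" "!!w. set w \<subseteq> {..<rk D} ==> f (fw w) = f' (fw w)"
 shows "f x = f' x"
 by (rule clinear_eq_on_span[OF assms(1,2), of "fw ` {w. set w \<subseteq> {..<rk D}}"]) (use assms(3) span_fw in auto)

lemma fw_weight_vec: "set w \<subseteq> {..<rk D} ==> weight_vec G act (wt_word D \<Lambda> w) (fw w)"
 by (simp add: weight_vec_def act_H_fw)

text \<open>In \<open>weight_vec\<close> a weight is an arbitrary function. On a nonzero vector it
  inherits linearity from the action, as is needed to evaluate the form on it.\<close>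

lemma weight_vec_linear: "weight_vec G act wt x ==> x ~= 0 ==> clinear wt"
proof -
 assume w: "weight_vec G act wt x" and x: "x ~= 0"
 have e: "wt h *\<^sub>C x = act (inH G h) x" for h using w by (simp add: weight_vec_def)
 show ?thesis
 proof (rule clinearI)
  fix a b
  have "wt (a + b) *\<^sub>C x = (wt a + wt b) *\<^sub>C x"
   unfolding scaleC_add_left e by (simp add: clinear_add[OF inH_linear] act_simps)
  thus "wt (a + b) = wt a + wt b" using x by simp
 next
  fix a b
  have "wt (a *\<^sub>C b) *\<^sub>C x = (a * wt b) *\<^sub>C x"
   unfolding scaleC_scaleC[symmetric] e by (simp add: clinear_scale[OF inH_linear] act_simps)
  thus "wt (a *\<^sub>C b) = a *\<^sub>C wt b" using x by (simp add: scaleC_complex_def)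
 qed
qed

end

section \<open>Root space decomposition of the nilpotent subalgebra\<close>

primrec magma_content :: "nat magma => nat => nat" where
 "magma_content (Leaf i) = (%k. if k = i then 1 else 0)"
| "magma_content (Br a b) = (%k. magma_content a k + magma_content b k)"

lemma magma_content_support: "k \<notin> set_magma a ==> magma_content a k = 0"
 by (induction a) auto

lemma magma_content_nonzero: "\<exists>k. magma_content a k ~= 0"
 by (induction a) (auto intro: exI[of _ "_::nat"])

text \<open>A bracket expression has at least one letter on each side, so expressions with at most
  N+1 letters are single letters or brackets of two with at most N. This bounds the dimension of
  root spaces.\<close>

lemma finite_magmas:
 fixes X :: "nat set"
 assumes "finite X"
 shows "finite {a. set_magma a \<subseteq> X \<and> (\<Sum>k\<in>X. magma_content a k) \<le> N}"
proof (induction N)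
 have pos: "(\<Sum>k\<in>X. magma_content a k) > 0" if "set_magma a \<subseteq> X" for a
 proof -
  obtain k where k: "magma_content a k ~= 0" using magma_content_nonzero by blast
  hence "k \<in> X" using magma_content_support[of k a] that by (metis subsetD)
  show ?thesis by (rule sum_pos2[OF assms \<open>k \<in> X\<close>]) (use k in simp_all)
 qed
 case 0
 have "{a. set_magma a \<subseteq> X \<and> (\<Sum>k\<in>X. magma_content a k) \<le> 0} = {}" (is "?E = {}")
 proof (rule equals0I)
  fix a assume "a \<in> ?E"
  hence "set_magma a \<subseteq> X" and le: "(\<Sum>k\<in>X. magma_content a k) \<le> 0" by auto
  from pos[OF this(1)] le show False by linarith
 qed
 thus ?case by (simp only: finite.emptyI)
 case (Suc N)
 let ?A = "%N. {a. set_magma a \<subseteq> X \<and> (\<Sum>k\<in>X. magma_content a k) \<le> N}"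
 have sub: "?A (Suc N) \<subseteq> Leaf ` X \<union> (%(a, b). Br a b) ` (?A N \<times> ?A N)"
 proof
  fix a assume a: "a \<in> ?A (Suc N)"
  show "a \<in> Leaf ` X \<union> (%(a, b). Br a b) ` (?A N \<times> ?A N)"
  proof (cases a)
   case (Leaf x) thus ?thesis using a by auto
  next
   case (Br b c)
   hence s: "set_magma b \<subseteq> X" "set_magma c \<subseteq> X" and "(\<Sum>k\<in>X. magma_content b k) + (\<Sum>k\<in>X. magma_content c k) \<le> Suc N"
    using a by (auto simp: sum.distrib)
   hence "b \<in> ?A N" "c \<in> ?A N" using pos[OF s(1)] pos[OF s(2)] by auto
   thus ?thesis using Br by auto
  qed
 qed
 show ?case by (rule finite_subset[OF sub]) (intro finite_UnI finite_imageI finite_cartesian_product assms Suc.IH)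
qed

context km_algebra begin

primrec fval :: "nat magma => 'g" where
 "fval (Leaf i) = geF G i"
| "fval (Br a b) = brk G (fval a) (fval b)"

lemma fval_n_minus: "set_magma a \<subseteq> {..<rk D} ==> fval a \<in> n_minus D G"
 by (induction a) (auto intro: n_minus.intros)

lemma n_minus_subspace: "cvec.subspace (n_minus D G)"
 by (auto simp: cvec.subspace_def intro: n_minus.intros)

lemma n_minus_span: "n_minus D G = cvec.span (fval ` {a. set_magma a \<subseteq> {..<rk D}})" (is "_ = cvec.span ?S")
proof
 show "cvec.span ?S \<subseteq> n_minus D G"
  by (rule cvec.span_minimal) (auto intro: fval_n_minus n_minus_subspace)
 have br: "brk G x y \<in> cvec.span ?S" if "x \<in> cvec.span ?S" "y \<in> cvec.span ?S" for x y
  using that(1)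
 proof (induction rule: cvec.span_induct_alt)
  case base show ?case by (simp add: clinear_zero[OF brk_linear_left] cvec.span_zero)
 next
  case (step c x z)
  then obtain a where a: "x = fval a" "set_magma a \<subseteq> {..<rk D}" by auto
  have "brk G x y \<in> cvec.span ?S" using that(2)
  proof (induction rule: cvec.span_induct_alt)
   case base show ?case by (simp add: clinear_zero[OF brk_linear_right] cvec.span_zero)
  next
   case (step c y z)
   then obtain b where b: "y = fval b" "set_magma b \<subseteq> {..<rk D}" by auto
   have "brk G x y \<in> cvec.span ?S" by (rule cvec.span_base, rule image_eqI[of _ _ "Br a b"]) (use a b in auto)
   thus ?case using step by (auto simp only: brk_simps intro!: cvec.span_add cvec.span_scale)
  qed
  thus ?case using step by (auto simp only: brk_simps intro!: cvec.span_add cvec.span_scale)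
 qed
 show "n_minus D G \<subseteq> cvec.span ?S"
 proof
  fix x assume "x \<in> n_minus D G"
  thus "x \<in> cvec.span ?S"
  proof induction
   case (2 i) show ?case by (rule cvec.span_base, rule image_eqI[of _ _ "Leaf i"]) (use 2 in auto)
  qed (auto intro: br cvec.span_zero cvec.span_add cvec.span_scale)
 qed
qed

lemma root_fun_add: "root_fun D (%k. \<beta> k + \<gamma> k) h = root_fun D \<beta> h + root_fun D \<gamma> h"
 by (simp add: root_fun_def algebra_simps sum.distrib)

lemma root_fun_inj:
 assumes "!!h. root_fun D \<beta> h = root_fun D \<gamma> h" "\<forall>i\<ge>rk D. \<beta> i = 0" "\<forall>i\<ge>rk D. \<gamma> i = 0"
 shows "\<beta> = \<gamma>"
proof
 fix i
 have "\<forall>h. (\<Sum>i<rk D. (of_nat (\<beta> i) - of_nat (\<gamma> i)) * sroot D i h) = 0"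
  using assms(1) by (simp add: root_fun_def algebra_simps sum_subtractf)
 moreover have "!!a. (\<forall>h. (\<Sum>i<rk D. a i * sroot D i h) = 0) ==> \<forall>i<rk D. a i = 0"
  using cartan unfolding cartan_datum_def by blast
 note this[of "%i. of_nat (\<beta> i) - of_nat (\<gamma> i)"]
 ultimately have "\<forall>i<rk D. (of_nat (\<beta> i) :: complex) - of_nat (\<gamma> i) = 0" by blast
 thus "\<beta> i = \<gamma> i" using assms(2,3) by (cases "i < rk D") (auto simp: not_less)
qed

lemma brk_H_fval: "set_magma a \<subseteq> {..<rk D} ==> brk G (inH G h) (fval a) = - (root_fun D (magma_content a) h *\<^sub>C fval a)"
proof (induction a)
 case (Leaf i)
 have "root_fun D (magma_content (Leaf i)) h = (\<Sum>j<rk D. if j = i then sroot D j h else 0)"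
  unfolding root_fun_def by (intro sum.cong) auto
 thus ?case using Leaf by (simp add: brk_HF)
next
 case (Br a b)
 have "brk G (inH G h) (fval (Br a b)) = brk G (brk G (inH G h) (fval a)) (fval b) + brk G (fval a) (brk G (inH G h) (fval b))"
  unfolding fval.simps by (rule brk_derivation)
 also have "... = - ((root_fun D (magma_content a) h + root_fun D (magma_content b) h) *\<^sub>C fval (Br a b))"
  using Br by (simp add: clinear_neg[OF brk_linear_left] clinear_neg[OF brk_linear_right] brk_simps scaleC_add_left)
 finally show ?case by (simp add: root_fun_add)
qed

lemma fval_weight: "set_magma a \<subseteq> {..<rk D} ==> fval a \<in> n_minus_wt D G (magma_content a)"
 by (simp add: n_minus_wt_def fval_n_minus brk_H_fval)

lemma n_minus_wt_subspace: "cvec.subspace (n_minus_wt D G \<beta>)"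
 using n_minus_subspace
 by (auto simp: cvec.subspace_def n_minus_wt_def brk_simps clinear_zero[OF brk_linear_right]
   scaleC_add_right scaleC_scaleC mult.commute)

text \<open>Applying ad h to the relation and eliminating one component multiplies the others by
  differences of weights. By induction these products vanish for all \<open>h\<close>, and distinct
  weights differ on some \<open>h\<close> since the simple roots are linearly independent.\<close>

lemma weight_spaces_independent:
 assumes "finite \<Gamma>" "!!\<gamma>. \<gamma> \<in> \<Gamma> ==> x \<gamma> \<in> n_minus_wt D G \<gamma>" "!!\<gamma> i. \<gamma> \<in> \<Gamma> ==> i \<ge> rk D ==> \<gamma> i = 0"
  "(\<Sum>\<gamma>\<in>\<Gamma>. x \<gamma>) = 0" "\<gamma> \<in> \<Gamma>"
 shows "x \<gamma> = 0"
 using assms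
proof (induction \<Gamma> arbitrary: x \<gamma> rule: finite_induct)
 case empty thus ?case by simp
next
 case (insert \<delta> \<Gamma>)
 have zero: "x \<gamma> = 0" if g: "\<gamma> \<in> \<Gamma>" for \<gamma>
 proof -
  have *: "(root_fun D \<gamma> h - root_fun D \<delta> h) *\<^sub>C x \<gamma> = 0" for h
  proof (rule insert.IH[of "%\<gamma>. (root_fun D \<gamma> h - root_fun D \<delta> h) *\<^sub>C x \<gamma>"])
   show "(root_fun D \<gamma> h - root_fun D \<delta> h) *\<^sub>C x \<gamma> \<in> n_minus_wt D G \<gamma>" if "\<gamma> \<in> \<Gamma>" for \<gamma>
    using insert.prems(1) that by (intro cvec.subspace_scale n_minus_wt_subspace) auto
   have w: "brk G (inH G h) (x \<gamma>) = - (root_fun D \<gamma> h *\<^sub>C x \<gamma>)" if "\<gamma> \<in> insert \<delta> \<Gamma>" for \<gamma>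
    using insert.prems(1)[OF that] by (simp add: n_minus_wt_def)
   have s: "x \<delta> = - (\<Sum>\<gamma>\<in>\<Gamma>. x \<gamma>)" using insert.prems(3) insert.hyps by (simp add: eq_neg_iff_add_eq_0)
   have "0 = brk G (inH G h) (\<Sum>\<gamma>\<in>insert \<delta> \<Gamma>. x \<gamma>)" by (simp only: insert.prems(3) clinear_zero[OF brk_linear_right])
   also have "... = (\<Sum>\<gamma>\<in>insert \<delta> \<Gamma>. - (root_fun D \<gamma> h *\<^sub>C x \<gamma>))"
    unfolding clinear_sum[OF brk_linear_right] by (intro sum.cong refl w)
   also have "... = - (root_fun D \<delta> h *\<^sub>C x \<delta>) - (\<Sum>\<gamma>\<in>\<Gamma>. root_fun D \<gamma> h *\<^sub>C x \<gamma>)"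
    using insert.hyps by (simp add: sum_negf)
   also have "... = - (\<Sum>\<gamma>\<in>\<Gamma>. (root_fun D \<gamma> h - root_fun D \<delta> h) *\<^sub>C x \<gamma>)"
    unfolding s by (simp add: cvec.scale_left_diff_distrib sum_subtractf cvec.scale_sum_right)
   finally show "(\<Sum>\<gamma>\<in>\<Gamma>. (root_fun D \<gamma> h - root_fun D \<delta> h) *\<^sub>C x \<gamma>) = 0" by simp
   show "!!\<gamma> i. \<gamma> \<in> \<Gamma> ==> i \<ge> rk D ==> \<gamma> i = 0" using insert.prems(2) by auto
  qed (rule g)
  have "\<gamma> ~= \<delta>" using g insert.hyps by auto
  hence "\<exists>h. root_fun D \<gamma> h ~= root_fun D \<delta> h"
   using root_fun_inj[of \<gamma> \<delta>] insert.prems(2) g by auto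
  thus ?thesis using * by auto
 qed
 show ?case
  using zero insert.prems(3,4) insert.hyps by auto
qed

text \<open>An expansion in iterated brackets is grouped by weight. Independence of the weight
  spaces leaves only the group of weight \<open>\<beta>\<close>.\<close>

lemma n_minus_wt_span:
 assumes beta: "\<forall>i\<ge>rk D. \<beta> i = 0"
 shows "n_minus_wt D G \<beta> \<subseteq> cvec.span (fval ` {a. set_magma a \<subseteq> {..<rk D} \<and> magma_content a = \<beta>})"
proof
 fix x assume x: "x \<in> n_minus_wt D G \<beta>"
 hence "x \<in> cvec.span (fval ` {a. set_magma a \<subseteq> {..<rk D}})" by (simp add: n_minus_wt_def n_minus_span[symmetric])
 then obtain T r where T: "finite T" "T \<subseteq> fval ` {a. set_magma a \<subseteq> {..<rk D}}" "x = (\<Sum>a\<in>T. r a *\<^sub>C a)"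
  unfolding cvec.span_explicit by auto
 then obtain W where W: "W \<subseteq> {a. set_magma a \<subseteq> {..<rk D}}" "inj_on fval W" "fval ` W = T"
  using subset_image_inj[of T fval] by metis
 have fW: "finite W" using W T(1) finite_imageD by blast
 have xs: "x = (\<Sum>a\<in>W. r (fval a) *\<^sub>C fval a)"
  unfolding T(3) W(3)[symmetric] by (simp add: sum.reindex[OF W(2)])
 define y where "y \<gamma> = (\<Sum>a | a \<in> W \<and> magma_content a = \<gamma>. r (fval a) *\<^sub>C fval a)" for \<gamma>
 let ?\<Gamma> = "insert \<beta> (magma_content ` W)"
 have yw: "y \<gamma> \<in> n_minus_wt D G \<gamma>" for \<gamma>
  unfolding y_def using W(1) fval_weight
  by (intro cvec.subspace_sum n_minus_wt_subspace cvec.subspace_scale) auto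
 have "y \<beta> - x = 0"
 proof -
  have "y \<beta> - (if \<beta> = \<beta> then x else 0) = 0"
  proof (rule weight_spaces_independent[of ?\<Gamma> "%\<gamma>. y \<gamma> - (if \<gamma> = \<beta> then x else 0)"])
   show "y \<gamma> - (if \<gamma> = \<beta> then x else 0) \<in> n_minus_wt D G \<gamma>" for \<gamma>
    using yw x by (auto intro: cvec.subspace_diff n_minus_wt_subspace)
   show "!!\<gamma> i. \<gamma> \<in> ?\<Gamma> ==> i \<ge> rk D ==> \<gamma> i = 0"
    using beta W(1) magma_content_support by fastforce
   have "(\<Sum>\<gamma>\<in>?\<Gamma>. y \<gamma>) = (\<Sum>a\<in>W. r (fval a) *\<^sub>C fval a)"
    unfolding y_def by (rule sum.group) (use fW in auto)
   thus "(\<Sum>\<gamma>\<in>?\<Gamma>. y \<gamma> - (if \<gamma> = \<beta> then x else 0)) = 0"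
    using fW xs by (simp add: sum_subtractf sum.delta del: sum.insert)
  qed (use fW in auto)
  thus ?thesis by simp
 qed
 hence "x = y \<beta>" by simp
 also have "... \<in> cvec.span (fval ` {a. set_magma a \<subseteq> {..<rk D} \<and> magma_content a = \<beta>})"
  unfolding y_def using W(1) by (intro cvec.span_sum cvec.span_scale cvec.span_base) auto
 finally show "x \<in> cvec.span (fval ` {a. set_magma a \<subseteq> {..<rk D} \<and> magma_content a = \<beta>})" .
qed

end

locale km_roots = km_algebra D G
 for D :: "'h::complex_vector cartan" and G :: "('h, 'g::complex_vector) km_lie" +
 fixes B :: "(nat => nat) => 'g set"
 assumes bases: "root_bases D G B"
begin

lemma root_basis: "\<beta> \<in> pos_roots D G ==> cvec.independent (B \<beta>)"
  "\<beta> \<in> pos_roots D G ==> cvec.span (B \<beta>) = n_minus_wt D G \<beta>"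
 using bases by (auto simp: root_bases_def)

lemma basis_weight: "\<beta> \<in> pos_roots D G ==> x \<in> B \<beta> ==> x \<in> n_minus_wt D G \<beta>"
 using root_basis(2) cvec.span_base by blast

text \<open>The bases are arbitrary, and a sum over an infinite set has the value zero by
  convention; finiteness gives the sums in \<Omega>_+ their intended meaning.\<close>

lemma finite_root_basis:
 assumes "\<beta> \<in> pos_roots D G"
 shows "finite (B \<beta>)"
proof -
 let ?M = "{a. set_magma a \<subseteq> {..<rk D} \<and> magma_content a = \<beta>}"
 have "finite ?M"
  by (rule finite_subset[OF _ finite_magmas[of "{..<rk D}" "\<Sum>k<rk D. \<beta> k"]]) auto
 hence "finite (fval ` ?M)" by simp
 moreover have "B \<beta> \<subseteq> cvec.span (fval ` ?M)"
  using n_minus_wt_span[of \<beta>] basis_weight[OF assms] assms by (auto simp: pos_roots_def)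
 ultimately show ?thesis using cvec.independent_span_bound root_basis(1)[OF assms] by blast
qed

abbreviation all_basis :: "'g set" where
 "all_basis \<equiv> \<Union>\<gamma>\<in>pos_roots D G. B \<gamma>"

lemma basis_disjoint:
 assumes "\<beta> \<in> pos_roots D G" "\<gamma> \<in> pos_roots D G" "\<beta> ~= \<gamma>"
 shows "B \<beta> \<inter> B \<gamma> = {}"
proof (rule ccontr)
 assume "B \<beta> \<inter> B \<gamma> ~= {}"
 then obtain x where x: "x \<in> B \<beta>" "x \<in> B \<gamma>" by auto
 let ?y = "%\<delta>. if \<delta> = \<beta> then x else - x"
 have "?y \<beta> = 0"
 proof (rule weight_spaces_independent[of "{\<beta>, \<gamma>}" ?y])
  show "?y \<delta> \<in> n_minus_wt D G \<delta>" if "\<delta> \<in> {\<beta>, \<gamma>}" for \<delta>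
   using that basis_weight[OF assms(1) x(1)] basis_weight[OF assms(2) x(2)] cvec.subspace_neg[OF n_minus_wt_subspace] by auto
  show "\<delta> i = 0" if "\<delta> \<in> {\<beta>, \<gamma>}" "i \<ge> rk D" for \<delta> i using that assms by (auto simp: pos_roots_def)
 qed (use assms in auto)
 hence "0 \<in> B \<beta>" using x by simp
 thus False using root_basis(1)[OF assms(1)] cvec.dependent_zero by blast
qed

lemma all_basis_independent: "cvec.independent all_basis"
 unfolding cvec.independent_explicit_module
proof (intro allI impI)
 fix T r x
 assume T: "finite T" "T \<subseteq> all_basis" "(\<Sum>x\<in>T. r x *\<^sub>C x) = 0" and x: "x \<in> T"
 have "\<exists>\<gamma>. \<gamma> \<in> pos_roots D G \<and> x \<in> B \<gamma>" if "x \<in> T" for x using that T(2) by auto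
 then obtain g where g: "g x \<in> pos_roots D G" "x \<in> B (g x)" if "x \<in> T" for x by metis
 let ?y = "%\<gamma>. \<Sum>x | x \<in> T \<and> g x = \<gamma>. r x *\<^sub>C x"
 have "?y (g x) = 0"
 proof (rule weight_spaces_independent[of "g ` T" ?y])
  show "?y \<gamma> \<in> n_minus_wt D G \<gamma>" for \<gamma>
   using basis_weight[OF g] by (intro cvec.subspace_sum n_minus_wt_subspace cvec.subspace_scale) auto
  show "\<gamma> i = 0" if "\<gamma> \<in> g ` T" "i \<ge> rk D" for \<gamma> i using that g(1) by (auto simp: pos_roots_def)
  show "sum ?y (g ` T) = 0" using sum.image_gen[OF T(1), of "%x. r x *\<^sub>C x" g] T(3) by simp
 qed (use T x in auto)
 moreover have "{y \<in> T. g y = g x} \<subseteq> B (g x)" using g(2) by force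
 ultimately show "r x = 0"
  by (intro cvec.independentD[OF root_basis(1)[OF g(1)[OF x]], of "{y\<in>T. g y = g x}" r x]) (use T(1) x in auto)
qed

lemma n_minus_all_basis: "n_minus D G \<subseteq> cvec.span all_basis"
proof -
 have "fval a \<in> cvec.span all_basis" if "set_magma a \<subseteq> {..<rk D}" for a
 proof (cases "fval a = 0")
  case True thus ?thesis by (simp add: cvec.span_zero)
 next
  case False
  have "magma_content a \<in> pos_roots D G"
   using False fval_weight[OF that] magma_content_nonzero[of a] magma_content_support[of _ a] that
   by (fastforce simp: pos_roots_def)
  hence "fval a \<in> cvec.span (B (magma_content a))" "B (magma_content a) \<subseteq> all_basis"
   using root_basis(2) fval_weight[OF that] by auto
  thus ?thesis using cvec.span_mono by blast
 qed
 thus ?thesis unfolding n_minus_span by (intro cvec.span_minimal cvec.subspace_span) auto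
qed

lemma dual_vec_linear:
 assumes "d \<in> n_minus D G" "d' \<in> n_minus D G"
 shows "dual_vec D G B x (d + d') = dual_vec D G B x d + dual_vec D G B x d'"
  and "dual_vec D G B x (a *\<^sub>C d) = a * dual_vec D G B x d"
 using assms n_minus_all_basis all_basis_independent
 by (auto simp: dual_vec_def cvec.representation_add cvec.representation_scale subset_iff)

text \<open>\<open>F0\<close> consists of the roots in which \<open>d\<close> has a nonzero
  coordinate. Allowing every finite \<open>F\<close> above \<open>F0\<close> makes it possible to
  pass to common finite sets for several vectors.\<close>

lemma root_expansion:
 assumes d: "d \<in> n_minus D G"
 obtains F0 where "finite F0" "F0 \<subseteq> pos_roots D G"
  "!!\<beta> x. \<beta> \<in> pos_roots D G - F0 ==> x \<in> B \<beta> ==> dual_vec D G B x d = 0"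
  "!!F. finite F ==> F0 \<subseteq> F ==> F \<subseteq> pos_roots D G ==> (\<Sum>\<beta>\<in>F. \<Sum>x\<in>B \<beta>. dual_vec D G B x d *\<^sub>C x) = d"
proof -
 let ?r = "%x. dual_vec D G B x d"
 let ?X = "{x. ?r x ~= 0}"
 have fX: "finite ?X" unfolding dual_vec_def by (rule cvec.finite_representation)
 have X: "x \<in> all_basis" if "?r x ~= 0" for x
  using that unfolding dual_vec_def by (rule cvec.representation_ne_zero)
 have dX: "(\<Sum>x\<in>?X. ?r x *\<^sub>C x) = d"
  using cvec.sum_nonzero_representation_eq[OF all_basis_independent, of d] d n_minus_all_basis
  unfolding dual_vec_def by blast
 let ?F0 = "{\<beta> \<in> pos_roots D G. \<exists>x\<in>B \<beta>. ?r x ~= 0}"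
 have "\<exists>\<gamma>. \<gamma> \<in> pos_roots D G \<and> x \<in> B \<gamma>" if "?r x ~= 0" for x using X[OF that] by auto
 then obtain g where g: "g x \<in> pos_roots D G" "x \<in> B (g x)" if "?r x ~= 0" for x by metis
 have "?F0 \<subseteq> g ` ?X"
 proof
  fix \<beta> assume "\<beta> \<in> ?F0"
  then obtain x where x: "x \<in> B \<beta>" "?r x ~= 0" and b: "\<beta> \<in> pos_roots D G" by auto
  have "g x = \<beta>" using basis_disjoint[OF g(1)[OF x(2)] b] g(2)[OF x(2)] x(1) by auto
  thus "\<beta> \<in> g ` ?X" using x by auto
 qed
 hence fin: "finite ?F0" using fX finite_surj by blast
 show thesis
 proof (rule that[of ?F0])
  fix F assume F: "finite F" "?F0 \<subseteq> F" "F \<subseteq> pos_roots D G"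
  have "(\<Sum>\<beta>\<in>F. \<Sum>x\<in>B \<beta>. ?r x *\<^sub>C x) = (\<Sum>x\<in>(\<Union>\<beta>\<in>F. B \<beta>). ?r x *\<^sub>C x)"
   using F finite_root_basis basis_disjoint by (intro sum.UNION_disjoint[symmetric]) (auto, blast)
  also have "... = (\<Sum>x\<in>?X. ?r x *\<^sub>C x)"
  proof (rule sum.mono_neutral_right)
   show "finite (\<Union>\<beta>\<in>F. B \<beta>)" using F finite_root_basis by auto
   show "?X \<subseteq> (\<Union>\<beta>\<in>F. B \<beta>)"
   proof
    fix x assume "x \<in> ?X"
    hence "g x \<in> ?F0" "x \<in> B (g x)" using g by auto
    thus "x \<in> (\<Union>\<beta>\<in>F. B \<beta>)" using F(2) by blast
   qed
  qed auto
  finally show "(\<Sum>\<beta>\<in>F. \<Sum>x\<in>B \<beta>. ?r x *\<^sub>C x) = d" by (simp add: dX)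
 qed (use fin in auto)
qed

end

section \<open>Tensor products\<close>

lemma tensor_product_lift:
 fixes tn :: "'g::complex_vector => 'm::complex_vector => 's::complex_vector" and f :: "'g => 'm => 'w::complex_vector"
 assumes T: "tensor_product V tn"
  and f: "!!d d' y. d \<in> V ==> d' \<in> V ==> f (d + d') y = f d y + f d' y"
   "!!c d y. d \<in> V ==> f (c *\<^sub>C d) y = c *\<^sub>C f d y" "!!d. d \<in> V ==> clinear (f d)"
 obtains L where "clinear L" "!!d y. d \<in> V ==> L (tn d y) = f d y"
proof -
 have ind: "lin_ext (%(d, y). f d y) p = 0" if "p \<in> cvec.span R" "!!p. p \<in> R ==> lin_ext (%(d, y). f d y) p = 0" for p R
  by (rule clinear_eq_on_span[OF clinear_lin_ext clinear_const_zero that(2,1)])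
 have "lin_ext (%(d, y). f d y) p = 0" if "p \<in> cvec.span
    ({fgen (d + d', y) - fgen (d, y) - fgen (d', y) | d d' y. d \<in> V \<and> d' \<in> V} \<union>
    {fgen (d, y + y') - fgen (d, y) - fgen (d, y') | d y y'. d \<in> V} \<union>
    {fgen (c *\<^sub>C d, y) - c *\<^sub>C fgen (d, y) | c d y. d \<in> V} \<union>
    {fgen (d, c *\<^sub>C y) - c *\<^sub>C fgen (d, y) | c d y. d \<in> V})" for p
  by (rule ind[OF that])
    (auto simp: lin_ext_diff lin_ext_scale f clinear_add[OF f(3)] clinear_scale[OF f(3)])
 from presented_lift[OF T[unfolded tensor_product_def] this]
 obtain L where "clinear L" "!!x. x \<in> V \<times> UNIV ==> L (case x of (d, y) => tn d y) = (case x of (d, y) => f d y)"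
  by metis
 thus thesis using that[of L] by force
qed

lemma tensor_product_ext:
 assumes "tensor_product V tn" "clinear L" "clinear L'" "!!d y. d \<in> V ==> L (tn d y) = L' (tn d y)"
 shows "L = L'"
 by (rule presented_unique[OF assms(1)[unfolded tensor_product_def] assms(2,3)]) (use assms(4) in auto)

lemma tensor_product_span:
 assumes "tensor_product V tn"
 shows "s \<in> cvec.span {tn d y | d y. d \<in> V}"
proof -
 have "(%(d, y). tn d y) ` (V \<times> UNIV) = {tn d y | d y. d \<in> V}" by auto
 thus ?thesis using presented_span[OF assms[unfolded tensor_product_def]] by auto
qed

lemma tensor_product_linear:
 assumes T: "tensor_product V tn" and V: "cvec.subspace V"
 shows "d \<in> V ==> clinear (tn d)" "d \<in> V ==> d' \<in> V ==> tn (d + d') y = tn d y + tn d' y"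
  "d \<in> V ==> tn (c *\<^sub>C d) y = c *\<^sub>C tn d y"
proof -
 note rel = presented_rel[OF T[unfolded tensor_product_def] cvec.span_base]
 show "clinear (tn d)" if d: "d \<in> V"
 proof (rule clinearI)
  fix x y
  have "lin_ext (%(d, y). tn d y) (fgen (d, x + y) - fgen (d, x) - fgen (d, y)) = 0"
   by (rule rel, rule UnI1, rule UnI1, rule UnI2) (use d in blast)
  thus "tn d (x + y) = tn d x + tn d y" by (simp only: lin_ext_diff lin_ext_fgen) (simp add: algebra_simps)
 next
  fix a x
  have "lin_ext (%(d, y). tn d y) (fgen (d, a *\<^sub>C x) - a *\<^sub>C fgen (d, x)) = 0"
   by (rule rel, rule UnI2) (use d in blast)
  thus "tn d (a *\<^sub>C x) = a *\<^sub>C tn d x" by (simp only: lin_ext_diff lin_ext_scale lin_ext_fgen) simp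
 qed
 show "tn (d + d') y = tn d y + tn d' y" if d: "d \<in> V" "d' \<in> V"
 proof -
  have "lin_ext (%(d, y). tn d y) (fgen (d + d', y) - fgen (d, y) - fgen (d', y)) = 0"
   by (rule rel, rule UnI1, rule UnI1, rule UnI1) (use d in blast)
  thus ?thesis by (simp only: lin_ext_diff lin_ext_fgen) (simp add: algebra_simps)
 qed
 show "tn (c *\<^sub>C d) y = c *\<^sub>C tn d y" if d: "d \<in> V"
 proof -
  have "lin_ext (%(d, y). tn d y) (fgen (c *\<^sub>C d, y) - c *\<^sub>C fgen (d, y)) = 0"
   by (rule rel, rule UnI1, rule UnI2) (use d in blast)
  thus ?thesis by (simp only: lin_ext_diff lin_ext_scale lin_ext_fgen) simp
 qed
qed

lemma tuples_upd: "p \<in> tuples n ==> i < n ==> p(i := x) \<in> tuples n"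
 by (auto simp: tuples_def PiE_def extensional_def)

lemma tensor_power_lift:
 fixes tens :: "(nat => 'm::complex_vector) => 't::complex_vector" and f :: "(nat => 'm) => 'w::complex_vector"
 assumes T: "tensor_power n tens" and f: "!!p k. p \<in> tuples n ==> k < n ==> clinear (%x. f (p(k := x)))"
 obtains L where "clinear L" "!!p. p \<in> tuples n ==> L (tens p) = f p"
proof -
 have ind: "lin_ext f p = 0" if "p \<in> cvec.span R" "!!p. p \<in> R ==> lin_ext f p = 0" for p R
  by (rule clinear_eq_on_span[OF clinear_lin_ext clinear_const_zero that(2,1)])
 have "lin_ext f q = 0" if "q \<in> cvec.span
    ({fgen (p(i := x + y)) - fgen (p(i := x)) - fgen (p(i := y)) | p i x y.
      p \<in> tuples n \<and> i < n} \<union>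
    {fgen (p(i := c *\<^sub>C x)) - c *\<^sub>C fgen (p(i := x)) | p i c x.
      p \<in> tuples n \<and> i < n})" for q
  by (rule ind[OF that])
    (auto simp: lin_ext_diff lin_ext_scale clinear_add[OF f] clinear_scale[OF f])
 from presented_lift[OF T[unfolded tensor_power_def] this] show thesis using that by metis
qed

lemma tensor_power_linear:
 assumes T: "tensor_power n tens" and p: "p \<in> tuples n" and k: "k < n"
 shows "clinear (%x. tens (p(k := x)))"
proof (rule clinearI)
 note rel = presented_rel[OF T[unfolded tensor_power_def] cvec.span_base]
 fix x y
 have "lin_ext tens (fgen (p(k := x + y)) - fgen (p(k := x)) - fgen (p(k := y))) = 0"
  by (rule rel, rule UnI1) (use p k in blast)
 thus "tens (p(k := x + y)) = tens (p(k := x)) + tens (p(k := y))"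
  by (simp only: lin_ext_diff lin_ext_fgen) (simp add: algebra_simps)
next
 note rel = presented_rel[OF T[unfolded tensor_power_def] cvec.span_base]
 fix a x
 have "lin_ext tens (fgen (p(k := a *\<^sub>C x)) - a *\<^sub>C fgen (p(k := x))) = 0"
  by (rule rel, rule UnI2) (use p k in blast)
 thus "tens (p(k := a *\<^sub>C x)) = a *\<^sub>C tens (p(k := x))"
  by (simp only: lin_ext_diff lin_ext_scale lin_ext_fgen) simp
qed

lemma tensor_power_ext:
 assumes "tensor_power n tens" "clinear L" "clinear L'" "!!p. p \<in> tuples n ==> L (tens p) = L' (tens p)"
 shows "L = L'"
 by (rule presented_unique[OF assms(1)[unfolded tensor_power_def] assms(2-4)])

lemma factor_op_spec:
 assumes T: "tensor_power n tens" and i: "i < n" and A: "clinear A"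
 shows "clinear (factor_op n tens i A)" "p \<in> tuples n ==> factor_op n tens i A (tens p) = tens (p(i := A (p i)))"
proof -
 have "clinear (%x. tens ((p(k := x))(i := A ((p(k := x)) i))))" if "p \<in> tuples n" "k < n" for p k
 proof (cases "k = i")
  case True thus ?thesis using clinear_comp[OF tensor_power_linear[OF T that(1) i] A] by simp
 next
  case False
  hence "(p(k := x))(i := A ((p(k := x)) i)) = (p(i := A (p i)))(k := x)" for x by auto
  thus ?thesis using tensor_power_linear[OF T tuples_upd[OF that(1) i] that(2)] by simp
 qed
 from tensor_power_lift[OF T this] obtain L where
  L: "clinear L" "!!p. p \<in> tuples n ==> L (tens p) = tens (p(i := A (p i)))" by metis
 have "factor_op n tens i A = L"
  unfolding factor_op_def
  by (rule the_equality) (use L in \<open>auto intro!: tensor_power_ext[OF T]\<close>)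
 thus "clinear (factor_op n tens i A)" "p \<in> tuples n ==> factor_op n tens i A (tens p) = tens (p(i := A (p i)))"
  using L by auto
qed

section \<open>The map \<nu>_- on a Verma module\<close>

locale km_nu = km_verma D G \<Lambda> act v
 for D :: "'h::complex_vector cartan" and G :: "('h, 'g::complex_vector) km_lie"
  and \<Lambda> :: "'h => complex" and act :: "'g => 'm => 'm::complex_vector" and v :: 'm +
 fixes tn :: "'g => 'm => 's::complex_vector"
 assumes tn: "tensor_product (n_minus D G) tn"
begin

lemmas tn_linear = tensor_product_linear[OF tn n_minus_subspace]

lemma nm_act_spec:
 assumes a: "a \<in> n_minus D G"
 shows "clinear (nm_act D G tn act a)"
  "d \<in> n_minus D G ==> nm_act D G tn act a (tn d y) = tn (brk G a d) y + tn d (act a y)"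
proof -
 have b: "brk G a d \<in> n_minus D G" if "d \<in> n_minus D G" for d using a that by (rule n_minus.intros)
 have "\<exists>L. clinear L \<and> (\<forall>d\<in>n_minus D G. \<forall>y. L (tn d y) = tn (brk G a d) y + tn d (act a y))"
  by (rule tensor_product_lift[OF tn, of "%d y. tn (brk G a d) y + tn d (act a y)"])
    (auto intro!: clinear_plus clinear_comp[OF tn_linear(1) act_linear] tn_linear(1) b
     simp: brk_simps tn_linear b scaleC_add_right)
 then obtain L where L: "clinear L" "!!d y. d \<in> n_minus D G ==> L (tn d y) = tn (brk G a d) y + tn d (act a y)" by metis
 have "nm_act D G tn act a = L"
  unfolding nm_act_def
  by (rule the_equality) (use L in \<open>auto intro!: tensor_product_ext[OF tn]\<close>)
 thus "clinear (nm_act D G tn act a)"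
  "d \<in> n_minus D G ==> nm_act D G tn act a (tn d y) = tn (brk G a d) y + tn d (act a y)"
  using L by auto
qed

text \<open>The recursion prescribes \<nu>_- on words. It defines a linear map because the words
  form a basis of the Verma module, and at most one since they span it.\<close>

lemma nu_minus_spec:
 shows "clinear (nu_minus D G tn act v)" "nu_minus D G tn act v v = 0"
  "i < rk D ==> nu_minus D G tn act v (act (geF G i) x) =
      tn (geF G i) (act (inH G (hcor D i)) x) + nm_act D G tn act (geF G i) (nu_minus D G tn act v x)"
proof -
 note F = n_minus.intros(2)[of _ D G]
 \<comment> \<open>The recursion of \<nu>_- along the word, with the leading letter as the operator
   applied last.\<close>
 define f where "f = rec_list 0 (%i w s. tn (geF G i) (act (inH G (hcor D i)) (fw w)) + nm_act D G tn act (geF G i) s)"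
 obtain L where L: "clinear L" "!!w. set w \<subseteq> {..<rk D} ==> L (fw w) = f w" using fw_lift[of f] by metis
 let ?P = "%\<nu>. clinear \<nu> \<and> \<nu> v = 0 \<and> (\<forall>i<rk D. \<forall>x. \<nu> (act (geF G i) x) =
      tn (geF G i) (act (inH G (hcor D i)) x) + nm_act D G tn act (geF G i) (\<nu> x))"
 have "L v = 0" using L(2)[of "[]"] by (simp add: f_def)
 moreover have "L (act (geF G i) x) = tn (geF G i) (act (inH G (hcor D i)) x) + nm_act D G tn act (geF G i) (L x)" if i: "i < rk D" for i x
 proof (rule fw_ext[of "%x. L (act (geF G i) x)" "%x. tn (geF G i) (act (inH G (hcor D i)) x) + nm_act D G tn act (geF G i) (L x)"])
  show "clinear (%x. L (act (geF G i) x))" by (rule clinear_comp[OF L(1) act_linear])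
  show "clinear (%x. tn (geF G i) (act (inH G (hcor D i)) x) + nm_act D G tn act (geF G i) (L x))"
   by (rule clinear_plus[OF clinear_comp[OF tn_linear(1)[OF F[OF i]] act_linear] clinear_comp[OF nm_act_spec(1)[OF F[OF i]] L(1)]])
  fix w assume w: "set w \<subseteq> {..<rk D}"
  have "L (act (geF G i) (fw w)) = f (i # w)" using L(2)[of "i # w"] i w by (simp add: fw_Cons)
  thus "L (act (geF G i) (fw w)) = tn (geF G i) (act (inH G (hcor D i)) (fw w)) + nm_act D G tn act (geF G i) (L (fw w))"
   using L(2)[OF w] by (simp add: f_def)
 qed
 ultimately have PL: "?P L" using L(1) by blast
 have uniq: "\<nu> = L" if P: "?P \<nu>" for \<nu>
 proof
  fix x
  show "\<nu> x = L x"
  proof (rule fw_ext)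
   show "\<nu> (fw w) = L (fw w)" if "set w \<subseteq> {..<rk D}" for w
    using that
   proof (induction w)
    case Nil show ?case using P PL by simp
   next
    case (Cons i w)
    hence i: "i < rk D" and e: "\<nu> (fw w) = L (fw w)" by auto
    have "\<nu> (act (geF G i) (fw w)) = tn (geF G i) (act (inH G (hcor D i)) (fw w)) + nm_act D G tn act (geF G i) (\<nu> (fw w))"
     using P i by blast
    also have "... = L (act (geF G i) (fw w))" unfolding e using PL i by metis
    finally show ?case by (simp only: fw_Cons)
   qed
  qed (use P L in auto)
 qed
 have "nu_minus D G tn act v = L" unfolding nu_minus_def by (rule the_equality[of ?P, OF PL uniq])
 thus "clinear (nu_minus D G tn act v)" "nu_minus D G tn act v v = 0"
  "i < rk D ==> nu_minus D G tn act v (act (geF G i) x) =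
      tn (geF G i) (act (inH G (hcor D i)) x) + nm_act D G tn act (geF G i) (nu_minus D G tn act v x)"
  using PL by auto
qed

lemma dform_sroot: "i < rk D ==> clinear \<xi> ==> dform D \<xi> (sroot D i) = \<xi> (hcor D i)"
 by (simp add: dform_right[OF cartan] hcor_def)

text \<open>Words are read in the order of application here: \<open>fold\<close> applies the first letter first.\<close>

lemma nu_minus_word:
 assumes w: "c ` set w \<subseteq> {..<rk D}"
 shows "nu_minus D G tn act v (fold (%k. act (geF G (c k))) w v) =
  (\<Sum>j<length w. (dform D \<Lambda> (sroot D (c (w ! j))) - (\<Sum>k\<leftarrow>take j w. dform D (sroot D (c (w ! j))) (sroot D (c k)))) *\<^sub>C
    fold (%k. nm_act D G tn act (geF G (c k))) (drop (Suc j) w) (tn (geF G (c (w ! j))) (fold (%k. act (geF G (c k))) (take j w) v)))"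
 using w
proof (induction w rule: rev_induct)
 case Nil show ?case by (simp add: nu_minus_spec)
next
 case (snoc b w)
 let ?f = "%k. act (geF G (c k))" and ?fs = "%k. nm_act D G tn act (geF G (c k))"
 have b: "c b < rk D" and w: "c ` set w \<subseteq> {..<rk D}" using snoc.prems by auto
 have fs: "clinear (?fs b)" using b by (intro nm_act_spec n_minus.intros)
 have fld: "fold ?f w v = fw (rev (map c w))" for w
  by (simp add: fw_def foldr_conv_fold rev_map fold_map comp_def)
 \<comment> \<open>The eigenvalue of the coroot of the new letter on the word built so far; it
   becomes the coefficient of the term in which this letter is marked.\<close>
 have wt: "wt_word D \<Lambda> (rev (map c w)) (hcor D (c b)) = dform D \<Lambda> (sroot D (c b)) - (\<Sum>k\<leftarrow>w. dform D (sroot D (c b)) (sroot D (c k)))"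
 proof -
  have "(\<Sum>i\<leftarrow>rev (map c w). if i < rk D then sroot D i (hcor D (c b)) else 0) = (\<Sum>k\<leftarrow>w. dform D (sroot D (c b)) (sroot D (c k)))"
   using w
  proof (induction w)
   case (Cons k w)
   thus ?case using dform_commute[OF cartan, of "sroot D (c b)" "sroot D (c k)"]
    by (simp add: dform_sroot[OF b cartan_linear(3)[OF cartan]])
  qed simp
  thus ?thesis by (simp add: wt_word_def dform_sroot[OF b weight_linear])
 qed
 have sw: "set (rev (map c w)) \<subseteq> {..<rk D}" using w by auto
 have "nu_minus D G tn act v (fold ?f (w @ [b]) v) =
   wt_word D \<Lambda> (rev (map c w)) (hcor D (c b)) *\<^sub>C tn (geF G (c b)) (fold ?f w v) + ?fs b (nu_minus D G tn act v (fold ?f w v))"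
  using nu_minus_spec(3)[OF b, of "fold ?f w v"] act_H_fw[OF sw]
  by (simp add: fld clinear_scale[OF tn_linear(1)[OF n_minus.intros(2)[OF b]]])
 also have "?fs b (nu_minus D G tn act v (fold ?f w v)) = (\<Sum>j<length w.
    (dform D \<Lambda> (sroot D (c (w ! j))) - (\<Sum>k\<leftarrow>take j w. dform D (sroot D (c (w ! j))) (sroot D (c k)))) *\<^sub>C
    ?fs b (fold ?fs (drop (Suc j) w) (tn (geF G (c (w ! j))) (fold ?f (take j w) v))))"
  unfolding snoc.IH[OF w] by (simp add: clinear_sum[OF fs] clinear_scale[OF fs])
 finally show ?case
  unfolding wt by (simp add: nth_append add.commute cong: sum.cong_simp)
qed

end

section \<open>The operator \<open>\<Omega>\<^sub>+\<close>\<close>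

locale kz_tensor = km_roots D G B
 for D :: "'h::complex_vector cartan" and G :: "('h, 'g::complex_vector) km_lie" and B :: "(nat => nat) => 'g set" +
 fixes n :: nat and \<Lambda> :: "nat => 'h => complex" and act :: "nat => 'g => 'm => 'm::complex_vector" and v :: "nat => 'm"
  and tn :: "'g => 'm => 's::complex_vector" and tens :: "(nat => 'm) => 't::complex_vector"
 assumes weights: "!!j. j < n ==> clinear (\<Lambda> j)"
  and vermas: "!!j. j < n ==> verma_module D G (\<Lambda> j) (act j) (v j)"
  and tensor_nM: "tensor_product (n_minus D G) tn" and tensor_M: "tensor_power n tens"
begin

lemma km_nu_factor: "j < n ==> km_nu D G (\<Lambda> j) (act j) (v j) tn"
 by (intro km_nu.intro km_verma.intro km_verma_axioms.intro km_nu_axioms.intro weights vermas tensor_nM km_algebra_axioms)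

lemma km_verma_factor: "j < n ==> km_verma D G (\<Lambda> j) (act j) (v j)"
 by (intro km_verma.intro km_verma_axioms.intro weights vermas km_algebra_axioms)

lemmas tn_linear = tensor_product_linear[OF tensor_nM n_minus_subspace]
lemmas tens_linear = tensor_power_linear[OF tensor_M]
lemmas act_linear = km_verma.act_linear[OF km_verma_factor]
lemmas act_simps = km_verma.act_simps[OF km_verma_factor]
lemmas act_linear_left = km_verma.act_linear_left[OF km_verma_factor]
lemmas factor_spec = factor_op_spec[OF tensor_M]

abbreviation word_vec :: "nat => nat list => 'm" where
 "word_vec j w \<equiv> foldr (%i. act j (geF G i)) w (v j)"

abbreviation valid_word :: "nat list => bool" where
 "valid_word w \<equiv> set w \<subseteq> {..<rk D}"

lemma fw_eq: "j < n ==> km_verma.fw G (act j) (v j) w = word_vec j w"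
 by (simp add: km_verma.fw_def[OF km_verma_factor])

lemma word_vec_ext:
 assumes "j < n" "clinear f" "clinear f'" "!!w. valid_word w ==> f (word_vec j w) = f' (word_vec j w)"
 shows "f x = f' x"
 by (rule km_verma.fw_ext[OF km_verma_factor[OF assms(1)] assms(2,3)]) (simp add: fw_eq assms)

lemma word_vec_weight: "j < n ==> valid_word w ==> weight_vec G (act j) (wt_word D (\<Lambda> j) w) (word_vec j w)"
 using km_verma.fw_weight_vec[OF km_verma_factor] by (simp add: fw_eq)

text \<open>The definition of \<Omega>_+ prescribes values only where the factors \<open>i\<close>
  and \<open>j\<close> are weight vectors. Words are weight vectors and span, so replacing the two
  factors one after the other yields uniqueness.\<close>

lemma word_tens_ext:
 assumes "i < n" "j < n" "i ~= j" "clinear L" "clinear L'"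
  and eq: "!!p I J. p \<in> tuples n ==> valid_word I ==> valid_word J ==> p i = word_vec i I ==> p j = word_vec j J ==> L (tens p) = L' (tens p)"
 shows "L = L'"
proof (rule tensor_power_ext[OF tensor_M assms(4,5)])
 fix p :: "nat => 'm" assume p: "p \<in> tuples n"
 note up = tuples_upd[OF tuples_upd[OF p assms(1)] assms(2)]
 have 1: "L (tens (p(i := word_vec i I, j := y))) = L' (tens (p(i := word_vec i I, j := y)))" if I: "valid_word I" for I y
 proof (rule word_vec_ext[OF assms(2), of "%y. L (tens (p(i := word_vec i I, j := y)))" "%y. L' (tens (p(i := word_vec i I, j := y)))"])
  note t = tens_linear[OF tuples_upd[OF p assms(1)] assms(2), of "word_vec i I"]
  show "clinear (%y. L (tens (p(i := word_vec i I, j := y))))" "clinear (%y. L' (tens (p(i := word_vec i I, j := y))))"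
   by (rule clinear_comp[OF assms(4) t], rule clinear_comp[OF assms(5) t])
  show "L (tens (p(i := word_vec i I, j := word_vec j w))) = L' (tens (p(i := word_vec i I, j := word_vec j w)))" if "valid_word w" for w
   by (rule eq[OF up I that]) (use assms(3) in simp_all)
 qed
 have 2: "L (tens (p(j := y, i := x))) = L' (tens (p(j := y, i := x)))" for x y
 proof (rule word_vec_ext[OF assms(1), of "%x. L (tens (p(j := y, i := x)))" "%x. L' (tens (p(j := y, i := x)))"])
  note t = tens_linear[OF tuples_upd[OF p assms(2)] assms(1), of y]
  show "clinear (%x. L (tens (p(j := y, i := x))))" "clinear (%x. L' (tens (p(j := y, i := x))))"
   by (rule clinear_comp[OF assms(4) t], rule clinear_comp[OF assms(5) t])
  show "L (tens (p(j := y, i := word_vec i w))) = L' (tens (p(j := y, i := word_vec i w)))" if "valid_word w" for w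
   unfolding fun_upd_twist[OF assms(3)[symmetric]] by (rule 1[OF that])
 qed
 show "L (tens p) = L' (tens p)" using 2[of "p j" "p i"] by simp
qed

lemma contract_spec:
 shows "clinear (contract D G tn (dual_vec D G B x) :: 's => 'm)"
  "d \<in> n_minus D G ==> contract D G tn (dual_vec D G B x) (tn d y) = dual_vec D G B x d *\<^sub>C y"
proof -
 have "\<exists>L. clinear L \<and> (\<forall>d\<in>n_minus D G. \<forall>y. L (tn d y) = dual_vec D G B x d *\<^sub>C y)"
  by (rule tensor_product_lift[OF tensor_nM, of "%d y. dual_vec D G B x d *\<^sub>C y"])
    (auto simp: dual_vec_linear scaleC_add_left scaleC_scaleC intro: clinear_scaleC clinear_ident)
 then obtain L where L: "clinear L" "!!d y. d \<in> n_minus D G ==> L (tn d y) = dual_vec D G B x d *\<^sub>C y" by metis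
 have "contract D G tn (dual_vec D G B x) = L"
  unfolding contract_def
  by (rule the_equality) (use L in \<open>auto intro!: tensor_product_ext[OF tensor_nM]\<close>)
 thus "clinear (contract D G tn (dual_vec D G B x) :: 's => 'm)"
  "d \<in> n_minus D G ==> contract D G tn (dual_vec D G B x) (tn d y) = dual_vec D G B x d *\<^sub>C y"
  using L by auto
qed

text \<open>The basis-free form of the nilpotent part of \<Omega>_+: the Lie algebra component of a
  tensor acts on factor \<open>i\<close> and its module component replaces factor
  \<open>j\<close>.\<close>

definition ins_op :: "nat => nat => (nat => 'm) => 's => 't" where
 "ins_op i j p = (SOME L. clinear L \<and> (\<forall>d\<in>n_minus D G. \<forall>y. L (tn d y) = tens (p(i := act i d (p i), j := y))))"

lemma ins_op_spec:
 assumes p: "p \<in> tuples n" and ij: "i < n" "j < n" "i ~= j"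
 shows "clinear (ins_op i j p)" "d \<in> n_minus D G ==> ins_op i j p (tn d y) = tens (p(i := act i d (p i), j := y))"
proof -
 have tl: "clinear (%x. tens (p(i := x, j := y)))" for y
  unfolding fun_upd_twist[OF ij(3)] by (rule tens_linear[OF tuples_upd[OF p ij(2)] ij(1)])
 have "\<exists>L. clinear L \<and> (\<forall>d\<in>n_minus D G. \<forall>y. L (tn d y) = tens (p(i := act i d (p i), j := y)))"
  by (rule tensor_product_lift[OF tensor_nM, of "%d y. tens (p(i := act i d (p i), j := y))"])
    (use p ij in \<open>auto simp: act_simps clinear_add[OF tl] clinear_scale[OF tl] intro: tens_linear tuples_upd\<close>)
 hence "clinear (ins_op i j p) \<and> (\<forall>d\<in>n_minus D G. \<forall>y. ins_op i j p (tn d y) = tens (p(i := act i d (p i), j := y)))"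
  unfolding ins_op_def by (rule someI_ex)
 thus "clinear (ins_op i j p)" "d \<in> n_minus D G ==> ins_op i j p (tn d y) = tens (p(i := act i d (p i), j := y))"
  by auto
qed

lemma ins_op_upd: "ins_op i j (p(j := x)) = ins_op i j p" if "i ~= j"
 using that by (simp add: ins_op_def fun_upd_twist[of j i])

lemma ins_op_linear:
 assumes p: "p \<in> tuples n" and ij: "i < n" "j < n" "i ~= j" and k: "k < n" "k ~= j"
 shows "clinear (%x. ins_op i j (p(k := x)) s)"
 using tensor_product_span[OF tensor_nM, of s]
proof (induction rule: cvec.span_induct_alt)
 note spec = ins_op_spec[OF tuples_upd[OF p k(1)] ij]
 case base
 show ?case unfolding clinear_zero[OF spec(1)] by (rule clinear_const_zero)
next
 note spec = ins_op_spec[OF tuples_upd[OF p k(1)] ij]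
 case (step a q s)
 then obtain d y where q: "q = tn d y" "d \<in> n_minus D G" by auto
 have "clinear (%x. tens ((p(k := x))(i := act i d ((p(k := x)) i), j := y)))"
 proof (cases "k = i")
  case True
  hence "(p(k := x))(i := act i d ((p(k := x)) i), j := y) = (p(j := y))(i := act i d x)" for x
   using ij by auto
  thus ?thesis using clinear_comp[OF tens_linear[OF tuples_upd[OF p ij(2)] ij(1)] act_linear[OF ij(1)]] by simp
 next
  case False
  hence "(p(k := x))(i := act i d ((p(k := x)) i), j := y) = (p(i := act i d (p i), j := y))(k := x)" for x
   using k(2) by auto
  thus ?thesis using tens_linear[OF tuples_upd[OF tuples_upd[OF p ij(1)] ij(2)] k(1)] by simp
 qed
 thus ?case unfolding clinear_add[OF spec(1)] clinear_scale[OF spec(1)] q(1) spec(2)[OF q(2)]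
  by (intro clinear_plus clinear_scaleC step)
qed

text \<open>On a pure tensor \<open>tn d y\<close> the contraction is a coordinate of
  \<open>d\<close> times \<open>y\<close>, and the sum over a finite set of roots rebuilds
  \<open>d\<close> inside the action. General elements follow by linearity, taking the union of the
  finite sets of roots.\<close>

lemma ins_op_expansion:
 assumes p: "p \<in> tuples n" and ij: "i < n" "j < n" "i ~= j"
 shows "\<exists>F0. finite F0 \<and> F0 \<subseteq> pos_roots D G \<and>
  (\<forall>\<beta>\<in>pos_roots D G - F0. \<forall>x\<in>B \<beta>. contract D G tn (dual_vec D G B x) s = (0::'m)) \<and>
  (\<forall>F. finite F --> F0 \<subseteq> F --> F \<subseteq> pos_roots D G -->
   (\<Sum>\<beta>\<in>F. \<Sum>x\<in>B \<beta>. tens (p(i := act i x (p i), j := contract D G tn (dual_vec D G B x) s))) = ins_op i j p s)"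
 using tensor_product_span[OF tensor_nM, of s]
proof (induction rule: cvec.span_induct_alt)
 case base
 have "tens (p(i := x, j := 0)) = 0" for x
  by (rule clinear_zero[OF tens_linear[OF tuples_upd[OF p ij(1)] ij(2)]])
 thus ?case
  unfolding clinear_zero[OF contract_spec(1)] clinear_zero[OF ins_op_spec(1)[OF p ij]]
  by (intro exI[of _ "{}"]) (simp only: sum.neutral_const, simp)
next
 case (step a q s)
 then obtain d y where q: "q = tn d y" and d: "d \<in> n_minus D G" by auto
 let ?C = "%x s. contract D G tn (dual_vec D G B x) s :: 'm"
 let ?T = "%x y. tens (p(i := x, j := y))"
 have tl: "clinear (%x. ?T x y)" for y
  unfolding fun_upd_twist[OF ij(3)] by (rule tens_linear[OF tuples_upd[OF p ij(2)] ij(1)])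
 have ca: "clinear (%g. ?T (act i g (p i)) y)" by (rule clinear_comp[OF tl act_linear_left[OF ij(1)]])
 have tr: "clinear (?T x)" for x by (rule tens_linear[OF tuples_upd[OF p ij(1)] ij(2)])
 obtain F0 where F0: "finite F0" "F0 \<subseteq> pos_roots D G"
  "!!\<beta> x. \<beta> \<in> pos_roots D G - F0 ==> x \<in> B \<beta> ==> dual_vec D G B x d = 0"
  "!!F. finite F ==> F0 \<subseteq> F ==> F \<subseteq> pos_roots D G ==> (\<Sum>\<beta>\<in>F. \<Sum>x\<in>B \<beta>. dual_vec D G B x d *\<^sub>C x) = d"
  by (rule root_expansion[OF d]) blast
 obtain F1 where F1: "finite F1" "F1 \<subseteq> pos_roots D G"
  "!!\<beta> x. \<beta> \<in> pos_roots D G - F1 ==> x \<in> B \<beta> ==> ?C x s = 0"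
  "!!F. finite F ==> F1 \<subseteq> F ==> F \<subseteq> pos_roots D G ==>
   (\<Sum>\<beta>\<in>F. \<Sum>x\<in>B \<beta>. ?T (act i x (p i)) (?C x s)) = ins_op i j p s"
  using step.IH by blast
 have C: "?C x (a *\<^sub>C q + s) = a *\<^sub>C (dual_vec D G B x d *\<^sub>C y) + ?C x s" for x
  unfolding clinear_add[OF contract_spec(1)] clinear_scale[OF contract_spec(1)] q contract_spec(2)[OF d] ..
 have "(\<Sum>\<beta>\<in>F. \<Sum>x\<in>B \<beta>. ?T (act i x (p i)) (?C x (a *\<^sub>C q + s))) = ins_op i j p (a *\<^sub>C q + s)"
  if F: "finite F" "F0 \<union> F1 \<subseteq> F" "F \<subseteq> pos_roots D G" for F
 proof -
  have "(\<Sum>\<beta>\<in>F. \<Sum>x\<in>B \<beta>. ?T (act i x (p i)) (?C x (a *\<^sub>C q + s)))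
   = a *\<^sub>C (\<Sum>\<beta>\<in>F. \<Sum>x\<in>B \<beta>. dual_vec D G B x d *\<^sub>C ?T (act i x (p i)) y)
    + (\<Sum>\<beta>\<in>F. \<Sum>x\<in>B \<beta>. ?T (act i x (p i)) (?C x s))"
   unfolding C clinear_add[OF tr] clinear_scale[OF tr] sum.distrib cvec.scale_sum_right ..
  also have "(\<Sum>\<beta>\<in>F. \<Sum>x\<in>B \<beta>. dual_vec D G B x d *\<^sub>C ?T (act i x (p i)) y)
   = ?T (act i (\<Sum>\<beta>\<in>F. \<Sum>x\<in>B \<beta>. dual_vec D G B x d *\<^sub>C x) (p i)) y"
   by (simp only: clinear_sum[OF ca] clinear_scale[OF ca])
  also have "... = ins_op i j p q"
   unfolding q ins_op_spec(2)[OF p ij d] using F0(4)[of F] F by simp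
  finally show ?thesis
   using F1(4)[of F] F by (simp only: clinear_add[OF ins_op_spec(1)[OF p ij]] clinear_scale[OF ins_op_spec(1)[OF p ij]] Un_subset_iff)
 qed
 moreover have "?C x (a *\<^sub>C q + s) = 0" if "\<beta> \<in> pos_roots D G - (F0 \<union> F1)" "x \<in> B \<beta>" for \<beta> x
  unfolding C using that F0(3)[of \<beta> x] F1(3)[of \<beta> x] by simp
 ultimately show ?case using F0(1,2) F1(1,2)
  by (intro exI[of _ "F0 \<union> F1"] conjI ballI allI impI) (simp only: finite_UnI Un_subset_iff | blast)+
qed

abbreviation nu :: "nat => 'm => 's" where
 "nu j \<equiv> nu_minus D G tn (act j) (v j)"

lemmas nu_linear = km_nu.nu_minus_spec(1)[OF km_nu_factor]

lemma lift_ins_op: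
 assumes ij: "i < n" "j < n" "i ~= j"
 obtains N where "clinear N" "!!p. p \<in> tuples n ==> N (tens p) = ins_op i j p (nu j (p j))"
proof (rule tensor_power_lift[OF tensor_M, of "%p. ins_op i j p (nu j (p j))"])
 fix p :: "nat => 'm" and k assume p: "p \<in> tuples n" and k: "k < n"
 show "clinear (%x. ins_op i j (p(k := x)) (nu j ((p(k := x)) j)))"
 proof (cases "k = j")
  case True thus ?thesis
   using clinear_comp[OF ins_op_spec(1)[OF p ij] nu_linear[OF ij(2)]] by (simp add: ins_op_upd[OF ij(3)])
 next
  case False thus ?thesis using ins_op_linear[OF p ij k False] by simp
 qed
qed (use that in blast)

text \<open>Multiplication by the form of the two weights is not visibly linear in the vector. It is
  realised by Cartan elements acting on the factors \<open>i\<close> and \<open>j\<close>, with the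
  decomposition of the form as coefficients.\<close>

lemma lift_weight_form:
 assumes ij: "i < n" "j < n" "i ~= j"
 obtains W where "clinear W" "!!p wt1 wt2. p \<in> tuples n ==> weight_vec G (act i) wt1 (p i) ==> weight_vec G (act j) wt2 (p j) ==>
  W (tens p) = dform D wt1 wt2 *\<^sub>C tens p"
proof -
 obtain Bh :: "'h set" and y where Bh: "finite Bh"
  "!!\<xi> \<eta>. clinear \<xi> ==> clinear \<eta> ==> dform D \<xi> \<eta> = (\<Sum>b\<in>Bh. \<xi> b * \<eta> (y b))"
  using dform_decomposition[OF cartan] by metis
 let ?W = "%t. \<Sum>b\<in>Bh. factor_op n tens i (act i (inH G b)) (factor_op n tens j (act j (inH G (y b))) t)"
 have Wt: "?W (tens p) = dform D wt1 wt2 *\<^sub>C tens p"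
  if p: "p \<in> tuples n" and w: "weight_vec G (act i) wt1 (p i)" "weight_vec G (act j) wt2 (p j)" for p wt1 wt2
 proof (cases "p i = 0 \<or> p j = 0")
  \<comment> \<open>Any function is a weight of the zero vector, so here the weights need not be
    linear; both sides vanish instead.\<close>
  case True
  hence 0: "tens p = 0"
   using clinear_zero[OF tens_linear[OF p ij(1)]] clinear_zero[OF tens_linear[OF p ij(2)]] by (metis fun_upd_triv)
  show ?thesis unfolding 0 using factor_spec(1)[OF ij(1) act_linear[OF ij(1)]] factor_spec(1)[OF ij(2) act_linear[OF ij(2)]]
   by (simp add: clinear_zero)
 next
  case False
  have lin: "clinear wt1" "clinear wt2"
   using False w km_verma.weight_vec_linear[OF km_verma_factor] ij by blast+
  have "?W (tens p) = (\<Sum>b\<in>Bh. (wt1 b * wt2 (y b)) *\<^sub>C tens p)"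
  proof (rule sum.cong[OF refl])
   fix b
   have "factor_op n tens j (act j (inH G (y b))) (tens p) = tens (p(j := wt2 (y b) *\<^sub>C p j))"
    using factor_spec(2)[OF ij(2) act_linear[OF ij(2)] p] w(2) by (simp add: weight_vec_def)
   hence 1: "factor_op n tens j (act j (inH G (y b))) (tens p) = wt2 (y b) *\<^sub>C tens p"
    by (simp add: clinear_scale[OF tens_linear[OF p ij(2)]])
   have "factor_op n tens i (act i (inH G b)) (tens p) = tens (p(i := wt1 b *\<^sub>C p i))"
    using factor_spec(2)[OF ij(1) act_linear[OF ij(1)] p] w(1) by (simp add: weight_vec_def)
   hence "factor_op n tens i (act i (inH G b)) (tens p) = wt1 b *\<^sub>C tens p"
    by (simp add: clinear_scale[OF tens_linear[OF p ij(1)]])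
   thus "factor_op n tens i (act i (inH G b)) (factor_op n tens j (act j (inH G (y b))) (tens p)) = (wt1 b * wt2 (y b)) *\<^sub>C tens p"
    unfolding 1 by (simp add: clinear_scale[OF factor_spec(1)[OF ij(1) act_linear[OF ij(1)]]] scaleC_scaleC mult.commute)
  qed
  also have "... = dform D wt1 wt2 *\<^sub>C tens p" unfolding Bh(2)[OF lin] cvec.scale_sum_left ..
  finally show ?thesis .
 qed
 have "clinear ?W"
  by (intro clinear_sum_fun clinear_comp[OF factor_spec(1)[OF ij(1) act_linear[OF ij(1)]] factor_spec(1)[OF ij(2) act_linear[OF ij(2)]]])
 thus thesis using that[of ?W] Wt by blast
qed

text \<open>The map is the sum of the weight form and two insertions, one for each direction. It has
  the prescribed values since for a given tensor the sum over roots is finite, and word tensors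
  determine it.\<close>

lemma Omega_plus_spec:
 assumes ij: "i < n" "j < n" "i ~= j"
 shows "clinear (Omega_plus D G B tn act v n tens i j)" (is ?lin)
  "p \<in> tuples n ==> weight_vec G (act i) wt1 (p i) ==> weight_vec G (act j) wt2 (p j) ==>
    Omega_plus D G B tn act v n tens i j (tens p) = dform D wt1 wt2 *\<^sub>C tens p + ins_op i j p (nu j (p j)) + ins_op j i p (nu i (p i))"
proof -
 have ji: "j < n" "i < n" "j ~= i" using ij by auto
 obtain N where N: "clinear N" "!!p. p \<in> tuples n ==> N (tens p) = ins_op i j p (nu j (p j))"
  by (rule lift_ins_op[OF ij]) blast
 obtain N' where N': "clinear N'" "!!p. p \<in> tuples n ==> N' (tens p) = ins_op j i p (nu i (p i))"
  by (rule lift_ins_op[OF ji]) blast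
 obtain W where W: "clinear W" "!!p wt1 wt2. p \<in> tuples n ==> weight_vec G (act i) wt1 (p i) ==> weight_vec G (act j) wt2 (p j) ==>
  W (tens p) = dform D wt1 wt2 *\<^sub>C tens p"
  by (rule lift_weight_form[OF ij]) blast
 define L where "L t = W t + N t + N' t" for t
 have L: "clinear L" unfolding L_def by (intro clinear_plus W(1) N(1) N'(1))
 let ?s = "%p \<beta>. \<Sum>x\<in>B \<beta>.
   tens (p(i := act i x (p i), j := lowering D G tn (act j) (v j) (dual_vec D G B x) (p j))) +
   tens (p(i := lowering D G tn (act i) (v i) (dual_vec D G B x) (p i), j := act j x (p j)))"
 have any: "Sum_any (%\<beta>. if \<beta> \<in> pos_roots D G then ?s p \<beta> else 0) = ins_op i j p (nu j (p j)) + ins_op j i p (nu i (p i))"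
  if p: "p \<in> tuples n" for p
 proof -
  let ?C = "%x s. contract D G tn (dual_vec D G B x) s :: 'm"
  obtain F1 where F1: "finite F1" "F1 \<subseteq> pos_roots D G"
   "!!\<beta> x. \<beta> \<in> pos_roots D G - F1 ==> x \<in> B \<beta> ==> ?C x (nu j (p j)) = 0"
   "!!F. finite F ==> F1 \<subseteq> F ==> F \<subseteq> pos_roots D G ==>
   (\<Sum>\<beta>\<in>F. \<Sum>x\<in>B \<beta>. tens (p(i := act i x (p i), j := ?C x (nu j (p j))))) = ins_op i j p (nu j (p j))"
   using ins_op_expansion[OF p ij, of "nu j (p j)"] by blast
  obtain F2 where F2: "finite F2" "F2 \<subseteq> pos_roots D G"
   "!!\<beta> x. \<beta> \<in> pos_roots D G - F2 ==> x \<in> B \<beta> ==> ?C x (nu i (p i)) = 0"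
   "!!F. finite F ==> F2 \<subseteq> F ==> F \<subseteq> pos_roots D G ==>
   (\<Sum>\<beta>\<in>F. \<Sum>x\<in>B \<beta>. tens (p(j := act j x (p j), i := ?C x (nu i (p i))))) = ins_op j i p (nu i (p i))"
   using ins_op_expansion[OF p ji, of "nu i (p i)"] by blast
  let ?F = "F1 \<union> F2"
  have z: "tens (p(i := x, j := 0)) = 0" "tens (p(i := 0, j := y)) = 0" for x y
   using clinear_zero[OF tens_linear[OF tuples_upd[OF p ij(1), of x] ij(2)]]
    clinear_zero[OF tens_linear[OF tuples_upd[OF p ij(2), of y] ij(1)]] by (simp_all add: fun_upd_twist[OF ij(3)])
  have "?s p \<beta> = 0" if "\<beta> \<in> pos_roots D G - ?F" for \<beta>
   using that F1(3)[of \<beta>] F2(3)[of \<beta>] by (intro sum.neutral) (simp add: lowering_def z)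
  \<comment> \<open>Outside the two finite sets all contractions vanish, so \<open>Sum_any\<close>
    has finite support and may be evaluated on their union.\<close>
  hence "{\<beta>. (if \<beta> \<in> pos_roots D G then ?s p \<beta> else 0) ~= 0} \<subseteq> ?F" by auto
  hence "Sum_any (%\<beta>. if \<beta> \<in> pos_roots D G then ?s p \<beta> else 0) = (\<Sum>\<beta>\<in>?F. if \<beta> \<in> pos_roots D G then ?s p \<beta> else 0)"
   using F1(1) F2(1) by (intro Sum_any.expand_superset) auto
  also have "... = (\<Sum>\<beta>\<in>?F. ?s p \<beta>)" using F1(2) F2(2) by (intro sum.cong) auto
  also have "... = (\<Sum>\<beta>\<in>?F. \<Sum>x\<in>B \<beta>. tens (p(i := act i x (p i), j := ?C x (nu j (p j)))))
    + (\<Sum>\<beta>\<in>?F. \<Sum>x\<in>B \<beta>. tens (p(j := act j x (p j), i := ?C x (nu i (p i)))))"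
   by (simp add: lowering_def sum.distrib fun_upd_twist[OF ij(3)])
  also have "... = ins_op i j p (nu j (p j)) + ins_op j i p (nu i (p i))"
   using F1(1,2) F2(1,2) by (simp add: F1(4) F2(4))
  finally show ?thesis .
 qed
 let ?P = "%L. clinear L \<and>
    (\<forall>p\<in>tuples n. \<forall>wt1 wt2.
      weight_vec G (act i) wt1 (p i) --> weight_vec G (act j) wt2 (p j) -->
      L (tens p) = dform D wt1 wt2 *\<^sub>C tens p + Sum_any (%\<beta>. if \<beta> \<in> pos_roots D G then ?s p \<beta> else 0))"
 have Lt: "L (tens p) = dform D wt1 wt2 *\<^sub>C tens p + ins_op i j p (nu j (p j)) + ins_op j i p (nu i (p i))"
  if "p \<in> tuples n" "weight_vec G (act i) wt1 (p i)" "weight_vec G (act j) wt2 (p j)" for p wt1 wt2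
  unfolding L_def N(2)[OF that(1)] N'(2)[OF that(1)] W(2)[OF that] ..
 have PL: "?P L" using L Lt any by (simp add: add.assoc)
 have "L' = L" if P: "?P L'" for L'
 proof (rule word_tens_ext[OF ij])
  fix p :: "nat => 'm" and I J
  assume p: "p \<in> tuples n" and IJ: "valid_word I" "valid_word J" and pp: "p i = word_vec i I" "p j = word_vec j J"
  have w: "weight_vec G (act i) (wt_word D (\<Lambda> i) I) (p i)" "weight_vec G (act j) (wt_word D (\<Lambda> j) J) (p j)"
   unfolding pp using word_vec_weight ij IJ by auto
  have "L' (tens p) = dform D (wt_word D (\<Lambda> i) I) (wt_word D (\<Lambda> j) J) *\<^sub>C tens p + Sum_any (%\<beta>. if \<beta> \<in> pos_roots D G then ?s p \<beta> else 0)"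
   by (rule P[THEN conjunct2, rule_format, OF p w])
  also have "... = L (tens p)" by (rule PL[THEN conjunct2, rule_format, OF p w, symmetric])
  finally show "L' (tens p) = L (tens p)" .
 qed (use P L in auto)
 hence "Omega_plus D G B tn act v n tens i j = L"
  unfolding Omega_plus_def by (intro the_equality[of ?P, OF PL])
 thus ?lin and "p \<in> tuples n ==> weight_vec G (act i) wt1 (p i) ==> weight_vec G (act j) wt2 (p j) ==>
    Omega_plus D G B tn act v n tens i j (tens p) = dform D wt1 wt2 *\<^sub>C tens p + ins_op i j p (nu j (p j)) + ins_op j i p (nu i (p i))"
  using L Lt by auto
qed

end

section \<open>The pair identity\<close>

lemma wt_word_linear:
 assumes "cartan_datum D" "clinear \<Lambda>"
 shows "clinear (wt_word D \<Lambda> w)"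
proof (rule clinearI)
 note s = clinear_add[OF cartan_linear(3)[OF assms(1)]] clinear_scale[OF cartan_linear(3)[OF assms(1)]]
 show "wt_word D \<Lambda> w (x + y) = wt_word D \<Lambda> w x + wt_word D \<Lambda> w y" for x y
  by (induction w) (simp_all add: wt_word_def clinear_add[OF assms(2)] s algebra_simps)
 show "wt_word D \<Lambda> w (a *\<^sub>C x) = a *\<^sub>C wt_word D \<Lambda> w x" for a x
  by (induction w) (simp_all add: wt_word_def clinear_scale[OF assms(2)] s algebra_simps scaleC_complex_def)
qed

lemma dform_wt_word_left:
 assumes D: "cartan_datum D" and L: "clinear \<Lambda>" and w: "set w \<subseteq> {..<rk D}"
 shows "dform D (wt_word D \<Lambda> w) \<eta> = dform D \<Lambda> \<eta> - (\<Sum>a\<leftarrow>w. dform D (sroot D a) \<eta>)"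
proof -
 have "(\<Sum>a\<leftarrow>w. if a < rk D then sroot D a (binv D \<eta>) else 0) = (\<Sum>a\<leftarrow>w. dform D (sroot D a) \<eta>)"
  using w by (induction w) (simp_all add: dform_right[OF D cartan_linear(3)[OF D]])
 thus ?thesis by (simp add: dform_right[OF D wt_word_linear[OF D L]] dform_right[OF D L] wt_word_def)
qed

lemma dform_wt_words:
 assumes D: "cartan_datum D" and L: "clinear \<Lambda>" "clinear \<Lambda>'"
  and w: "distinct u" "distinct u'" "c ` (set u \<union> set u') \<subseteq> {..<rk D}"
 shows "dform D (wt_word D \<Lambda> (rev (map c u))) (wt_word D \<Lambda>' (rev (map c u')))
  = dform D \<Lambda> \<Lambda>' - (\<Sum>b\<in>set u. dform D (sroot D (c b)) \<Lambda>') - (\<Sum>a\<in>set u'. dform D \<Lambda> (sroot D (c a)))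
   + (\<Sum>b\<in>set u. \<Sum>a\<in>set u'. dform D (sroot D (c b)) (sroot D (c a)))"
proof -
 have v: "set (rev (map c u)) \<subseteq> {..<rk D}" "set (rev (map c u')) \<subseteq> {..<rk D}" using w by auto
 have sl: "(\<Sum>a\<leftarrow>rev (map c u). h a) = (\<Sum>b\<in>set u. h (c b))" if "distinct u" for u h
  by (simp add: rev_map[symmetric] sum_list_rev comp_def sum_list_distinct_conv_sum_set[OF that])
 have right: "dform D \<xi> (wt_word D \<Lambda>' (rev (map c u'))) = dform D \<xi> \<Lambda>' - (\<Sum>a\<in>set u'. dform D \<xi> (sroot D (c a)))" for \<xi>
  unfolding dform_commute[OF D, of \<xi>] dform_wt_word_left[OF D L(2) v(2)] sl[OF w(2)] by simp
 show ?thesis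
  unfolding dform_wt_word_left[OF D L(1) v(1)] sl[OF w(1)] right by (simp add: sum_subtractf sum.swap[of _ "set u'"])
qed

lemma sum_Pow_complement:
 assumes "finite S"
 shows "(\<Sum>P\<in>Pow S. H P (S - P)) = (\<Sum>P\<in>Pow S. H (S - P) P)"
 by (rule sum.reindex_bij_witness[of _ "%P. S - P" "%P. S - P"]) (auto simp: double_diff)

context kz_tensor begin

abbreviation col_vec :: "(nat => nat) => nat => nat list => 'm" where
 "col_vec c a w \<equiv> fold (%k. act a (geF G (c k))) w (v a)"

text \<open>The abstract transport of letters, with the insertion as \<open>T\<close>, the tensor as
  \<open>bb\<close>, and \<open>F\<close> the sum of the actions of a generator on both factors.
  That \<open>F\<close> is a derivation of the insertion is the module axiom: the bracket term in
  the action on the tensor \<open>n_minus\<close> with M accounts for commuting f_k past the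
  inserted element.\<close>

lemma ins_op_sum_words:
 fixes c :: "nat => nat" and t :: "nat => complex"
 assumes p: "p \<in> tuples n" and ij: "i < n" "j < n" "i ~= j"
  and S: "finite S" "c ` S \<subseteq> {..<rk D}" "inj_on t S" "z \<notin> t ` S" "z' \<notin> t ` S"
 shows "(\<Sum>P\<in>Pow S. \<Sum>w\<in>perms P. \<Sum>w'\<in>perms (S - P).
   (chain t w z * chain t w' z') *\<^sub>C ins_op i j (p(i := col_vec c i w)) (nu j (col_vec c j w')))
  = (\<Sum>P\<in>Pow S. \<Sum>w\<in>perms P. \<Sum>w'\<in>perms (S - P).
   (chain t w z * chain t w' z' * (\<Sum>b\<in>P. (t b - z) * (dform D (sroot D (c b)) (\<Lambda> j) / (t b - z')
     - (\<Sum>a\<in>S - P. dform D (sroot D (c b)) (sroot D (c a)) / (t b - t a))))) *\<^sub>C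
     tens (p(i := col_vec c i w, j := col_vec c j w')))"
proof -
 define bb where "bb x y = tens (p(i := x, j := y))" for x y
 define T where "T x s = ins_op i j (p(i := x)) s" for x s
 \<comment> \<open>The transport lemma asks for linear operators for every index. Outside the valid
   colours they are set to zero, which does not affect words with letters in
   \<open>S\<close>.\<close>
 define fo where "fo a k x = (if c k < rk D then act a (geF G (c k)) x else 0)" for a k x
 define fs where "fs k s = (if c k < rk D then nm_act D G tn (act j) (geF G (c k)) s else 0)" for k s
 \<comment> \<open>The coproduct of the generator, acting on the two factors concerned.\<close>
 define F where "F k x = (if c k < rk D then factor_op n tens i (act i (geF G (c k))) x
   + factor_op n tens j (act j (geF G (c k))) x else 0)" for k x
 note geF = n_minus.intros(2)[of _ D G]
 note nm = km_nu.nm_act_spec[OF km_nu_factor[OF ij(2)] geF]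
 have fo_lin: "clinear (fo a k)" if "a < n" for a k
  unfolding fo_def by (cases "c k < rk D") (simp_all add: act_linear[OF that] clinear_const_zero)
 have fs_lin: "clinear (fs k)" for k
  unfolding fs_def using nm(1) by (cases "c k < rk D") (simp_all add: clinear_const_zero)
 have F_lin: "clinear (F k)" for k
  unfolding F_def
  by (cases "c k < rk D") (simp_all add: clinear_const_zero clinear_plus factor_spec(1) ij act_linear)
 have up: "p(i := x, j := y) \<in> tuples n" for x y by (rule tuples_upd[OF tuples_upd[OF p ij(1)] ij(2)])
 have bb_bil: "cbilinear bb"
  unfolding cbilinear_def
 proof (intro conjI allI)
  show "clinear (bb x)" for x unfolding bb_def by (rule tens_linear[OF tuples_upd[OF p ij(1)] ij(2)])
  show "clinear (%x. bb x y)" for y unfolding bb_def fun_upd_twist[OF ij(3)]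
   by (rule tens_linear[OF tuples_upd[OF p ij(2)] ij(1)])
 qed
 have T_bil: "cbilinear T"
  unfolding cbilinear_def T_def by (intro conjI allI ins_op_spec(1) tuples_upd p ij ins_op_linear)+
 have T_tn: "T x (tn d y) = bb (act i d x) y" if "d \<in> n_minus D G" for x d y
  unfolding T_def ins_op_spec(2)[OF tuples_upd[OF p ij(1)] ij that] bb_def by simp
 note zero = clinear_zero[OF cbilinear_left[OF bb_bil]] clinear_zero[OF cbilinear_right[OF bb_bil]]
  clinear_zero[OF cbilinear_left[OF T_bil]] clinear_zero[OF cbilinear_right[OF T_bil]]
 have FB: "F k (bb x y) = bb (fo i k x) y + bb x (fo j k y)" for k x y
 proof (cases "c k < rk D")
  case True
  have "factor_op n tens i (act i (geF G (c k))) (bb x y) = bb (act i (geF G (c k)) x) y"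
   unfolding bb_def factor_spec(2)[OF ij(1) act_linear[OF ij(1)] up] using ij(3) by (simp add: fun_upd_twist[of i j])
  moreover have "factor_op n tens j (act j (geF G (c k))) (bb x y) = bb x (act j (geF G (c k)) y)"
   unfolding bb_def factor_spec(2)[OF ij(2) act_linear[OF ij(2)] up] by simp
  ultimately show ?thesis using True by (simp add: F_def fo_def)
 qed (simp add: F_def fo_def zero)
 have br: "brk G (geF G b) d \<in> n_minus D G" if "b < rk D" "d \<in> n_minus D G" for b d
  using that by (intro n_minus.intros)
 have FT: "F k (T x s) = T (fo i k x) s + T x (fs k s)" for k x s
 proof (cases "c k < rk D")
  case True
  have "(%s. F k (T x s)) = (%s. T (fo i k x) s + T x (fs k s))"
  proof (rule tensor_product_ext[OF tensor_nM])
   show "clinear (%s. F k (T x s))" by (rule clinear_comp[OF F_lin cbilinear_right[OF T_bil]])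
   show "clinear (%s. T (fo i k x) s + T x (fs k s))"
    by (intro clinear_plus cbilinear_right[OF T_bil] clinear_comp[OF cbilinear_right[OF T_bil] fs_lin])
   fix d y assume d: "d \<in> n_minus D G"
   have "fs k (tn d y) = tn (brk G (geF G (c k)) d) y + tn d (act j (geF G (c k)) y)"
    using True d nm(2) by (simp add: fs_def)
   thus "F k (T x (tn d y)) = T (fo i k x) (tn d y) + T x (fs k (tn d y))"
    using True by (simp add: clinear_add[OF cbilinear_right[OF T_bil]] T_tn[OF d] T_tn[OF br[OF True d]] FB
     km_verma.act_brk[OF km_verma_factor[OF ij(1)]] clinear_diff[OF cbilinear_left[OF bb_bil]] fo_def)
  qed
  thus ?thesis by meson
 qed (simp add: F_def fo_def fs_def zero)
 let ?g = "%b a. dform D (sroot D (c b)) (sroot D (c a))"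
 let ?l = "%b. dform D (sroot D (c b)) (\<Lambda> j)"
 define \<sigma> where "\<sigma> b y = (if c b < rk D then tn (geF G (c b)) y else 0)" for b y
 have sig: "T x (\<sigma> b y) = bb (fo i b x) y" for x y b
  by (simp add: \<sigma>_def fo_def T_tn geF zero)
 define nuw where "nuw w = (\<Sum>q<length w. (?l (w ! q) - (\<Sum>b\<leftarrow>take q w. ?g (w ! q) b)) *\<^sub>C
    fold fs (drop (Suc q) w) (\<sigma> (w ! q) (fold (fo j) (take q w) (v j))))" for w
 have fold_fo: "col_vec c a w = fold (fo a) w (v a)" if "set w \<subseteq> S" for a w
  by (rule fold_cong) (use that S(2) in \<open>auto simp: fo_def fun_eq_iff image_subset_iff subset_iff\<close>)
 have nu_eq: "nu j (col_vec c j w) = nuw w" if w: "set w \<subseteq> S" for w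
  unfolding nuw_def km_nu.nu_minus_word[OF km_nu_factor[OF ij(2)] order_trans[OF image_mono[OF w] S(2)]]
 proof (rule sum.cong[OF refl])
  fix q assume q: "q \<in> {..<length w}"
  have cw: "c ` set w \<subseteq> {..<rk D}" using w S(2) by auto
  have 1: "col_vec c j (take q w) = fold (fo j) (take q w) (v j)"
   using fold_fo[of "take q w" j] w set_take_subset[of q w] by auto
  have cq: "c (w ! q) < rk D" using cw q by (auto simp: image_subset_iff)
  have 2: "fold (%k. nm_act D G tn (act j) (geF G (c k))) (drop (Suc q) w) s = fold fs (drop (Suc q) w) s" for s
   by (rule fold_cong) (use cw set_drop_subset[of "Suc q" w] in \<open>auto simp: fs_def fun_eq_iff image_subset_iff subset_iff\<close>)
  show "(dform D (\<Lambda> j) (sroot D (c (w ! q))) - (\<Sum>k\<leftarrow>take q w. ?g (w ! q) k)) *\<^sub>C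
    fold (%k. nm_act D G tn (act j) (geF G (c k))) (drop (Suc q) w) (tn (geF G (c (w ! q))) (col_vec c j (take q w)))
   = (?l (w ! q) - (\<Sum>b\<leftarrow>take q w. ?g (w ! q) b)) *\<^sub>C fold fs (drop (Suc q) w) (\<sigma> (w ! q) (fold (fo j) (take q w) (v j)))"
   unfolding 1 2 dform_commute[OF cartan, of "\<Lambda> j"] \<sigma>_def using cq by simp
 qed
 have sub: "set w \<subseteq> S" "set w' \<subseteq> S" if "P \<in> Pow S" "w \<in> perms P" "w' \<in> perms (S - P)" for P w w'
  using that by (auto simp: permutations_of_set_def)
 have "(\<Sum>P\<in>Pow S. \<Sum>w\<in>perms P. \<Sum>w'\<in>perms (S - P).
   (chain t w z * chain t w' z') *\<^sub>C T (col_vec c i w) (nu j (col_vec c j w')))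
  = (\<Sum>P\<in>Pow S. \<Sum>w\<in>perms P. \<Sum>w'\<in>perms (S - P).
   (chain t w z * chain t w' z') *\<^sub>C T (fold (fo i) w (v i)) (nuw w'))"
  by (intro sum.cong refl) (simp only: nu_eq[OF sub(2)] fold_fo[OF sub(1)])
 also have "... = (\<Sum>P\<in>Pow S. \<Sum>w\<in>perms P. \<Sum>w'\<in>perms (S - P).
   (chain t w z * chain t w' z' * (\<Sum>b\<in>P. (t b - z) * (?l b / (t b - z') - (\<Sum>a\<in>S - P. ?g b a / (t b - t a))))) *\<^sub>C
   bb (fold (fo i) w (v i)) (fold (fo j) w' (v j)))"
  by (rule sum_words_pair_transport[where F = F and fs = fs and \<sigma> = \<sigma>])
    (fact fo_lin[OF ij(1)] fo_lin[OF ij(2)] fs_lin F_lin bb_bil T_bil FB FT sig nuw_def S)+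
 also have "... = (\<Sum>P\<in>Pow S. \<Sum>w\<in>perms P. \<Sum>w'\<in>perms (S - P).
   (chain t w z * chain t w' z' * (\<Sum>b\<in>P. (t b - z) * (?l b / (t b - z') - (\<Sum>a\<in>S - P. ?g b a / (t b - t a))))) *\<^sub>C
   bb (col_vec c i w) (col_vec c j w'))"
  by (intro sum.cong refl) (simp only: fold_fo[OF sub(1)] fold_fo[OF sub(2)])
 finally show ?thesis unfolding T_def bb_def .
qed

text \<open>On each pair of words \<Omega>_+ splits into the weight form and two insertions. After
  transport all three have the same tensors with scalar coefficients \<open>Wc\<close>,
  \<open>A1\<close> and \<open>A2\<close>, whose sum is z - z' times the interaction by
  \<open>pair_coefficients\<close>.\<close>

lemma pair_identity:
 fixes c :: "nat => nat" and t :: "nat => complex"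
 assumes p: "p \<in> tuples n" and ij: "i < n" "j < n" "i ~= j"
  and S: "finite S" "c ` S \<subseteq> {..<rk D}" "inj_on t S" "z \<notin> t ` S" "z' \<notin> t ` S" "z ~= z'"
 shows "(\<Sum>P\<in>Pow S. \<Sum>w\<in>perms P. \<Sum>w'\<in>perms (S - P).
   (chain t w z * chain t w' z') *\<^sub>C ((1 / (z - z')) *\<^sub>C
     Omega_plus D G B tn act v n tens i j (tens (p(i := col_vec c i w, j := col_vec c j w')))))
  = (\<Sum>P\<in>Pow S. \<Sum>w\<in>perms P. \<Sum>w'\<in>perms (S - P).
   (chain t w z * chain t w' z' * (dform D (\<Lambda> i) (\<Lambda> j) / (z - z')
     - (\<Sum>b\<in>P. dform D (sroot D (c b)) (\<Lambda> j) / (t b - z'))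
     - (\<Sum>a\<in>S - P. dform D (sroot D (c a)) (\<Lambda> i) / (z - t a))
     + (\<Sum>b\<in>P. \<Sum>a\<in>S - P. dform D (sroot D (c b)) (sroot D (c a)) / (t b - t a)))) *\<^sub>C
     tens (p(i := col_vec c i w, j := col_vec c j w')))"
proof -
 have ji: "j < n" "i < n" "j ~= i" using ij by auto
 let ?f = "col_vec c"
 let ?q = "%w w'. p(i := ?f i w, j := ?f j w')"
 let ?b = "%w w'. tens (?q w w')"
 let ?T = "%w w'. ins_op i j (p(i := ?f i w)) (nu j (?f j w'))"
 let ?T' = "%w w'. ins_op j i (p(j := ?f j w')) (nu i (?f i w))"
 let ?g = "%b a. dform D (sroot D (c b)) (sroot D (c a))"
 let ?l = "%a b. dform D (sroot D (c b)) (\<Lambda> a)"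
 have up: "?q w w' \<in> tuples n" for w w' by (rule tuples_upd[OF tuples_upd[OF p ij(1)] ij(2)])
 define Wc where "Wc P = dform D (\<Lambda> i) (\<Lambda> j) - (\<Sum>b\<in>P. ?l j b) - (\<Sum>a\<in>S - P. ?l i a) + (\<Sum>b\<in>P. \<Sum>a\<in>S - P. ?g b a)" for P
 define A1 where "A1 P = (\<Sum>b\<in>P. (t b - z) * (?l j b / (t b - z') - (\<Sum>a\<in>S - P. ?g b a / (t b - t a))))" for P
 define A2 where "A2 P = (\<Sum>b\<in>S - P. (t b - z') * (?l i b / (t b - z) - (\<Sum>a\<in>P. ?g b a / (t b - t a))))" for P
 have Om: "Omega_plus D G B tn act v n tens i j (?b w w') = Wc P *\<^sub>C ?b w w' + ?T w w' + ?T' w w'"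
  if P: "P \<in> Pow S" and w: "w \<in> perms P" "w' \<in> perms (S - P)" for P w w'
 proof -
  have d: "distinct w" "distinct w'" "set w = P" "set w' = S - P" using w by (auto simp: permutations_of_set_def)
  have sub: "set w \<subseteq> S" "set w' \<subseteq> S" using d P by auto
  have fl: "?f a w = word_vec a (rev (map c w))" for a w
   by (simp add: foldr_conv_fold rev_map fold_map comp_def)
  have valid: "valid_word (rev (map c w))" "valid_word (rev (map c w'))" using sub S(2) by auto
  have wv: "weight_vec G (act i) (wt_word D (\<Lambda> i) (rev (map c w))) (?q w w' i)"
   "weight_vec G (act j) (wt_word D (\<Lambda> j) (rev (map c w'))) (?q w w' j)"
   using word_vec_weight[OF ij(1) valid(1)] word_vec_weight[OF ij(2) valid(2)] ij(3) unfolding fl by simp_all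
  have "dform D (wt_word D (\<Lambda> i) (rev (map c w))) (wt_word D (\<Lambda> j) (rev (map c w'))) = Wc P"
   using dform_wt_words[OF cartan weights[OF ij(1)] weights[OF ij(2)] d(1,2), of c] sub S(2)
   unfolding Wc_def d(3,4) dform_commute[OF cartan, of "\<Lambda> i" "sroot D _"] by auto
  moreover have "ins_op i j (?q w w') = ins_op i j (p(i := ?f i w))" by (rule ins_op_upd[OF ij(3)])
  moreover have "ins_op j i (?q w w') = ins_op j i (p(j := ?f j w'))"
   unfolding fun_upd_twist[OF ij(3)] by (rule ins_op_upd[OF ji(3)])
  moreover have "?q w w' i = ?f i w" "?q w w' j = ?f j w'" using ij(3) by simp_all
  ultimately show ?thesis using Omega_plus_spec(2)[OF ij up wv] by (simp only:)
 qed
 define SS where "SS H = (\<Sum>P\<in>Pow S. \<Sum>w\<in>perms P. \<Sum>w'\<in>perms (S - P). H P w w')"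
  for H :: "nat set => nat list => nat list => 't"
 have SS_cong: "SS H = SS H'" if "!!P w w'. P \<in> Pow S ==> w \<in> perms P ==> w' \<in> perms (S - P) ==> H P w w' = H' P w w'" for H H'
  unfolding SS_def by (intro sum.cong refl that)
 have SS_add: "SS (%P w w'. H P w w' + H' P w w') = SS H + SS H'" for H H'
  unfolding SS_def by (simp only: sum.distrib)
 have SS_scale: "SS (%P w w'. a *\<^sub>C H P w w') = a *\<^sub>C SS H" for a H
  unfolding SS_def by (simp only: cvec.scale_sum_right)
 have SS_swap: "SS H = (\<Sum>P\<in>Pow S. \<Sum>w'\<in>perms P. \<Sum>w\<in>perms (S - P). H (S - P) w w')" for H
  unfolding SS_def using sum_Pow_complement[OF S(1), of "%P Q. \<Sum>w\<in>perms P. \<Sum>w'\<in>perms Q. H P w w'"]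
  by (subst (asm) (2) sum.swap) (simp cong: sum.cong add: double_diff)
 let ?X = "%w w'. chain t w z * chain t w' z'"
 have S1: "SS (%P w w'. ?X w w' *\<^sub>C ?T w w') = SS (%P w w'. (?X w w' * A1 P) *\<^sub>C ?b w w')"
  unfolding SS_def A1_def by (rule ins_op_sum_words[OF p ij S(1-5)])
 \<comment> \<open>The other insertion is the same statement with the two factors exchanged, which
   replaces \<open>P\<close> by its complement in \<open>S\<close>.\<close>
 have S2: "SS (%P w w'. ?X w w' *\<^sub>C ?T' w w') = SS (%P w w'. (?X w w' * A2 P) *\<^sub>C ?b w w')"
 proof -
  have "SS (%P w w'. ?X w w' *\<^sub>C ?T' w w') = (\<Sum>P\<in>Pow S. \<Sum>w'\<in>perms P. \<Sum>w\<in>perms (S - P).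
    (chain t w' z' * chain t w z) *\<^sub>C ?T' w w')"
   unfolding SS_swap by (intro sum.cong refl) (simp only: mult.commute)
  also have "... = SS (%P w w'. (?X w w' * A2 P) *\<^sub>C ?b w w')"
   unfolding SS_swap A2_def ins_op_sum_words[OF p ji S(1-3,5,4)]
  proof (intro sum.cong refl)
   fix P w w' assume "P \<in> Pow S"
   hence e: "S - (S - P) = P" by auto
   show "(chain t w' z' * chain t w z * (\<Sum>b\<in>P. (t b - z') * (?l i b / (t b - z) - (\<Sum>a\<in>S - P. ?g b a / (t b - t a))))) *\<^sub>C
     tens (p(j := ?f j w', i := ?f i w))
    = (?X w w' * (\<Sum>b\<in>S - (S - P). (t b - z') * (?l i b / (t b - z) - (\<Sum>a\<in>S - P. ?g b a / (t b - t a))))) *\<^sub>C ?b w w'"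
    unfolding e fun_upd_twist[OF ij(3)] by (simp only: mult.commute[of "chain t w z"])
  qed
  finally show ?thesis .
 qed
 let ?K = "%P. dform D (\<Lambda> i) (\<Lambda> j) / (z - z') - (\<Sum>b\<in>P. ?l j b / (t b - z')) - (\<Sum>a\<in>S - P. ?l i a / (z - t a))
     + (\<Sum>b\<in>P. \<Sum>a\<in>S - P. ?g b a / (t b - t a))"
 have co: "Wc P + A1 P + A2 P = (z - z') * ?K P" if P: "P \<in> Pow S" for P
 proof -
  have PS: "P \<union> S = S" using P by auto
  show ?thesis unfolding Wc_def A1_def A2_def
   by (rule pair_coefficients) (use S in \<open>simp_all add: PS dform_commute[OF cartan]\<close>)
 qed
 have "SS (%P w w'. ?X w w' *\<^sub>C ((1 / (z - z')) *\<^sub>C Omega_plus D G B tn act v n tens i j (?b w w')))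
   = SS (%P w w'. (1 / (z - z')) *\<^sub>C ((?X w w' * Wc P) *\<^sub>C ?b w w' + ?X w w' *\<^sub>C ?T w w' + ?X w w' *\<^sub>C ?T' w w'))"
 proof (rule SS_cong)
  fix P w w' assume a: "P \<in> Pow S" "w \<in> perms P" "w' \<in> perms (S - P)"
  show "?X w w' *\<^sub>C ((1 / (z - z')) *\<^sub>C Omega_plus D G B tn act v n tens i j (?b w w'))
   = (1 / (z - z')) *\<^sub>C ((?X w w' * Wc P) *\<^sub>C ?b w w' + ?X w w' *\<^sub>C ?T w w' + ?X w w' *\<^sub>C ?T' w w')"
   unfolding Om[OF a] by (simp only: scaleC_add_right scaleC_scaleC mult.commute mult.left_commute mult.assoc)
 qed
 also have "... = (1 / (z - z')) *\<^sub>C (SS (%P w w'. (?X w w' * Wc P) *\<^sub>C ?b w w') + SS (%P w w'. (?X w w' * A1 P) *\<^sub>C ?b w w')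
   + SS (%P w w'. (?X w w' * A2 P) *\<^sub>C ?b w w'))"
  unfolding SS_scale SS_add S1 S2 ..
 also have "... = SS (%P w w'. (1 / (z - z')) *\<^sub>C ((?X w w' * (Wc P + A1 P + A2 P)) *\<^sub>C ?b w w'))"
  unfolding SS_scale SS_add[symmetric] by (simp only: distrib_left scaleC_add_left)
 also have "... = SS (%P w w'. (?X w w' * ?K P) *\<^sub>C ?b w w')"
 proof (rule SS_cong)
  fix P w w' assume a: "P \<in> Pow S"
  have "1 / (z - z') * (?X w w' * ((z - z') * ?K P)) = ?X w w' * ?K P" using S(6) by simp
  thus "(1 / (z - z')) *\<^sub>C ((?X w w' * (Wc P + A1 P + A2 P)) *\<^sub>C ?b w w') = (?X w w' * ?K P) *\<^sub>C ?b w w'"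
   unfolding co[OF a] scaleC_scaleC by (simp only:)
 qed
 finally show ?thesis unfolding SS_def .
qed

end

section \<open>Integrals over horizontal families\<close>

definition ti :: "master => (nat => complex) => tchain => (point => complex) => complex" where
 "ti A z c F = tint A z c (iform (nvars A) id F)"

definition conv :: "master => (nat => complex) => tchain => (point => complex) => bool" where
 "conv A z c F \<longleftrightarrow> integral_converges A z c (iform (nvars A) id F)"

lemma simplex_integral_form_cong:
 assumes c: "twisted_chain A (nvars A) z c" and s: "\<sigma> \<in> supp c"
  and eq: "!!t u. t \<in> fibre A z ==> \<omega> (t, z) (%b. (u b, %_. 0)) = \<omega>' (t, z) (%b. (u b, %_. 0))"
 shows "sint (nvars A) z \<sigma> (c \<sigma>) \<omega> = sint (nvars A) z \<sigma> (c \<sigma>) \<omega>'"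
proof -
 have "singular_simplex (nvars A) (top_of_set (fibre A z)) \<sigma>" using c s by (auto simp: twisted_chain_def)
 hence "\<sigma> x \<in> fibre A z" if "x \<in> std (nvars A)" for x
  using that continuous_map_image_subset_topspace by (fastforce simp: singular_simplex_def)
 thus ?thesis
  unfolding simplex_integral_def set_lebesgue_integral_def
  using eq bary_dom_in_std
  by (intro Bochner_Integration.integral_cong) (auto simp: indicator_def)
qed

lemma twisted_integral_form_cong:
 assumes "twisted_chain A (nvars A) z c"
  and "!!t u. t \<in> fibre A z ==> \<omega> (t, z) (%b. (u b, %_. 0)) = \<omega>' (t, z) (%b. (u b, %_. 0))"
 shows "tint A z c \<omega> = tint A z c \<omega>'"
  "integral_converges A z c \<omega> \<longleftrightarrow> integral_converges A z c \<omega>'"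
 unfolding twisted_integral_def integral_converges_def
 by (intro infsum_cong summable_on_cong simplex_integral_form_cong[OF assms(1)] assms(2); assumption)+

lemma ti_cong:
 assumes "twisted_chain A (nvars A) z c" "!!t. t \<in> fibre A z ==> F (t, z) = F' (t, z)"
 shows "ti A z c F = ti A z c F'" "conv A z c F \<longleftrightarrow> conv A z c F'"
 using twisted_integral_form_cong[OF assms(1), of "iform (nvars A) id F" "iform (nvars A) id F'"] assms(2)
 by (simp_all add: ti_def conv_def iform_def)

lemma twisted_integral_scale:
 "tint A z c (%p w. a * \<omega> p w) = a * tint A z c \<omega>"
 "integral_converges A z c \<omega> ==> integral_converges A z c (%p w. a * \<omega> p w)"
 unfolding twisted_integral_def integral_converges_def simplex_integral_cmult
 by (rule infsum_cmult_right') (rule summable_on_cmult_right)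

lemma iform_scale: "iform q \<iota> (%p. a * F p) = (%p w. a * iform q \<iota> F p w)"
 by (intro ext) (simp add: iform_def)

lemma ti_scale: "ti A z c (%p. a * F p) = a * ti A z c F" "conv A z c F ==> conv A z c (%p. a * F p)"
 unfolding ti_def conv_def iform_scale by (rule twisted_integral_scale, rule twisted_integral_scale)

lemma ti_zero: "ti A z c (%_. 0) = 0" "conv A z c (%_. 0)"
proof -
 have "sint q z \<sigma> \<phi> (iform q id (%_. 0)) = 0" for q \<sigma> \<phi>
 proof -
  have "iform q id (%_. 0) = (%p w. 0 * 0)" by (intro ext) (simp add: iform_def)
  thus ?thesis by (simp only: simplex_integral_cmult) simp
 qed
 thus "ti A z c (%_. 0) = 0" "conv A z c (%_. 0)"
  by (simp_all add: ti_def conv_def twisted_integral_def integral_converges_def)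
qed

text \<open>Value and convergence are proved together: for infinitely many simplices an integral of
  a sum may be split only if the parts are summable.\<close>

lemma ti_linear:
 assumes c: "twisted_chain A (nvars A) z c" and z: "z \<in> base A" and I: "finite I"
  and F: "!!x. x \<in> I ==> fibre_cont A z (F x)" "!!x. x \<in> I ==> conv A z c (F x)"
 shows "ti A z c (%p. \<Sum>x\<in>I. a x * F x p) = (\<Sum>x\<in>I. a x * ti A z c (F x))
  \<and> conv A z c (%p. \<Sum>x\<in>I. a x * F x p)"
 using I F
proof (induction I rule: finite_induct)
 case empty
 show ?case by (simp add: ti_zero)
next
 case (insert x I)
 let ?G = "%p. \<Sum>x\<in>I. a x * F x p" and ?H = "%p. a x * F x p"
 have IH: "ti A z c ?G = (\<Sum>x\<in>I. a x * ti A z c (F x))" "conv A z c ?G" using insert by auto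
 have cH: "conv A z c ?H" by (rule ti_scale(2)) (use insert in auto)
 have tH: "ti A z c ?H = a x * ti A z c (F x)" by (rule ti_scale(1))
 have fH: "fibre_cont A z ?H" and fG: "fibre_cont A z ?G"
  using insert by (auto intro!: fibre_cont_mult fibre_cont_const fibre_cont_sum)
 have add: "sint (nvars A) z \<sigma> (c \<sigma>) (iform (nvars A) id (%p. ?H p + ?G p))
   = sint (nvars A) z \<sigma> (c \<sigma>) (iform (nvars A) id ?H) + sint (nvars A) z \<sigma> (c \<sigma>) (iform (nvars A) id ?G)"
  if "\<sigma> \<in> supp c" for \<sigma>
  by (rule simplex_integral_add[OF twisted_chain_branch[OF c that] z fH fG])
 have "ti A z c (%p. ?H p + ?G p) = ti A z c ?H + ti A z c ?G"
  using cH IH(2) unfolding ti_def conv_def twisted_integral_def integral_converges_def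
  by (subst infsum_cong[OF add]) (auto intro: infsum_add)
 moreover have "conv A z c (%p. ?H p + ?G p)"
  using cH IH(2) unfolding conv_def integral_converges_def by (subst summable_on_cong[OF add]) (auto intro: summable_on_add)
 ultimately show ?case using insert.hyps by (simp add: IH(1) tH)
qed

text \<open>The pairs of a sequence of colours and a compatible permutation in a single object: the
  letters are the integration variables themselves, each used once, and colours are read off
  afterwards.\<close>

definition full_words :: "nat => nat => nat list list set" where
 "full_words n m = {W. length W = n \<and> distinct (concat W) \<and> set (concat W) = {..<m}}"

lemma full_words_permutation:
 assumes "W \<in> full_words n m"
 obtains \<sigma> where "\<sigma> permutes {..<m}" "concat W = map \<sigma> [0..<m]"
proof -
 let ?\<sigma> = "%k. if k < m then concat W ! k else k"
 have d: "distinct (concat W)" "set (concat W) = {..<m}" using assms by (auto simp: full_words_def)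
 have l: "length (concat W) = m" using distinct_card[OF d(1)] d(2) by simp
 have "bij_betw ((!) (concat W)) {..<m} {..<m}" using bij_betw_nth[OF d(1), of "{..<m}" "{..<m}"] d(2) l by simp
 hence "bij_betw ?\<sigma> {..<m} {..<m}" by (rule bij_betw_cong[THEN iffD1, rotated]) simp
 hence "?\<sigma> permutes {..<m}" by (rule bij_imp_permutes) simp
 moreover have "concat W = map ?\<sigma> [0..<m]" by (rule nth_equalityI) (simp_all add: l)
 ultimately show thesis by (rule that)
qed

lemma word_forms_dlog_lists:
 assumes W: "distinct (concat W)" "set (concat W) \<subseteq> {..<nvars A}" "length W = npts A"
 shows "map dlog (word_forms W) \<in> dlog_lists A"
proof -
 have "dlog f \<in> {dlog (tz k j) | k j. k < nvars A \<and> j < npts A} \<union> {dlog (tt k l) | k l. k < nvars A \<and> l < nvars A \<and> k ~= l}"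
  if f: "f \<in> set (word_forms W)" for f
 proof -
  obtain j where j: "j < length W" "f \<in> set (block_forms (W ! j) j)" using f by (auto simp: word_forms_def)
  have "W ! j \<in> set W" using j(1) by simp
  hence "distinct (W ! j)" "set (W ! j) \<subseteq> {..<nvars A}" using W by (auto simp: distinct_concat_iff)
  from this(2) block_forms_memD[OF j(2) this(1)] j(1) W(3) show ?thesis by (auto simp: subset_iff)
 qed
 thus ?thesis unfolding dlog_lists_def in_lists_conv_set set_map by blast
qed

lemma horizontal_family_chain:
 assumes hf: "horizontal_family A U \<gamma>" and z: "z \<in> U"
 shows "twisted_chain A (nvars A) z (\<gamma> z)"
 using hf unfolding horizontal_family_def
proof
 assume "horizontal_compact A U \<gamma>"
 from this[unfolded horizontal_compact_def, THEN conjunct1, rule_format, OF z]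
 show ?thesis by (simp add: compact_twisted_cycle_def)
next
 assume "horizontal_noncompact A U \<gamma>"
 from this[unfolded horizontal_noncompact_def, THEN conjunct1, rule_format, OF z]
 show ?thesis by (simp add: noncompact_twisted_cycle_def)
qed

text \<open>The common ground of the two kinds of families. In the compact case the derivative comes
  from \<open>horizontal_compact_derivative\<close>; in the other case the definition gives it as
  the integral of a contracted form, which agrees with \<open>F\<close> on vertical vectors up to
  the sign of the permutation underlying \<open>W\<close>.\<close>

lemma horizontal_family_word_integral:
 assumes hf: "horizontal_family A U \<gamma>" and U: "openin (top_of_set (base A)) U" and z: "z \<in> U" and i: "i < npts A"
  and W: "W \<in> full_words (npts A) (nvars A)"
 defines "F \<equiv> %p. 1 / kap A * ((dlog_Phi A p (unit_z i) + (\<Sum>k\<in>set (W ! i). dlog_Phi A p (unit_t k))) * lmono (word_forms W) p)"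
 shows "conv A z (\<gamma> z) (lmono (word_forms W))" "conv A z (\<gamma> z) F"
  "((%w. ti A (z(i := w)) (\<gamma> (z(i := w))) (lmono (word_forms W))) has_field_derivative ti A z (\<gamma> z) F) (at (z i))"
proof -
 have w: "distinct (concat W)" "set (concat W) \<subseteq> {..<nvars A}" "length W = npts A" using W by (auto simp: full_words_def)
 have L: "set (word_forms W) \<subseteq> lforms A" by (rule word_forms_lforms[OF w])
 have S: "set (W ! i) \<subseteq> {..<nvars A}" using w i nth_mem[of i W] by fastforce
 have kill: "f (unit_z i) + (\<Sum>k\<in>set (W ! i). f (unit_t k)) = 0" if "f \<in> set (word_forms W)" for f
  by (rule word_forms_kill[OF w(1) _ that]) (use w(3) i in simp)
 obtain \<sigma> where \<sigma>: "\<sigma> permutes {..<nvars A}" "concat W = map \<sigma> [0..<nvars A]" by (rule full_words_permutation[OF W])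
 let ?\<eta> = "map dlog (word_forms W)"
 have \<eta>: "?\<eta> \<in> dlog_lists A" "length ?\<eta> = nvars A"
  using word_forms_dlog_lists[OF w] \<sigma>(2) by (simp_all add: length_word_forms)
 have eq1: "of_int (sign \<sigma>) * wedge ?\<eta> p (%b. (u b, %_. 0)) = iform (nvars A) id (lmono (word_forms W)) p (%b. (u b, %_. 0))" for p u
  by (rule wedge_word_forms[OF \<sigma>])
 have eq2: "of_int (sign \<sigma>) * insert_dz i (twisted_d A ?\<eta>) p (%b. (u b, %_. 0)) = iform (nvars A) id F p (%b. (u b, %_. 0))" for p u
 proof -
  have l: "length (word_forms W) = nvars A" using \<eta>(2) by simp
  have "of_int (sign \<sigma>) * insert_dz i (twisted_d A ?\<eta>) p (%b. (u b, %_. 0))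
   = 1 / kap A * ((dlog_Phi A p (unit_z i) + (\<Sum>k\<in>set (W ! i). dlog_Phi A p (unit_t k))) * (of_int (sign \<sigma>) * wedge ?\<eta> p (%b. (u b, %_. 0))))"
   using insert_dz_twisted_d[OF L l S kill, of p u] by (simp add: mult_ac)
  thus ?thesis unfolding eq1 F_def by (simp add: iform_def)
 qed
 have ch: "twisted_chain A (nvars A) z' (\<gamma> z')" if "z' \<in> U" for z' by (rule horizontal_family_chain[OF hf that])
 have c1: "ti A z' (\<gamma> z') (lmono (word_forms W)) = of_int (sign \<sigma>) * tint A z' (\<gamma> z') (wedge ?\<eta>)"
   "conv A z' (\<gamma> z') (lmono (word_forms W)) \<longleftrightarrow> integral_converges A z' (\<gamma> z') (%p v. of_int (sign \<sigma>) * wedge ?\<eta> p v)"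
  if "z' \<in> U" for z'
  unfolding ti_def conv_def twisted_integral_scale(1)[symmetric]
  by (rule twisted_integral_form_cong[OF ch[OF that]], rule eq1[symmetric])+
 have c2: "ti A z (\<gamma> z) F = of_int (sign \<sigma>) * tint A z (\<gamma> z) (insert_dz i (twisted_d A ?\<eta>))"
   "conv A z (\<gamma> z) F \<longleftrightarrow> integral_converges A z (\<gamma> z) (%p v. of_int (sign \<sigma>) * insert_dz i (twisted_d A ?\<eta>) p v)"
  unfolding ti_def conv_def twisted_integral_scale(1)[symmetric]
  by (rule twisted_integral_form_cong[OF ch[OF z]], rule eq2[symmetric])+
 have cases: "conv A z (\<gamma> z) (lmono (word_forms W)) \<and> conv A z (\<gamma> z) F \<and>
  ((%w. ti A (z(i := w)) (\<gamma> (z(i := w))) (lmono (word_forms W))) has_field_derivative ti A z (\<gamma> z) F) (at (z i))"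
  using hf unfolding horizontal_family_def
 proof
  assume hc: "horizontal_compact A U \<gamma>"
  hence "finite (supp (\<gamma> z))" using z by (auto simp: horizontal_compact_def compact_twisted_cycle_def)
  thus ?thesis using horizontal_compact_derivative[OF hc U z i L S kill]
   by (simp add: F_def integral_converges_def ti_def conv_def)
 next
  assume hn: "horizontal_noncompact A U \<gamma>"
  have cyc: "noncompact_twisted_cycle A z (\<gamma> z)" using hn z by (auto simp: horizontal_noncompact_def)
  hence "integral_converges A z (\<gamma> z) (wedge ?\<eta>)" using \<eta> by (auto simp: noncompact_twisted_cycle_def)
  hence cv: "conv A z (\<gamma> z) (lmono (word_forms W))"
   using c1(2)[OF z] twisted_integral_scale(2) by blast
  have h: "integral_converges A z (\<gamma> z) (insert_dz i (twisted_d A ?\<eta>))"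
    "((%w. tint A (z(i := w)) (\<gamma> (z(i := w))) (wedge ?\<eta>))
      has_field_derivative tint A z (\<gamma> z) (insert_dz i (twisted_d A ?\<eta>))) (at (z i))"
   using hn[unfolded horizontal_noncompact_def, THEN conjunct2, THEN conjunct2, rule_format, OF z i \<eta>] by auto
  have cF: "conv A z (\<gamma> z) F" using c2(2) twisted_integral_scale(2)[OF h(1)] by blast
  have "((%w. of_int (sign \<sigma>) * tint A (z(i := w)) (\<gamma> (z(i := w))) (wedge ?\<eta>))
      has_field_derivative of_int (sign \<sigma>) * tint A z (\<gamma> z) (insert_dz i (twisted_d A ?\<eta>))) (at (z i))"
   by (rule DERIV_cmult[OF h(2)])
  moreover have "of_int (sign \<sigma>) * tint A z (\<gamma> z) (insert_dz i (twisted_d A ?\<eta>)) = ti A z (\<gamma> z) F"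
   by (rule c2(1)[symmetric])
  \<comment> \<open>The forms can be exchanged only over points of \<open>U\<close>, where a cycle
    is available; this is enough near \<open>z i\<close>.\<close>
  moreover have "\<forall>\<^sub>F w in nhds (z i). of_int (sign \<sigma>) * tint A (z(i := w)) (\<gamma> (z(i := w))) (wedge ?\<eta>)
    = ti A (z(i := w)) (\<gamma> (z(i := w))) (lmono (word_forms W))"
  proof -
   obtain e where e: "e > 0" "!!w. w \<in> ball (z i) (2 * e) ==> z(i := w) \<in> U"
    by (rule base_open_line[OF U z i]) blast
   have "\<forall>\<^sub>F w in nhds (z i). w \<in> ball (z i) (2 * e)"
    using e(1) by (intro eventually_nhds_in_open) auto
   thus ?thesis by (rule eventually_mono) (rule c1(1)[OF e(2), symmetric])
  qed
  ultimately have "((%w. ti A (z(i := w)) (\<gamma> (z(i := w))) (lmono (word_forms W))) has_field_derivative ti A z (\<gamma> z) F) (at (z i))"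
   using DERIV_cong_ev by fastforce
  thus ?thesis using cv cF by blast
 qed
 thus "conv A z (\<gamma> z) (lmono (word_forms W))" "conv A z (\<gamma> z) F"
  "((%w. ti A (z(i := w)) (\<gamma> (z(i := w))) (lmono (word_forms W))) has_field_derivative ti A z (\<gamma> z) F) (at (z i))"
  by auto
qed

section \<open>Reindexing by words of integration variables\<close>

lemma concat_take_blocks:
 "j \<le> length I ==> concat (map (block I \<sigma>) [0..<j]) = map \<sigma> [0..<sum_list (map length (take j I))]"
proof (induction j)
 case (Suc j)
 let ?s = "sum_list (map length (take j I))"
 have s: "sum_list (map length (take (Suc j) I)) = ?s + length (I ! j)"
  using Suc.prems by (simp add: take_Suc_conv_app_nth)
 have "block I \<sigma> j = map \<sigma> [?s..<?s + length (I ! j)]"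
  unfolding block_def by (intro nth_equalityI) simp_all
 thus ?case using Suc unfolding s by (simp add: upt_add_eq_append[of 0 ?s])
qed simp

lemma concat_blocks: "concat (map (block I \<sigma>) [0..<length I]) = map \<sigma> [0..<length (concat I)]"
 using concat_take_blocks[of "length I" I \<sigma>] by (simp add: length_concat)

lemma length_block: "length (block I \<sigma> j) = length (I ! j)"
 by (simp add: block_def)

lemma map_block_of_concat:
 assumes \<sigma>: "concat W = map \<sigma> [0..<length (concat W)]" and I: "map length I = map length W" and j: "j < length W"
 shows "block I \<sigma> j = W ! j"
proof (rule nth_equalityI)
 have l: "length (I ! j) = length (W ! j)" using arg_cong[OF I, of "%xs. xs ! j"] j map_eq_imp_length_eq[OF I] by simp
 show "length (block I \<sigma> j) = length (W ! j)" by (simp add: length_block l)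
 fix q assume q: "q < length (block I \<sigma> j)"
 let ?s = "sum_list (map length (take j W))"
 have q': "q < length (W ! j)" using q by (simp add: length_block l)
 have split: "concat W = concat (take j W) @ W ! j @ concat (drop (Suc j) W)"
  using id_take_nth_drop[OF j] by (metis concat.simps(2) concat_append)
 have "concat W ! (?s + q) = W ! j ! q"
  unfolding split using q' by (simp add: nth_append length_concat)
 moreover have "?s + q < length (concat W)" unfolding split using q' by (simp add: length_concat)
 hence "concat W ! (?s + q) = \<sigma> (?s + q)" by (subst \<sigma>) simp
 moreover have "sum_list (map length (take j I)) = ?s" using I by (metis take_map)
 ultimately show "block I \<sigma> j ! q = W ! j ! q" using q' by (simp add: block_def l)
qed

lemma finite_lists_of_words:
 assumes "finite X"
 shows "finite {W. length W = n \<and> (\<forall>w\<in>set W. set w \<subseteq> X \<and> length w \<le> N)}"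
proof -
 have "{W. length W = n \<and> (\<forall>w\<in>set W. set w \<subseteq> X \<and> length w \<le> N)} = {W. set W \<subseteq> {w. set w \<subseteq> X \<and> length w \<le> N} \<and> length W = n}"
  by auto
 thus ?thesis using assms by (simp only: finite_lists_length_eq finite_lists_length_le)
qed

lemma finite_distinct_words: "finite {W. length W = n \<and> distinct (concat W) \<and> set (concat W) \<subseteq> {..<m :: nat}}"
proof (rule finite_subset[OF _ finite_lists_of_words[of "{..<m}" n m]])
 have "set w \<subseteq> {..<m} \<and> length w \<le> m" if "distinct (concat W)" "set (concat W) \<subseteq> {..<m}" "w \<in> set W" for W and w :: "nat list"
 proof -
  have "distinct w" "set w \<subseteq> {..<m}" using that by (auto simp: distinct_concat_iff)
  thus ?thesis using distinct_card[of w] card_mono[of "{..<m}" "set w"] by simp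
 qed
 thus "{W. length W = n \<and> distinct (concat W) \<and> set (concat W) \<subseteq> {..<m}} \<subseteq> {W. length W = n \<and> (\<forall>w\<in>set W. set w \<subseteq> {..<m} \<and> length w \<le> m)}"
  by blast
qed simp

lemma finite_full_words: "finite (full_words n m)"
 by (rule finite_subset[OF _ finite_distinct_words[of n m]]) (auto simp: full_words_def)

lemma Pseq_length:
 assumes "I \<in> Pseq r lam n" shows "length (concat I) = (\<Sum>i<r. lam i)"
proof -
 have "length (concat I) = (\<Sum>i<r. count_list (concat I) i)"
  using assms by (intro sum_count_set[symmetric]) (auto simp: Pseq_def)
 thus ?thesis using assms by (simp add: Pseq_def)
qed

lemma finite_Pseq: "finite (Pseq r lam n)"
proof (rule finite_subset[OF _ finite_lists_of_words[of "{..<r}" n "\<Sum>i<r. lam i"]])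
 have "length w \<le> length (concat I)" if "w \<in> set I" for w and I :: "nat list list"
  using that by (induction I) auto
 thus "Pseq r lam n \<subseteq> {I. length I = n \<and> (\<forall>w\<in>set I. set w \<subseteq> {..<r} \<and> length w \<le> (\<Sum>i<r. lam i))}"
  using Pseq_length[of _ r lam n] by (fastforce simp: Pseq_def)
qed simp

lemma finite_Sig: "finite (Sig m c I)"
 by (rule finite_subset[OF _ finite_permutations[of "{..<m}"]]) (auto simp: Sig_def)

lemma count_list_colouring:
 assumes c: "colouring r lam m c" and xs: "distinct xs" "set xs = {..<m}" and i: "i < r"
 shows "count_list (map c xs) i = lam i"
proof -
 have "count_list (map c xs) i = card {k \<in> set xs. c k = i}"
  using xs(1)
 proof (induction xs)
  case (Cons x xs)
  have "{k \<in> set (x # xs). c k = i} = (if c x = i then insert x {k \<in> set xs. c k = i} else {k \<in> set xs. c k = i})" by auto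
  thus ?case using Cons by simp
 qed simp
 thus ?thesis using c xs i by (simp add: colouring_def)
qed

lemma Sig_words:
 assumes I: "I \<in> Pseq r lam n" and s: "\<sigma> \<in> Sig m c I" and m: "m = (\<Sum>i<r. lam i)"
 shows "concat (map (block I \<sigma>) [0..<n]) = map \<sigma> [0..<m]" "map (block I \<sigma>) [0..<n] \<in> full_words n m"
  "map (map c) (map (block I \<sigma>) [0..<n]) = I"
proof -
 have n: "length I = n" using I by (simp add: Pseq_def)
 have p: "\<sigma> permutes {..<m}" using s by (simp add: Sig_def)
 show cc: "concat (map (block I \<sigma>) [0..<n]) = map \<sigma> [0..<m]"
  using concat_blocks[of I \<sigma>] n Pseq_length[OF I] m by simp
 show "map (block I \<sigma>) [0..<n] \<in> full_words n m"
  unfolding full_words_def mem_Collect_eq cc using permutes_image[OF p] permutes_inj_on[OF p]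
  by (simp add: distinct_map atLeast0LessThan)
 show "map (map c) (map (block I \<sigma>) [0..<n]) = I"
  using s n by (intro nth_equalityI) (simp_all add: Sig_def)
qed

text \<open>Reading the variables in the blocks of \<open>\<sigma>\<close> gives \<open>W\<close>;
  conversely the colours of \<open>W\<close> give \<open>I\<close> and its concatenation, read as a
  map, gives \<open>\<sigma>\<close>. The colouring has the right multiplicities for
  \<open>I\<close> to lie in \<open>Pseq\<close>.\<close>

lemma sum_Pseq_Sig:
 fixes g :: "nat list list => 'a::comm_monoid_add"
 assumes c: "colouring r lam m c" and m: "m = (\<Sum>i<r. lam i)"
 shows "(\<Sum>I\<in>Pseq r lam n. \<Sum>\<sigma>\<in>Sig m c I. g (map (block I \<sigma>) [0..<n])) = (\<Sum>W\<in>full_words n m. g W)"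
proof -
 let ?f = "%(I, \<sigma>). map (block I \<sigma>) [0..<n]"
 \<comment> \<open>Continued by the identity beyond \<open>m\<close>, as \<open>permutes\<close>
   requires.\<close>
 let ?perm = "%W k. if k < m then concat W ! k else k"
 have perm: "?perm W permutes {..<m}" "concat W = map (?perm W) [0..<length (concat W)]" "length (concat W) = m"
  if W: "W \<in> full_words n m" for W
 proof -
  have d: "distinct (concat W)" "set (concat W) = {..<m}" using W by (auto simp: full_words_def)
  show l: "length (concat W) = m" using distinct_card[OF d(1)] d(2) by simp
  have "bij_betw ((!) (concat W)) {..<m} {..<m}" using bij_betw_nth[OF d(1), of "{..<m}" "{..<m}"] d(2) l by simp
  hence "bij_betw (?perm W) {..<m} {..<m}" by (rule bij_betw_cong[THEN iffD1, rotated]) simp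
  thus "?perm W permutes {..<m}" by (rule bij_imp_permutes) simp
  show "concat W = map (?perm W) [0..<length (concat W)]" by (rule nth_equalityI) (simp_all add: l)
 qed
 have fwd: "map (block I \<sigma>) [0..<n] \<in> full_words n m" "map (map c) (map (block I \<sigma>) [0..<n]) = I"
   "?perm (map (block I \<sigma>) [0..<n]) = \<sigma>"
  if I: "I \<in> Pseq r lam n" and s: "\<sigma> \<in> Sig m c I" for I \<sigma>
 proof -
  have p: "\<sigma> permutes {..<m}" using s by (simp add: Sig_def)
  note w = Sig_words[OF I s m]
  show "map (block I \<sigma>) [0..<n] \<in> full_words n m" "map (map c) (map (block I \<sigma>) [0..<n]) = I"
   using w by blast+
  show "?perm (map (block I \<sigma>) [0..<n]) = \<sigma>"
   unfolding w(1) using permutes_not_in[OF p] by auto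
 qed
 have bwd: "map (map c) W \<in> Pseq r lam n" "?perm W \<in> Sig m c (map (map c) W)" "map (block (map (map c) W) (?perm W)) [0..<n] = W"
  if W: "W \<in> full_words n m" for W
 proof -
  have d: "distinct (concat W)" "set (concat W) = {..<m}" "length W = n" using W by (auto simp: full_words_def)
  show "map (map c) W \<in> Pseq r lam n"
  proof -
   have "concat (map (map c) W) = map c (concat W)" by (simp add: map_concat)
   moreover have "c k < r" if "w \<in> set W" "k \<in> set w" for k w using c d(2) that by (auto simp: colouring_def)
   ultimately show ?thesis using d(3) count_list_colouring[OF c d(1,2)] by (auto simp: Pseq_def)
  qed
  have bl: "block (map (map c) W) (?perm W) j = W ! j" if "j < n" for j
   by (rule map_block_of_concat[OF perm(2)[OF W]]) (use that d in simp_all)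
  show "?perm W \<in> Sig m c (map (map c) W)" using perm(1)[OF W] bl d(3) by (simp add: Sig_def)
  show "map (block (map (map c) W) (?perm W)) [0..<n] = W" using bl d(3) by (intro nth_equalityI) simp_all
 qed
 have "(\<Sum>I\<in>Pseq r lam n. \<Sum>\<sigma>\<in>Sig m c I. g (map (block I \<sigma>) [0..<n])) = (\<Sum>x\<in>Sigma (Pseq r lam n) (Sig m c). g (?f x))"
  by (subst sum.Sigma) (auto simp: finite_Pseq finite_Sig case_prod_beta)
 also have "... = (\<Sum>W\<in>full_words n m. g W)"
 proof (rule sum.reindex_bij_witness[where j = ?f and i = "%W. (map (map c) W, ?perm W)"])
  fix x assume "x \<in> Sigma (Pseq r lam n) (Sig m c)"
  then obtain I \<sigma> where x: "x = (I, \<sigma>)" "I \<in> Pseq r lam n" "\<sigma> \<in> Sig m c I" by auto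
  show "(map (map c) (?f x), ?perm (?f x)) = x" "?f x \<in> full_words n m" "g (?f x) = g (?f x)"
   using fwd[OF x(2,3)] unfolding x(1) prod.case by (simp_all only: )
 next
  fix W assume W: "W \<in> full_words n m"
  show "(map (map c) W, ?perm W) \<in> Sigma (Pseq r lam n) (Sig m c)" "?f (map (map c) W, ?perm W) = W"
   using bwd[OF W] unfolding prod.case by blast+
 qed
 finally show ?thesis .
qed

lemma concat_upd_perm:
 "i < length V ==> V ! i = [] ==> set (concat (V[i := w])) = set w \<union> set (concat V)"
 "i < length V ==> V ! i = [] ==> distinct (concat (V[i := w])) \<longleftrightarrow> distinct w \<and> distinct (concat V) \<and> set w \<inter> set (concat V) = {}"
proof -
 assume i: "i < length V" and e: "V ! i = []"
 have V: "concat V = concat (take i V) @ concat (drop (Suc i) V)"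
  using id_take_nth_drop[OF i] e by (metis append_Nil concat.simps(2) concat_append)
 have "concat (V[i := w]) = concat (take i V) @ w @ concat (drop (Suc i) V)"
  using i by (simp add: upd_conv_take_nth_drop)
 thus "set (concat (V[i := w])) = set w \<union> set (concat V)"
  "distinct (concat (V[i := w])) \<longleftrightarrow> distinct w \<and> distinct (concat V) \<and> set w \<inter> set (concat V) = {}"
  unfolding V by auto
qed

definition rest_words :: "nat => nat => nat => nat => nat list list set" where
 "rest_words n m i j = {V. length V = n \<and> V ! i = [] \<and> V ! j = [] \<and> distinct (concat V) \<and> set (concat V) \<subseteq> {..<m}}"

lemma finite_rest_words: "finite (rest_words n m i j)"
 by (rule finite_subset[OF _ finite_distinct_words[of n m]]) (auto simp: rest_words_def)

text \<open>All words except the \<open>i\<close>-th and \<open>j\<close>-th are frozen in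
  \<open>V\<close>; the left-over variables are divided between these two and arranged. The words
  are reversed because the pair identity reads them from the root.\<close>

lemma sum_full_words_pair:
 fixes g :: "nat list list => 'a::comm_monoid_add"
 assumes ij: "i < n" "j < n" "i ~= j"
 shows "(\<Sum>W\<in>full_words n m. g W) = (\<Sum>V\<in>rest_words n m i j. \<Sum>P\<in>Pow ({..<m} - set (concat V)).
   \<Sum>w\<in>perms P. \<Sum>w'\<in>perms ({..<m} - set (concat V) - P). g (V[i := rev w, j := rev w']))"
proof -
 let ?S = "%V. {..<m} - set (concat V)"
 let ?X = "SIGMA V:rest_words n m i j. SIGMA P:Pow (?S V). perms P \<times> perms (?S V - P)"
 let ?f = "%(V, P, w, w'). V[i := rev w, j := rev w']"
 let ?h = "%W. (W[i := [], j := []], set (W ! i), rev (W ! i), rev (W ! j))"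
 have "(\<Sum>V\<in>rest_words n m i j. \<Sum>P\<in>Pow (?S V). \<Sum>w\<in>perms P. \<Sum>w'\<in>perms (?S V - P). g (V[i := rev w, j := rev w']))
  = (\<Sum>x\<in>?X. g (?f x))"
  by (simp add: sum.Sigma finite_rest_words sum.cartesian_product case_prod_beta finite_Pow_iff)
 also have "... = (\<Sum>W\<in>full_words n m. g W)"
 proof (rule sum.reindex_bij_witness[where j = ?f and i = ?h])
  fix x assume "x \<in> ?X"
  then obtain V P w w' where x: "x = (V, P, w, w')" and V: "V \<in> rest_words n m i j" and P: "P \<subseteq> ?S V"
   and w: "w \<in> perms P" "w' \<in> perms (?S V - P)" by auto
  have v: "length V = n" "V ! i = []" "V ! j = []" "distinct (concat V)" "set (concat V) \<subseteq> {..<m}"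
   using V by (auto simp: rest_words_def)
  have ww: "set w = P" "distinct w" "set w' = ?S V - P" "distinct w'" using w by (auto simp: permutations_of_set_def)
  let ?V1 = "V[i := rev w]"
  have 1: "set (concat ?V1) = P \<union> set (concat V)" "distinct (concat ?V1)"
   using concat_upd_perm[of i V "rev w"] v ij ww P by auto
  have 2: "set (concat (?V1[j := rev w'])) = (?S V - P) \<union> (P \<union> set (concat V))" "distinct (concat (?V1[j := rev w']))"
   using concat_upd_perm[of j ?V1 "rev w'"] v ij ww P 1 by auto
  show "?f x \<in> full_words n m" unfolding x full_words_def using 2 v P by auto
  have "V[i := [], j := []] = V" using v(2,3) by (metis list_update_id)
  hence "V[i := rev w, j := rev w', i := [], j := []] = V" using ij by (simp add: list_update_swap[of j i])
  thus "?h (?f x) = x" unfolding x using ij v ww by simp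
  show "g (?f x) = g (?f x)" ..
 next
  fix W assume W: "W \<in> full_words n m"
  have d: "length W = n" "distinct (concat W)" "set (concat W) = {..<m}" using W by (auto simp: full_words_def)
  let ?V = "W[i := [], j := []]" let ?V1 = "W[j := []]"
  have v: "length ?V = n" "?V ! i = []" "?V ! j = []" using d ij by simp_all
  have e1: "?V[i := W ! i] = ?V1" using ij d by (simp add: list_update_swap[of j i])
  have e2: "?V1[j := W ! j] = W" by simp
  have V1: "?V1 ! j = []" using ij d by simp
  have s2: "set (concat W) = set (W ! j) \<union> set (concat ?V1)"
    "distinct (W ! j) \<and> distinct (concat ?V1) \<and> set (W ! j) \<inter> set (concat ?V1) = {}"
   using concat_upd_perm[of j ?V1 "W ! j"] V1 ij d unfolding e2 by auto
  have s1: "set (concat ?V1) = set (W ! i) \<union> set (concat ?V)"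
    "distinct (W ! i) \<and> distinct (concat ?V) \<and> set (W ! i) \<inter> set (concat ?V) = {}"
   using concat_upd_perm[of i ?V "W ! i"] v s2 ij unfolding e1 by auto
  have "?V \<in> rest_words n m i j" using v s1 s2 d by (auto simp: rest_words_def)
  moreover have "set (W ! i) \<subseteq> ?S ?V" using s1 s2 d by auto
  moreover have "?S ?V - set (W ! i) = set (W ! j)" using s1 s2 d by auto
  moreover have "rev (W ! i) \<in> perms (set (W ! i))" "rev (W ! j) \<in> perms (set (W ! j))"
   using s1 s2 by (simp_all add: permutations_of_set_def)
  ultimately show "?h W \<in> ?X" by (simp only: mem_Sigma_iff Pow_iff)
  show "?f (?h W) = W" using e1 e2 by simp
 qed
 finally show ?thesis ..
qed

section \<open>The KZ equations\<close>

text \<open>If the difference were nonzero, it would be an independent set, and a functional with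
  value 1 on it would exist by extension. This reduces identities between vector-valued integrals to
  scalar ones.\<close>

lemma clinear_separates:
 fixes x y :: "'t::complex_vector"
 assumes "!!\<phi> :: 't => complex. clinear \<phi> ==> \<phi> x = \<phi> y"
 shows "x = y"
proof (rule ccontr)
 interpret vp: vector_space_pair "scaleC :: complex => 't => 't" "scaleC :: complex => complex => complex" ..
 assume "x ~= y"
 hence "cvec.independent {x - y}" by (simp add: cvec.dependent_single)
 then obtain \<phi> where \<phi>: "clinear \<phi>" "\<forall>w\<in>{x - y}. \<phi> w = (1 :: complex)"
  using vp.linear_independent_extend[of "{x - y}" "%_. 1"] by blast
 have "\<phi> (x - y) = 0" using assms[OF \<phi>(1)] by (simp add: clinear_diff[OF \<phi>(1)])
 thus False using \<phi>(2) by simp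
qed

lemma sum_list_roots:
 "set w \<subseteq> {..<rk D} ==> (\<Sum>a\<leftarrow>w. if a < rk D then sroot D a h else 0) = root_fun D (count_list w) h"
proof (induction w)
 case (Cons a w)
 have "root_fun D (count_list (a # w)) h = (\<Sum>i<rk D. (if i = a then sroot D i h else 0) + of_nat (count_list w i) * sroot D i h)"
  unfolding root_fun_def by (intro sum.cong refl) (simp add: algebra_simps)
 thus ?case using Cons by (simp add: sum.distrib root_fun_def)
qed (simp add: root_fun_def)

lemma full_words_blocks:
 assumes W: "W \<in> full_words n m"
 shows "length W = n" "!!j. j < n ==> distinct (W ! j)" "!!j. j < n ==> set (W ! j) \<subseteq> {..<m}"
  "(\<Union>j<n. set (W ! j)) = {..<m}" "!!j k. j < n ==> k < n ==> j ~= k ==> set (W ! j) \<inter> set (W ! k) = {}"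
proof -
 have w: "length W = n" "distinct (concat W)" "set (concat W) = {..<m}" using W by (auto simp: full_words_def)
 show "length W = n" by (rule w(1))
 show "distinct (W ! j)" if "j < n" for j using w that nth_mem[of j W] by (auto simp: distinct_concat_iff)
 show u: "(\<Union>j<n. set (W ! j)) = {..<m}"
  using w(1) unfolding w(3)[symmetric] by (auto simp: set_conv_nth[of W])
 show "set (W ! j) \<subseteq> {..<m}" if "j < n" for j using u that by blast
 show "set (W ! j) \<inter> set (W ! k) = {}" if "j < n" "k < n" "j ~= k" for j k
  by (rule distinct_concat_disjoint[OF w(2)]) (use that w(1) in simp_all)
qed

context kz_tensor begin

abbreviation fvec :: "(nat => nat) => nat list list => 't" where
 "fvec c W \<equiv> f_vec G n act v tens (map (map c) W)"

lemma factor_weight_f_vec: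
 assumes i: "i < n" and I: "length I = n" "valid_word (I ! i)"
 shows "factor_op n tens i (act i (inH G h)) (f_vec G n act v tens I) = wt_word D (\<Lambda> i) (I ! i) h *\<^sub>C f_vec G n act v tens I"
proof -
 let ?q = "\<lambda>j\<in>{..<n}. word_vec j (I ! j)"
 have q: "?q \<in> tuples n" by (simp add: tuples_def)
 have qi: "?q i = word_vec i (I ! i)" using i by simp
 have "factor_op n tens i (act i (inH G h)) (tens ?q) = tens (?q(i := act i (inH G h) (?q i)))"
  by (rule factor_spec(2)[OF i act_linear[OF i] q])
 also have "act i (inH G h) (?q i) = wt_word D (\<Lambda> i) (I ! i) h *\<^sub>C ?q i"
  unfolding qi using word_vec_weight[OF i I(2)] by (simp add: weight_vec_def)
 also have "tens (?q(i := wt_word D (\<Lambda> i) (I ! i) h *\<^sub>C ?q i)) = wt_word D (\<Lambda> i) (I ! i) h *\<^sub>C tens ?q"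
  unfolding clinear_scale[OF tens_linear[OF q i]] fun_upd_triv ..
 finally show ?thesis unfolding f_vec_def .
qed

lemma factor_weight_fvec:
 assumes i: "i < n" and W: "W \<in> full_words n m" and c: "c ` {..<m} \<subseteq> {..<rk D}"
 shows "factor_op n tens i (act i (inH G h)) (fvec c W) = (\<Lambda> i h - (\<Sum>k\<in>set (W ! i). sroot D (c k) h)) *\<^sub>C fvec c W"
proof -
 note w = full_words_blocks[OF W]
 have sub: "set (W ! i) \<subseteq> {..<m}" by (rule w(3)[OF i])
 have nth: "map (map c) W ! i = map c (W ! i)" using i w(1) by simp
 have val: "valid_word (map c (W ! i))" using sub c by auto
 have "(\<Sum>a\<leftarrow>map c (W ! i). if a < rk D then sroot D a h else 0) = (\<Sum>k\<in>set (W ! i). if c k < rk D then sroot D (c k) h else 0)"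
  by (simp add: comp_def sum_list_distinct_conv_sum_set[OF w(2)[OF i]])
 also have "... = (\<Sum>k\<in>set (W ! i). sroot D (c k) h)" using sub c by (intro sum.cong refl) auto
 finally have wt: "wt_word D (\<Lambda> i) (map c (W ! i)) h = \<Lambda> i h - (\<Sum>k\<in>set (W ! i). sroot D (c k) h)"
  by (simp only: wt_word_def)
 show ?thesis using factor_weight_f_vec[OF i, of "map (map c) W" h] w(1) val unfolding nth wt by simp
qed

lemma f_vec_weight_space:
 assumes I: "I \<in> Pseq (rk D) lam n"
 shows "(\<Sum>j<n. factor_op n tens j (act j (inH G h)) (f_vec G n act v tens I))
  = ((\<Sum>j<n. \<Lambda> j h) - root_fun D lam h) *\<^sub>C f_vec G n act v tens I"
proof -
 have l: "length I = n" and val: "set (concat I) \<subseteq> {..<rk D}" and cnt: "!!i. i < rk D ==> count_list (concat I) i = lam i"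
  using I by (auto simp: Pseq_def)
 have "(\<Sum>j<n. factor_op n tens j (act j (inH G h)) (f_vec G n act v tens I)) = (\<Sum>j<n. wt_word D (\<Lambda> j) (I ! j) h *\<^sub>C f_vec G n act v tens I)"
 proof (intro sum.cong refl factor_weight_f_vec l)
  fix j assume j: "j \<in> {..<n}"
  show "j < n" using j by simp
  have "I ! j \<in> set I" using l j by simp
  thus "valid_word (I ! j)" using val by auto
 qed
 also have "... = (\<Sum>j<n. wt_word D (\<Lambda> j) (I ! j) h) *\<^sub>C f_vec G n act v tens I"
  by (simp only: cvec.scale_sum_left)
 also have "(\<Sum>j<n. wt_word D (\<Lambda> j) (I ! j) h) = (\<Sum>j<n. \<Lambda> j h) - (\<Sum>j<n. \<Sum>a\<leftarrow>I ! j. if a < rk D then sroot D a h else 0)"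
  by (simp add: wt_word_def sum_subtractf)
 also have "(\<Sum>j<n. \<Sum>a\<leftarrow>I ! j. if a < rk D then sroot D a h else 0) = (\<Sum>a\<leftarrow>concat I. if a < rk D then sroot D a h else 0)"
  unfolding l[symmetric]
 proof (induction I)
  case (Cons w I)
  have "(\<Sum>j<length (w # I). \<Sum>a\<leftarrow>(w # I) ! j. if a < rk D then sroot D a h else 0)
   = (\<Sum>a\<leftarrow>w. if a < rk D then sroot D a h else 0) + (\<Sum>j<length I. \<Sum>a\<leftarrow>I ! j. if a < rk D then sroot D a h else 0)"
   by (simp only: length_Cons sum.lessThan_Suc_shift nth_Cons_0 nth_Cons_Suc)
  thus ?case using Cons by simp
 qed simp
 also have "... = root_fun D lam h" unfolding sum_list_roots[OF val] using cnt by (simp add: root_fun_def)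
 finally show ?thesis .
qed

text \<open>The part of the logarithmic derivative of \<Phi> that joins z_i and the variables of the
  word \<open>i\<close> to z_j and those of the word \<open>j\<close>.\<close>

definition pair_coeff :: "(nat => nat) => (nat => complex) => (nat => complex) => nat list list => nat => nat => complex" where
 "pair_coeff c t z W i j = dform D (\<Lambda> i) (\<Lambda> j) / (z i - z j)
   - (\<Sum>b\<in>set (W ! i). dform D (sroot D (c b)) (\<Lambda> j) / (t b - z j))
   - (\<Sum>a\<in>set (W ! j). dform D (sroot D (c a)) (\<Lambda> i) / (z i - t a))
   + (\<Sum>b\<in>set (W ! i). \<Sum>a\<in>set (W ! j). dform D (sroot D (c b)) (sroot D (c a)) / (t b - t a))"

text \<open>For each frozen configuration of the other words this is \<open>pair_identity\<close>;
  the chains of those words form the common factor \<open>?R\<close>.\<close>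

lemma Omega_sum_words:
 assumes ij: "i < n" "j < n" "i ~= j" and c: "c ` {..<m} \<subseteq> {..<rk D}"
  and t: "inj_on t {..<m}" "z i \<notin> t ` {..<m}" "z j \<notin> t ` {..<m}" "z i ~= z j"
 defines "M \<equiv> %W. \<Prod>k<n. chain t (rev (W ! k)) (z k)"
 shows "(\<Sum>W\<in>full_words n m. M W *\<^sub>C ((1 / (z i - z j)) *\<^sub>C Omega_plus D G B tn act v n tens i j (fvec c W)))
  = (\<Sum>W\<in>full_words n m. (M W * pair_coeff c t z W i j) *\<^sub>C fvec c W)"
 unfolding sum_full_words_pair[OF ij]
proof (rule sum.cong[OF refl])
 fix V assume V: "V \<in> rest_words n m i j"
 let ?S = "{..<m} - set (concat V)"
 let ?p = "\<lambda>k\<in>{..<n}. word_vec k (map c (V ! k))"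
 let ?f = "col_vec c"
 let ?W = "%w w'. V[i := rev w, j := rev w']"
 let ?R = "\<Prod>k\<in>{..<n} - {i, j}. chain t (rev (V ! k)) (z k)"
 have l: "length V = n" using V by (simp add: rest_words_def)
 have M: "M (?W w w') = ?R * (chain t w (z i) * chain t w' (z j))" for w w'
 proof -
  have "M (?W w w') = chain t (rev (?W w w' ! i)) (z i) * (\<Prod>k\<in>{..<n} - {i}. chain t (rev (?W w w' ! k)) (z k))"
   unfolding M_def by (rule prod.remove) (use ij in auto)
  also have "(\<Prod>k\<in>{..<n} - {i}. chain t (rev (?W w w' ! k)) (z k))
   = chain t (rev (?W w w' ! j)) (z j) * (\<Prod>k\<in>{..<n} - {i} - {j}. chain t (rev (?W w w' ! k)) (z k))"
   by (rule prod.remove) (use ij in auto)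
  also have "(\<Prod>k\<in>{..<n} - {i} - {j}. chain t (rev (?W w w' ! k)) (z k)) = ?R"
   by (intro prod.cong) auto
  finally show ?thesis using ij l by simp
 qed
 have fv: "fvec c (?W w w') = tens (?p(i := ?f i w, j := ?f j w'))" for w w'
 proof -
  have "(\<lambda>k\<in>{..<n}. foldr (%i. act k (geF G i)) (map (map c) (?W w w') ! k) (v k)) = ?p(i := ?f i w, j := ?f j w')"
  proof
   fix k
   show "(\<lambda>k\<in>{..<n}. foldr (%i. act k (geF G i)) (map (map c) (?W w w') ! k) (v k)) k = (?p(i := ?f i w, j := ?f j w')) k"
    using ij l by (auto simp: nth_list_update foldr_conv_fold rev_map fold_map comp_def)
  qed
  thus ?thesis unfolding f_vec_def by simp
 qed
 have p: "?p \<in> tuples n" by (simp add: tuples_def)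
 have S: "finite ?S" "c ` ?S \<subseteq> {..<rk D}" "inj_on t ?S" "z i \<notin> t ` ?S" "z j \<notin> t ` ?S" "z i ~= z j"
  using c t inj_on_subset[OF t(1), of ?S] by auto
 have "(\<Sum>P\<in>Pow ?S. \<Sum>w\<in>perms P. \<Sum>w'\<in>perms (?S - P).
    M (?W w w') *\<^sub>C ((1 / (z i - z j)) *\<^sub>C Omega_plus D G B tn act v n tens i j (fvec c (?W w w'))))
  = ?R *\<^sub>C (\<Sum>P\<in>Pow ?S. \<Sum>w\<in>perms P. \<Sum>w'\<in>perms (?S - P).
    (chain t w (z i) * chain t w' (z j)) *\<^sub>C ((1 / (z i - z j)) *\<^sub>C Omega_plus D G B tn act v n tens i j (tens (?p(i := ?f i w, j := ?f j w')))))"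
  unfolding M fv cvec.scale_sum_right scaleC_scaleC by (simp only: mult.assoc)
 also have "... = (\<Sum>P\<in>Pow ?S. \<Sum>w\<in>perms P. \<Sum>w'\<in>perms (?S - P).
    (M (?W w w') * pair_coeff c t z (?W w w') i j) *\<^sub>C fvec c (?W w w'))"
  unfolding pair_identity[OF p ij S] cvec.scale_sum_right
 proof (intro sum.cong refl)
  fix P w w' assume w: "w \<in> perms P" "w' \<in> perms (?S - P)"
  have s: "set (?W w w' ! i) = P" "set (?W w w' ! j) = ?S - P"
   using w ij l by (auto simp: permutations_of_set_def)
  show "?R *\<^sub>C (chain t w (z i) * chain t w' (z j) * (dform D (\<Lambda> i) (\<Lambda> j) / (z i - z j)
     - (\<Sum>b\<in>P. dform D (sroot D (c b)) (\<Lambda> j) / (t b - z j))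
     - (\<Sum>a\<in>?S - P. dform D (sroot D (c a)) (\<Lambda> i) / (z i - t a))
     + (\<Sum>b\<in>P. \<Sum>a\<in>?S - P. dform D (sroot D (c b)) (sroot D (c a)) / (t b - t a)))) *\<^sub>C
     tens (?p(i := ?f i w, j := ?f j w')) = (M (?W w w') * pair_coeff c t z (?W w w') i j) *\<^sub>C fvec c (?W w w')"
   unfolding M fv pair_coeff_def s scaleC_scaleC by (simp only: mult.assoc)
 qed
 finally show "(\<Sum>P\<in>Pow ?S. \<Sum>w\<in>perms P. \<Sum>w'\<in>perms (?S - P).
    M (?W w w') *\<^sub>C ((1 / (z i - z j)) *\<^sub>C Omega_plus D G B tn act v n tens i j (fvec c (?W w w'))))
  = (\<Sum>P\<in>Pow ?S. \<Sum>w\<in>perms P. \<Sum>w'\<in>perms (?S - P).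
    (M (?W w w') * pair_coeff c t z (?W w w') i j) *\<^sub>C fvec c (?W w w'))" .
qed

end

text \<open>On vertical vectors each signed wedge is \<open>lmono\<close> of a word times the
  standard volume form, so the sum over permutations may leave the integral.\<close>

lemma u_coef_words:
 assumes hf: "horizontal_family A U \<gamma>" and U: "openin (top_of_set (base A)) U" and z: "z \<in> U" and n: "0 < npts A"
  and I: "I \<in> Pseq r lam (npts A)" and m: "nvars A = (\<Sum>i<r. lam i)"
 shows "u_coef A c \<gamma> z I = (\<Sum>\<sigma>\<in>Sig (nvars A) c I. ti A z (\<gamma> z) (lmono (word_forms (map (block I \<sigma>) [0..<npts A]))))"
proof -
 let ?n = "npts A" and ?m = "nvars A"
 let ?W = "%\<sigma>. map (block I \<sigma>) [0..<?n]"
 have zb: "z \<in> base A" using U z openin_subset[of "top_of_set (base A)" U] by auto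
 have ch: "twisted_chain A ?m z (\<gamma> z)" by (rule horizontal_family_chain[OF hf z])
 have lI: "length I = ?n" using I by (simp add: Pseq_def)
 note W = Sig_words(2)[OF I _ m]
 have eq: "(\<Sum>\<sigma>\<in>Sig ?m c I. of_int (sign \<sigma>) * wedge (omega I \<sigma>) p (%b. (u b, %_. 0)))
   = iform ?m id (%p. \<Sum>\<sigma>\<in>Sig ?m c I. 1 * lmono (word_forms (?W \<sigma>)) p) p (%b. (u b, %_. 0))" for p u
 proof -
  have "of_int (sign \<sigma>) * wedge (omega I \<sigma>) p (%b. (u b, %_. 0)) = iform ?m id (lmono (word_forms (?W \<sigma>))) p (%b. (u b, %_. 0))"
   if s: "\<sigma> \<in> Sig ?m c I" for \<sigma>
  proof -
   have "\<sigma> permutes {..<?m}" using s by (simp add: Sig_def)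
   moreover have "concat (?W \<sigma>) = map \<sigma> [0..<?m]" by (rule Sig_words(1)[OF I s m])
   ultimately show ?thesis unfolding omega_eq lI by (rule wedge_word_forms)
  qed
  thus ?thesis by (simp add: iform_def sum_distrib_right)
 qed
 have "u_coef A c \<gamma> z I = tint A z (\<gamma> z) (iform ?m id (%p. \<Sum>\<sigma>\<in>Sig ?m c I. 1 * lmono (word_forms (?W \<sigma>)) p))"
  unfolding u_coef_def by (rule twisted_integral_form_cong[OF ch], rule eq)
 also have "... = (\<Sum>\<sigma>\<in>Sig ?m c I. 1 * ti A z (\<gamma> z) (lmono (word_forms (?W \<sigma>))))"
  unfolding ti_def[symmetric]
 proof (rule ti_linear[OF ch zb finite_Sig, THEN conjunct1])
  fix \<sigma> assume s: "\<sigma> \<in> Sig ?m c I"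
  show "fibre_cont A z (lmono (word_forms (?W \<sigma>)))"
   by (rule fibre_cont_lmono[OF zb word_forms_lforms]) (use W[OF s] in \<open>simp_all add: full_words_def\<close>)
  show "conv A z (\<gamma> z) (lmono (word_forms (?W \<sigma>)))"
   \<comment> \<open>Convergence does not refer to a direction of differentiation; the index 0 is
     just one available point.\<close>
   by (rule horizontal_family_word_integral(1)[OF hf U z n W[OF s]])
 qed
 finally show ?thesis by simp
qed

context kz_tensor begin

lemma hypergeometric_weight_space:
 "hypergeometric_integral D G n \<Lambda> act v tens lam m c \<mu> \<kappa> \<gamma> z \<in> weight_space D G n \<Lambda> act tens lam"
 unfolding weight_space_def
proof (intro CollectI allI)
 fix h
 let ?u = "u_coef (kz_master D n \<Lambda> m c \<mu> \<kappa>) c \<gamma> z"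
 have lin: "clinear (%x. \<Sum>j<n. factor_op n tens j (act j (inH G h)) x)"
  by (intro clinearI)
    (simp_all add: clinear_add[OF factor_spec(1)[OF _ act_linear]] clinear_scale[OF factor_spec(1)[OF _ act_linear]] sum.distrib cvec.scale_sum_right)
 have "(\<Sum>j<n. factor_op n tens j (act j (inH G h)) (\<Sum>I\<in>Pseq (rk D) lam n. ?u I *\<^sub>C f_vec G n act v tens I))
  = (\<Sum>I\<in>Pseq (rk D) lam n. ?u I *\<^sub>C (\<Sum>j<n. factor_op n tens j (act j (inH G h)) (f_vec G n act v tens I)))"
  by (simp only: clinear_sum[OF lin] clinear_scale[OF lin])
 also have "... = (\<Sum>I\<in>Pseq (rk D) lam n. ((\<Sum>j<n. \<Lambda> j h) - root_fun D lam h) *\<^sub>C (?u I *\<^sub>C f_vec G n act v tens I))"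
  by (intro sum.cong refl) (simp add: f_vec_weight_space scaleC_scaleC mult.commute)
 finally show "(\<Sum>j<n. factor_op n tens j (act j (inH G h)) (hypergeometric_integral D G n \<Lambda> act v tens lam m c \<mu> \<kappa> \<gamma> z)) =
   ((\<Sum>j<n. \<Lambda> j h) - root_fun D lam h) *\<^sub>C hypergeometric_integral D G n \<Lambda> act v tens lam m c \<mu> \<kappa> \<gamma> z"
  unfolding hypergeometric_integral_def cvec.scale_sum_right .
qed

text \<open>The right-hand side is a linear operator \<open>R\<close>, so the assertion compares two
  linear combinations of integrals over the same cycle. Their integrands agree at every point of the
  fibre, and linear functionals transfer this to the integrals.\<close>

lemma kz_equation:
 fixes \<mu> :: 'h and \<kappa> :: complex and lam c :: "nat => nat" and m :: nat and \<gamma> :: "(nat => complex) => tchain"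
 defines "A \<equiv> kz_master D n \<Lambda> m c \<mu> \<kappa>"
 defines "u \<equiv> hypergeometric_integral D G n \<Lambda> act v tens lam m c \<mu> \<kappa> \<gamma>"
 assumes kappa: "\<kappa> ~= 0" and m: "m = (\<Sum>i<rk D. lam i)" and col: "colouring (rk D) lam m c"
  and U: "openin (top_of_set (base A)) U" and hf: "horizontal_family A U \<gamma>" and z: "z \<in> U" and i: "i < n"
 shows "\<exists>du. has_vec_derivative_at (%w. u (z(i := w))) du (z i) \<and>
    \<kappa> *\<^sub>C du = factor_op n tens i (act i (inH G \<mu>)) (u z) +
     (\<Sum>j\<in>{..<n} - {i}. (1 / (z i - z j)) *\<^sub>C Omega_plus D G B tn act v n tens i j (u z))"
proof -
 have A: "npts A = n" "nvars A = m" "kap A = \<kappa>" by (simp_all add: A_def kz_master_def)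
 have c: "c ` {..<m} \<subseteq> {..<rk D}" using col by (auto simp: colouring_def)
 have zb: "z \<in> base A" using U z openin_subset[of "top_of_set (base A)" U] by auto
 have ch: "twisted_chain A (nvars A) z (\<gamma> z)" by (rule horizontal_family_chain[OF hf z])
 have iA: "i < npts A" using i A by simp
 define L where "L W = lmono (word_forms W)" for W
 define C where "C W p = dlog_Phi A p (unit_z i) + (\<Sum>k\<in>set (W ! i). dlog_Phi A p (unit_t k))" for W p
 define F where "F W p = 1 / kap A * (C W p * L W p)" for W p
 let ?\<W> = "full_words n m"
 have u: "u z = (\<Sum>W\<in>?\<W>. ti A z (\<gamma> z) (L W) *\<^sub>C fvec c W)" if z: "z \<in> U" for z
 proof -
  have "u z = (\<Sum>I\<in>Pseq (rk D) lam n. \<Sum>\<sigma>\<in>Sig m c I.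
    ti A z (\<gamma> z) (L (map (block I \<sigma>) [0..<n])) *\<^sub>C fvec c (map (block I \<sigma>) [0..<n]))"
   unfolding u_def hypergeometric_integral_def A_def[symmetric]
  proof (rule sum.cong[OF refl])
   fix I assume I: "I \<in> Pseq (rk D) lam n"
   have "u_coef A c \<gamma> z I = (\<Sum>\<sigma>\<in>Sig m c I. ti A z (\<gamma> z) (L (map (block I \<sigma>) [0..<n])))"
    using u_coef_words[OF hf U z, of I "rk D" lam c] I i m A by (simp add: L_def)
   thus "u_coef A c \<gamma> z I *\<^sub>C f_vec G n act v tens I = (\<Sum>\<sigma>\<in>Sig m c I.
     ti A z (\<gamma> z) (L (map (block I \<sigma>) [0..<n])) *\<^sub>C fvec c (map (block I \<sigma>) [0..<n]))"
    using Sig_words(3)[OF I _ m] by (simp only: cvec.scale_sum_left cong: sum.cong)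
  qed
  also have "... = (\<Sum>W\<in>?\<W>. ti A z (\<gamma> z) (L W) *\<^sub>C fvec c W)"
   by (rule sum_Pseq_Sig[OF col m])
  finally show ?thesis .
 qed
 have word: "conv A z (\<gamma> z) (L W)" "conv A z (\<gamma> z) (F W)"
   "((%w. ti A (z(i := w)) (\<gamma> (z(i := w))) (L W)) has_field_derivative ti A z (\<gamma> z) (F W)) (at (z i))"
  if W: "W \<in> ?\<W>" for W
  using horizontal_family_word_integral[OF hf U z iA, of W] W unfolding L_def F_def[abs_def] C_def A by blast+
 have forms: "set (word_forms W) \<subseteq> lforms A" if W: "W \<in> ?\<W>" for W
  by (rule word_forms_lforms) (use W in \<open>simp_all add: full_words_def A\<close>)
 have fibL: "fibre_cont A z (L W)" if W: "W \<in> ?\<W>" for W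
  unfolding L_def by (rule fibre_cont_lmono[OF zb forms[OF W]])
 have fibF: "fibre_cont A z (F W)" if W: "W \<in> ?\<W>" for W
 proof (rule fibre_cont_lincomb[OF _ zb])
  show "lincomb A (F W)"
   unfolding F_def[abs_def] C_def L_def distrib_right sum_distrib_right
   by (intro lincomb_cmult lincomb_add lincomb_sum lincomb_dlog_Phi forms W)
 qed
 define du where "du = (\<Sum>W\<in>?\<W>. ti A z (\<gamma> z) (F W) *\<^sub>C fvec c W)"
 have deriv: "has_vec_derivative_at (%w. u (z(i := w))) du (z i)"
  unfolding has_vec_derivative_at_def
 proof (intro allI impI)
  fix \<phi> :: "'t => complex" assume \<phi>: "clinear \<phi>"
  obtain e where e: "e > 0" "!!w. w \<in> ball (z i) (2 * e) ==> z(i := w) \<in> U"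
   by (rule base_open_line[OF U z iA]) blast
  have ev: "\<forall>\<^sub>F w in nhds (z i). \<phi> (u (z(i := w))) = (\<Sum>W\<in>?\<W>. ti A (z(i := w)) (\<gamma> (z(i := w))) (L W) * \<phi> (fvec c W))"
  proof (rule eventually_mono)
   show "\<forall>\<^sub>F w in nhds (z i). w \<in> ball (z i) (2 * e)" using e(1) by (intro eventually_nhds_in_open) auto
   show "\<phi> (u (z(i := w))) = (\<Sum>W\<in>?\<W>. ti A (z(i := w)) (\<gamma> (z(i := w))) (L W) * \<phi> (fvec c W))" if "w \<in> ball (z i) (2 * e)" for w
    unfolding u[OF e(2)[OF that]] clinear_sum[OF \<phi>] clinear_scale[OF \<phi>] scaleC_complex_def ..
  qed
  have "((%w. \<Sum>W\<in>?\<W>. ti A (z(i := w)) (\<gamma> (z(i := w))) (L W) * \<phi> (fvec c W)) has_field_derivative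
    (\<Sum>W\<in>?\<W>. ti A z (\<gamma> z) (F W) * \<phi> (fvec c W))) (at (z i))"
   by (intro DERIV_sum DERIV_cmult_right word(3))
  moreover have "\<phi> du = (\<Sum>W\<in>?\<W>. ti A z (\<gamma> z) (F W) * \<phi> (fvec c W))"
   unfolding du_def clinear_sum[OF \<phi>] clinear_scale[OF \<phi>] scaleC_complex_def ..
  ultimately show "((%w. \<phi> (u (z(i := w)))) has_field_derivative \<phi> du) (at (z i))"
   using DERIV_cong_ev[OF refl ev refl] by simp
 qed
 let ?\<Omega> = "%j. Omega_plus D G B tn act v n tens i j"
 let ?H = "factor_op n tens i (act i (inH G \<mu>))"
 have Hlin: "clinear ?H" by (rule factor_spec(1)[OF i act_linear[OF i]])
 have Olin: "clinear (?\<Omega> j)" if "j \<in> {..<n} - {i}" for j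
  using Omega_plus_spec(1)[of i j] i that by auto
 define R where "R x = ?H x + (\<Sum>j\<in>{..<n} - {i}. (1 / (z i - z j)) *\<^sub>C ?\<Omega> j x)" for x
 have Rlin: "clinear R"
  unfolding R_def by (intro clinearI)
   (simp_all add: clinear_add[OF Hlin] clinear_scale[OF Hlin] clinear_add[OF Olin] clinear_scale[OF Olin]
    sum.distrib scaleC_add_right cvec.scale_sum_right scaleC_scaleC mult.commute)
 \<comment> \<open>The purely rational identity: for fixed \<open>t\<close>, applying
   \<open>R\<close> to the vectors has the same effect as multiplying each term by the logarithmic
   derivative of \<Phi> along its own translation. It holds for the sum over all \<open>W\<close>,
   not term by term.\<close>
 have point: "(\<Sum>W\<in>?\<W>. L W (t, z) *\<^sub>C R (fvec c W)) = (\<Sum>W\<in>?\<W>. (C W (t, z) * L W (t, z)) *\<^sub>C fvec c W)"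
  if t: "t \<in> fibre A z" for t
 proof -
  have ti: "inj_on t {..<m}" using t unfolding fibre_def A inj_on_def by auto
  have tz: "z j \<notin> t ` {..<m}" if "j < n" for j
  proof
   assume "z j \<in> t ` {..<m}"
   then obtain k where "k < m" "t k = z j" by auto
   thus False using t that unfolding fibre_def A by auto
  qed
  have zz: "z i ~= z j" if "j \<in> {..<n} - {i}" for j
   using zb i that by (auto simp: base_def A inj_on_def)
  have M: "L W (t, z) = (\<Prod>k<n. chain t (rev (W ! k)) (z k))" if "W \<in> ?\<W>" for W
   using that by (simp add: L_def lmono_word_forms full_words_def)
  have Cv: "C W (t, z) = (\<Lambda> i \<mu> - (\<Sum>k\<in>set (W ! i). sroot D (c k) \<mu>)) + (\<Sum>j\<in>{..<n} - {i}. pair_coeff c t z W i j)"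
   if W: "W \<in> ?\<W>" for W
   unfolding C_def A_def pair_coeff_def
   by (rule dlog_Phi_kz_master[OF cartan i full_words_blocks(3-5)[OF W]])
  have "(\<Sum>W\<in>?\<W>. L W (t, z) *\<^sub>C R (fvec c W)) = (\<Sum>W\<in>?\<W>. L W (t, z) *\<^sub>C ?H (fvec c W))
    + (\<Sum>j\<in>{..<n} - {i}. \<Sum>W\<in>?\<W>. L W (t, z) *\<^sub>C ((1 / (z i - z j)) *\<^sub>C ?\<Omega> j (fvec c W)))"
   unfolding R_def scaleC_add_right sum.distrib cvec.scale_sum_right by (subst sum.swap) simp
  also have "(\<Sum>j\<in>{..<n} - {i}. \<Sum>W\<in>?\<W>. L W (t, z) *\<^sub>C ((1 / (z i - z j)) *\<^sub>C ?\<Omega> j (fvec c W)))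
   = (\<Sum>j\<in>{..<n} - {i}. \<Sum>W\<in>?\<W>. (L W (t, z) * pair_coeff c t z W i j) *\<^sub>C fvec c W)"
  proof (rule sum.cong[OF refl])
   fix j assume j: "j \<in> {..<n} - {i}"
   have "(\<Sum>W\<in>?\<W>. (\<Prod>k<n. chain t (rev (W ! k)) (z k)) *\<^sub>C ((1 / (z i - z j)) *\<^sub>C ?\<Omega> j (fvec c W)))
    = (\<Sum>W\<in>?\<W>. ((\<Prod>k<n. chain t (rev (W ! k)) (z k)) * pair_coeff c t z W i j) *\<^sub>C fvec c W)"
    by (rule Omega_sum_words) (use i j c ti tz zz[OF j] in auto)
   thus "(\<Sum>W\<in>?\<W>. L W (t, z) *\<^sub>C ((1 / (z i - z j)) *\<^sub>C ?\<Omega> j (fvec c W)))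
    = (\<Sum>W\<in>?\<W>. (L W (t, z) * pair_coeff c t z W i j) *\<^sub>C fvec c W)"
    by (simp only: M cong: sum.cong)
  qed
  also have "(\<Sum>W\<in>?\<W>. L W (t, z) *\<^sub>C ?H (fvec c W))
   = (\<Sum>W\<in>?\<W>. (L W (t, z) * (\<Lambda> i \<mu> - (\<Sum>k\<in>set (W ! i). sroot D (c k) \<mu>))) *\<^sub>C fvec c W)"
   by (intro sum.cong refl) (simp only: factor_weight_fvec[OF i _ c] scaleC_scaleC)
  also have "... + (\<Sum>j\<in>{..<n} - {i}. \<Sum>W\<in>?\<W>. (L W (t, z) * pair_coeff c t z W i j) *\<^sub>C fvec c W)
   = (\<Sum>W\<in>?\<W>. (C W (t, z) * L W (t, z)) *\<^sub>C fvec c W)"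
   unfolding sum.swap[of _ ?\<W>] sum.distrib[symmetric]
   by (intro sum.cong refl)
     (simp only: Cv cvec.scale_sum_left[symmetric] scaleC_add_left[symmetric] sum_distrib_left[symmetric] distrib_left[symmetric] mult.commute)
  finally show ?thesis .
 qed
 have "\<kappa> *\<^sub>C du = R (u z)"
 \<comment> \<open>After a functional is applied, both sides are finite combinations of convergent
   scalar integrals and can be compared under one integral; the factor \<kappa> cancels the one in
   \<open>F\<close>.\<close>
 proof (rule clinear_separates)
  fix \<phi> :: "'t => complex" assume \<phi>: "clinear \<phi>"
  have "\<phi> (\<kappa> *\<^sub>C du) = (\<Sum>W\<in>?\<W>. (\<kappa> * \<phi> (fvec c W)) * ti A z (\<gamma> z) (F W))"
   unfolding du_def by (simp add: clinear_sum[OF \<phi>] clinear_scale[OF \<phi>] scaleC_complex_def sum_distrib_left mult_ac)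
  also have "... = ti A z (\<gamma> z) (%p. \<Sum>W\<in>?\<W>. (\<kappa> * \<phi> (fvec c W)) * F W p)"
   by (rule ti_linear[OF ch zb finite_full_words, THEN conjunct1, symmetric]) (auto intro: fibF word)
  also have "... = ti A z (\<gamma> z) (%p. \<Sum>W\<in>?\<W>. \<phi> (R (fvec c W)) * L W p)"
  proof (rule ti_cong(1)[OF ch])
   fix t assume t: "t \<in> fibre A z"
   have "(\<Sum>W\<in>?\<W>. (\<kappa> * \<phi> (fvec c W)) * F W (t, z)) = \<phi> (\<Sum>W\<in>?\<W>. (C W (t, z) * L W (t, z)) *\<^sub>C fvec c W)"
    using kappa by (simp add: clinear_sum[OF \<phi>] clinear_scale[OF \<phi>] scaleC_complex_def F_def A(3) mult_ac)
   also have "... = (\<Sum>W\<in>?\<W>. \<phi> (R (fvec c W)) * L W (t, z))"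
    unfolding point[OF t, symmetric] by (simp add: clinear_sum[OF \<phi>] clinear_scale[OF \<phi>] scaleC_complex_def mult_ac)
   finally show "(\<Sum>W\<in>?\<W>. (\<kappa> * \<phi> (fvec c W)) * F W (t, z)) = (\<Sum>W\<in>?\<W>. \<phi> (R (fvec c W)) * L W (t, z))" .
  qed
  also have "... = (\<Sum>W\<in>?\<W>. \<phi> (R (fvec c W)) * ti A z (\<gamma> z) (L W))"
   by (rule ti_linear[OF ch zb finite_full_words, THEN conjunct1]) (auto intro: fibL word)
  also have "... = \<phi> (R (u z))"
   unfolding u[OF z] clinear_sum[OF Rlin] clinear_scale[OF Rlin]
   by (simp add: clinear_sum[OF \<phi>] clinear_scale[OF \<phi>] scaleC_complex_def mult_ac)
  finally show "\<phi> (\<kappa> *\<^sub>C du) = \<phi> (R (u z))" .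
 qed
 thus ?thesis using deriv unfolding R_def by blast
qed

end

theorem theorem7p1:
  fixes D :: "'h::complex_vector cartan"
    and G :: "('h, 'g::complex_vector) km_lie"
    and B :: "(nat \<Rightarrow> nat) \<Rightarrow> 'g set"
    and n :: nat
    and \<Lambda> :: "nat \<Rightarrow> 'h \<Rightarrow> complex"
    and act :: "nat \<Rightarrow> 'g \<Rightarrow> 'm \<Rightarrow> 'm::complex_vector"
    and v :: "nat \<Rightarrow> 'm"
    and tn :: "'g \<Rightarrow> 'm \<Rightarrow> 's::complex_vector"
    and tens :: "(nat \<Rightarrow> 'm) \<Rightarrow> 't::complex_vector"
    and lam :: "nat \<Rightarrow> nat" and m :: nat and c :: "nat \<Rightarrow> nat"
    and \<mu> :: 'h and \<kappa> :: complex
    and U :: "(nat \<Rightarrow> complex) set"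
    and \<gamma> :: "(nat \<Rightarrow> complex) \<Rightarrow> tchain"
    and u :: "(nat \<Rightarrow> complex) \<Rightarrow> 't"
  assumes cartan: "cartan_datum D"
    and km: "km_lie_algebra D G"
    and bases: "root_bases D G B"
    and weights: "\<forall>j<n. clinear (\<Lambda> j)"
    and verma: "\<forall>j<n. verma_module D G (\<Lambda> j) (act j) (v j)"
    and tensor_nM: "tensor_product (n_minus D G) tn"
    and tensor_M: "tensor_power n tens"
    and kappa: "\<kappa> \<noteq> 0"
    and m_def: "m = (\<Sum>i<rk D. lam i)"
    and c: "colouring (rk D) lam m c"
    and U: "openin (top_of_set (base (kz_master D n \<Lambda> m c \<mu> \<kappa>))) U"
    and gamma: "horizontal_family (kz_master D n \<Lambda> m c \<mu> \<kappa>) U \<gamma>"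
    and u_def: "\<forall>z. u z = hypergeometric_integral D G n \<Lambda> act v tens lam m c \<mu> \<kappa> \<gamma> z"
  shows "\<forall>z\<in>U. u z \<in> weight_space D G n \<Lambda> act tens lam \<and>
    (\<forall>i<n. \<exists>du. has_vec_derivative_at (\<lambda>w. u (z(i := w))) du (z i) \<and>
       \<kappa> *\<^sub>C du = factor_op n tens i (act i (inH G \<mu>)) (u z) +
         (\<Sum>j\<in>{..<n} - {i}.
            (1 / (z i - z j)) *\<^sub>C Omega_plus D G B tn act v n tens i j (u z)))"
proof -
 interpret K: kz_tensor D G B n \<Lambda> act v tn tens
  by (intro kz_tensor.intro km_roots.intro km_algebra.intro km_roots_axioms.intro kz_tensor_axioms.intro
    cartan km bases tensor_nM tensor_M)
    (use weights verma in blast)+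
 have u: "u = hypergeometric_integral D G n \<Lambda> act v tens lam m c \<mu> \<kappa> \<gamma>" using u_def by blast
 show ?thesis
  unfolding u using K.hypergeometric_weight_space K.kz_equation[OF kappa m_def c U gamma] by blast
qed

end
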